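(* Let $g\geq 1$, and let $m,n\in\mathbb{N}=\{1,2,3,\ldots\}$. Then there exists a surjective homomorphism of $B_n(U_g)$ onto $P_m(U_g)$ if and only if either $g=m=1$ or $n=m=1$.
   Context: $U_g$ is the compact, connected, non-orientable surface of genus $g$ without boundary (the connected sum of $g$ projective planes). Let $\mathbb{F}_n(U_g)$ be the configuration space of ordered $n$-tuples of pairwise distinct points of $U_g$; $S_n$ acts freely on it by permuting coordinates. $P_n(U_g)=\pi_1(\mathbb{F}_n(U_g))$ is the $n$-string pure braid group and $B_n(U_g)=\pi_1(\mathbb{F}_n(U_g)/S_n)$ is the $n$-string braid group of $U_g$. *)

theory Defs
  imports "HOL-Analysis.Analysis" "HOL-Algebra.Group" "HOL-Combinatorics.Permutations"
begin

definition quotient_topology :: "'a topology \<Rightarrow> ('a \<Rightarrow> 'b) \<Rightarrow> 'b topology" where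
  "quotient_topology X f =
     topology (\<lambda>U. U \<subseteq> f ` topspace X \<and> openin X {x \<in> topspace X. f x \<in> U})"

lemma openin_quotient_topology:
  "openin (quotient_topology X f) U \<longleftrightarrow>
     U \<subseteq> f ` topspace X \<and> openin X {x \<in> topspace X. f x \<in> U}"
proof -
  have "istopology (\<lambda>U. U \<subseteq> f ` topspace X \<and> openin X {x \<in> topspace X. f x \<in> U})"
    unfolding istopology_def
  proof (intro conjI allI impI; (elim conjE)?)
    fix S T
    assume "openin X {x \<in> topspace X. f x \<in> S}" "openin X {x \<in> topspace X. f x \<in> T}"
    moreover have "{x \<in> topspace X. f x \<in> S \<inter> T} =
        {x \<in> topspace X. f x \<in> S} \<inter> {x \<in> topspace X. f x \<in> T}"
      by blast
    ultimately show "openin X {x \<in> topspace X. f x \<in> S \<inter> T}"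
      by (simp only: openin_Int)
  next
    fix K
    assume "\<forall>S\<in>K. S \<subseteq> f ` topspace X \<and> openin X {x \<in> topspace X. f x \<in> S}"
    then have "openin X (\<Union>S\<in>K. {x \<in> topspace X. f x \<in> S})"
      by blast
    moreover have "{x \<in> topspace X. f x \<in> \<Union>K} = (\<Union>S\<in>K. {x \<in> topspace X. f x \<in> S})"
      by blast
    ultimately show "openin X {x \<in> topspace X. f x \<in> \<Union>K}"
      by (simp only:)
  qed auto
  then show ?thesis
    by (simp add: quotient_topology_def)
qed

lemma topspace_quotient_topology [simp]:
  "topspace (quotient_topology X f) = f ` topspace X"
proof
  show "topspace (quotient_topology X f) \<subseteq> f ` topspace X"
    using openin_topspace[of "quotient_topology X f"] unfolding openin_quotient_topology by blast
  have "{x \<in> topspace X. f x \<in> f ` topspace X} = topspace X"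
    by blast
  then have "openin (quotient_topology X f) (f ` topspace X)"
    by (simp add: openin_quotient_topology)
  then show "f ` topspace X \<subseteq> topspace (quotient_topology X f)"
    by (rule openin_subset)
qed

lemma quotient_map_quotient_topology: "quotient_map X (quotient_topology X f) f"
  by (simp add: quotient_map_def openin_quotient_topology)


text \<open>
  The connected sum of \<open>g\<close> projective planes. Copy number \<open>i < g\<close> of the projective plane is
  \<open>{i}\<close> times the closed unit disc with antipodal points of the unit circle identified. For
  \<open>i + 1 < g\<close>, the open disc of radius 1/4 around 1/2 is removed from copy \<open>i\<close>, the one around
  -1/2 is removed from copy \<open>i + 1\<close>, and the two boundary circles are identified by the
  reflection \<open>z \<mapsto> - cnj z\<close>. Hence the case of \<open>g + 1\<close> is the connected sum of the case of \<open>g\<close>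
  with one further projective plane.
\<close>

definition punctured_discs :: "nat \<Rightarrow> (nat \<times> complex) set" where
  "punctured_discs g =
     {(i, z). i < g \<and> z \<in> cball 0 1 \<and>
        (0 < i \<longrightarrow> z \<notin> ball (-1/2) (1/4)) \<and> (i + 1 < g \<longrightarrow> z \<notin> ball (1/2) (1/4))}"

inductive glued :: "nat \<Rightarrow> nat \<times> complex \<Rightarrow> nat \<times> complex \<Rightarrow> bool" for g :: nat where
  antipodal: "i < g \<Longrightarrow> z \<in> sphere 0 1 \<Longrightarrow> glued g (i, z) (i, - z)"
| tube: "i + 1 < g \<Longrightarrow> z \<in> sphere (1/2) (1/4) \<Longrightarrow> glued g (i, z) (i + 1, - cnj z)"

definition nonorientable_surface :: "nat \<Rightarrow> (nat \<times> complex) set topology" where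
  "nonorientable_surface g =
     quotient_topology (top_of_set (punctured_discs g)) (\<lambda>p. {q. equivclp (glued g) p q})"


text \<open>An ordered \<open>n\<close>-tuple is an extensional function on \<open>{..<n}\<close>.\<close>

definition ordered_config :: "nat \<Rightarrow> 'a topology \<Rightarrow> (nat \<Rightarrow> 'a) topology" where
  "ordered_config n X =
     subtopology (product_topology (\<lambda>_. X) {..<n}) {c. inj_on c {..<n}}"

definition unordered_config :: "nat \<Rightarrow> 'a topology \<Rightarrow> (nat \<Rightarrow> 'a) set topology" where
  "unordered_config n X =
     quotient_topology (ordered_config n X) (\<lambda>c. {c \<circ> \<sigma> |\<sigma>. \<sigma> permutes {..<n}})"


definition loop_homotopic :: "'a topology \<Rightarrow> 'a \<Rightarrow> (real \<Rightarrow> 'a) \<Rightarrow> (real \<Rightarrow> 'a) \<Rightarrow> bool" where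
  "loop_homotopic X x =
     homotopic_with (\<lambda>r. r 0 = x \<and> r 1 = x) (top_of_set {0..1}) X"

text \<open>The library's \<open>(+++)\<close> needs the points to form a type of class \<open>topological_space\<close>.\<close>

definition loop_concat :: "(real \<Rightarrow> 'a) \<Rightarrow> (real \<Rightarrow> 'a) \<Rightarrow> real \<Rightarrow> 'a" where
  "loop_concat p q = (\<lambda>t. if t \<le> 1/2 then p (2 * t) else q (2 * t - 1))"

definition fundamental_group :: "'a topology \<Rightarrow> 'a \<Rightarrow> (real \<Rightarrow> 'a) set monoid" where
  "fundamental_group X x =
     \<lparr>carrier = {{q. loop_homotopic X x p q} |p. pathin X p \<and> p 0 = x \<and> p 1 = x},
      mult = (\<lambda>A B. {r. \<exists>p\<in>A. \<exists>q\<in>B. loop_homotopic X x (loop_concat p q) r}),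
      one = {q. loop_homotopic X x (\<lambda>_. x) q}\<rparr>"

definition pure_braid_group ::
    "nat \<Rightarrow> 'a topology \<Rightarrow> (nat \<Rightarrow> 'a) \<Rightarrow> (real \<Rightarrow> nat \<Rightarrow> 'a) set monoid" where
  "pure_braid_group n X c = fundamental_group (ordered_config n X) c"

definition braid_group ::
    "nat \<Rightarrow> 'a topology \<Rightarrow> (nat \<Rightarrow> 'a) set \<Rightarrow> (real \<Rightarrow> (nat \<Rightarrow> 'a) set) set monoid" where
  "braid_group n X d = fundamental_group (unordered_config n X) d"

end

theory Submission
 imports Defs "HOL-Library.Z2"
begin

text \<open>
 All group theory is done with path functionals: assignments of group elements to paths that are
 additive under concatenation and invariant under homotopy. A surjection of fundamental groups pulls
 them back without losing values on loops.

 For \<open>n \<ge> 2\<close> the pure braid group maps onto the quaternion group unless \<open>g = m = 1\<close>, but \<open>B\<^sub>n\<close> does not: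
 the standard half twist has square one whenever two crosscap strands commute, strands through distinct
 crosscaps commute, and a functional with values in the field of two elements that vanishes on all
 crosscap strands and on the half twist vanishes on all loops. For \<open>n = 1\<close>, \<open>m \<ge> 2\<close> the mod 2
 cohomology of the ordered configuration space is too large. In the remaining cases \<open>P\<^sub>1 = B\<^sub>1\<close>, or
 \<open>P\<^sub>1\<close> of the projective plane has order two and \<open>B\<^sub>n\<close> has a nontrivial character.
\<close>

text \<open>Abelian invariants alone cannot decide: braids map onto the first homology of the
  surface by adding up the strands, so for \<open>n \<ge> 2\<close> a non-abelian target is needed.
  In the quaternion group, modulo its centre, an element is a vector \<open>(qa, qb)\<close> over
  the field of two elements, and two elements commute iff their vectors are parallel. The vector of
  a crosscap strand depends only on the crosscap, because the points at rest can be moved about. So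
  two strands through one crosscap commute in the quaternion group, and together with the
  commutation for distinct crosscaps all vectors lie on one line. An element of square one is
  central. Hence some nonzero linear form in \<open>qa\<close> and \<open>qb\<close> vanishes on the
  image of the braid group.

  The quaternion quotients have two sources. For \<open>g \<ge> 2\<close> the squares of the
  crosscap generators multiply to one, and so do the squares of \<open>i\<close> and
  \<open>j\<close>. Two points of the projective plane are two lines in space, which give an
  orthonormal frame up to signs. Both quotients are realised as monodromy of explicit fields, so
  that no group presentation enters.\<close>

section \<open>Paths up to homotopy relative to their ends\<close>

definition path_homotopic :: "'a topology => (real => 'a) => (real => 'a) => bool" where "path_homotopic X p q =
   homotopic_with (\<lambda>r. r 0 = p 0 & r 1 = p 1) (top_of_set {0..1}) X p q"

lemma loop_homotopic_eq: "p 0 = x ==> p 1 = x ==> loop_homotopic X x p q = path_homotopic X p q" by (simp add: loop_homotopic_def path_homotopic_def)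

lemma path_homotopic_refl: "pathin X p ==> path_homotopic X p p" by (simp add: path_homotopic_def pathin_def)

lemma path_homotopic_ends: "path_homotopic X p q ==> q 0 = p 0 & q 1 = p 1" unfolding path_homotopic_def by (drule homotopic_with_imp_property) auto

lemma path_homotopic_pathin: "path_homotopic X p q ==> pathin X p & pathin X q"
 unfolding path_homotopic_def pathin_def by (drule homotopic_with_imp_continuous_maps) auto

lemma path_homotopic_sym: "path_homotopic X p q ==> path_homotopic X q p" using path_homotopic_ends[of X p q] unfolding path_homotopic_def
 by (auto intro: homotopic_with_symD)

lemma path_homotopic_trans [trans]: "path_homotopic X p q ==> path_homotopic X q r ==> path_homotopic X p r"
 using path_homotopic_ends[of X p q] unfolding path_homotopic_def by (auto intro: homotopic_with_trans)

lemma path_homotopic_cong: assumes "pathin X p" "\<And>t. 0 <= t ==> t <= 1 ==> p t = q t" shows "path_homotopic X p q" unfolding path_homotopic_def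
 by (rule homotopic_with_equal) (use assms in "auto simp: pathin_def")

lemma path_homotopic_compose: "path_homotopic X p q ==> continuous_map X Y f ==> path_homotopic Y (f o p) (f o q)" unfolding path_homotopic_def
 by (erule (1) homotopic_with_compose_continuous_map_left) auto

lemma pathin_top_of_set: "pathin (top_of_set S) u \<longleftrightarrow> path u & path_image u \<subseteq> S"
 by (simp add: pathin_def continuous_map_in_subtopology path_def path_image_def image_subset_iff_funcset)

lemma path_homotopic_simply_connected: fixes S :: "'b::real_normed_vector set" assumes "simply_connected S" "continuous_map (top_of_set S) X f"
  "pathin (top_of_set S) u" "pathin (top_of_set S) v" "u 0 = v 0" "u 1 = v 1" shows "path_homotopic X (f o u) (f o v)"
proof (rule path_homotopic_compose[OF _ assms(2)])
 have "homotopic_paths S u v" using assms by (auto simp: simply_connected_eq_homotopic_paths pathin_top_of_set pathstart_def pathfinish_def)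
 then show "path_homotopic (top_of_set S) u v" by (simp add: homotopic_paths_def path_homotopic_def pathstart_def pathfinish_def)
qed

lemma path_homotopic_convex: fixes S :: "'b::real_normed_vector set" assumes "convex S" "continuous_map (top_of_set S) X f"
  "pathin (top_of_set S) u" "pathin (top_of_set S) v" "u 0 = v 0" "u 1 = v 1" shows "path_homotopic X (f o u) (f o v)"
 using assms convex_imp_simply_connected path_homotopic_simply_connected by blast

text \<open>Two parameter functions with equal ends are homotopic because the interval is convex.
  Associativity, units and inverses below are all instances, each for one fixed path.\<close>

lemma path_homotopic_reparam: fixes u v :: "real => real" assumes "pathin X p" "continuous_on {0..1} u" "continuous_on {0..1} v"
  "\<And>t. 0 <= t ==> t <= 1 ==> 0 <= u t & u t <= 1 & 0 <= v t & v t <= 1" "u 0 = v 0" "u 1 = v 1" shows "path_homotopic X (p o u) (p o v)"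
 by (rule path_homotopic_convex[of "{0..1}"])
  (use assms in "auto simp: pathin_def continuous_map_in_subtopology")

definition loop_reverse :: "(real => 'a) => real => 'a" where "loop_reverse p = (\<lambda>t. p (1 - t))"

lemma loop_concat_compose: "loop_concat (f o p) (f o q) = f o loop_concat p q" by (auto simp: loop_concat_def)

lemma loop_concat_ends [simp]: "loop_concat p q 0 = p 0" "loop_concat p q 1 = q 1" by (auto simp: loop_concat_def)

lemma pathin_affine: assumes "pathin X p" "\<And>t. t \<in> A ==> 0 <= a * t + b & a * t + b <= 1"
 shows "continuous_map (top_of_set A) X (\<lambda>t. p (a * t + b))"
proof -
 have "continuous_map (top_of_set A) (top_of_set {0..1}) (\<lambda>t. a * t + b)"
  using assms(2) by (auto simp: continuous_map_in_subtopology intro!: continuous_intros)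
 then have "continuous_map (top_of_set A) X (p o (\<lambda>t. a * t + b))" using assms(1) unfolding pathin_def by (rule continuous_map_compose)
 then show ?thesis by (simp add: o_def)
qed

lemma pathin_loop_concat: assumes "pathin X p" "pathin X q" "p 1 = q 0" shows "pathin X (loop_concat p q)" unfolding pathin_def loop_concat_def
proof (rule continuous_map_cases_le)
 have 1: "subtopology (top_of_set {0..1}) {x \<in> topspace (top_of_set {0..1}). x <= (1/2::real)} = top_of_set {0..1/2}"
  by (simp add: subtopology_subtopology) (rule arg_cong[where f=top_of_set], auto)
 have 2: "subtopology (top_of_set {0..1}) {x \<in> topspace (top_of_set {0..1}). (1/2::real) <= x} = top_of_set {1/2..1}"
  by (simp add: subtopology_subtopology) (rule arg_cong[where f=top_of_set], auto)
 show "continuous_map (subtopology (top_of_set {0..1}) {x \<in> topspace (top_of_set {0..1}). x <= (1/2::real)}) X (\<lambda>t. p (2 * t))"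
  unfolding 1 using pathin_affine[OF assms(1), of "{0..1/2}" 2 0] by simp
 show "continuous_map (subtopology (top_of_set {0..1}) {x \<in> topspace (top_of_set {0..1}). (1/2::real) <= x}) X (\<lambda>t. q (2 * t - 1))"
  unfolding 2 using pathin_affine[OF assms(2), of "{1/2..1}" 2 "-1"] by simp
 show "p (2 * t) = q (2 * t - 1)" if "t = 1/2" for t unfolding that using assms(3) by simp
qed auto

lemma pathin_loop_reverse: "pathin X p ==> pathin X (loop_reverse p)" using pathin_affine[of X p "{0..1}" "-1" 1] by (simp add: pathin_def loop_reverse_def)

lemma loop_reverse_ends [simp]: "loop_reverse p 0 = p 1" "loop_reverse p 1 = p 0" by (auto simp: loop_reverse_def)

lemma loop_reverse_reverse [simp]: "loop_reverse (loop_reverse p) = p" by (simp add: loop_reverse_def)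

lemma path_homotopic_concat: assumes "path_homotopic X p p'" "path_homotopic X q q'" "p 1 = q 0" shows "path_homotopic X (loop_concat p q) (loop_concat p' q')"
proof -
 let ?I = "{0..1::real}"
 let ?P = "prod_topology (top_of_set ?I) (top_of_set ?I)"
 obtain h where h: "continuous_map ?P X h" "\<And>t. h (0, t) = p t" "\<And>t. h (1, t) = p' t"
  "\<And>s. s \<in> ?I ==> h (s, 0) = p 0 & h (s, 1) = p 1" using assms(1) unfolding path_homotopic_def homotopic_with_def by blast
 obtain k where k: "continuous_map ?P X k" "\<And>t. k (0, t) = q t" "\<And>t. k (1, t) = q' t"
  "\<And>s. s \<in> ?I ==> k (s, 0) = q 0 & k (s, 1) = q 1" using assms(2) unfolding path_homotopic_def homotopic_with_def by blast
 let ?H = "\<lambda>z. if snd z <= 1/2 then h (fst z, 2 * snd z) else k (fst z, 2 * snd z - 1)"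
 have PP: "?P = top_of_set (?I \<times> ?I)" by (metis prod_topology_subtopology_eu)
 have *: "continuous_map (top_of_set A) X (\<lambda>z. f (fst z, a * snd z + b))"
  if "continuous_map ?P X f" "\<And>z. z \<in> A ==> fst z \<in> ?I & a * snd z + b \<in> ?I" for f A and a b :: real
 proof -
  have "continuous_map (top_of_set A) (top_of_set (?I \<times> ?I)) (\<lambda>z. (fst z, a * snd z + b))"
   using that(2) by (auto simp: continuous_map_in_subtopology intro!: continuous_intros)
  then have "continuous_map (top_of_set A) X (f o (\<lambda>z. (fst z, a * snd z + b)))" using that(1) unfolding PP by (rule continuous_map_compose)
  then show ?thesis by (simp add: o_def)
 qed
 have "continuous_map ?P X ?H" unfolding PP
 proof (rule continuous_map_cases_le)
  show "continuous_map (subtopology (top_of_set (?I \<times> ?I)) {z \<in> topspace (top_of_set (?I \<times> ?I)). snd z <= 1/2}) X (\<lambda>z. h (fst z, 2 * snd z))"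
   unfolding subtopology_subtopology using *[OF h(1), of "?I \<times> ?I \<inter> {z \<in> topspace (top_of_set (?I \<times> ?I)). snd z <= 1/2}" 2 0] by fastforce
  show "continuous_map (subtopology (top_of_set (?I \<times> ?I)) {z \<in> topspace (top_of_set (?I \<times> ?I)). 1/2 <= snd z}) X (\<lambda>z. k (fst z, 2 * snd z - 1))"
   unfolding subtopology_subtopology using *[OF k(1), of "?I \<times> ?I \<inter> {z \<in> topspace (top_of_set (?I \<times> ?I)). 1/2 <= snd z}" 2 "-1"] by fastforce
  show "h (fst z, 2 * snd z) = k (fst z, 2 * snd z - 1)" if "z \<in> topspace (top_of_set (?I \<times> ?I))" "snd z = 1/2" for z
   unfolding that(2) using that(1) h(4)[of "fst z"] k(4)[of "fst z"] assms(3) by auto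
 qed (auto intro!: continuous_intros)
 then show ?thesis unfolding path_homotopic_def homotopic_with_def by (intro exI[of _ ?H]) (auto simp: loop_concat_def h k)
qed

lemma path_homotopic_assoc: assumes "pathin X p" "pathin X q" "pathin X r" "p 1 = q 0" "q 1 = r 0"
 shows "path_homotopic X (loop_concat (loop_concat p q) r) (loop_concat p (loop_concat q r))"
proof -
 let ?c = "loop_concat p (loop_concat q r)"
 have c: "pathin X ?c" by (intro pathin_loop_concat assms) (use assms in auto)
 \<comment> \<open>The two bracketings have their breaks at 1/4, 1/2 and at 1/2, 3/4. The piecewise
   linear map between them is concave, hence the minimum of its three linear pieces.\<close>
 let ?u = "\<lambda>t::real. min (2*t) (min (t + 1/4) ((t+1)/2))"
 have u: "t <= 1/4 ==> ?u t = 2 * t" "1/4 <= t ==> t <= 1/2 ==> ?u t = t + 1/4" "1/2 <= t ==> ?u t = (t+1)/2" for t by (auto simp: min_def)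
 have "path_homotopic X (?c o ?u) (?c o (\<lambda>t. t))" by (rule path_homotopic_reparam[OF c]) (auto intro!: continuous_intros simp: min_le_iff_disj)
 moreover have "(?c o ?u) t = loop_concat (loop_concat p q) r t" for t
 proof -
  consider "t <= 1/4" | "1/4 < t" "t <= 1/2" | "1/2 < t" by linarith
  then show ?thesis
  proof cases
   case 1 then show ?thesis by (simp add: u loop_concat_def)
  next
   case 2 then show ?thesis by (simp add: u loop_concat_def)
  next
   case 3
   have e: "(4 * t + 4) / 2 - 3 = 2 * t - 1" by (simp add: add_divide_distrib)
   from 3 show ?thesis by (simp add: u loop_concat_def e)
  qed
 qed
 then have "?c o ?u = loop_concat (loop_concat p q) r" by (rule ext)
 ultimately show ?thesis by (simp add: o_def)
qed

lemma path_homotopic_lid: assumes "pathin X p" shows "path_homotopic X (loop_concat (\<lambda>_. p 0) p) p"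
proof -
 have "path_homotopic X (p o (\<lambda>t. max 0 (2*t-1))) (p o (\<lambda>t. t))" by (rule path_homotopic_reparam[OF assms]) (auto intro!: continuous_intros)
 moreover have "(p o (\<lambda>t. max 0 (2*t-1))) t = loop_concat (\<lambda>_. p 0) p t" for t
 proof (cases "t = 1/2")
  case True
  show ?thesis unfolding True by (simp add: loop_concat_def)
 qed (auto simp: loop_concat_def max_def)
 then have "p o (\<lambda>t. max 0 (2*t-1)) = loop_concat (\<lambda>_. p 0) p" by (rule ext)
 ultimately show ?thesis by (simp add: o_def)
qed

lemma path_homotopic_rid: assumes "pathin X p" shows "path_homotopic X (loop_concat p (\<lambda>_. p 1)) p"
proof -
 have "path_homotopic X (p o (\<lambda>t. min 1 (2*t))) (p o (\<lambda>t. t))" by (rule path_homotopic_reparam[OF assms]) (auto intro!: continuous_intros)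
 moreover have "(p o (\<lambda>t. min 1 (2*t))) t = loop_concat p (\<lambda>_. p 1) t" for t
 proof (cases "t = 1/2")
  case True
  show ?thesis unfolding True by (simp add: loop_concat_def)
 qed (auto simp: loop_concat_def min_def)
 then have "p o (\<lambda>t. min 1 (2*t)) = loop_concat p (\<lambda>_. p 1)" by (rule ext)
 ultimately show ?thesis by (simp add: o_def)
qed

lemma path_homotopic_rinv: assumes "pathin X p" shows "path_homotopic X (loop_concat p (loop_reverse p)) (\<lambda>_. p 0)"
proof -
 have "path_homotopic X (p o (\<lambda>t. min (2*t) (2-2*t))) (p o (\<lambda>t. 0))" by (rule path_homotopic_reparam[OF assms]) (auto intro!: continuous_intros)
 moreover have "p o (\<lambda>t. min (2*t) (2-2*t)) = loop_concat p (loop_reverse p)"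
  by (rule ext) (auto simp: loop_concat_def min_def loop_reverse_def algebra_simps)
 ultimately show ?thesis by (simp add: o_def)
qed

lemma path_homotopic_linv: assumes "pathin X p" shows "path_homotopic X (loop_concat (loop_reverse p) p) (\<lambda>_. p 1)"
 using path_homotopic_rinv[OF pathin_loop_reverse[OF assms]] by simp

definition whisker :: "(real => 'a) => (real => 'a) => (real => 'a) => (real => 'a)" where "whisker d p e = loop_concat d (loop_concat p (loop_reverse e))"

lemma whisker_ends [simp]: "whisker d p e 0 = d 0" "whisker d p e 1 = e 0" by (auto simp: whisker_def)

lemma pathin_whisker: "pathin X d ==> pathin X p ==> pathin X e ==> d 1 = p 0 ==> e 1 = p 1 ==> pathin X (whisker d p e)"
 unfolding whisker_def by (intro pathin_loop_concat pathin_loop_reverse) auto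

lemma whisker_cong: "path_homotopic X p q ==> pathin X d ==> pathin X e ==> d 1 = p 0 ==> e 1 = p 1 ==>
  path_homotopic X (whisker d p e) (whisker d q e)" unfolding whisker_def by (intro path_homotopic_concat path_homotopic_refl pathin_loop_reverse) auto

lemma whisker_concat: assumes "pathin X d" "pathin X e" "pathin X f" "pathin X p" "pathin X q" "d 1 = p 0" "e 1 = p 1" "q 0 = p 1" "f 1 = q 1"
 shows "path_homotopic X (loop_concat (whisker d p e) (whisker e q f)) (whisker d (loop_concat p q) f)"
proof -
 note I = path_homotopic_concat path_homotopic_refl pathin_loop_reverse pathin_loop_concat
 let ?e = "loop_reverse e" and ?f = "loop_reverse f"
 let ?qf = "loop_concat q ?f"
 have "path_homotopic X (loop_concat (whisker d p e) (whisker e q f))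
   (loop_concat d (loop_concat (loop_concat p ?e) (loop_concat e ?qf)))" unfolding whisker_def using assms by (intro path_homotopic_assoc I) auto
 also have "path_homotopic X \<dots> (loop_concat d (loop_concat p (loop_concat ?e (loop_concat e ?qf))))" using assms by (intro I path_homotopic_assoc) auto
 also have "path_homotopic X \<dots> (loop_concat d (loop_concat p (loop_concat (loop_concat ?e e) ?qf)))"
  using assms by (intro I path_homotopic_sym[OF path_homotopic_assoc]) auto
 also have "path_homotopic X \<dots> (loop_concat d (loop_concat p (loop_concat (\<lambda>_. ?qf 0) ?qf)))"
  using assms path_homotopic_linv[of X e] by (intro path_homotopic_concat path_homotopic_refl pathin_loop_concat pathin_loop_reverse) auto
 also have "path_homotopic X \<dots> (loop_concat d (loop_concat p ?qf))"
  using assms by (intro path_homotopic_concat path_homotopic_refl path_homotopic_lid pathin_loop_concat pathin_loop_reverse) auto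
 also have "path_homotopic X \<dots> (loop_concat d (loop_concat (loop_concat p q) ?f))"
  using assms by (intro I path_homotopic_sym[OF path_homotopic_assoc]) auto
 finally show ?thesis unfolding whisker_def .
qed

section \<open>Path functionals and potentials\<close>

text \<open>A homomorphism from the fundamental groupoid to a group, taken on paths instead of
  classes. The group is written additively but need not be commutative.\<close>

definition path_functional :: "'a topology => ((real => 'a) => 'g::group_add) => bool" where "path_functional X \<Phi> \<longleftrightarrow>
   (ALL p q. pathin X p --> pathin X q --> p 1 = q 0 --> \<Phi> (loop_concat p q) = \<Phi> p + \<Phi> q) &
   (ALL p q. path_homotopic X p q --> \<Phi> p = \<Phi> q)"

text \<open>Says that the functional is the coboundary of \<open>f\<close>. The order of the two
  terms matters in a non-commutative group: it lets the middle terms cancel under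
  concatenation.\<close>

definition potential :: "'a topology => ((real => 'a) => 'g::group_add) => ('a => 'g) => bool" where
 "potential X \<Phi> f \<longleftrightarrow> (ALL p. pathin X p --> \<Phi> p = - f (p 0) + f (p 1))"

lemma pf_concat: "path_functional X \<Phi> ==> pathin X p ==> pathin X q ==> p 1 = q 0 ==> \<Phi> (loop_concat p q) = \<Phi> p + \<Phi> q"
 by (simp add: path_functional_def)

lemma pf_homotopic: "path_functional X \<Phi> ==> path_homotopic X p q ==> \<Phi> p = \<Phi> q" unfolding path_functional_def by blast

lemma pf_cong: "path_functional X \<Phi> ==> pathin X p ==> (\<And>t. 0 <= t ==> t <= 1 ==> p t = q t) ==> \<Phi> p = \<Phi> q"
 by (rule pf_homotopic[OF _ path_homotopic_cong])

lemma pf_const: assumes "path_functional X \<Phi>" "a \<in> topspace X" shows "\<Phi> (\<lambda>_. a) = 0"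
proof -
 have "loop_concat (\<lambda>_. a) (\<lambda>_. a) = (\<lambda>_. a)" by (auto simp: loop_concat_def)
 then have "\<Phi> (\<lambda>_. a) + 0 = \<Phi> (\<lambda>_. a) + \<Phi> (\<lambda>_. a)"
  using pf_concat[OF assms(1), of "\<lambda>_. a" "\<lambda>_. a"] assms(2) by simp
 then show ?thesis unfolding add_left_cancel by simp
qed

lemma pf_reverse: assumes "path_functional X \<Phi>" "pathin X p" shows "\<Phi> (loop_reverse p) = - \<Phi> p"
proof -
 have "\<Phi> p + \<Phi> (loop_reverse p) = \<Phi> (\<lambda>_. p 0)" using pf_concat[OF assms pathin_loop_reverse[OF assms(2)]]
   pf_homotopic[OF assms(1) path_homotopic_rinv[OF assms(2)]] by simp
 also have "\<dots> = 0" by (rule pf_const[OF assms(1) path_start_in_topspace[OF assms(2)]])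
 finally show ?thesis by (rule minus_unique[symmetric])
qed

lemma pf_compose: assumes "path_functional X \<Phi>" "continuous_map Y X f" shows "path_functional Y (\<lambda>p. \<Phi> (f o p))" unfolding path_functional_def
proof (intro conjI allI impI)
 fix p q assume "pathin Y p" "pathin Y q" "p 1 = q 0"
 then show "\<Phi> (f o loop_concat p q) = \<Phi> (f o p) + \<Phi> (f o q)"
  using pf_concat[OF assms(1) pathin_compose[OF _ assms(2)] pathin_compose[OF _ assms(2)], of p q] by (simp add: loop_concat_compose)
next
 fix p q assume "path_homotopic Y p q"
 then show "\<Phi> (f o p) = \<Phi> (f o q)" by (rule pf_homotopic[OF assms(1) path_homotopic_compose[OF _ assms(2)]])
qed

lemma pf_subtopology: "path_functional X \<Phi> ==> path_functional (subtopology X S) \<Phi>"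
 using pf_compose[of X \<Phi> "subtopology X S" id] by (simp add: continuous_map_from_subtopology)

lemma pf_hom: assumes "path_functional X \<Phi>" "\<And>a b. h (a + b) = h a + h b" shows "path_functional X (\<lambda>p. h (\<Phi> p))"
 using assms by (simp add: path_functional_def)

lemma pathin_subpath: assumes "pathin X p" "0 <= a" "a <= 1" "0 <= b" "b <= 1" shows "pathin X (p o linepath a b)"
proof (rule pathin_compose)
 show "pathin (top_of_set {0..1}) (linepath a b)" using assms by (auto simp: pathin_top_of_set path_image_linepath closed_segment_eq_real_ivl split: if_splits)
 show "continuous_map (top_of_set {0..1}) X p" using assms(1) by (simp add: pathin_def)
qed

lemma linepath_ends [simp]: "linepath a b 0 = a" "linepath a b 1 = b" by (auto simp: linepath_def)

lemma pathin_linepath: "convex S ==> a \<in> S ==> b \<in> S ==> pathin (top_of_set S) (linepath a b)" by (simp add: pathin_top_of_set closed_segment_subset)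

lemma linepath_id: "linepath 0 (1::real) = (\<lambda>t. t)" by (auto simp: linepath_def)

lemma path_homotopic_subpaths: assumes "pathin X p" "0 <= a" "a <= 1" "0 <= b" "b <= 1" "0 <= c" "c <= 1"
 shows "path_homotopic X (loop_concat (p o linepath a b) (p o linepath b c)) (p o linepath a c)" unfolding loop_concat_compose
proof (rule path_homotopic_convex[of "{0..1}"])
 show "continuous_map (top_of_set {0..1}) X p" using assms(1) by (simp add: pathin_def)
 show "pathin (top_of_set {0..1}) (loop_concat (linepath a b) (linepath b c))" using assms by (intro pathin_loop_concat pathin_linepath) auto
 show "pathin (top_of_set {0..1}) (linepath a c)" using assms by (intro pathin_linepath) auto
qed auto

lemma pf_subpaths: assumes "path_functional X \<Phi>" "pathin X p" "0 <= a" "a <= 1" "0 <= b" "b <= 1" "0 <= c" "c <= 1"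
 shows "\<Phi> (p o linepath a c) = \<Phi> (p o linepath a b) + \<Phi> (p o linepath b c)"
proof -
 have "\<Phi> (loop_concat (p o linepath a b) (p o linepath b c)) = \<Phi> (p o linepath a c)"
  by (rule pf_homotopic[OF assms(1) path_homotopic_subpaths[OF assms(2-8)]])
 moreover have "\<Phi> (loop_concat (p o linepath a b) (p o linepath b c)) = \<Phi> (p o linepath a b) + \<Phi> (p o linepath b c)"
  by (rule pf_concat[OF assms(1)]) (simp_all add: pathin_subpath assms)
 ultimately show ?thesis by simp
qed

lemma pathin_local: assumes "pathin X p" "openin X V" "p x \<in> V" "0 <= x" "x <= 1"
 shows "EX d>0. ALL t. 0 <= t & t <= 1 & \<bar>t - x\<bar> < d --> p t \<in> V"
proof -
 have "openin (top_of_set {0..1}) {t \<in> {0..1}. p t \<in> V}" using assms(1,2) unfolding pathin_def continuous_map_def by simp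
 then obtain d where "d > 0" "\<And>t. t \<in> {0..1} ==> dist t x < d ==> t \<in> {t \<in> {0..1}. p t \<in> V}"
  using assms(3-5) unfolding openin_euclidean_subtopology_iff by force
 then show ?thesis by (intro exI[of _ d]) (auto simp: dist_real_def)
qed

lemma pathin_subpath_local: assumes "pathin X p" "\<And>t. a <= t ==> t <= b ==> p t \<in> V" "0 <= a" "a <= b" "b <= 1"
 shows "pathin (subtopology X V) (p o linepath a b)"
proof -
 have "linepath a b t \<in> {a..b}" if "t \<in> {0..1}" for t using that linepath_in_path[of t a b] assms(4) by (simp add: closed_segment_eq_real_ivl)
 then show ?thesis using assms pathin_subpath[of X p a b] by (auto simp: pathin_subtopology)
qed

text \<open>Bisection replaces Lebesgue numbers.\<close>
lemma path_local_induct: assumes local: "\<And>x. x \<in> topspace X ==> EX V. openin X V & x \<in> V & (ALL p. pathin (subtopology X V) p --> Q p)"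
  and concat: "\<And>p q. pathin X p ==> pathin X q ==> p 1 = q 0 ==> Q p ==> Q q ==> Q (loop_concat p q)"
  and homotopic: "\<And>p q. path_homotopic X p q ==> Q p ==> Q q" and p: "pathin X p" shows "Q p"
proof -
 have "0 <= (0::real) --> (1::real) <= 1 --> Q (p o linepath 0 1)"
 proof (rule Bolzano[where P="\<lambda>a b. 0 <= a --> b <= 1 --> Q (p o linepath a b)"])
  fix a b c :: real
  assume *: "0 <= a --> b <= 1 --> Q (p o linepath a b)" "0 <= b --> c <= 1 --> Q (p o linepath b c)" "a <= b" "b <= c"
  show "0 <= a --> c <= 1 --> Q (p o linepath a c)"
  proof (intro impI)
   assume "0 <= a" "c <= 1"
   with * have "Q (loop_concat (p o linepath a b) (p o linepath b c))" by (intro concat pathin_subpath p) auto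
   with * \<open>0 <= a\<close> \<open>c <= 1\<close> show "Q (p o linepath a c)" by (intro homotopic[OF path_homotopic_subpaths[OF p, of a b c]]) auto
  qed
 next
  fix x :: real assume x: "0 <= x" "x <= 1"
  then have "p x \<in> topspace X" using p by (auto simp: pathin_def continuous_map_def)
  then obtain V where V: "openin X V" "p x \<in> V" "\<And>p. pathin (subtopology X V) p ==> Q p" using local by blast
  then obtain d where "d > 0" "ALL t. 0 <= t & t <= 1 & \<bar>t - x\<bar> < d --> p t \<in> V" using pathin_local[OF p V(1,2) x] by blast
  then show "EX d>0. ALL a b. a <= x & x <= b & b - a < d --> 0 <= a --> b <= 1 --> Q (p o linepath a b)"
   using p by (intro exI[of _ d]) (auto intro!: V(3) pathin_subpath_local)
 qed auto
 then show ?thesis by (simp add: o_def linepath_id)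
qed

text \<open>For a fixed \<open>f\<close> the equation passes to concatenations and to homotopic
  paths, so small paths suffice. One global \<open>f\<close> has to serve all the neighbourhoods; in
  the applications this is where local potentials must first be made to match.\<close>

lemma potential_local: assumes "path_functional X \<Phi>"
  and "\<And>x. x \<in> topspace X ==> EX V. openin X V & x \<in> V & potential (subtopology X V) \<Phi> f" shows "potential X \<Phi> f" unfolding potential_def
proof (intro allI impI)
 fix p assume "pathin X p"
 then show "\<Phi> p = - f (p 0) + f (p 1)"
 proof (rule path_local_induct[rotated -1])
  show "EX V. openin X V & x \<in> V & (ALL p. pathin (subtopology X V) p --> \<Phi> p = - f (p 0) + f (p 1))" if "x \<in> topspace X" for x
   using assms(2)[OF that] by (simp add: potential_def)
  show "\<Phi> (loop_concat p q) = - f (loop_concat p q 0) + f (loop_concat p q 1)"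
   if "pathin X p" "pathin X q" "p 1 = q 0" "\<Phi> p = - f (p 0) + f (p 1)" "\<Phi> q = - f (q 0) + f (q 1)" for p q
   using that pf_concat[OF assms(1) that(1-3)] by (simp add: add.assoc)
  show "\<Phi> q = - f (q 0) + f (q 1)" if "path_homotopic X p q" "\<Phi> p = - f (p 0) + f (p 1)" for p q
   using that pf_homotopic[OF assms(1) that(1)] path_homotopic_ends[OF that(1)] by simp
 qed
qed

text \<open>Integrate from a base point: the value along any path from \<open>a\<close> to
  \<open>x\<close> is the same, as all these paths are homotopic.\<close>

lemma potential_simply_connected: fixes S :: "'b::real_normed_vector set" assumes S: "simply_connected S" and pf: "path_functional (top_of_set S) \<Phi>"
 obtains f where "potential (top_of_set S) \<Phi> f"
proof (cases "S = {}")
 case True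
 show ?thesis by (rule that[of "\<lambda>_. 0"]) (auto simp: True potential_def dest: path_start_in_topspace)
next
 case False
 then obtain a where a: "a \<in> S" by blast
 have pc: "path_connected S" using S by (simp add: simply_connected_eq_homotopic_paths)
 have "ALL x:S. EX p. pathin (top_of_set S) p & p 0 = a & p 1 = x"
  using pc[unfolded path_connected_def, rule_format, OF a] by (auto simp: pathin_top_of_set pathstart_def pathfinish_def)
 then obtain P where P: "\<And>x. x \<in> S ==> pathin (top_of_set S) (P x) & P x 0 = a & P x 1 = x" by metis
 have "\<Phi> p = - \<Phi> (P (p 0)) + \<Phi> (P (p 1))" if p: "pathin (top_of_set S) p" for p
 proof -
  have 01: "p 0 \<in> S" "p 1 \<in> S" using p by (auto simp: pathin_def continuous_map_def)
  have "path_homotopic (top_of_set S) (id o loop_concat (P (p 0)) p) (id o P (p 1))"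
   by (rule path_homotopic_simply_connected[OF S]) (use P 01 p in "auto intro!: pathin_loop_concat")
  then have "\<Phi> (P (p 0)) + \<Phi> p = \<Phi> (P (p 1))" using pf_homotopic[OF pf] pf_concat[OF pf, of "P (p 0)" p] P 01 p by simp
  then show ?thesis by (metis add.assoc add_0 left_minus)
 qed
 then show ?thesis using that[of "\<lambda>x. \<Phi> (P x)"] by (simp add: potential_def)
qed

lemma potential_convex: fixes S :: "'b::real_normed_vector set" assumes "convex S" "path_functional (top_of_set S) \<Phi>"
 obtains f where "potential (top_of_set S) \<Phi> f" using assms convex_imp_simply_connected potential_simply_connected by blast

text \<open>A van Kampen theorem: functionals on an open cover that agree on overlaps glue.\<close>
lemma path_functional_glue: fixes X :: "'a topology" and T :: "'i => (real => 'a) => 'g::group_add"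
 assumes cover: "\<And>x. x \<in> topspace X ==> EX i:I. x \<in> V i" and opn: "\<And>i. i \<in> I ==> openin X (V i)"
  and T: "\<And>i. i \<in> I ==> path_functional (subtopology X (V i)) (T i)"
  and agree: "\<And>i j p. i \<in> I ==> j \<in> I ==> pathin (subtopology X (V i)) p ==> pathin (subtopology X (V j)) p ==> T i p = T j p"
 obtains \<Phi> where "path_functional X \<Phi>" "\<And>i p. i \<in> I ==> pathin (subtopology X (V i)) p ==> \<Phi> p = T i p"
proof -
 \<comment> \<open>\<open>k\<close> is a primitive along \<open>p\<close> on \<open>[a, b]\<close>:
   on each subinterval that stays in one member of the cover, the local functional is the increment
   of \<open>k\<close>. The glued functional will be the total increment of any primitive.\<close>
 define good where "good p a b k \<longleftrightarrow> (ALL x y. ALL i:I. a <= x & x <= y & y <= b & (ALL t. x <= t & t <= y --> p t \<in> V i) -->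
   T i (p o linepath x y) = - k x + k y)" for p :: "real => 'a" and a b and k :: "real => 'g"
 have goodD: "T i (p o linepath x y) = - k x + k y"
  if "good p a b k" "i \<in> I" "a <= x" "x <= y" "y <= b" "\<And>t. x <= t ==> t <= y ==> p t \<in> V i" for p a b k i x y
  using that unfolding good_def by blast
 have add: "T i (p o linepath x z) = T i (p o linepath x y) + T i (p o linepath y z)"
  if "pathin X p" "i \<in> I" "0 <= x" "x <= y" "y <= z" "z <= 1" "\<And>t. x <= t ==> t <= z ==> p t \<in> V i" for p i x y z
 proof -
  let ?q = "p o linepath x z"
  have q: "pathin (subtopology X (V i)) ?q" using that by (intro pathin_subpath_local) auto
  show ?thesis
  proof (cases "x = z")
   case True
   then have "p o linepath x z = (\<lambda>_. p x)" "p o linepath x y = (\<lambda>_. p x)" "p o linepath y z = (\<lambda>_. p x)"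
    using that by (auto simp: linepath_def algebra_simps)
   moreover have "p x \<in> topspace (subtopology X (V i))" using path_start_in_topspace[OF q] by simp
   ultimately show ?thesis using pf_const[OF T[OF that(2)]] by simp
  next
   case False
   define u where "u = (y - x) / (z - x)"
   have u: "0 <= u" "u <= 1" using that False by (auto simp: u_def divide_simps)
   have uz: "u * (z - x) = y - x" using False by (simp add: u_def)
   have 1: "?q o linepath 0 u = p o linepath x y"
   proof
    fix t have "linepath x z (linepath 0 u t) = x + t * (u * (z - x))" by (simp add: linepath_def algebra_simps)
    then show "(?q o linepath 0 u) t = (p o linepath x y) t" by (simp add: uz) (simp add: linepath_def algebra_simps)
   qed
   have 2: "?q o linepath u 1 = p o linepath y z"
   proof
    fix t have "linepath x z (linepath u 1 t) = x + (1 - t) * (u * (z - x)) + t * (z - x)" by (simp add: linepath_def algebra_simps)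
    then show "(?q o linepath u 1) t = (p o linepath y z) t" by (simp add: uz) (simp add: linepath_def algebra_simps)
   qed
   show ?thesis using pf_subpaths[OF T[OF that(2)] q, of 0 u 1] u 1 2 by (simp add: o_def linepath_id)
  qed
 qed
 have ex: "EX k. good p 0 1 k" if p: "pathin X p" for p
 proof -
  have "0 <= (0::real) --> (1::real) <= 1 --> (EX k. good p 0 1 k)"
  proof (rule Bolzano[where P="\<lambda>a b. 0 <= a --> b <= 1 --> (EX k. good p a b k)"])
   fix a b c :: real
   assume *: "0 <= a --> b <= 1 --> (EX k. good p a b k)" "0 <= b --> c <= 1 --> (EX k. good p b c k)" "a <= b" "b <= c"
   show "0 <= a --> c <= 1 --> (EX k. good p a c k)"
   proof (intro impI)
    assume ac: "0 <= a" "c <= 1"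
    then obtain k l where k: "good p a b k" and l: "good p b c l" using * by auto
    \<comment> \<open>The second primitive is shifted by a left constant so that both agree at
      \<open>b\<close>. A subinterval that contains \<open>b\<close> in its interior lies in one
      \<open>V i\<close> and is split there by \<open>add\<close>.\<close>
    define h where "h t = (if t <= b then k t else k b + (- l b + l t))" for t
    have "good p a c h" unfolding good_def
    proof (intro allI ballI impI)
     fix x y i assume i: "i \<in> I" and xy: "a <= x & x <= y & y <= c & (ALL t. x <= t & t <= y --> p t \<in> V i)"
     consider "y <= b" | "b < x" | "x <= b" "b < y" by linarith
     then show "T i (p o linepath x y) = - h x + h y"
     proof cases
      case 1 then show ?thesis using k i xy by (auto simp: good_def h_def)
     next
      case 2
      then have "T i (p o linepath x y) = - l x + l y" using l i xy by (auto simp: good_def)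
      with 2 xy show ?thesis by (simp add: h_def minus_add add.assoc del: add_uminus_conv_diff)
     next
      case 3
      have "T i (p o linepath x b) = - k x + k b" using 3 k i xy by (auto simp: good_def)
      moreover have "T i (p o linepath b y) = - l b + l y" using 3 l i xy by (auto simp: good_def)
      ultimately show ?thesis using add[OF p i, of x b y] 3 xy ac by (auto simp: h_def add.assoc)
     qed
    qed
    then show "EX k. good p a c k" by blast
   qed
  next
   fix x :: real assume x: "0 <= x" "x <= 1"
   then have "p x \<in> topspace X" using p by (auto simp: pathin_def continuous_map_def)
   then obtain j where j: "j \<in> I" "p x \<in> V j" using cover by blast
   obtain d where d: "d > 0" "\<And>t. 0 <= t & t <= 1 & \<bar>t - x\<bar> < d ==> p t \<in> V j" using pathin_local[OF p opn[OF j(1)] j(2) x] by blast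
   have "EX k. good p a b k" if ab: "a <= x" "x <= b" "b - a < d" "0 <= a" "b <= 1" for a b
   proof -
    have V: "p t \<in> V j" if "a <= t" "t <= b" for t using that ab by (intro d) auto
    have "good p a b (\<lambda>t. T j (p o linepath a t))" unfolding good_def
    proof (intro allI ballI impI)
     fix x y i assume i: "i \<in> I" and xy: "a <= x & x <= y & y <= b & (ALL t. x <= t & t <= y --> p t \<in> V i)"
     have "T i (p o linepath x y) = T j (p o linepath x y)" by (rule agree[OF i j(1)]; rule pathin_subpath_local[OF p]) (use xy ab V in auto)
     moreover have "T j (p o linepath a y) = T j (p o linepath a x) + T j (p o linepath x y)" by (rule add[OF p j(1)]) (use xy ab V in auto)
     ultimately show "T i (p o linepath x y) = - T j (p o linepath a x) + T j (p o linepath a y)" by (simp add: add.assoc[symmetric])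
    qed
    then show ?thesis by blast
   qed
   then show "EX d>0. ALL a b. a <= x & x <= b & b - a < d --> 0 <= a --> b <= 1 --> (EX k. good p a b k)" using d(1) by blast
  qed auto
  then show ?thesis by simp
 qed
 \<comment> \<open>Primitives differ in general, but on a short interval both increments are the
   value of one local functional, and increments add up.\<close>
 have uniq: "- k 0 + k 1 = - l 0 + l 1" if p: "pathin X p" and k: "good p 0 1 k" and l: "good p 0 1 l" for p k l
 proof -
  have "0 <= (0::real) --> (1::real) <= 1 --> - k 0 + k 1 = - l 0 + l 1"
  proof (rule Bolzano[where P="\<lambda>a b. 0 <= a --> b <= 1 --> - k a + k b = - l a + l b"])
   fix a b c :: real
   assume *: "0 <= a --> b <= 1 --> - k a + k b = - l a + l b" "0 <= b --> c <= 1 --> - k b + k c = - l b + l c" "a <= b" "b <= c"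
   show "0 <= a --> c <= 1 --> - k a + k c = - l a + l c"
   proof (intro impI)
    assume "0 <= a" "c <= 1"
    with * have "(- k a + k b) + (- k b + k c) = (- l a + l b) + (- l b + l c)" by simp
    then show "- k a + k c = - l a + l c" by (simp add: add.assoc)
   qed
  next
   fix x :: real assume x: "0 <= x" "x <= 1"
   then have "p x \<in> topspace X" using p by (auto simp: pathin_def continuous_map_def)
   then obtain j where j: "j \<in> I" "p x \<in> V j" using cover by blast
   obtain d where d: "d > 0" "\<And>t. 0 <= t & t <= 1 & \<bar>t - x\<bar> < d ==> p t \<in> V j" using pathin_local[OF p opn[OF j(1)] j(2) x] by blast
   show "EX d>0. ALL a b. a <= x & x <= b & b - a < d --> 0 <= a --> b <= 1 --> - k a + k b = - l a + l b"
   proof (intro exI[of _ d] conjI allI impI d(1))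
    fix a b assume ab: "a <= x & x <= b & b - a < d" "0 <= a" "b <= 1"
    have "ALL t. a <= t & t <= b --> p t \<in> V j" using ab by (intro allI impI d) auto
    then have "0 <= a & a <= b & b <= 1 & (ALL t. a <= t & t <= b --> p t \<in> V j)" using ab by auto
    then have "T j (p o linepath a b) = - k a + k b" "T j (p o linepath a b) = - l a + l b" using k l j(1) unfolding good_def by blast+
    then show "- k a + k b = - l a + l b" by simp
   qed
  qed auto
  then show ?thesis by simp
 qed
 define \<Phi> where "\<Phi> p = (let k = SOME k. good p 0 1 k in - k 0 + k 1)" for p
 have \<Phi>: "\<Phi> p = - k 0 + k 1" if "pathin X p" "good p 0 1 k" for p k
  unfolding \<Phi>_def Let_def by (rule uniq[OF that(1) someI[of "good p 0 1"] that(2)]) (rule that(2))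
 have local: "\<Phi> p = T i p" if i: "i \<in> I" and p: "pathin (subtopology X (V i)) p" for i p
 proof -
  have pX: "pathin X p" and V: "\<And>t. 0 <= t ==> t <= 1 ==> p t \<in> V i" using p by (auto simp: pathin_subtopology)
  obtain k where k: "good p 0 1 k" using ex[OF pX] by blast
  have "T i (p o linepath 0 1) = - k 0 + k 1" using V by (intro goodD[OF k i]) auto
  then show ?thesis using \<Phi>[OF pX k] by (simp add: o_def linepath_id)
 qed
 have cong: "\<Phi> p = \<Phi> q" if p: "pathin X p" and pq: "\<And>t. 0 <= t ==> t <= 1 ==> p t = q t" for p q
 proof -
  have q: "pathin X q" using path_homotopic_pathin[OF path_homotopic_cong[OF p pq]] by blast
  obtain k where k: "good p 0 1 k" using ex[OF p] by blast
  have "good q 0 1 k" unfolding good_def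
  proof (intro allI ballI impI)
   fix x y i assume i: "i \<in> I" and xy: "0 <= x & x <= y & y <= 1 & (ALL t. x <= t & t <= y --> q t \<in> V i)"
   have V: "p t \<in> V i" if "x <= t" "t <= y" for t using pq[of t] xy that by auto
   have "T i (p o linepath x y) = T i (q o linepath x y)"
   proof (rule pf_cong[OF T[OF i]])
    show "pathin (subtopology X (V i)) (p o linepath x y)" using V xy by (intro pathin_subpath_local p) auto
    fix t :: real assume "0 <= t" "t <= 1"
    then have "linepath x y t \<in> {x..y}" using linepath_in_path[of t x y] xy by (simp add: closed_segment_eq_real_ivl)
    then show "(p o linepath x y) t = (q o linepath x y) t" using pq xy by simp
   qed
   moreover have "T i (p o linepath x y) = - k x + k y" using xy V by (intro goodD[OF k i]) auto
   ultimately show "T i (q o linepath x y) = - k x + k y" by simp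
  qed
  then show ?thesis using \<Phi>[OF p k] \<Phi>[OF q] by simp
 qed
 have sub: "\<Phi> (p o linepath a b) = - k a + k b" if p: "pathin X p" and k: "good p 0 1 k" and ab: "0 <= a" "a <= b" "b <= 1" for p k a b
 proof -
  have "good (p o linepath a b) 0 1 (k o linepath a b)" unfolding good_def
  proof (intro allI ballI impI)
   fix x y i assume i: "i \<in> I" and xy: "0 <= x & x <= y & y <= 1 & (ALL t. x <= t & t <= y --> (p o linepath a b) t \<in> V i)"
   let ?l = "linepath a b"
   define D where "D = b - a"
   have D: "0 <= D" "a + D <= 1" using ab by (auto simp: D_def)
   have lp: "?l t = a + t * D" for t by (simp add: linepath_def D_def algebra_simps)
   have l: "0 <= ?l x" "?l x <= ?l y" "?l y <= 1"
   proof -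
    have 1: "x * D <= y * D" "0 <= x * D" using xy D by (auto intro!: mult_right_mono mult_nonneg_nonneg)
    have 2: "y * D <= D" using xy D by (simp add: mult_left_le_one_le)
    show "0 <= ?l x" "?l x <= ?l y" "?l y <= 1" using 1 2 D ab(1) unfolding lp by linarith+
   qed
   have V: "p t \<in> V i" if t: "?l x <= t" "t <= ?l y" for t
   proof (cases "a = b")
    case True
    then have "t = ?l x" using t by (simp add: lp D_def)
    then show ?thesis using xy by auto
   next
    case False
    then have D0: "0 < D" using ab by (simp add: D_def)
    define u where "u = (t - a) / D"
    have u: "u * D = t - a" using D0 by (simp add: u_def)
    have "x * D <= u * D" "u * D <= y * D" using t by (auto simp: u lp)
    then have "x <= u" "u <= y" using D0 by auto
    then have "p (?l u) \<in> V i" using xy by auto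
    then show ?thesis by (simp add: lp u)
   qed
   have "(p o ?l) o linepath x y = p o linepath (?l x) (?l y)" by (auto simp: linepath_def algebra_simps)
   moreover have "T i (p o linepath (?l x) (?l y)) = - k (?l x) + k (?l y)" using l V by (intro goodD[OF k i])
   ultimately show "T i ((p o ?l) o linepath x y) = - (k o ?l) x + (k o ?l) y" by (simp add: o_def)
  qed
  then show ?thesis using \<Phi>[OF pathin_subpath[OF p]] ab by fastforce
 qed
 have concat: "\<Phi> (loop_concat p q) = \<Phi> p + \<Phi> q" if p: "pathin X p" and q: "pathin X q" and pq: "p 1 = q 0" for p q
 proof -
  let ?r = "loop_concat p q"
  have r: "pathin X ?r" by (rule pathin_loop_concat[OF p q pq])
  obtain k where k: "good ?r 0 1 k" using ex[OF r] by blast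
  have "\<Phi> p = \<Phi> (?r o linepath 0 (1/2))" by (rule cong[OF p]) (simp add: loop_concat_def linepath_def)
  moreover have "\<Phi> q = \<Phi> (?r o linepath (1/2) 1)"
  proof (rule cong[OF q])
   fix t :: real assume t: "0 <= t" "t <= 1"
   have e: "linepath (1/2) 1 t = t/2 + 1/2" by (simp add: linepath_def field_simps)
   show "q t = (?r o linepath (1/2) 1) t" unfolding o_apply e using t pq by (cases "t = 0") (auto simp: loop_concat_def)
  qed
  ultimately show ?thesis using \<Phi>[OF r k] sub[OF r k, of 0 "1/2"] sub[OF r k, of "1/2" 1] by (simp add: add.assoc)
 qed
 have homot: "\<Phi> p = \<Phi> q" if pq: "path_homotopic X p q" for p q
 proof -
  let ?I = "{0..1::real}"
  obtain h where h: "continuous_map (prod_topology (top_of_set ?I) (top_of_set ?I)) X h" "\<And>t. h (0, t) = p t" "\<And>t. h (1, t) = q t"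
   "\<And>s. s \<in> ?I ==> h (s, 0) = p 0 & h (s, 1) = p 1" using pq unfolding path_homotopic_def homotopic_with_def by blast
  have h1: "continuous_map (top_of_set (?I \<times> ?I)) X h" using h(1) by (metis prod_topology_subtopology_eu)
  define G where "G a b = \<Phi> (h o linepath a b)" for a b :: "real \<times> real"
  have pin: "pathin X (h o linepath a b)" if "a \<in> ?I \<times> ?I" "b \<in> ?I \<times> ?I" for a b
   by (rule pathin_compose[OF pathin_linepath h1]) (use that in "auto intro: convex_Times")
  \<comment> \<open>The two ways round a rectangle in the parameter square of a homotopy. Small
    rectangles satisfy this because the homotopy sends them into one member of the cover, where a
    convex domain has a potential; then rectangles are stacked in the direction of \<open>t\<close>
    and the resulting strips in the direction of \<open>s\<close>.\<close>
  define sq where "sq s s' t t' \<longleftrightarrow> G (s,t) (s,t') + G (s,t') (s',t') = G (s,t) (s',t) + G (s',t) (s',t')" for s s' t t'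
  have Gloc: "EX f. ALL a:R. ALL b:R. G a b = - f a + f b" if R: "convex R" "R \<subseteq> ?I \<times> ?I" "h ` R \<subseteq> V i" "i \<in> I" for R i
  proof -
   have hR: "continuous_map (top_of_set R) (subtopology X (V i)) h"
    using continuous_map_from_subtopology_mono[OF h1 R(2)] R(3) by (auto simp: continuous_map_in_subtopology)
   obtain f where f: "potential (top_of_set R) (\<lambda>u. T i (h o u)) f" using potential_convex[OF R(1) pf_compose[OF T[OF R(4)] hR]] .
   have "G a b = - f a + f b" if "a \<in> R" "b \<in> R" for a b
    using f pathin_linepath[OF R(1) that] local[OF R(4) pathin_compose[OF pathin_linepath[OF R(1) that] hR]] by (simp add: potential_def G_def)
   then show ?thesis by blast
  qed
  have Ghor: "G (s,t) (s'',t) = G (s,t) (s',t) + G (s',t) (s'',t)" "G (t,s) (t,s'') = G (t,s) (t,s') + G (t,s') (t,s'')"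
   if "s <= s'" "s' <= s''" "0 <= s" "s'' <= 1" "t \<in> ?I" for s s' s'' t
  proof -
   have sub2: "\<Phi> (p o linepath s s'') = \<Phi> (p o linepath s s') + \<Phi> (p o linepath s' s'')" if p: "pathin X p" for p
   proof -
    obtain k where k: "good p 0 1 k" using ex[OF p] by blast
    show ?thesis using sub[OF p k, of s s''] sub[OF p k, of s s'] sub[OF p k, of s' s''] \<open>s <= s'\<close> \<open>s' <= s''\<close> \<open>0 <= s\<close> \<open>s'' <= 1\<close>
     by (simp add: add.assoc)
   qed
   have 1: "h o linepath (a,t) (b,t) = (h o linepath (0,t) (1,t)) o linepath a b" for a b by (auto simp: linepath_def algebra_simps)
   have 2: "h o linepath (t,a) (t,b) = (h o linepath (t,0) (t,1)) o linepath a b" for a b by (auto simp: linepath_def algebra_simps)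
   show "G (s,t) (s'',t) = G (s,t) (s',t) + G (s',t) (s'',t)" unfolding G_def 1[of s s''] 1[of s s'] 1[of s' s''] using that by (intro sub2 pin) auto
   show "G (t,s) (t,s'') = G (t,s) (t,s') + G (t,s') (t,s'')" unfolding G_def 2[of s s''] 2[of s s'] 2[of s' s''] using that by (intro sub2 pin) auto
  qed
  have sqt: "sq s s' t t''" if "sq s s' t t'" "sq s s' t' t''" "t <= t'" "t' <= t''" "0 <= t" "t'' <= 1" "s \<in> ?I" "s' \<in> ?I" for s s' t t' t''
  proof -
   have "G (s,t) (s,t'') + G (s,t'') (s',t'') = G (s,t) (s,t') + (G (s,t') (s,t'') + G (s,t'') (s',t''))"
    using Ghor(2)[of t t' t'' s] that by (simp add: add.assoc)
   also have "\<dots> = G (s,t) (s,t') + (G (s,t') (s',t') + G (s',t') (s',t''))" using that(2) by (simp add: sq_def)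
   also have "\<dots> = (G (s,t) (s',t) + G (s',t) (s',t')) + G (s',t') (s',t'')" using that(1) by (simp add: sq_def add.assoc[symmetric])
   also have "\<dots> = G (s,t) (s',t) + G (s',t) (s',t'')" using Ghor(2)[of t t' t'' s'] that by (simp add: add.assoc)
   finally show ?thesis by (simp add: sq_def)
  qed
  have sqs: "sq s s'' t t'" if "sq s s' t t'" "sq s' s'' t t'" "s <= s'" "s' <= s''" "0 <= s" "s'' <= 1" "t \<in> ?I" "t' \<in> ?I" for s s' s'' t t'
  proof -
   have "G (s,t) (s,t') + G (s,t') (s'',t') = (G (s,t) (s,t') + G (s,t') (s',t')) + G (s',t') (s'',t')"
    using Ghor(1)[of s s' s'' t'] that by (simp add: add.assoc)
   also have "\<dots> = G (s,t) (s',t) + (G (s',t) (s',t') + G (s',t') (s'',t'))" using that(1) by (simp add: sq_def add.assoc)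
   also have "\<dots> = (G (s,t) (s',t) + G (s',t) (s'',t)) + G (s'',t) (s'',t')" using that(2) by (simp add: sq_def add.assoc)
   also have "\<dots> = G (s,t) (s'',t) + G (s'',t) (s'',t')" using Ghor(1)[of s s' s'' t] that by simp
   finally show ?thesis by (simp add: sq_def)
  qed
  have loc2: "EX d>0. ALL s s' t t'. s \<in> ?I & s' \<in> ?I & t \<in> ?I & t' \<in> ?I & \<bar>s - s0\<bar> < d & \<bar>s' - s0\<bar> < d & \<bar>t - t0\<bar> < d & \<bar>t' - t0\<bar> < d --> sq s s' t t'"
   if st: "s0 \<in> ?I" "t0 \<in> ?I" for s0 t0
  proof -
   have "h (s0, t0) \<in> topspace X" using h1 st by (auto simp: continuous_map_def)
   then obtain i where i: "i \<in> I" "h (s0,t0) \<in> V i" using cover by blast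
   let ?W = "{z \<in> ?I \<times> ?I. h z \<in> V i}"
   have W: "openin (top_of_set (?I \<times> ?I)) ?W" using h1 opn[OF i(1)] unfolding continuous_map_def by simp
   have "(s0,t0) \<in> ?W" using i st by simp
   then obtain d where d0: "d > 0" and d1: "ALL z:?I \<times> ?I. dist z (s0,t0) < d --> z \<in> ?W"
    using W[unfolded openin_euclidean_subtopology_iff, THEN conjunct2, rule_format, of "(s0,t0)"] by blast
   have d: "d > 0" "\<And>z. z \<in> ?I \<times> ?I ==> dist z (s0,t0) < d ==> h z \<in> V i" using d0 d1 by blast+
   let ?R = "(?I \<times> ?I) \<inter> ball (s0,t0) d"
   obtain f where f: "\<And>a b. a \<in> ?R ==> b \<in> ?R ==> G a b = - f a + f b"
   proof -
    have "convex ?R" by (intro convex_Int convex_Times convex_ball convex_real_interval)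
    moreover have "h ` ?R \<subseteq> V i" using d(2) by (auto simp: dist_commute)
    ultimately show ?thesis using Gloc[of ?R i, OF _ Int_lower1 _ i(1)] that by blast
   qed
   have mem: "(s, t) \<in> ?R" if "s \<in> ?I" "t \<in> ?I" "\<bar>s - s0\<bar> < d/2" "\<bar>t - t0\<bar> < d/2" for s t
   proof -
    have "dist (s,t) (s0,t0) <= \<bar>s - s0\<bar> + \<bar>t - t0\<bar>" by (simp add: dist_prod_def dist_real_def sqrt_sum_squares_le_sum_abs)
    then have "dist (s0,t0) (s,t) < d" using that by (simp add: dist_commute)
    then show ?thesis using that by simp
   qed
   show ?thesis
   proof (intro exI[of _ "d/2"] conjI allI impI)
    fix s s' t t' assume *: "s \<in> ?I & s' \<in> ?I & t \<in> ?I & t' \<in> ?I & \<bar>s - s0\<bar> < d/2 & \<bar>s' - s0\<bar> < d/2 & \<bar>t - t0\<bar> < d/2 & \<bar>t' - t0\<bar> < d/2"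
    have R: "(s,t) \<in> ?R" "(s,t') \<in> ?R" "(s',t) \<in> ?R" "(s',t') \<in> ?R" by (rule mem; use * in blast)+
    show "sq s s' t t'" unfolding sq_def by (simp only: f R) (simp add: add.assoc)
   qed (use d in auto)
  qed
  have line: "EX d>0. ALL s s'. s \<in> ?I & s' \<in> ?I & \<bar>s - s0\<bar> < d & \<bar>s' - s0\<bar> < d --> sq s s' 0 1" if s0: "s0 \<in> ?I" for s0
  proof -
   let ?P = "\<lambda>a b. EX d>0. ALL s s'. s \<in> ?I & s' \<in> ?I & \<bar>s - s0\<bar> < d & \<bar>s' - s0\<bar> < d --> sq s s' a b"
   have "0 <= (0::real) --> (1::real) <= 1 --> ?P 0 1"
   proof (rule Bolzano[where P="\<lambda>a b. 0 <= a --> b <= 1 --> ?P a b"])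
    fix a b c :: real
    assume *: "0 <= a --> b <= 1 --> ?P a b" "0 <= b --> c <= 1 --> ?P b c" "a <= b" "b <= c"
    show "0 <= a --> c <= 1 --> ?P a c"
    proof (intro impI)
     assume ac: "0 <= a" "c <= 1"
     have "?P a b" "?P b c" using * ac by auto
     then obtain d1 d2 where d1: "d1 > 0" "\<And>s s'. s \<in> ?I & s' \<in> ?I & \<bar>s - s0\<bar> < d1 & \<bar>s' - s0\<bar> < d1 ==> sq s s' a b"
      and d2: "d2 > 0" "\<And>s s'. s \<in> ?I & s' \<in> ?I & \<bar>s - s0\<bar> < d2 & \<bar>s' - s0\<bar> < d2 ==> sq s s' b c" by blast
     show "?P a c"
     proof (intro exI[of _ "min d1 d2"] conjI allI impI)
      fix s s' assume ss: "s \<in> ?I & s' \<in> ?I & \<bar>s - s0\<bar> < min d1 d2 & \<bar>s' - s0\<bar> < min d1 d2"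
      show "sq s s' a c" by (rule sqt[of s s' a b c]) (use ss * ac in "auto intro!: d1(2) d2(2)")
     qed (use d1(1) d2(1) in auto)
    qed
   next
    fix x :: real assume x: "0 <= x" "x <= 1"
    obtain d where d: "d > 0" "\<And>s s' t t'. (0 <= s & s <= 1) & (0 <= s' & s' <= 1) & (0 <= t & t <= 1) & (0 <= t' & t' <= 1) & \<bar>s - s0\<bar> < d & \<bar>s' - s0\<bar> < d & \<bar>t - x\<bar> < d & \<bar>t' - x\<bar> < d ==> sq s s' t t'"
     using loc2[OF s0, of x] x unfolding atLeastAtMost_iff by blast
    show "EX d>0. ALL a b. a <= x & x <= b & b - a < d --> 0 <= a --> b <= 1 --> ?P a b"
     using d x by (intro exI[of _ d] conjI allI impI d(1) exI[of _ d] d(2)) auto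
   qed auto
   then show ?thesis by simp
  qed
  have "0 <= (0::real) --> (1::real) <= 1 --> sq 0 1 0 1"
  proof (rule Bolzano[where P="\<lambda>a b. 0 <= a --> b <= 1 --> sq a b 0 1"])
   fix x :: real assume x: "0 <= x" "x <= 1"
   then obtain d where d: "d > 0" "\<And>s s'. (0 <= s & s <= 1) & (0 <= s' & s' <= 1) & \<bar>s - x\<bar> < d & \<bar>s' - x\<bar> < d ==> sq s s' 0 1"
    using line[of x] unfolding atLeastAtMost_iff by blast
   show "EX d>0. ALL a b. a <= x & x <= b & b - a < d --> 0 <= a --> b <= 1 --> sq a b 0 1" using d(1) x by (intro exI[of _ d] conjI allI impI d(2)) auto
  qed (auto intro: sqs)
  then have S: "sq 0 1 0 1" by simp
  have const: "\<Phi> (\<lambda>_. a) = 0" if "a \<in> topspace X" for a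
  proof -
   have "loop_concat (\<lambda>_. a) (\<lambda>_. a) = (\<lambda>_. a)" by (auto simp: loop_concat_def)
   then have "\<Phi> (\<lambda>_. a) + 0 = \<Phi> (\<lambda>_. a) + \<Phi> (\<lambda>_. a)" using concat[of "\<lambda>_. a" "\<lambda>_. a"] that by simp
   then show ?thesis unfolding add_left_cancel by simp
  qed
  have ends: "p 0 \<in> topspace X" "p 1 \<in> topspace X" using path_homotopic_pathin[OF pq] path_start_in_topspace path_finish_in_topspace by blast+
  have "G (0,0) (1,0) = \<Phi> (\<lambda>_. p 0)" "G (0,1) (1,1) = \<Phi> (\<lambda>_. p 1)"
   unfolding G_def by (rule cong[OF pin]; use h(4) in "auto simp: linepath_def")+
  then have c: "G (0,0) (1,0) = 0" "G (0,1) (1,1) = 0" using const ends by auto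
  have gp: "G (0,0) (0,1) = \<Phi> p" "G (1,0) (1,1) = \<Phi> q" by (auto simp: G_def o_def linepath_def h)
  show ?thesis using S by (simp add: sq_def c gp)
 qed
 show ?thesis using that[of \<Phi>] local concat homot by (auto simp: path_functional_def)
qed

section \<open>Squares, annuli and extension over open sets\<close>

lemma path_functional_square: assumes "path_functional X \<Phi>" "continuous_map (top_of_set ({0..1} \<times> {0..1})) X F"
 shows "\<Phi> (\<lambda>t. F (0, t)) + \<Phi> (\<lambda>s. F (s, 1)) = \<Phi> (\<lambda>s. F (s, 0)) + \<Phi> (\<lambda>t. F (1::real, t::real))"
proof -
 let ?Q = "{0..1::real} \<times> {0..1::real}"
 have cQ: "convex ?Q" by (intro convex_Times convex_real_interval)
 obtain f where f: "potential (top_of_set ?Q) (\<lambda>u. \<Phi> (F o u)) f" using potential_convex[OF cQ pf_compose[OF assms]] .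
 have *: "\<Phi> (\<lambda>t. F (linepath a b t)) = - f a + f b" if "a \<in> ?Q" "b \<in> ?Q" for a b
  using f pathin_linepath[OF cQ that] by (simp add: potential_def o_def)
 have "\<Phi> (\<lambda>t. F (0, t)) = - f (0,0) + f (0,1)" "\<Phi> (\<lambda>s. F (s, 1)) = - f (0,1) + f (1,1)"
  "\<Phi> (\<lambda>s. F (s, 0)) = - f (0,0) + f (1,0)" "\<Phi> (\<lambda>t. F (1, t)) = - f (1,0) + f (1,1)"
  using *[of "(0,0)" "(0,1)"] *[of "(0,1)" "(1,1)"] *[of "(0,0)" "(1,0)"] *[of "(1,0)" "(1,1)"] by (auto simp: linepath_def)
 then show ?thesis by (simp add: add.assoc)
qed

text \<open>The base point moves along \<open>s \<mapsto> F (s, 0)\<close>, so the two values are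
  conjugate; in a commutative group they are equal.\<close>

lemma path_functional_free_homotopy: fixes \<Phi> :: "(real => 'a) => 'g::ab_group_add"
 assumes "path_functional X \<Phi>" "continuous_map (top_of_set ({0..1} \<times> {0..1})) X F"
  "\<And>s. 0 <= s ==> s <= 1 ==> F (s, 0) = F (s, 1)" shows "\<Phi> (\<lambda>t. F (0, t)) = \<Phi> (\<lambda>t. F (1::real, t::real))"
proof -
 have "pathin X (F o (\<lambda>s. (s, 0)))"
  by (rule pathin_compose[OF _ assms(2)]) (auto simp: pathin_def continuous_map_in_subtopology intro!: continuous_intros)
 then have "\<Phi> (\<lambda>s. F (s, 0)) = \<Phi> (\<lambda>s. F (s, 1))" using assms(3) by (intro pf_cong[OF assms(1)]) (auto simp: o_def)
 then show ?thesis using path_functional_square[OF assms(1,2)] by simp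
qed

lemma path_functional_coboundary: "path_functional X (\<lambda>p. - f (p 0) + f (p 1))" unfolding path_functional_def
 by (intro conjI allI impI; (drule path_homotopic_ends)?) (simp_all add: add.assoc)

text \<open>On \<open>B\<close> the coboundary of \<open>f\<close> is taken as the continuation. It
  agrees with \<Phi> on the overlap, and the two glue.\<close>

lemma path_functional_extend: assumes "openin X A" "openin X B" "topspace X \<subseteq> A \<union> B"
  and "path_functional (subtopology X A) \<Phi>" "potential (subtopology X (A \<inter> B)) \<Phi> f"
 obtains \<Psi> where "path_functional X \<Psi>" "\<And>p. pathin (subtopology X A) p ==> \<Psi> p = \<Phi> p"
proof (rule path_functional_glue[of X "UNIV::bool set" "\<lambda>i. if i then A else B" "\<lambda>i. if i then \<Phi> else (\<lambda>p. - f (p 0) + f (p 1))"])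
 fix i j p
 assume *: "pathin (subtopology X (if i then A else B)) p" "pathin (subtopology X (if j then A else B)) p"
 have "\<Phi> p = - f (p 0) + f (p 1)" if "pathin (subtopology X A) p" "pathin (subtopology X B) p"
  using assms(5) that unfolding potential_def pathin_subtopology by blast
 with * show "(if i then \<Phi> else (\<lambda>p. - f (p 0) + f (p 1))) p = (if j then \<Phi> else (\<lambda>p. - f (p 0) + f (p 1))) p"
  by (auto split: if_splits)
next
 fix \<Psi> assume "path_functional X \<Psi>"
  and \<Psi>: "\<And>i p. i \<in> UNIV ==> pathin (subtopology X (if i then A else B)) p ==> \<Psi> p = (if i then \<Phi> else (\<lambda>p. - f (p 0) + f (p 1))) p"
 then have "path_functional X \<Psi>" "\<And>p. pathin (subtopology X A) p ==> \<Psi> p = \<Phi> p" using \<Psi>[of True] by simp_all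
 then show thesis by (rule that)
qed (use assms(1-4) in "auto simp: path_functional_coboundary UNIV_bool")

text \<open>The exponential map covers the annulus by a vertical strip, or a half plane if
  \<open>r = 0\<close>. That domain is convex, so a potential exists upstairs. Its increment over
  one period is the value on the circle; if this is zero, the potential descends.\<close>

lemma potential_annulus: fixes c :: complex and r \<rho> R :: real assumes r: "0 <= r" "r < \<rho>" "\<rho> < R"
  and S: "S = {z. r < norm (z - c) & norm (z - c) < R}" and pf: "path_functional (top_of_set S) \<Phi>"
  and circle: "\<Phi> (\<lambda>t. c + \<rho> * cis (2 * pi * t)) = 0" obtains f where "potential (top_of_set S) \<Phi> f"
proof -
 define J where "J = {x::real. r < exp x & exp x < R}"
 define W where "W = Re -` J"
 define E where "E w = c + exp w" for w
 have "is_interval J" unfolding is_interval_1 J_def by (auto intro: less_le_trans le_less_trans simp: exp_le_cancel_iff)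
 then have W: "convex W" unfolding W_def by (intro convex_linear_vimage is_interval_convex) (auto intro: bounded_linear.linear[OF bounded_linear_Re])
 have ES: "E w \<in> S \<longleftrightarrow> w \<in> W" for w by (auto simp: E_def S W_def J_def)
 have cE: "continuous_map (top_of_set W) (top_of_set S) E" using ES by (auto simp: continuous_map_in_subtopology E_def[abs_def] intro!: continuous_intros)
 obtain k where "potential (top_of_set W) (\<lambda>u. \<Phi> (E o u)) k" using potential_convex[OF W pf_compose[OF pf cE]] .
 then have k: "\<Phi> (E o u) = - k (u 0) + k (u 1)" if "pathin (top_of_set W) u" for u using that by (simp add: potential_def)
 let ?\<tau> = "2 * of_real pi * \<i>"
 define w0 where "w0 = complex_of_real (ln \<rho>)"
 have \<rho>: "\<rho> > 0" using r by simp
 have w0: "w0 \<in> W" "w0 + ?\<tau> \<in> W" using r \<rho> by (auto simp: W_def J_def w0_def)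
 have shift: "w + ?\<tau> \<in> W \<longleftrightarrow> w \<in> W" for w by (simp add: W_def)
 have Eshift: "E (w + ?\<tau>) = E w" for w by (simp add: E_def exp_add)
 have "E o linepath w0 (w0 + ?\<tau>) = (\<lambda>t. c + \<rho> * cis (2 * pi * t))"
 proof
  fix t
  have "linepath w0 (w0 + ?\<tau>) t = w0 + \<i> * of_real (2 * pi * t)" by (simp add: linepath_def algebra_simps scaleR_conv_of_real)
  moreover have "exp w0 = of_real \<rho>" using \<rho> by (simp add: w0_def exp_of_real)
  ultimately show "(E o linepath w0 (w0 + ?\<tau>)) t = c + \<rho> * cis (2 * pi * t)" unfolding o_apply E_def by (simp only: exp_add cis_conv_exp)
 qed
 then have k0: "k (w0 + ?\<tau>) = k w0" using k[OF pathin_linepath[OF W w0]] circle by (simp add: eq_neg_iff_add_eq_0 neg_eq_iff_add_eq_0 minus_equation_iff)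
   (metis add_minus_cancel add.right_neutral)
 have k1: "k (w + ?\<tau>) = k w" if w: "w \<in> W" for w
 proof -
  have "E o linepath w0 w = E o linepath (w0 + ?\<tau>) (w + ?\<tau>)"
  proof
   fix t have "linepath (w0 + ?\<tau>) (w + ?\<tau>) t = linepath w0 w t + ?\<tau>" by (simp add: linepath_def algebra_simps scaleR_conv_of_real)
   then show "(E o linepath w0 w) t = (E o linepath (w0 + ?\<tau>) (w + ?\<tau>)) t" by (simp add: Eshift)
  qed
  then have "- k w0 + k w = - k (w0 + ?\<tau>) + k (w + ?\<tau>)"
   using k[OF pathin_linepath[OF W w0(1) w]] k[OF pathin_linepath[OF W w0(2), of "w + ?\<tau>"]] w by (simp add: shift)
  then show ?thesis by (simp add: k0)
 qed
 have k2: "k (w + of_nat n * ?\<tau>) = k w" if "w \<in> W" for w n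
 proof (induction n)
  case (Suc n)
  have "w + of_nat n * ?\<tau> \<in> W" using that by (simp add: W_def)
  from k1[OF this] Suc show ?case by (simp add: algebra_simps)
 qed simp
 have k3: "k w = k w'" if w: "w \<in> W" "w' \<in> W" and e: "exp w = exp w'" for w w'
 proof -
  obtain n :: int where n: "w = w' + (of_int (2 * n) * pi) * \<i>" using e unfolding exp_eq by blast
  show ?thesis
  proof (cases "n >= 0")
   case True
   then have "w = w' + of_nat (nat n) * ?\<tau>" using n by (simp add: algebra_simps)
   then show ?thesis using k2[OF w(2)] by simp
  next
   case False
   then have "of_int n = - (of_nat (nat (- n)) :: complex)" by simp
   then have "w' = w + of_nat (nat (- n)) * ?\<tau>" unfolding n by (simp add: algebra_simps)
   then show ?thesis using k2[OF w(1)] by metis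
  qed
 qed
 \<comment> \<open>The cut of the principal branch does no harm, because \<open>k\<close> takes
   equal values at all logarithms of a point.\<close>
 define f where "f z = k (Ln (z - c))" for z
 have zc: "z ~= c" if "z \<in> S" for z using that r by (auto simp: S)
 have fE: "f (E w) = k w" if "w \<in> W" for w
 proof -
  have "E w \<in> S" using that ES by simp
  have e: "exp (Ln (E w - c)) = exp w" by (simp add: E_def)
  moreover have "Ln (E w - c) \<in> W" using ES[of "Ln (E w - c)"] e \<open>E w \<in> S\<close> unfolding E_def by simp
  ultimately show ?thesis unfolding f_def by (intro k3 that) auto
 qed
 have "potential (top_of_set S) \<Phi> f"
 proof (rule potential_local[OF pf])
  fix z0 assume "z0 \<in> topspace (top_of_set S)"
  then have z0: "z0 \<in> S" by simp
  then have z0c: "z0 ~= c" by (rule zc)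
  \<comment> \<open>Seen from \<open>c\<close>, this half plane around the direction of
    \<open>z0\<close> keeps the quotient away from the cut of \<open>Ln\<close>, so a path in it
    lifts continuously.\<close>
  let ?V = "S \<inter> {z. Re ((z - c) / (z0 - c)) > 0}"
  have "open {z. Re ((z - c) / (z0 - c)) > 0}" by (intro open_Collect_less continuous_intros) (use z0c in auto)
  then have 1: "openin (top_of_set S) ?V" by blast
  have "potential (subtopology (top_of_set S) ?V) \<Phi> f" unfolding potential_def
  proof (intro allI impI)
   fix p assume p: "pathin (subtopology (top_of_set S) ?V) p"
   then have pS: "pathin (top_of_set S) p" and pV: "\<And>t. t \<in> {0..1} ==> p t \<in> S & Re ((p t - c) / (z0 - c)) > 0" by (auto simp: pathin_subtopology)
   have pc: "continuous_on {0..1} p" using pS by (simp add: pathin_top_of_set path_def)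
   define w where "w t = Ln ((p t - c) / (z0 - c)) + Ln (z0 - c)" for t
   have nn: "(p t - c) / (z0 - c) ~: \<real>\<^sub>\<le>\<^sub>0" if "t \<in> {0..1}" for t using pV[OF that] by (auto simp: complex_nonpos_Reals_iff)
   have Ew: "E (w t) = p t" if "t \<in> {0..1}" for t
   proof -
    have "p t ~= c" using zc pV[OF that] by blast
    then show ?thesis using z0c by (simp add: w_def E_def exp_add)
   qed
   have "continuous_on {0..1} w" unfolding w_def by (intro continuous_intros pc) (use z0c nn in auto)
   moreover have "w t \<in> W" if "t \<in> {0..1}" for t using ES[of "w t"] Ew[OF that] pV[OF that] by simp
   ultimately have w: "pathin (top_of_set W) w" by (auto simp: pathin_top_of_set path_def path_image_def)
   have "\<Phi> p = \<Phi> (E o w)" using Ew by (intro pf_cong[OF pf pS]) auto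
   also have "\<dots> = - k (w 0) + k (w 1)" by (rule k[OF w])
   also have "\<dots> = - f (p 0) + f (p 1)" using fE[of "w 0"] fE[of "w 1"] Ew[of 0] Ew[of 1] \<open>\<And>t. t \<in> {0..1} ==> w t \<in> W\<close> by simp
   finally show "\<Phi> p = - f (p 0) + f (p 1)" .
  qed
  with 1 z0 z0c show "EX V. openin (top_of_set S) V & z0 \<in> V & potential (subtopology (top_of_set S) V) \<Phi> f" by (intro exI[of _ ?V]) auto
 qed
 then show ?thesis by (rule that)
qed

section \<open>Loop classes and functionals pulled back along epimorphisms\<close>

definition loop_at :: "'a topology => 'a => (real => 'a) => bool" where "loop_at X x p \<longleftrightarrow> pathin X p & p 0 = x & p 1 = x"

definition loop_class :: "'a topology => 'a => (real => 'a) => (real => 'a) set" where "loop_class X x p = {q. loop_homotopic X x p q}"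

lemma loop_class_iff: "loop_at X x p ==> q \<in> loop_class X x p \<longleftrightarrow> path_homotopic X p q"
 by (simp add: loop_class_def loop_at_def loop_homotopic_eq)

lemma loop_class_refl: "loop_at X x p ==> p \<in> loop_class X x p" by (simp add: loop_class_iff path_homotopic_refl loop_at_def)

lemma loop_at_homotopic: "loop_at X x p ==> path_homotopic X p q ==> loop_at X x q"
 using path_homotopic_ends[of X p q] path_homotopic_pathin[of X p q] by (simp add: loop_at_def)

lemma loop_at_concat: "loop_at X x p ==> loop_at X x q ==> loop_at X x (loop_concat p q)" by (simp add: loop_at_def pathin_loop_concat)

lemma loop_class_eq_iff: assumes "loop_at X x p" "loop_at X x q" shows "loop_class X x p = loop_class X x q \<longleftrightarrow> path_homotopic X p q"
proof
 assume "loop_class X x p = loop_class X x q"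
 then show "path_homotopic X p q" using loop_class_refl[OF assms(2)] loop_class_iff[OF assms(1)] by auto
next
 assume "path_homotopic X p q"
 then show "loop_class X x p = loop_class X x q" using loop_class_iff[OF assms(1)] loop_class_iff[OF assms(2)] path_homotopic_trans path_homotopic_sym by blast
qed

lemma carrier_fundamental_group: "carrier (fundamental_group X x) = {loop_class X x p |p. loop_at X x p}"
 by (auto simp: fundamental_group_def loop_class_def loop_at_def)

lemma mult_fundamental_group: assumes "loop_at X x p" "loop_at X x q"
 shows "loop_class X x p \<otimes>\<^bsub>fundamental_group X x\<^esub> loop_class X x q = loop_class X x (loop_concat p q)"
proof -
 have "(EX p':loop_class X x p. EX q':loop_class X x q. loop_homotopic X x (loop_concat p' q') r)
   \<longleftrightarrow> path_homotopic X (loop_concat p q) r" (is "?L \<longleftrightarrow> ?R") for r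
 proof
  assume ?L
  then obtain p' q' where *: "path_homotopic X p p'" "path_homotopic X q q'" "loop_homotopic X x (loop_concat p' q') r"
   using assms by (auto simp: loop_class_iff)
  have l: "loop_at X x p'" "loop_at X x q'" using loop_at_homotopic[OF assms(1) *(1)] loop_at_homotopic[OF assms(2) *(2)] by auto
  then have "path_homotopic X (loop_concat p' q') r" using *(3) by (simp add: loop_homotopic_eq loop_at_def)
  moreover have "path_homotopic X (loop_concat p q) (loop_concat p' q')" using assms by (intro path_homotopic_concat *) (auto simp: loop_at_def)
  ultimately show ?R by (rule path_homotopic_trans[rotated])
 next
  assume ?R
  then show ?L using assms loop_class_refl[OF assms(1)] loop_class_refl[OF assms(2)]
   by (intro bexI[of _ p] bexI[of _ q]) (auto simp: loop_homotopic_eq loop_at_def)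
 qed
 then have "{r. EX p':loop_class X x p. EX q':loop_class X x q. loop_homotopic X x (loop_concat p' q') r}
   = loop_class X x (loop_concat p q)" using loop_class_iff[OF loop_at_concat[OF assms]] by blast
 then show ?thesis by (simp add: fundamental_group_def)
qed

text \<open>A choice of paths from the base point to all points turns every path into a loop;
  concatenation is respected because the inserted paths cancel.\<close>

lemma path_functional_of_hom: fixes \<kappa> :: "(real => 'a) set => 'g::group_add"
 assumes conn: "\<And>y. y \<in> topspace X ==> EX p. pathin X p & p 0 = x & p 1 = y" and x: "x \<in> topspace X"
  and hom: "\<And>p q. loop_at X x p ==> loop_at X x q ==>
   \<kappa> (loop_class X x (loop_concat p q)) = \<kappa> (loop_class X x p) + \<kappa> (loop_class X x q)"
 obtains \<Phi> where "path_functional X \<Phi>" "\<And>p. loop_at X x p ==> \<Phi> p = \<kappa> (loop_class X x p)"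
proof -
 \<comment> \<open>At the base point itself the constant path is chosen, so that a loop is changed
   only up to homotopy.\<close>
 define P where "P y = (if y = x then (\<lambda>_. x) else (SOME p. pathin X p & p 0 = x & p 1 = y))" for y
 have P: "pathin X (P y)" "P y 0 = x" "P y 1 = y" if "y \<in> topspace X" for y using someI_ex[OF conn[OF that]] x by (auto simp: P_def)
 define W where "W p = whisker (P (p 0)) p (P (p 1))" for p
 have W: "loop_at X x (W p)" if "pathin X p" for p using P[OF path_start_in_topspace[OF that]] P[OF path_finish_in_topspace[OF that]] that
  by (simp add: loop_at_def W_def pathin_whisker)
 define \<Phi> where "\<Phi> p = \<kappa> (loop_class X x (W p))" for p
 have "path_functional X \<Phi>" unfolding path_functional_def
 proof (intro conjI allI impI)
  fix p q assume pq: "pathin X p" "pathin X q" "p 1 = q 0"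
  note PP = P[OF path_start_in_topspace[OF pq(1)]] P[OF path_finish_in_topspace[OF pq(1)]] P[OF path_finish_in_topspace[OF pq(2)]]
  have "path_homotopic X (loop_concat (W p) (W q)) (W (loop_concat p q))" unfolding W_def loop_concat_ends pq(3)[symmetric]
   by (rule whisker_concat) (use PP pq(1,2) pq(3)[symmetric] in "simp_all only:")
  then have "loop_class X x (W (loop_concat p q)) = loop_class X x (loop_concat (W p) (W q))"
   using loop_class_eq_iff[OF loop_at_concat[OF W W] W] pathin_loop_concat pq by blast
  then show "\<Phi> (loop_concat p q) = \<Phi> p + \<Phi> q" using hom[OF W W] pq by (simp add: \<Phi>_def)
 next
  fix p q assume pq: "path_homotopic X p q"
  note pin = path_homotopic_pathin[OF pq, THEN conjunct1] path_homotopic_pathin[OF pq, THEN conjunct2]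
  note PP = P[OF path_start_in_topspace[OF pin(1)]] P[OF path_finish_in_topspace[OF pin(1)]]
  have "path_homotopic X (W p) (W q)" using whisker_cong[OF pq, of "P (p 0)" "P (p 1)"] PP path_homotopic_ends[OF pq] by (simp add: W_def)
  then have "loop_class X x (W p) = loop_class X x (W q)" using loop_class_eq_iff[OF W W] pin by blast
  then show "\<Phi> p = \<Phi> q" by (simp add: \<Phi>_def)
 qed
 moreover have "\<Phi> p = \<kappa> (loop_class X x p)" if p: "loop_at X x p" for p
 proof -
  have pp: "pathin X p" "p 0 = x" "p 1 = x" using p by (auto simp: loop_at_def)
  have c: "loop_reverse (\<lambda>_. x) = (\<lambda>_. x)" by (simp add: loop_reverse_def)
  have "path_homotopic X (W p) (loop_concat (\<lambda>_. x) p)" unfolding W_def whisker_def using path_homotopic_rid[OF pp(1)] pp x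
   by (auto simp: P_def c intro!: path_homotopic_concat path_homotopic_refl)
  also have "path_homotopic X (loop_concat (\<lambda>_. x) p) p" using path_homotopic_lid[OF pp(1)] pp by simp
  finally have "loop_class X x (W p) = loop_class X x p" using loop_class_eq_iff[OF W p] pp by blast
  then show ?thesis by (simp add: \<Phi>_def)
 qed
 ultimately show ?thesis by (rule that)
qed

text \<open>The homomorphism acts on classes only; \<open>r\<close> chooses a representative of each
  image, and values of functionals do not depend on the choice. By surjectivity every loop of the
  target is homotopic to some \<open>r p\<close>.\<close>

lemma epi_pullback: assumes epi: "\<phi> \<in> epi (fundamental_group X x) (fundamental_group Y y)"
  and conn: "\<And>z. z \<in> topspace X ==> EX p. pathin X p & p 0 = x & p 1 = z" and x: "x \<in> topspace X"
 obtains r where "\<And>p. loop_at X x p ==> loop_at Y y (r p)"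
  "\<And>q. loop_at Y y q ==> EX p. loop_at X x p & path_homotopic Y (r p) q"
  "\<And>\<Theta> :: (real => 'b) => 'g::group_add. path_functional Y \<Theta> ==>
    EX \<Phi>. path_functional X \<Phi> & (ALL p. loop_at X x p --> \<Phi> p = \<Theta> (r p))"
proof -
 have hom: "\<phi> \<in> hom (fundamental_group X x) (fundamental_group Y y)"
  and surj: "\<phi> ` carrier (fundamental_group X x) = carrier (fundamental_group Y y)" using epi by (auto simp: epi_def)
 have "EX q. loop_at Y y q & \<phi> (loop_class X x p) = loop_class Y y q" if "loop_at X x p" for p using surj that unfolding carrier_fundamental_group by blast
 then obtain r where r: "\<And>p. loop_at X x p ==> loop_at Y y (r p) & \<phi> (loop_class X x p) = loop_class Y y (r p)" by metis
 show ?thesis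
 proof
  show "loop_at Y y (r p)" if "loop_at X x p" for p using r that by blast
  show "EX p. loop_at X x p & path_homotopic Y (r p) q" if q: "loop_at Y y q" for q
  proof -
   have "loop_class Y y q \<in> carrier (fundamental_group Y y)" using q by (auto simp: carrier_fundamental_group)
   then have "loop_class Y y q \<in> \<phi> ` carrier (fundamental_group X x)" by (simp only: surj)
   then obtain A where A: "A \<in> carrier (fundamental_group X x)" "loop_class Y y q = \<phi> A" by (rule imageE) simp
   from A(1) obtain p where p: "loop_at X x p" "A = loop_class X x p" unfolding carrier_fundamental_group by (rule CollectE) blast
   have "loop_class Y y (r p) = loop_class Y y q" using r[OF p(1)] A(2) p(2) by simp
   then have "path_homotopic Y (r p) q" using loop_class_eq_iff[OF conjunct1[OF r[OF p(1)]] q] by simp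
   with p(1) show ?thesis by blast
  qed
  fix \<Theta> :: "(real => 'b) => 'g" assume \<Theta>: "path_functional Y \<Theta>"
  define \<theta> where "\<theta> A = \<Theta> (SOME q. q \<in> A)" for A
  have \<theta>: "\<theta> (loop_class Y y q) = \<Theta> q" if q: "loop_at Y y q" for q
  proof -
   have "(SOME q'. q' \<in> loop_class Y y q) \<in> loop_class Y y q"
    by (rule someI[of "\<lambda>q'. q' \<in> loop_class Y y q" q]) (rule loop_class_refl[OF q])
   then have "path_homotopic Y q (SOME q'. q' \<in> loop_class Y y q)" by (simp only: loop_class_iff[OF q])
   then show ?thesis unfolding \<theta>_def by (rule pf_homotopic[OF \<Theta>, symmetric])
  qed
  obtain \<Phi> where \<Phi>: "path_functional X \<Phi>" "\<And>p. loop_at X x p ==> \<Phi> p = \<theta> (\<phi> (loop_class X x p))"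
  proof (rule path_functional_of_hom[OF conn x, of "\<lambda>A. \<theta> (\<phi> A)"])
   fix p q assume pq: "loop_at X x p" "loop_at X x q"
   have "\<phi> (loop_class X x (loop_concat p q)) = \<phi> (loop_class X x p) \<otimes>\<^bsub>fundamental_group Y y\<^esub> \<phi> (loop_class X x q)"
    unfolding mult_fundamental_group[OF pq, symmetric] by (rule hom_mult[OF hom]) (use pq in "auto simp: carrier_fundamental_group")
   also have "\<dots> = loop_class Y y (loop_concat (r p) (r q))" using r pq by (simp add: mult_fundamental_group)
   finally show "\<theta> (\<phi> (loop_class X x (loop_concat p q))) = \<theta> (\<phi> (loop_class X x p)) + \<theta> (\<phi> (loop_class X x q))"
    using r[OF pq(1)] r[OF pq(2)] pf_concat[OF \<Theta>] by (simp add: \<theta> loop_at_concat) (simp add: loop_at_def)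
  qed auto
  then show "EX \<Phi>. path_functional X \<Phi> & (ALL p. loop_at X x p --> \<Phi> p = \<Theta> (r p))" using r \<theta> by auto
 qed
qed

section \<open>Charts of the non-orientable surface\<close>

text \<open>
 Each disc with holes is thickened to an open plane domain. The transition maps are the antipodal
 map \<open>z \<mapsto> -1 / cnj z\<close> near the unit circle and \<open>z \<mapsto> -1/2 - 1 / (16 (z - 1/2))\<close>, which is
 \<open>z \<mapsto> - cnj z\<close> on the circle of radius 1/4 around 1/2, near the tubes. The widths are chosen such that the
 annuli on one disc are disjoint; so no point lies in three charts.
\<close>

definition antipode :: "complex => complex" where "antipode z = - 1 / cnj z"
definition tube_map :: "complex => complex" where "tube_map z = - 1/2 - 1 / (16 * (z - 1/2))"
definition tube_inv :: "complex => complex" where "tube_inv z = 1/2 - 1 / (16 * (z + 1/2))"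

text \<open>The bounds 9/10 and 10/9 are reciprocal, so the antipodal map preserves this annulus.
  For the two tube annuli \<open>5/32 * 2/5 = 1/16\<close>, hence inversion exchanges their bounds.
  Disjointness comes from \<open>1/2 + 2/5 = 9/10\<close> and \<open>2/5 + 2/5 < 1\<close>.\<close>

definition outer_annulus :: "complex set" where "outer_annulus = {z. 9/10 < norm z & norm z < 10/9}"
definition right_annulus :: "complex set" where "right_annulus = {z. 5/32 < norm (z - 1/2) & norm (z - 1/2) < 2/5}"
definition left_annulus :: "complex set" where "left_annulus = {z. 5/32 < norm (z + 1/2) & norm (z + 1/2) < 2/5}"

definition chart_dom :: "nat => nat => complex set" where
 "chart_dom g i = {z. norm z < 10/9 & (0 < i --> 5/32 < norm (z + 1/2)) & (i + 1 < g --> 5/32 < norm (z - 1/2))}"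

definition disc_piece :: "nat => nat => complex set" where
 "disc_piece g i = {z. norm z <= 1 & (0 < i --> 1/4 <= norm (z + 1/2)) & (i + 1 < g --> 1/4 <= norm (z - 1/2))}"

definition chart_rel :: "nat => nat => complex => nat => complex => bool" where
 "chart_rel g i z j w \<longleftrightarrow> i < g & j < g & z \<in> chart_dom g i & w \<in> chart_dom g j &
   (i = j & z = w \<or> i = j & z \<in> outer_annulus & w = antipode z \<or>
   j = Suc i & z \<in> right_annulus & w = tube_map z \<or> i = Suc j & w \<in> right_annulus & z = tube_map w)"

text \<open>The interface through which the surface is used from here on. A point is covered by a
  closed piece and not only by an open chart; the last assumption is the universal property of the
  quotient, for real functions.\<close>

locale surface = fixes U :: "'a topology" and g :: nat and p :: "nat => complex => 'a" assumes g_pos: "g >= 1"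
  and chart_cont: "i < g ==> continuous_map (top_of_set (chart_dom g i)) U (p i)"
  and chart_open: "i < g ==> open b ==> b \<subseteq> chart_dom g i ==> openin U (p i ` b)"
  and chart_eq: "i < g ==> j < g ==> z \<in> chart_dom g i ==> w \<in> chart_dom g j ==> p i z = p j w \<longleftrightarrow> chart_rel g i z j w"
  and chart_cover: "x \<in> topspace U ==> EX i<g. EX z:disc_piece g i. p i z = x"
  and continuous_on_pieces: "(\<And>i. i < g ==> continuous_on (disc_piece g i) (\<lambda>z. f (p i z))) ==> continuous_map U euclideanreal f"

lemma norm_half_cases: fixes z :: complex shows "norm z <= norm (z - 1/2) + 1/2" "norm z <= norm (z + 1/2) + 1/2"
  "norm (z - 1/2) <= norm z + 1/2" "norm (z + 1/2) <= norm z + 1/2" "norm z >= 1/2 - norm (z - 1/2)" "1 <= norm (z - 1/2) + norm (z + 1/2)"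
  "norm (z - 1/2) >= norm z - 1/2" "norm (z + 1/2) >= norm z - 1/2" using norm_triangle_ineq[of "z - 1/2" "1/2"] norm_triangle_ineq4[of "z + 1/2" "1/2"]
  norm_triangle_ineq4[of z "1/2"] norm_triangle_ineq[of z "1/2"]
  norm_triangle_ineq4[of z "z - 1/2"] norm_triangle_ineq4[of "z + 1/2" "z - 1/2"] by auto

lemma norm_antipode: "norm (antipode z) = 1 / norm z" by (simp add: antipode_def norm_divide)

lemma norm_tube_map: "norm (tube_map z + 1/2) = 1 / (16 * norm (z - 1/2))"
proof -
 have "tube_map z + 1/2 = - (1 / (16 * (z - 1/2)))" by (simp add: tube_map_def)
 then show ?thesis by (simp only: norm_minus_cancel norm_divide norm_mult) simp
qed

lemma norm_tube_inv: "norm (tube_inv z - 1/2) = 1 / (16 * norm (z + 1/2))"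
proof -
 have "tube_inv z - 1/2 = - (1 / (16 * (z + 1/2)))" by (simp add: tube_inv_def)
 then show ?thesis by (simp only: norm_minus_cancel norm_divide norm_mult) simp
qed

lemma antipode_antipode [simp]: "antipode (antipode z) = z" by (simp add: antipode_def)

lemma antipode_circle: "norm z = 1 ==> antipode z = - z"
 by (metis antipode_def complex_cnj_cnj complex_div_cnj complex_norm_square divide_minus_left div_by_1 mult_1
   mult.commute of_real_1 one_power2)

lemma antipode_outer: "z \<in> outer_annulus ==> antipode z \<in> outer_annulus" by (auto simp: outer_annulus_def norm_antipode divide_simps)

lemma tube_inv_tube_map: "tube_inv (tube_map z) = z" by (simp add: tube_map_def tube_inv_def add_divide_distrib diff_divide_distrib)

lemma tube_map_tube_inv: "tube_map (tube_inv z) = z" by (simp add: tube_map_def tube_inv_def add_divide_distrib diff_divide_distrib)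

lemma tube_map_circle: assumes "norm (z - 1/2) = 1/4" shows "tube_map z = - cnj z"
proof -
 define u where "u = z - 1/2"
 have z: "z = u + 1/2" by (simp add: u_def)
 have "u * cnj u = (1/4)\<^sup>2" using assms unfolding u_def[symmetric] by (metis complex_norm_square of_real_divide of_real_numeral of_real_1 of_real_power)
 then have "1 / (16 * u) = cnj u" by (cases "u = 0") (auto simp: field_simps power2_eq_square)
 then show ?thesis by (simp add: z tube_map_def)
qed

lemma reciprocal_bounds: fixes x r :: real assumes "x = 1 / (16 * r)" "0 < r"
 shows "5/32 < r ==> x < 2/5" "r < 2/5 ==> 5/32 < x" "r <= 1/4 ==> 1/4 <= x" "1/4 <= r ==> x <= 1/4"
 using assms(2) unfolding assms(1) by (auto simp: divide_simps)

lemma reciprocal_eq: fixes x r :: real assumes "x = 1 / (16 * r)" "1/4 <= x" "1/4 <= r" shows "r = 1/4"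
proof -
 have "1/4 <= 1 / (16 * r)" "0 < r" using assms by auto
 then have "r <= 1/4" by (simp add: field_simps)
 then show ?thesis using assms(3) by simp
qed

lemma tube_map_bound: assumes "5/32 < norm (z - 1/2)" "norm (z - 1/2) <= 1/4" shows "1/4 <= norm (tube_map z + 1/2)"
 by (rule reciprocal_bounds(3)[OF norm_tube_map]) (use assms in linarith)+

lemma tube_inv_bound: assumes "5/32 < norm (z + 1/2)" "norm (z + 1/2) <= 1/4" shows "1/4 <= norm (tube_inv z - 1/2)"
 by (rule reciprocal_bounds(3)[OF norm_tube_inv]) (use assms in linarith)+

lemma tube_map_left: assumes "z \<in> right_annulus" shows "tube_map z \<in> left_annulus"
proof -
 have a: "5/32 < norm (z - 1/2)" "norm (z - 1/2) < 2/5" "0 < norm (z - 1/2)"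
  using assms unfolding right_annulus_def by (simp_all only: mem_Collect_eq) linarith+
 show ?thesis unfolding left_annulus_def mem_Collect_eq using reciprocal_bounds(1,2)[OF norm_tube_map a(3)] a(1,2) by blast
qed

lemma tube_inv_right: assumes "z \<in> left_annulus" shows "tube_inv z \<in> right_annulus"
proof -
 have a: "5/32 < norm (z + 1/2)" "norm (z + 1/2) < 2/5" "0 < norm (z + 1/2)" using assms unfolding left_annulus_def by (simp_all only: mem_Collect_eq) linarith+
 show ?thesis unfolding right_annulus_def mem_Collect_eq using reciprocal_bounds(1,2)[OF norm_tube_inv a(3)] a(1,2) by blast
qed

lemma annuli_disjoint: "z \<in> outer_annulus ==> z ~: right_annulus" "z \<in> outer_annulus ==> z ~: left_annulus"
 "z \<in> right_annulus ==> z ~: left_annulus" using norm_half_cases[of z] by (auto simp: outer_annulus_def right_annulus_def left_annulus_def)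

lemma annuli_chart_dom:
 "z \<in> outer_annulus ==> z \<in> chart_dom g i" "z \<in> right_annulus ==> z \<in> chart_dom g i" "z \<in> left_annulus ==> z \<in> chart_dom g i"
 using norm_half_cases[of z] by (auto simp: outer_annulus_def right_annulus_def left_annulus_def chart_dom_def)

lemma disc_piece_chart_dom: "disc_piece g i \<subseteq> chart_dom g i" by (auto simp: disc_piece_def chart_dom_def)

lemma chart_rel_refl: "i < g ==> z \<in> chart_dom g i ==> chart_rel g i z i z" by (simp add: chart_rel_def)

lemma chart_rel_sym: "chart_rel g i z j w ==> chart_rel g j w i z" unfolding chart_rel_def using antipode_outer by auto

text \<open>The middle point of two nontrivial transitions lies in an annulus for each of them. As
  the annuli are disjoint, the two are of the same kind and cancel.\<close>

lemma chart_rel_trans: "chart_rel g i z j w ==> chart_rel g j w k v ==> chart_rel g i z k v"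
 unfolding chart_rel_def using antipode_outer tube_map_left annuli_disjoint tube_inv_tube_map by (elim conjE disjE; simp; metis)

lemma open_annuli: "open outer_annulus" "open right_annulus" "open left_annulus" "open (chart_dom g i)"
proof -
 show "open (chart_dom g i)" unfolding chart_dom_def by (cases "0 < i"; cases "i + 1 < g"; simp; intro open_Collect_conj open_Collect_less continuous_intros)
qed (unfold outer_annulus_def right_annulus_def left_annulus_def, (intro open_Collect_conj open_Collect_less continuous_intros)+)

lemma continuous_transitions: "continuous_on outer_annulus antipode" "continuous_on right_annulus tube_map" "continuous_on left_annulus tube_inv"
proof -
 show "continuous_on outer_annulus antipode" unfolding antipode_def by (intro continuous_intros) (auto simp: outer_annulus_def)
 have nz: "z \<in> right_annulus ==> 16 * (z - 1/2) ~= 0" "z \<in> left_annulus ==> 16 * (z + 1/2) ~= 0" for z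
  unfolding mult_eq_0_iff right_annulus_def left_annulus_def by fastforce+
 show "continuous_on right_annulus tube_map" unfolding tube_map_def by (intro continuous_intros ballI nz(1))
 show "continuous_on left_annulus tube_inv" unfolding tube_inv_def by (intro continuous_intros ballI nz(2))
qed

lemma punctured_discs_iff: "(i, z) \<in> punctured_discs g \<longleftrightarrow> i < g & z \<in> disc_piece g i"
proof -
 have "dist (-1/2) z = norm (z + 1/2)" "dist (1/2) z = norm (z - 1/2)" by (simp_all add: dist_norm norm_minus_commute)
 then show ?thesis by (auto simp: punctured_discs_def disc_piece_def not_less)
qed

lemma glued_chart_rel: "glued g x y ==> chart_rel g (fst x) (snd x) (fst y) (snd y)"
proof (induction rule: glued.induct)
 case (antipodal i z)
 then have "z \<in> outer_annulus" "antipode z = - z" by (auto simp: outer_annulus_def antipode_circle)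
 then show ?case using antipodal antipode_outer[of z] by (auto simp: chart_rel_def annuli_chart_dom)
next
 case (tube i z)
 then have "norm (z - 1/2) = 1/4" by (simp add: dist_norm norm_minus_commute)
 then have "z \<in> right_annulus" "tube_map z = - cnj z" by (auto simp: right_annulus_def tube_map_circle)
 then show ?case using tube tube_map_left[of z] by (auto simp: chart_rel_def annuli_chart_dom)
qed

text \<open>Forwards: the transitions contain the generating pairs and form an equivalence relation.
  Backwards: a transition exchanges the two sides of its circle, so it relates two points of closed
  pieces only on the circle, where it is the gluing map.\<close>

lemma equivclp_glued_iff: assumes "(i, z) \<in> punctured_discs g" "(j, w) \<in> punctured_discs g"
 shows "equivclp (glued g) (i, z) (j, w) \<longleftrightarrow> chart_rel g i z j w"
proof
 assume "equivclp (glued g) (i, z) (j, w)"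
 then have "(symclp (glued g))\<^sup>*\<^sup>* (i, z) (j, w)" by (simp add: equivclp_def)
 then have "chart_rel g (fst (i, z)) (snd (i, z)) (fst (j, w)) (snd (j, w))"
 proof (induction rule: rtranclp_induct)
  case base
  then show ?case using assms(1) disc_piece_chart_dom by (auto simp: punctured_discs_iff intro!: chart_rel_refl)
 next
  case (step x y)
  then have "chart_rel g (fst x) (snd x) (fst y) (snd y)" using glued_chart_rel chart_rel_sym by (auto elim!: symclpE)
  with step.IH show ?case by (rule chart_rel_trans)
 qed
 then show "chart_rel g i z j w" by simp
next
 have circle: "equivclp (glued g) (i, z) (Suc i, tube_map z)" if "(i, z) \<in> punctured_discs g" "(Suc i, tube_map z) \<in> punctured_discs g" for i z
 proof -
  have "1/4 <= norm (z - 1/2)" "1/4 <= norm (tube_map z + 1/2)" "Suc i < g" using that by (auto simp: punctured_discs_iff disc_piece_def)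
  have n: "norm (z - 1/2) = 1/4" by (rule reciprocal_eq[OF norm_tube_map]) fact+
  then have "glued g (i, z) (i + 1, - cnj z)" using \<open>Suc i < g\<close>
   by (intro glued.tube) (auto simp: dist_norm norm_minus_commute)
  then show ?thesis using tube_map_circle[OF n] by (auto intro: r_into_equivclp)
 qed
 assume "chart_rel g i z j w"
 then consider "i = j" "z = w" | "i = j" "z \<in> outer_annulus" "w = antipode z" | "j = Suc i" "w = tube_map z" | "i = Suc j" "z = tube_map w"
  by (auto simp: chart_rel_def)
 then show "equivclp (glued g) (i, z) (j, w)"
 proof cases
  case 1 then show ?thesis by simp
 next
  case 2
  have "norm z <= 1" "norm (antipode z) <= 1" "i < g" "z ~= 0" using assms 2 by (auto simp: punctured_discs_iff disc_piece_def outer_annulus_def)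
  then have "norm z = 1" by (auto simp: norm_antipode divide_simps split: if_splits)
  then have "glued g (i, z) (i, - z)" using \<open>i < g\<close> by (intro glued.antipodal) auto
  then show ?thesis using 2 antipode_circle[OF \<open>norm z = 1\<close>] by (auto intro: r_into_equivclp)
 next
  case 3 then show ?thesis using circle assms by simp
 next
  case 4 then show ?thesis using circle[of j w] assms by (auto intro: equivclp_sym)
 qed
qed

text \<open>Folds the collar of a chart back into the closed pieces, across whichever circle has
  been crossed. Followed by the quotient map this is the chart.\<close>

definition retract_chart :: "nat => nat => complex => nat \<times> complex" where "retract_chart g i z =
  (if norm z <= 1 then if i + 1 < g --> 1/4 <= norm (z - 1/2) then if 0 < i --> 1/4 <= norm (z + 1/2) then (i, z) else (i - 1, tube_inv z)
    else (Suc i, tube_map z)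
   else (i, antipode z))"

lemma retract_chart_mem: assumes "i < g" "z \<in> chart_dom g i"
 shows "retract_chart g i z \<in> punctured_discs g & chart_rel g i z (fst (retract_chart g i z)) (snd (retract_chart g i z))"
proof -
 consider (1) "norm z <= 1" "i + 1 < g --> 1/4 <= norm (z - 1/2)" "0 < i --> 1/4 <= norm (z + 1/2)"
  | (2) "norm z <= 1" "i + 1 < g --> 1/4 <= norm (z - 1/2)" "0 < i" "norm (z + 1/2) < 1/4"
  | (3) "norm z <= 1" "i + 1 < g" "norm (z - 1/2) < 1/4"
  | (4) "norm z > 1" by linarith
 then show ?thesis
 proof cases
  case 1
  then show ?thesis using assms by (auto simp: retract_chart_def punctured_discs_iff disc_piece_def chart_rel_refl)
 next
  case 2
  then have L: "z \<in> left_annulus" using assms by (auto simp: left_annulus_def chart_dom_def)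
  note R = tube_inv_right[OF L]
  have "norm (tube_inv z - 1/2) >= 1/4" using 2 L by (intro tube_inv_bound) (simp_all add: left_annulus_def)
  then have "tube_inv z \<in> disc_piece g (i - 1)" using R norm_half_cases[of "tube_inv z"] by (auto simp: right_annulus_def disc_piece_def)
  then show ?thesis using 2 R assms by (auto simp: retract_chart_def punctured_discs_iff chart_rel_def tube_map_tube_inv annuli_chart_dom)
 next
  case 3
  then have L: "z \<in> right_annulus" using assms by (auto simp: right_annulus_def chart_dom_def)
  note R = tube_map_left[OF L]
  have "norm (tube_map z + 1/2) >= 1/4" using 3 L by (intro tube_map_bound) (simp_all add: right_annulus_def)
  then have "tube_map z \<in> disc_piece g (Suc i)" using R norm_half_cases[of "tube_map z"] by (auto simp: left_annulus_def disc_piece_def)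
  then show ?thesis using 3 R L assms by (auto simp: retract_chart_def punctured_discs_iff chart_rel_def annuli_chart_dom)
 next
  case 4
  then have L: "z \<in> outer_annulus" using assms by (auto simp: outer_annulus_def chart_dom_def)
  note R = antipode_outer[OF L]
  have "norm (antipode z) <= 1" using 4 by (auto simp: norm_antipode divide_simps)
  then have "antipode z \<in> disc_piece g i" using R norm_half_cases[of "antipode z"] by (auto simp: outer_annulus_def disc_piece_def)
  then show ?thesis using 4 R L assms by (auto simp: retract_chart_def punctured_discs_iff chart_rel_def annuli_chart_dom)
 qed
qed

lemma continuous_on_Times_discrete: fixes F :: "nat \<times> complex => real" assumes "\<And>i. continuous_on {z. (i, z) \<in> A} (\<lambda>z. F (i, z))"
 shows "continuous_on A F" unfolding continuous_on_open_invariant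
proof (intro allI impI)
 fix B :: "real set" assume "open B"
 then have "ALL i. EX T. open T & T \<inter> {z. (i, z) \<in> A} = (\<lambda>z. F (i, z)) -` B \<inter> {z. (i, z) \<in> A}"
  using assms unfolding continuous_on_open_invariant by blast
 then obtain T where T: "\<And>i. open (T i)" "\<And>i. T i \<inter> {z. (i, z) \<in> A} = (\<lambda>z. F (i, z)) -` B \<inter> {z. (i, z) \<in> A}" by metis
 have "open (\<Union>i. {i} \<times> T i)" by (intro open_UN ballI open_Times T open_discrete)
 moreover have "(\<Union>i. {i} \<times> T i) \<inter> A = F -` B \<inter> A" using T(2) by fastforce
 ultimately show "EX T. open T & T \<inter> A = F -` B \<inter> A" by blast
qed

text \<open>The charts are the folded pieces followed by the quotient map and the given
  homeomorphism. They are continuous because the folding agrees with the gluing along each circle,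
  and open because the saturation of an open set is again open.\<close>

lemma exists_surface: assumes g: "g >= 1" and hom: "U homeomorphic_space nonorientable_surface g" obtains p where "surface U g p"
proof -
 let ?N = "nonorientable_surface g"
 let ?D = "top_of_set (punctured_discs g)"
 define cls where "cls x = {q. equivclp (glued g) x q}" for x
 have N: "?N = quotient_topology ?D cls" by (simp add: nonorientable_surface_def cls_def[abs_def])
 obtain h k where hk: "homeomorphic_maps U ?N k h" using hom homeomorphic_space_def by blast
 have ch: "continuous_map ?N U h" and ck: "continuous_map U ?N k"
  and kh: "\<And>y. y \<in> topspace ?N ==> k (h y) = y" and hk': "\<And>x. x \<in> topspace U ==> h (k x) = x" using hk by (auto simp: homeomorphic_maps_def)
 have oh: "openin U (h ` V)" if "openin ?N V" for V
 proof -
  have "homeomorphic_map ?N U h" using hk homeomorphic_maps_sym homeomorphic_maps_map by blast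
  then show ?thesis using that homeomorphic_map_openness_eq by blast
 qed
 have qc: "quotient_map ?D ?N cls" unfolding N by (rule quotient_map_quotient_topology)
 have cc: "continuous_map ?D ?N cls" using qc by (rule quotient_imp_continuous_map)
 have cls_eq: "cls x = cls y \<longleftrightarrow> equivclp (glued g) x y" for x y unfolding cls_def by (auto intro: equivclp_sym equivclp_trans)
 define P where "P i z = cls (retract_chart g i z)" for i z
 have PD: "P i z = cls (i, z)" if "z \<in> disc_piece g i" for i z using that by (auto simp: P_def retract_chart_def disc_piece_def)
 have Peq: "P i z = P j w \<longleftrightarrow> chart_rel g i z j w" if "i < g" "j < g" "z \<in> chart_dom g i" "w \<in> chart_dom g j" for i j z w
 proof -
  obtain i' z' where z': "retract_chart g i z = (i', z')" by fastforce
  obtain j' w' where w': "retract_chart g j w = (j', w')" by fastforce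
  have 1: "(i', z') \<in> punctured_discs g" "chart_rel g i z i' z'" using retract_chart_mem[OF that(1,3)] z' by auto
  have 2: "(j', w') \<in> punctured_discs g" "chart_rel g j w j' w'" using retract_chart_mem[OF that(2,4)] w' by auto
  have "P i z = P j w \<longleftrightarrow> chart_rel g i' z' j' w'" using equivclp_glued_iff[OF 1(1) 2(1)] by (simp add: P_def z' w' cls_eq)
  also have "\<dots> \<longleftrightarrow> chart_rel g i z j w" using 1(2) 2(2) chart_rel_sym chart_rel_trans by meson
  finally show ?thesis .
 qed
 have cls_cont: "continuous_map (top_of_set A) ?N (\<lambda>z. cls (j, f z))"
  if "continuous_on A f" "\<And>z. z \<in> A ==> f z \<in> disc_piece g j" "j < g" for A j and f :: "complex => complex"
 proof -
  have "continuous_map (top_of_set A) ?D (\<lambda>z. (j, f z))"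
   using that by (auto simp: continuous_map_in_subtopology punctured_discs_iff intro!: continuous_intros)
  from continuous_map_compose[OF this cc] show ?thesis by (simp add: o_def)
 qed
 have Pcont: "continuous_map (top_of_set (chart_dom g i)) ?N (P i)" if i: "i < g" for i
 proof -
  let ?A = "chart_dom g i"
  \<comment> \<open>Three pastings, one for each circle: \<open>?L\<close> around -1/2, then
    \<open>?R\<close> around 1/2, and finally along the unit circle. If a hole is absent, its test
    is vacuously true.\<close>
  let ?L = "\<lambda>z. if 0 < i --> 1/4 <= norm (z + 1/2) then cls (i, z) else cls (i - 1, tube_inv z)"
  let ?R = "\<lambda>z. if i + 1 < g --> 1/4 <= norm (z - 1/2) then ?L z else cls (Suc i, tube_map z)"
  have glue: "cls (j, w) = cls (j', w')" if "(j, w) \<in> punctured_discs g" "(j', w') \<in> punctured_discs g" "chart_rel g j w j' w'" for j w j' w'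
   using equivclp_glued_iff[OF that(1,2)] that(3) by (simp add: cls_eq)
  have sub: "subtopology (top_of_set B) {z \<in> topspace (top_of_set B). Q z} = top_of_set {z \<in> B. Q z}" for B :: "complex set" and Q
   by (simp add: subtopology_subtopology) (rule arg_cong[where f=top_of_set], auto)
  have Lc: "continuous_map (top_of_set {z \<in> ?A. norm z <= 1 & (i + 1 < g --> 1/4 <= norm (z - 1/2))}) ?N ?L" (is "continuous_map (top_of_set ?B) _ _")
  proof (cases "0 < i")
   case False
   then show ?thesis using i by (simp, intro cls_cont continuous_intros) (auto simp: disc_piece_def)
  next
   case True
   have "continuous_map (top_of_set ?B) ?N (\<lambda>z. if 1/4 <= norm (z + 1/2) then cls (i, z) else cls (i - 1, tube_inv z))"
   proof (rule continuous_map_cases_le; (unfold sub)?)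
    show "continuous_map (top_of_set {z \<in> ?B. 1/4 <= norm (z + 1/2)}) ?N (\<lambda>z. cls (i, z))"
     by (intro cls_cont continuous_intros i) (auto simp: disc_piece_def)
    have L: "z \<in> left_annulus" if "z \<in> ?B" "norm (z + 1/2) <= 1/4" for z using that True by (auto simp: left_annulus_def chart_dom_def)
    have I: "tube_inv z \<in> disc_piece g (i - 1)" if z: "z \<in> ?B" "norm (z + 1/2) <= 1/4" for z
    proof -
     have "norm (tube_inv z - 1/2) >= 1/4" using z L[OF z] by (intro tube_inv_bound) (simp_all add: left_annulus_def)
     then show ?thesis using tube_inv_right[OF L[OF z]] norm_half_cases[of "tube_inv z"] by (auto simp: right_annulus_def disc_piece_def)
    qed
    show "continuous_map (top_of_set {z \<in> ?B. norm (z + 1/2) <= 1/4}) ?N (\<lambda>z. cls (i - 1, tube_inv z))"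
    proof (rule cls_cont)
     show "continuous_on {z \<in> ?B. norm (z + 1/2) <= 1/4} tube_inv" by (rule continuous_on_subset[OF continuous_transitions(3)]) (use L in blast)
    qed (use I i in auto)
    fix z assume z: "z \<in> topspace (top_of_set ?B)" "1/4 = norm (z + 1/2)"
    have z': "z \<in> ?B" "norm (z + 1/2) <= 1/4" "1/4 <= norm (z + 1/2)" using z(1) by (simp, use z(2) in linarith, use z(2) in linarith)
    show "cls (i, z) = cls (i - 1, tube_inv z)"
    proof (rule glue)
     show "(i, z) \<in> punctured_discs g" using z' i by (auto simp: punctured_discs_iff disc_piece_def)
     show "(i - 1, tube_inv z) \<in> punctured_discs g" using I[OF z'(1,2)] i by (auto simp: punctured_discs_iff)
     show "chart_rel g i z (i - 1) (tube_inv z)"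
      using True i z' tube_inv_right[OF L[OF z'(1,2)]] by (auto simp: chart_rel_def tube_map_tube_inv annuli_chart_dom)
    qed
   qed (auto intro!: continuous_intros)
   then show ?thesis using True by simp
  qed
  have Rc: "continuous_map (top_of_set {z \<in> ?A. norm z <= 1}) ?N ?R" (is "continuous_map (top_of_set ?B) _ _")
  proof (cases "i + 1 < g")
   case False
   then show ?thesis using Lc by simp
  next
   case True
   have "continuous_map (top_of_set ?B) ?N (\<lambda>z. if 1/4 <= norm (z - 1/2) then ?L z else cls (Suc i, tube_map z))"
   proof (rule continuous_map_cases_le; (unfold sub)?)
    have "{z \<in> ?B. 1/4 <= norm (z - 1/2)} = {z \<in> ?A. norm z <= 1 & (i + 1 < g --> 1/4 <= norm (z - 1/2))}" using True by auto
    then show "continuous_map (top_of_set {z \<in> ?B. 1/4 <= norm (z - 1/2)}) ?N ?L" using Lc by simp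
    have L: "z \<in> right_annulus" if "z \<in> ?B" "norm (z - 1/2) <= 1/4" for z using that True by (auto simp: right_annulus_def chart_dom_def)
    have I: "tube_map z \<in> disc_piece g (Suc i)" if z: "z \<in> ?B" "norm (z - 1/2) <= 1/4" for z
    proof -
     have "norm (tube_map z + 1/2) >= 1/4" using z L[OF z] by (intro tube_map_bound) (simp_all add: right_annulus_def)
     then show ?thesis using tube_map_left[OF L[OF z]] norm_half_cases[of "tube_map z"] by (auto simp: left_annulus_def disc_piece_def)
    qed
    show "continuous_map (top_of_set {z \<in> ?B. norm (z - 1/2) <= 1/4}) ?N (\<lambda>z. cls (Suc i, tube_map z))"
    proof (rule cls_cont)
     show "continuous_on {z \<in> ?B. norm (z - 1/2) <= 1/4} tube_map" by (rule continuous_on_subset[OF continuous_transitions(2)]) (use L in blast)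
    qed (use I True in auto)
    fix z assume z: "z \<in> topspace (top_of_set ?B)" "1/4 = norm (z - 1/2)"
    have z': "z \<in> ?B" "norm (z - 1/2) <= 1/4" "1/4 <= norm (z - 1/2)" using z(1) by (simp, use z(2) in linarith, use z(2) in linarith)
    have l: "1/4 <= norm (z + 1/2)" using z' norm_half_cases[of z] by linarith
    have "cls (i, z) = cls (Suc i, tube_map z)"
    proof (rule glue)
     show "(i, z) \<in> punctured_discs g" using z' i l by (auto simp: punctured_discs_iff disc_piece_def)
     show "(Suc i, tube_map z) \<in> punctured_discs g" using I[OF z'(1,2)] True by (auto simp: punctured_discs_iff)
     show "chart_rel g i z (Suc i) (tube_map z)" using True i z' L[OF z'(1,2)] tube_map_left[OF L[OF z'(1,2)]] by (auto simp: chart_rel_def annuli_chart_dom)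
    qed
    then show "?L z = cls (Suc i, tube_map z)" using l by simp
   qed (auto intro!: continuous_intros)
   then show ?thesis using True by simp
  qed
  have "continuous_map (top_of_set ?A) ?N (\<lambda>z. if norm z <= 1 then ?R z else cls (i, antipode z))"
  proof (rule continuous_map_cases_le; (unfold sub)?)
   show "continuous_map (top_of_set {z \<in> ?A. norm z <= 1}) ?N ?R" by (rule Rc)
   have L: "z \<in> outer_annulus" if "z \<in> ?A" "1 <= norm z" for z using that by (auto simp: outer_annulus_def chart_dom_def)
   have I: "antipode z \<in> disc_piece g i" if z: "z \<in> ?A" "1 <= norm z" for z
   proof -
    have "norm (antipode z) <= 1" using z by (auto simp: norm_antipode divide_simps)
    then show ?thesis using antipode_outer[OF L[OF z]] norm_half_cases[of "antipode z"] by (auto simp: outer_annulus_def disc_piece_def)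
   qed
   show "continuous_map (top_of_set {z \<in> ?A. 1 <= norm z}) ?N (\<lambda>z. cls (i, antipode z))"
   proof (rule cls_cont)
    show "continuous_on {z \<in> ?A. 1 <= norm z} antipode" by (rule continuous_on_subset[OF continuous_transitions(1)]) (use L in blast)
   qed (use I i in auto)
   fix z assume z: "z \<in> topspace (top_of_set ?A)" "norm z = 1"
   then have z': "z \<in> ?A" "1 <= norm z" "norm z <= 1" by simp_all
   have l: "1/4 <= norm (z + 1/2)" "1/4 <= norm (z - 1/2)" using z norm_half_cases[of z] by linarith+
   have "cls (i, z) = cls (i, antipode z)"
   proof (rule glue)
    show "(i, z) \<in> punctured_discs g" using z' i l by (auto simp: punctured_discs_iff disc_piece_def)
    show "(i, antipode z) \<in> punctured_discs g" using I[OF z'(1,2)] i by (auto simp: punctured_discs_iff)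
    show "chart_rel g i z i (antipode z)" using i z' L[OF z'(1,2)] antipode_outer[OF L[OF z'(1,2)]] by (auto simp: chart_rel_def annuli_chart_dom)
   qed
   then show "?R z = cls (i, antipode z)" using l by simp
  qed (auto intro!: continuous_intros)
  then show ?thesis by (rule continuous_map_eq) (auto simp: P_def retract_chart_def)
 qed
 have Popen: "openin ?N (P i ` b)" if i: "i < g" and b: "open b" "b \<subseteq> chart_dom g i" for i b
 proof -
  define W where "W j = (if j = i then b \<union> (outer_annulus \<inter> antipode -` b) else if j = Suc i then left_annulus \<inter> tube_inv -` b
    else if i = Suc j then right_annulus \<inter> tube_map -` b else {})" for j
  have "open (W j)" for j unfolding W_def using b open_annuli continuous_transitions by (auto intro!: continuous_open_preimage)
  then have oW: "open (\<Union>j. {j} \<times> W j)" by (intro open_UN ballI open_Times open_discrete)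
  have W: "(j, w) \<in> {x \<in> topspace ?D. cls x \<in> P i ` b} \<longleftrightarrow> (j, w) \<in> punctured_discs g \<inter> (\<Union>j. {j} \<times> W j)" for j w
   proof (cases "(j, w) \<in> punctured_discs g")
    case True
    then have jw: "j < g" "w \<in> disc_piece g j" "w \<in> chart_dom g j" using disc_piece_chart_dom by (auto simp: punctured_discs_iff)
    have "cls (j, w) \<in> P i ` b \<longleftrightarrow> (EX z:b. chart_rel g i z j w)"
     using Peq[OF i jw(1) _ jw(3)] PD[OF jw(2)] b by (auto simp: image_iff) (metis subsetD)+
    also have "\<dots> \<longleftrightarrow> w \<in> W j"
    proof
     assume "EX z:b. chart_rel g i z j w"
     then show "w \<in> W j" using antipode_outer tube_map_left tube_inv_tube_map by (auto simp: chart_rel_def W_def)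
    next
     assume w: "w \<in> W j"
     consider "j = i" "w \<in> b" | "j = i" "w \<in> outer_annulus" "antipode w \<in> b" | "j = Suc i" "w \<in> left_annulus" "tube_inv w \<in> b"
      | "i = Suc j" "w \<in> right_annulus" "tube_map w \<in> b" using w by (auto simp: W_def split: if_splits)
     then show "EX z:b. chart_rel g i z j w"
     proof cases
      case 1 then show ?thesis using jw i by (auto intro!: bexI[of _ w] chart_rel_refl)
     next
      case 2 then show ?thesis using jw i b antipode_outer[of w] by (intro bexI[of _ "antipode w"]) (auto simp: chart_rel_def)
     next
      case 3 then show ?thesis using jw i b tube_inv_right[of w] by (intro bexI[of _ "tube_inv w"]) (auto simp: chart_rel_def tube_map_tube_inv)
     next
      case 4 then show ?thesis using jw i b by (intro bexI[of _ "tube_map w"]) (auto simp: chart_rel_def)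
     qed
    qed
    finally show ?thesis using True by auto
   qed auto
  have "{x \<in> topspace ?D. cls x \<in> P i ` b} = punctured_discs g \<inter> (\<Union>j. {j} \<times> W j)"
  proof (rule Set.set_eqI)
   fix x :: "nat \<times> complex"
   obtain j w where "x = (j, w)" by (cases x)
   then show "x \<in> {x \<in> topspace ?D. cls x \<in> P i ` b} \<longleftrightarrow> x \<in> punctured_discs g \<inter> (\<Union>j. {j} \<times> W j)"
    by (simp only: W)
  qed
  then have "openin ?D {x \<in> topspace ?D. cls x \<in> P i ` b}" using oW by (simp add: openin_open_Int)
  moreover have "P i ` b \<subseteq> cls ` topspace ?D" using retract_chart_mem[OF i] b(2) by (auto simp: P_def)
  ultimately show ?thesis unfolding N openin_quotient_topology by blast
 qed
 have PN: "P i z \<in> topspace ?N" if "i < g" "z \<in> chart_dom g i" for i z using retract_chart_mem[OF that] by (auto simp: P_def N)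
 have "surface U g (\<lambda>i z. h (P i z))"
 proof
  show "1 <= g" by (rule g)
  fix i assume i: "i < g"
  show "continuous_map (top_of_set (chart_dom g i)) U (\<lambda>z. h (P i z))" using continuous_map_compose[OF Pcont[OF i] ch] by (simp add: o_def)
  show "openin U ((\<lambda>z. h (P i z)) ` b)" if "open b" "b \<subseteq> chart_dom g i" for b using oh[OF Popen[OF i that]] by (simp add: image_image)
  show "h (P i z) = h (P j w) \<longleftrightarrow> chart_rel g i z j w" if "j < g" "z \<in> chart_dom g i" "w \<in> chart_dom g j" for j z w
   unfolding Peq[OF i that, symmetric] using kh[OF PN[OF i that(2)]] kh[OF PN[OF that(1,3)]] by (auto dest: arg_cong[of _ _ k])
 next
  fix x assume x: "x \<in> topspace U"
  then have "k x \<in> topspace ?N" using ck by (auto simp: continuous_map_def)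
  then obtain i z where iz: "(i, z) \<in> punctured_discs g" "k x = cls (i, z)" by (auto simp: N)
  then have "h (P i z) = x" using PD[of z i] hk'[OF x] by (simp add: punctured_discs_iff)
  then show "EX i<g. EX z:disc_piece g i. h (P i z) = x" using iz(1) by (auto simp: punctured_discs_iff)
 next
  fix f :: "'a => real"
  assume f: "\<And>i. i < g ==> continuous_on (disc_piece g i) (\<lambda>z. f (h (P i z)))"
  have "continuous_on (punctured_discs g) (\<lambda>x. f (h (cls x)))"
  proof (rule continuous_on_Times_discrete)
   fix i
   show "continuous_on {z. (i, z) \<in> punctured_discs g} (\<lambda>z. f (h (cls (i, z))))"
   proof (cases "i < g")
    case True
    then have "{z. (i, z) \<in> punctured_discs g} = disc_piece g i" by (auto simp: punctured_discs_iff)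
    then show ?thesis using f[OF True] PD by (simp cong: continuous_on_cong)
   next
    case False
    then have "{z. (i, z) \<in> punctured_discs g} = {}" by (auto simp: punctured_discs_iff)
    then show ?thesis by simp
   qed
  qed
  then have "continuous_map ?D euclideanreal ((\<lambda>y. f (h y)) o cls)" by (simp add: o_def)
  then have "continuous_map ?N euclideanreal (\<lambda>y. f (h y))" using continuous_compose_quotient_map[OF qc] by blast
  from continuous_map_compose[OF ck this] show "continuous_map U euclideanreal f" by (rule continuous_map_eq) (simp add: hk')
 qed
 then show ?thesis by (rule that)
qed

section \<open>Plane geometry of the charts\<close>

text \<open>A convex part common to all charts, whatever their holes: real part below 1/3 keeps a
  distance of more than 1/6 from 1/2 and -1/2, and 5/32 is less. It contains the diameter that
  passes through the crosscap, together with its ends.\<close>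

definition strip :: "complex set" where "strip = {z. norm z < 10/9 & \<bar>Re z\<bar> < 1/3}"

lemma strip_convex: "convex strip"
proof -
 have eq: "strip = ball 0 (10/9) \<inter> ({z. Re z < 1/3} \<inter> {z. Re z > - 1/3})" by (auto simp: strip_def abs_less_iff)
 show ?thesis by (subst eq) (intro convex_Int convex_ball convex_halfspace_Re_lt convex_halfspace_Re_gt)
qed

lemma open_strip: "open strip" unfolding strip_def by (intro open_Collect_conj open_Collect_less continuous_intros)

lemma strip_chart_dom: "strip \<subseteq> chart_dom g i"
proof
 fix z assume z: "z \<in> strip"
 have "norm (z - 1/2) >= \<bar>Re (z - 1/2)\<bar>" "norm (z + 1/2) >= \<bar>Re (z + 1/2)\<bar>" by (rule abs_Re_le_cmod)+
 then show "z \<in> chart_dom g i" using z by (auto simp: strip_def chart_dom_def)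
qed

text \<open>The distance is \<open>norm z + 1 / norm z\<close>. Therefore a chart is injective on
  sets of diameter less than 2.\<close>

lemma dist_antipode: assumes "z ~= 0" shows "2 <= dist z (antipode z)"
proof -
 have "cnj z * (z - antipode z) = of_real ((norm z)\<^sup>2 + 1)"
  using assms by (simp add: antipode_def distrib_left complex_norm_square mult.commute del: of_real_power)
 then have "norm (cnj z * (z - antipode z)) = norm (complex_of_real ((norm z)\<^sup>2 + 1))" by (rule arg_cong)
 then have "norm z * dist z (antipode z) = \<bar>(norm z)\<^sup>2 + 1\<bar>" by (simp only: norm_mult complex_mod_cnj norm_of_real dist_norm)
 also have "\<dots> = (norm z - 1)\<^sup>2 + norm z * 2" by (simp add: power2_eq_square algebra_simps)
 finally have "norm z * 2 <= norm z * dist z (antipode z)" by simp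
 then show ?thesis using assms by simp
qed

text \<open>Cleared of denominators, the transitions become polynomial equations, whose failure is
  an open condition on both coordinates. The same form of the tube map follows.\<close>

lemma antipode_iff: "z ~= 0 ==> w = antipode z \<longleftrightarrow> w * cnj z = - 1" by (auto simp: antipode_def field_simps)

lemma tube_map_iff: "z ~= 1/2 ==> w = tube_map z \<longleftrightarrow> (w + 1/2) * (z - 1/2) = - 1/16"
proof -
 assume "z ~= 1/2"
 then have "z - 1/2 ~= 0" by simp
 moreover define u where "u = z - 1/2"
 ultimately have "u ~= 0" by simp
 then have "w = - 1/2 - 1 / (16 * u) \<longleftrightarrow> (w + 1/2) * u = - 1/16" by (auto simp: field_simps) (simp_all add: eq_neg_iff_add_eq_0 ac_simps)
 then show ?thesis by (simp add: tube_map_def u_def)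
qed

lemma cball_half: "z \<in> cball (1/2) r \<longleftrightarrow> norm (z - 1/2) <= r" "z \<in> cball (-1/2) r \<longleftrightarrow> norm (z + 1/2) <= r"
 "z \<in> cball (-(1/2)) r \<longleftrightarrow> norm (z + 1/2) <= r" for z :: complex
proof -
 have "dist (1/2) z = norm (z - 1/2)" "dist (-1/2) z = norm (z - (-1/2))" "dist (-(1/2)) z = norm (z - (-1/2))"
  by (simp_all only: dist_norm norm_minus_commute minus_divide_left)
 then show "z \<in> cball (1/2) r \<longleftrightarrow> norm (z - 1/2) <= r" "z \<in> cball (-1/2) r \<longleftrightarrow> norm (z + 1/2) <= r"
  "z \<in> cball (-(1/2)) r \<longleftrightarrow> norm (z + 1/2) <= r" by (simp_all only: mem_cball) simp_all
qed

text \<open>Removing open balls of radius \<rho> between \<open>r\<close> and \<open>s\<close>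
  leaves connected sets; they exhaust the complement and share the point
  \<open>a + s\<close>.\<close>

lemma connected_diff_cball: fixes S :: "complex set" assumes "connected S" "cball a s \<subseteq> S" "0 < r" "r < s" shows "connected (S - cball a r)"
proof -
 have "S - cball a r = \<Union> ((\<lambda>\<rho>. S - ball a \<rho>) ` {r<..s})"
 proof (intro Set.set_eqI iffI)
  fix x assume "x \<in> S - cball a r"
  then show "x \<in> \<Union> ((\<lambda>\<rho>. S - ball a \<rho>) ` {r<..s})" using assms by (intro UN_I[of "min s (dist a x)"]) auto
 qed auto
 also have "connected \<dots>"
 proof (rule connected_Union)
  fix T assume "T \<in> (\<lambda>\<rho>. S - ball a \<rho>) ` {r<..s}"
  then obtain \<rho> where \<rho>: "r < \<rho>" "\<rho> <= s" "T = S - ball a \<rho>" by auto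
  then have "cball a \<rho> \<subseteq> S" using assms(2) by (meson order_trans subset_cball)
  then show "connected T" unfolding \<rho>(3) using assms(1) by (intro connected_diff_ball) auto
 next
  have "a + of_real s \<in> cball a s" using assms by (simp add: dist_norm)
  then have "a + of_real s \<in> S - ball a \<rho>" if "\<rho> \<in> {r<..s}" for \<rho> using assms that by (auto simp: dist_norm)
  then show "\<Inter> ((\<lambda>\<rho>. S - ball a \<rho>) ` {r<..s}) ~= {}" by blast
 qed
 finally show ?thesis .
qed

lemma connected_chart_dom: "connected (chart_dom g i)"
proof -
 define A where "A = ball (0::complex) (10/9)"
 define B where "B = (if i + 1 < g then A - cball (1/2) (5/32) else A)"
 have A: "connected A" by (auto simp: A_def)
 have sA: "cball (1/2) (2/5) \<subseteq> A"
 proof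
  fix z :: complex assume "z \<in> cball (1/2) (2/5)"
  then have "norm (z - 1/2) <= 2/5" by (simp only: cball_half)
  then show "z \<in> A" using norm_half_cases(1)[of z] by (simp add: A_def)
 qed
 have B: "connected B" using A connected_diff_cball[OF A sA, of "5/32"] by (simp add: B_def)
 have sB: "cball (-1/2) (2/5) \<subseteq> B"
 proof
  fix z :: complex assume "z \<in> cball (-1/2) (2/5)"
  then have "norm (z + 1/2) <= 2/5" by (simp only: cball_half)
  then show "z \<in> B" using norm_half_cases[of z] by (simp add: B_def A_def cball_half del: mem_cball)
 qed
 have "connected (B - cball (-1/2) (5/32))" using connected_diff_cball[OF B sB, of "5/32"] by simp
 moreover have "chart_dom g i = (if 0 < i then B - cball (-1/2) (5/32) else B)"
  by (rule Set.set_eqI) (simp add: chart_dom_def B_def A_def cball_half not_le conj_ac del: mem_cball)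
 ultimately show ?thesis using B by simp
qed

lemma path_connected_annuli: "path_connected outer_annulus" "path_connected right_annulus" "path_connected left_annulus"
proof -
 have "path_connected {z::complex. 9/10 < norm (z - 0) & norm (z - 0) < 10/9}" by (rule path_connected_annulus) simp
 then show "path_connected outer_annulus" by (simp add: outer_annulus_def)
 show "path_connected right_annulus" unfolding right_annulus_def by (rule path_connected_annulus) simp
 have "path_connected {z::complex. 5/32 < norm (z - (-1/2)) & norm (z - (-1/2)) < 2/5}" by (rule path_connected_annulus) simp
 then show "path_connected left_annulus" by (simp add: left_annulus_def)
qed

lemma path_connectedE: assumes "path_connected S" "x \<in> S" "y \<in> S" obtains u where "pathin (top_of_set S) u" "u 0 = x" "u 1 = y"
 using assms unfolding path_connected_def pathin_top_of_set pathstart_def pathfinish_def by metis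

section \<open>Topology of a charted surface\<close>

context surface
begin

lemma pathin_chart: "i < g ==> pathin (top_of_set (chart_dom g i)) u ==> pathin U (p i o u)" using chart_cont pathin_compose by blast

lemma pathin_chart_subset: "i < g ==> pathin (top_of_set S) u ==> S \<subseteq> chart_dom g i ==> pathin U (p i o u)"
 by (rule pathin_chart) (auto simp: pathin_top_of_set)

lemma chart_topspace: "i < g ==> z \<in> chart_dom g i ==> p i z \<in> topspace U" using chart_cont[of i] by (auto simp: continuous_map_def)

lemma chart_cover': "x \<in> topspace U ==> EX i<g. EX z:chart_dom g i. p i z = x" using chart_cover disc_piece_chart_dom by blast

lemma chart_antipode: "i < g ==> z \<in> outer_annulus ==> p i (antipode z) = p i z"
 using chart_eq[of i i "antipode z" z] antipode_outer[of z] by (auto simp: chart_rel_def annuli_chart_dom)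

lemma chart_minus: "i < g ==> norm z = 1 ==> p i (- z) = p i z" using chart_antipode[of i z] antipode_circle[of z] by (simp add: outer_annulus_def)

lemma chart_tube: "Suc i < g ==> z \<in> right_annulus ==> p (Suc i) (tube_map z) = p i z"
 using chart_eq[of i "Suc i" z "tube_map z"] tube_map_left[of z] by (auto simp: chart_rel_def annuli_chart_dom)

lemma chart_inj: assumes "i < g" "z \<in> chart_dom g i" "w \<in> chart_dom g i" "p i z = p i w" "dist z w < 2" shows "z = w"
proof (rule ccontr)
 assume "z ~= w"
 then have "z \<in> outer_annulus" "w = antipode z" using assms(4) unfolding chart_eq[OF assms(1,1-3)] by (auto simp: chart_rel_def)
 moreover have "z ~= 0" using \<open>z \<in> outer_annulus\<close> by (auto simp: outer_annulus_def)
 ultimately show False using dist_antipode[of z] assms(5) by simp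
qed

lemma chart_inj_disc: assumes "i < g" "z \<in> chart_dom g i" "w \<in> chart_dom g i" "p i z = p i w" "norm z < 1" "norm w <= 1" shows "z = w"
 using assms chart_eq[OF assms(1,1-3)] by (auto simp: chart_rel_def norm_antipode divide_simps outer_annulus_def split: if_splits)

text \<open>Continuity of the local inverse is the openness of the chart.\<close>

lemma chart_section: assumes i: "i < g" and b: "open b" "b \<subseteq> chart_dom g i" and inj: "inj_on (p i) b"
 shows "continuous_map (subtopology U (p i ` b)) (top_of_set b) (inv_into b (p i))" unfolding continuous_map_def
proof (intro conjI allI impI)
 show "inv_into b (p i) \<in> topspace (subtopology U (p i ` b)) \<rightarrow> topspace (top_of_set b)" by (auto simp: inv_into_into)
 fix T assume "openin (top_of_set b) T"
 then have T: "open T" "T \<subseteq> b" using b(1) by (auto simp: openin_open_eq)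
 have "{x \<in> topspace (subtopology U (p i ` b)). inv_into b (p i) x \<in> T} = p i ` T"
  using T(2) inj b(2) chart_topspace[OF i] by (auto simp: inv_into_f_f subset_iff)
 moreover have "openin U (p i ` T)" by (rule chart_open[OF i T(1)]) (use T b in blast)
 then have "openin (subtopology U (p i ` b)) (p i ` T)" unfolding openin_subtopology using T(2) by (intro exI[of _ "p i ` T"]) auto
 ultimately show "openin (subtopology U (p i ` b)) {x \<in> topspace (subtopology U (p i ` b)). inv_into b (p i) x \<in> T}" by simp
qed

lemma chart_ball: assumes "i < g" "z \<in> chart_dom g i" "open W" "z \<in> W"
 obtains e where "e > 0" "ball z e \<subseteq> chart_dom g i" "ball z e \<subseteq> W" "inj_on (p i) (ball z e)"
  "openin U (p i ` ball z e)" "p i z \<in> p i ` ball z e"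
proof -
 have "open (W \<inter> chart_dom g i)" using assms open_annuli by blast
 then obtain d where d: "d > 0" "ball z d \<subseteq> W \<inter> chart_dom g i" using assms openE by blast
 define e where "e = min d 1"
 have e: "e > 0" "ball z e \<subseteq> chart_dom g i" "ball z e \<subseteq> W" using d by (auto simp: e_def subset_iff)
 have "inj_on (p i) (ball z e)"
 proof (rule inj_onI)
  fix x y assume xy: "x \<in> ball z e" "y \<in> ball z e" "p i x = p i y"
  then have "dist x y < 2" using dist_triangle[of x y z] by (simp add: e_def dist_commute)
  then show "x = y" using chart_inj[OF assms(1) _ _ xy(3)] xy e by blast
 qed
 then show ?thesis using that[of e] e chart_open[OF assms(1), of "ball z e"] by simp
qed

lemma chart_lift: assumes "i < g" "z \<in> chart_dom g i" "open W" "z \<in> W" obtains V where "openin U V" "p i z \<in> V"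
  "\<And>q. pathin (subtopology U V) q ==>
   EX u. pathin (top_of_set (chart_dom g i \<inter> W)) u & (ALL t. 0 <= t & t <= 1 --> p i (u t) = q t)"
proof -
 obtain e where e: "e > 0" "ball z e \<subseteq> chart_dom g i" "ball z e \<subseteq> W" "inj_on (p i) (ball z e)"
  "openin U (p i ` ball z e)" "p i z \<in> p i ` ball z e" using chart_ball[OF assms] .
 show ?thesis
 proof (rule that[OF e(5,6)])
  fix q assume q: "pathin (subtopology U (p i ` ball z e)) q"
  let ?u = "inv_into (ball z e) (p i) o q"
  have "pathin (top_of_set (ball z e)) ?u" by (rule pathin_compose[OF q chart_section]) (use e assms in auto)
  then have "pathin (top_of_set (chart_dom g i \<inter> W)) ?u" using e by (auto simp: pathin_top_of_set)
  moreover have "p i (?u t) = q t" if "0 <= t & t <= 1" for t using q that by (auto simp: pathin_subtopology f_inv_into_f)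
  ultimately show "EX u. pathin (top_of_set (chart_dom g i \<inter> W)) u & (ALL t. 0 <= t & t <= 1 --> p i (u t) = q t)" by blast
 qed
qed

text \<open>Coordinates of distinct points are unrelated, and being unrelated is an open condition
  on the pair of coordinates. A product neighbourhood of the pair then gives disjoint
  images.\<close>

lemma Hausdorff: "Hausdorff_space U" unfolding Hausdorff_space_def
proof (intro allI impI)
 fix x y assume xy: "x \<in> topspace U & y \<in> topspace U & x ~= y"
 obtain i z where iz: "i < g" "z \<in> chart_dom g i" "p i z = x" using chart_cover' xy by blast
 obtain j w where jw: "j < g" "w \<in> chart_dom g j" "p j w = y" using chart_cover' xy by blast
 \<comment> \<open>The three conditions negate the equations of the transitions, without mention of
   the annuli: a solution whose two coordinates lie in chart domains lies in the annuli
   automatically, by the outer and inner bounds of the domains.\<close>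
 define S1 where "S1 = (if i = j then {v :: complex \<times> complex. fst v ~= snd v & snd v * cnj (fst v) ~= -1} else UNIV)"
 define S2 where "S2 = (if j = Suc i then {v :: complex \<times> complex. (snd v + 1/2) * (fst v - 1/2) ~= -1/16} else UNIV)"
 define S3 where "S3 = (if i = Suc j then {v :: complex \<times> complex. (fst v + 1/2) * (snd v - 1/2) ~= -1/16} else UNIV)"
 define D where "D = (if j = Suc i \<or> i = Suc j \<or> i = j then chart_dom g i \<times> chart_dom g j else UNIV)"
 have oS: "open (S1 \<inter> S2 \<inter> S3)"
  unfolding S1_def S2_def S3_def by (intro open_Int) (auto intro!: open_Collect_conj open_Collect_neq continuous_intros)
 have notrel: "\<not> chart_rel g i z j w" using chart_eq[OF iz(1) jw(1) iz(2) jw(2)] iz jw xy by simp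
 have "(z, w) \<in> S1"
 proof -
  have False if "i = j" "w * cnj z = -1"
  proof -
   have nz: "z ~= 0" "w ~= 0" using that by auto
   have "norm w * norm z = 1" using arg_cong[OF that(2), of norm] by (simp add: norm_mult)
   moreover have lt: "norm z < 10/9" "norm w < 10/9" using iz jw by (auto simp: chart_dom_def)
   ultimately have "9/10 < norm z"
   proof -
    assume 1: "norm w * norm z = 1"
    have "norm w * norm z <= norm w * (9/10)" if "norm z <= 9/10" using that by (intro mult_left_mono) auto
    then show ?thesis using 1 lt by linarith
   qed
   then have "z \<in> outer_annulus" using lt by (simp add: outer_annulus_def)
   then show False using notrel that iz jw antipode_iff[OF nz(1), of w] by (auto simp: chart_rel_def)
  qed
  moreover have "z ~= w" if "i = j" using notrel that chart_rel_refl[OF iz(1,2)] by auto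
  ultimately show ?thesis by (auto simp: S1_def)
 qed
 have tube: False if "j = Suc i" "(w + 1/2) * (z - 1/2) = - 1/16" "\<not> chart_rel g i z j w" "i < g" "j < g" "z \<in> chart_dom g i" "w \<in> chart_dom g j" for i j z w
 proof -
  have n: "5/32 < norm (z - 1/2)" "5/32 < norm (w + 1/2)" using that by (auto simp: chart_dom_def)
  have "z ~= 1/2"
  proof
   assume "z = 1/2"
   then have "norm (z - 1/2) = 0" by (simp only: diff_self norm_zero)
   then show False using n by linarith
  qed
  then have w: "w = tube_map z" using tube_map_iff that(2) by blast
  have "norm (z - 1/2) = 1 / (16 * norm (w + 1/2))" using norm_tube_map[of z] n unfolding w by (simp add: field_simps)
  then have "norm (z - 1/2) < 2/5" using reciprocal_bounds(1)[of "norm (z - 1/2)" "norm (w + 1/2)"] n by linarith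
  then show False using that n w by (auto simp: chart_rel_def right_annulus_def)
 qed
 have "(z, w) \<in> S2" using tube[OF _ _ notrel iz(1) jw(1) iz(2) jw(2)] by (auto simp: S2_def)
 moreover have "(z, w) \<in> S3" using tube[of i j z w] notrel chart_rel_sym[of g j w i z] iz jw by (auto simp: S3_def)
 ultimately have "(z, w) \<in> S1 \<inter> S2 \<inter> S3" using \<open>(z, w) \<in> S1\<close> by blast
 from open_prod_elim[OF oS this] obtain A B where AB: "open A" "open B" "(z, w) \<in> A \<times> B" "A \<times> B \<subseteq> S1 \<inter> S2 \<inter> S3" .
 let ?A = "A \<inter> chart_dom g i" and ?B = "B \<inter> chart_dom g j"
 have "p i ` ?A \<inter> p j ` ?B = {}"
 proof (rule ccontr)
  assume "p i ` ?A \<inter> p j ` ?B ~= {}"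
  then obtain z' w' where *: "z' \<in> ?A" "w' \<in> ?B" "p i z' = p j w'" by blast
  then have r: "chart_rel g i z' j w'" using chart_eq iz jw by auto
  have "(z', w') \<in> S1 \<inter> S2 \<inter> S3" using * AB by blast
  moreover have "z' ~= 0" if "z' \<in> outer_annulus" using that by (auto simp: outer_annulus_def)
  moreover have "v ~= 1/2" if "v \<in> right_annulus" for v
  proof
   assume "v = 1/2"
   then have "norm (v - 1/2) = 0" by (simp only: diff_self norm_zero)
   then show False using that unfolding right_annulus_def mem_Collect_eq by linarith
  qed
  ultimately show False using r antipode_iff[of z' w'] tube_map_iff[of z' w'] tube_map_iff[of w' z']
   by (auto simp: chart_rel_def S1_def S2_def S3_def split: if_splits)
 qed
 moreover have "openin U (p i ` ?A)" "openin U (p j ` ?B)" using AB open_annuli iz jw by (auto intro!: chart_open)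
 moreover have "x \<in> p i ` ?A" "y \<in> p j ` ?B" using AB iz jw by auto
 ultimately show "EX V W. openin U V & openin U W & x \<in> V & y \<in> W & disjnt V W" unfolding disjnt_def by blast
qed

lemma finite_chart_preimage: assumes "i < g" "finite F" shows "finite {z \<in> chart_dom g i. p i z \<in> F}"
proof -
 have "finite {z \<in> chart_dom g i. p i z = x}" for x
 proof (cases "EX z:chart_dom g i. p i z = x")
  case True
  then obtain z where z: "z \<in> chart_dom g i" "p i z = x" by blast
  have "{z \<in> chart_dom g i. p i z = x} \<subseteq> {z, antipode z}"
  proof
   fix w assume "w \<in> {z \<in> chart_dom g i. p i z = x}"
   then have "chart_rel g i z i w" using chart_eq[OF assms(1) assms(1) z(1), of w] z(2) by simp
   then show "w \<in> {z, antipode z}" by (auto simp: chart_rel_def)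
  qed
  then show ?thesis by (rule finite_subset) simp
 next
  case False
  then have "{z \<in> chart_dom g i. p i z = x} = {}" by blast
  then show ?thesis by (simp only: finite.emptyI)
 qed
 moreover have "{z \<in> chart_dom g i. p i z \<in> F} = (\<Union>x\<in>F. {z \<in> chart_dom g i. p i z = x})" by blast
 ultimately show ?thesis using assms(2) by simp
qed

text \<open>A finite set does not disconnect a connected open plane set, and consecutive charts
  overlap in an open annulus, which has points outside the preimage of \<open>F\<close> at which to
  change charts.\<close>

lemma path_in_complement: assumes F: "finite F" and x: "x \<in> topspace U - F" and y: "y \<in> topspace U - F"
 obtains q where "pathin (subtopology U (- F)) q" "q 0 = x" "q 1 = y"
proof -
 define conn where "conn x y \<longleftrightarrow> (EX q. pathin (subtopology U (- F)) q & q 0 = x & q 1 = y)" for x y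
 have sym: "conn y x" if "conn x y" for x y using that pathin_loop_reverse unfolding conn_def by (metis loop_reverse_ends)
 have trans: "conn x z" if "conn x y" "conn y z" for x y z using that pathin_loop_concat unfolding conn_def by (metis loop_concat_ends)
 have chart: "conn (p i z) (p i w)" if i: "i < g" and zw: "z \<in> chart_dom g i" "w \<in> chart_dom g i" "p i z ~: F" "p i w ~: F" for i z w
 proof -
  let ?B = "{z \<in> chart_dom g i. p i z \<in> F}"
  have B: "finite ?B" by (rule finite_chart_preimage[OF i F])
  have "connected (chart_dom g i - ?B)" by (rule connected_open_delete_finite) (use open_annuli connected_chart_dom B in auto)
  moreover have "open (chart_dom g i - ?B)" using open_annuli finite_imp_closed[OF B] by blast
  ultimately have "path_connected (chart_dom g i - ?B)" by (simp add: connected_open_path_connected)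
  then obtain u where u: "pathin (top_of_set (chart_dom g i - ?B)) u" "u 0 = z" "u 1 = w" using path_connectedE[of "chart_dom g i - ?B" z w] zw by auto
  have "pathin U (p i o u)" by (rule pathin_chart_subset[OF i u(1)]) blast
  moreover have "(p i o u) t \<in> - F" if "t \<in> {0..1}" for t using u(1) that unfolding pathin_top_of_set path_image_def image_subset_iff by force
  ultimately show ?thesis unfolding conn_def using u by (intro exI[of _ "p i o u"]) (auto simp: pathin_subtopology)
 qed
 have ex: "EX z:S. p i z ~: F" if i: "i < g" and S: "open S" "S ~= {}" "S \<subseteq> chart_dom g i" for i S
 proof (rule ccontr)
  assume "\<not> (EX z:S. p i z ~: F)"
  then have "S \<subseteq> {z \<in> chart_dom g i. p i z \<in> F}" using S by blast
  then have "finite S" using finite_chart_preimage[OF i F] finite_subset by blast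
  then show False using S finite_imp_not_open by blast
 qed
 have "3/10 + 1/2 \<in> right_annulus" by (simp add: right_annulus_def)
 then have ne: "right_annulus ~= {}" by blast
 \<comment> \<open>The charts form a chain, so every point is joined to copy 0 by descending through
   the tubes.\<close>
 have zero: "conn (p i z) (p 0 w)" if "i < g" "z \<in> chart_dom g i" "p i z ~: F" "w \<in> chart_dom g 0" "p 0 w ~: F" for i z w using that
 proof (induction i arbitrary: z)
  case 0 then show ?case using chart[of 0 z w] by auto
 next
  case (Suc i)
  obtain v where v: "v \<in> right_annulus" "p i v ~: F" using ex[OF Suc_lessD[OF Suc.prems(1)] open_annuli(2) ne] annuli_chart_dom(2) by blast
  have "conn (p i v) (p 0 w)" using Suc v annuli_chart_dom by auto
  moreover have "conn (p (Suc i) z) (p (Suc i) (tube_map v))"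
   using chart[of "Suc i" z "tube_map v"] Suc.prems v chart_tube[of i v] tube_map_left[of v] annuli_chart_dom by auto
  ultimately show ?case using trans chart_tube[of i v] Suc.prems v by auto
 qed
 obtain w where w: "w \<in> chart_dom g 0" "p 0 w ~: F"
 proof -
  have "(0::complex) \<in> strip" by (simp add: strip_def)
  then have "EX z:strip. p 0 z ~: F" using g_pos by (intro ex open_strip strip_chart_dom) auto
  then show ?thesis using that strip_chart_dom by blast
 qed
 obtain i z where iz: "i < g" "z \<in> chart_dom g i" "p i z = x" using chart_cover' x by blast
 obtain j v where jv: "j < g" "v \<in> chart_dom g j" "p j v = y" using chart_cover' y by blast
 have "conn x y" using trans[OF zero[of i z w] sym[OF zero[of j v w]]] iz jv w x y by auto
 then show ?thesis using that by (auto simp: conn_def)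
qed

lemma infinite_topspace: "infinite (topspace U)"
proof
 assume "finite (topspace U)"
 then have "finite {z \<in> chart_dom g 0. p 0 z \<in> topspace U}" using finite_chart_preimage g_pos by simp
 moreover have "{z \<in> chart_dom g 0. p 0 z \<in> topspace U} = chart_dom g 0" using chart_topspace g_pos by auto
 moreover have "0 \<in> chart_dom g 0" by (simp add: chart_dom_def)
 ultimately show False using finite_imp_not_open open_annuli by (metis empty_iff)
qed

end

section \<open>Functionals of exponent two on the surface\<close>

text \<open>Around the hole the functional has a potential, since it vanishes on a circle there; the
  coboundary of this potential continues it over the disc.\<close>

lemma fill_hole: fixes c :: complex and r \<rho> R :: real assumes A: "open A" "A \<inter> ball c R = {z. r < norm (z - c) & norm (z - c) < R}"
  and r: "0 <= r" "r < \<rho>" "\<rho> < R" and \<psi>: "path_functional (top_of_set A) \<psi>" "\<psi> (\<lambda>t. c + \<rho> * cis (2 * pi * t)) = 0"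
 obtains \<Psi> where "path_functional (top_of_set (A \<union> ball c R)) \<Psi>"
  "\<And>u. pathin (top_of_set A) u ==> \<Psi> u = \<psi> u"
proof -
 let ?X = "top_of_set (A \<union> ball c R)"
 have sub: "subtopology ?X T = top_of_set T" if "T \<subseteq> A \<union> ball c R" for T using that by (simp add: subtopology_subtopology Int_absorb1)
 have "subtopology (top_of_set A) (A \<inter> ball c R) = top_of_set (A \<inter> ball c R)" by (simp add: subtopology_subtopology Int_absorb1)
 then have "path_functional (top_of_set (A \<inter> ball c R)) \<psi>" using pf_subtopology[OF \<psi>(1), of "A \<inter> ball c R"] by simp
 from potential_annulus[OF r A(2) this \<psi>(2)]
 obtain h where "potential (top_of_set (A \<inter> ball c R)) \<psi> h" .
 then have h: "potential (subtopology ?X (A \<inter> ball c R)) \<psi> h" by (subst sub) auto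
 have 1: "openin ?X A" "openin ?X (ball c R)" by (auto intro!: open_subset A(1))
 have 2: "topspace ?X \<subseteq> A \<union> ball c R" by simp
 have 3: "path_functional (subtopology ?X A) \<psi>" using \<psi>(1) by (subst sub) auto
 obtain \<Psi> where \<Psi>: "path_functional ?X \<Psi>" "\<And>u. pathin (subtopology ?X A) u ==> \<Psi> u = \<psi> u"
  using path_functional_extend[OF 1 2 3 h] by blast
 show ?thesis by (rule that[OF \<Psi>(1)]) (use \<Psi>(2) sub[of A] in simp)
qed

lemma ball_half: "z \<in> ball (1/2) r \<longleftrightarrow> norm (z - 1/2) < r" "z \<in> ball (-1/2) r \<longleftrightarrow> norm (z + 1/2) < r"
 "z \<in> ball (-(1/2)) r \<longleftrightarrow> norm (z + 1/2) < r" for z :: complex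
proof -
 have "dist (1/2) z = norm (z - 1/2)" "dist (-1/2) z = norm (z - (-1/2))" "dist (-(1/2)) z = norm (z - (-1/2))"
  by (simp_all only: dist_norm norm_minus_commute minus_divide_left)
 then show "z \<in> ball (1/2) r \<longleftrightarrow> norm (z - 1/2) < r" "z \<in> ball (-1/2) r \<longleftrightarrow> norm (z + 1/2) < r"
  "z \<in> ball (-(1/2)) r \<longleftrightarrow> norm (z + 1/2) < r" by (simp_all only: mem_ball) simp_all
qed

context surface
begin

text \<open>The image of a diameter, closed because its ends are antipodal: the core of the Moebius
  band in copy \<open>i\<close>.\<close>

definition crosscap :: "nat => real => 'a" where "crosscap i = p i o linepath (- \<i>) \<i>"

lemma imaginary_strip: "\<i> \<in> strip" "- \<i> \<in> strip" by (auto simp: strip_def)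

lemma crosscap_loop: "i < g ==> pathin U (crosscap i)" "i < g ==> crosscap i 0 = crosscap i 1"
proof -
 show "i < g ==> pathin U (crosscap i)"
  unfolding crosscap_def by (rule pathin_chart_subset[OF _ pathin_linepath[OF strip_convex imaginary_strip(2,1)] strip_chart_dom])
 show "i < g ==> crosscap i 0 = crosscap i 1" using chart_minus[of i \<i>] by (simp add: crosscap_def)
qed

text \<open>Turning the diameter moves its two ends along antipodal arcs. These have the same image
  in the surface, so in a commutative group their contributions cancel.\<close>

lemma crosscap_value: fixes \<zeta> :: "(real => 'a) => 'g::ab_group_add"
 assumes \<zeta>: "path_functional U \<zeta>" and i: "i < g" and z: "norm z = 1" "\<bar>Re z\<bar> < 1/3" "Im z > 0"
  and u: "pathin (top_of_set strip) u" "u 0 = - z" "u 1 = z" shows "\<zeta> (p i o u) = \<zeta> (crosscap i)"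
proof -
 have c: "continuous_map (top_of_set strip) U (p i)" using continuous_map_from_subtopology_mono[OF chart_cont[OF i] strip_chart_dom] .
 obtain f where "potential (top_of_set strip) (\<lambda>u. \<zeta> (p i o u)) f" using potential_convex[OF strip_convex pf_compose[OF \<zeta> c]] .
 then have f: "\<zeta> (p i o u) = - f (u 0) + f (u 1)" if "pathin (top_of_set strip) u" for u using that by (simp add: potential_def)
 \<comment> \<open>The arc of the unit circle from \<open>\<i>\<close> to \<open>z\<close>,
   parametrised by its real part; both it and its negative stay in the strip.\<close>
 define v where "v t = Complex (t * Re z) (sqrt (1 - (t * Re z)\<^sup>2))" for t
 have tx: "\<bar>t * Re z\<bar> <= \<bar>Re z\<bar>" if "t \<in> {0..1}" for t using that by (auto simp: abs_mult mult_left_le_one_le)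
 have sq: "(t * Re z)\<^sup>2 <= 1" if "t \<in> {0..1}" for t using tx[OF that] z(2) by (simp add: abs_square_le_1)
 have vn: "norm (v t) = 1" if "t \<in> {0..1}" for t using sq[OF that] by (simp add: v_def cmod_def)
 have vs: "v t \<in> strip" "- v t \<in> strip" if "t \<in> {0..1}" for t using vn[OF that] tx[OF that] z(2) by (auto simp: strip_def v_def)
 have cv: "continuous_on {0..1} v" unfolding v_def Complex_eq by (intro continuous_intros)
 have pv: "pathin (top_of_set strip) v" "pathin (top_of_set strip) (\<lambda>t. - v t)"
  using cv vs by (auto simp: pathin_top_of_set path_def path_image_def intro!: continuous_intros)
 have "v 0 = \<i>" by (simp add: v_def complex_eq_iff)
 moreover have "v 1 = z"
 proof -
  have "(Re z)\<^sup>2 + (Im z)\<^sup>2 = 1" using z(1) by (simp add: cmod_def)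
  then have "1 - (Re z)\<^sup>2 = (Im z)\<^sup>2" by linarith
  then show ?thesis using z(3) by (simp add: v_def complex_eq_iff)
 qed
 moreover have "\<zeta> (p i o v) = \<zeta> (p i o (\<lambda>t. - v t))" by (rule pf_cong[OF \<zeta> pathin_compose[OF pv(1) c]]) (simp add: chart_minus i vn)
 ultimately have "- f \<i> + f z = - f (- \<i>) + f (- z)" using f[OF pv(1)] f[OF pv(2)] by simp
 then have "f z - f (- z) = f \<i> - f (- \<i>)" by (simp add: algebra_simps)
 moreover have "\<zeta> (crosscap i) = f \<i> - f (- \<i>)" using f[OF pathin_linepath[OF strip_convex imaginary_strip(2,1)]] by (simp add: crosscap_def)
 ultimately show ?thesis using f[OF u(1)] u by simp
qed

text \<open>By induction along the chain of copies. The circle around the left hole is a closed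
  curve in the previous copy, where a potential exists, so its value is zero and the hole can be
  filled. The outer circle runs twice along one closed curve, so its value is zero in exponent two;
  after the first filling it is freely homotopic to the circle around the right hole, which can then
  be filled as well. A disc without holes is convex.\<close>

lemma chart_potential: fixes \<zeta> :: "(real => 'a) => 'g::ab_group_add" assumes \<zeta>: "path_functional U \<zeta>" and two: "\<And>a::'g. a + a = 0"
 shows "i < g ==> EX f. potential (top_of_set (chart_dom g i)) (\<lambda>u. \<zeta> (p i o u)) f"
proof (induction i rule: less_induct)
 case (less i)
 let ?B = "ball (0::complex) (10/9)"
 define \<psi> where "\<psi> u = \<zeta> (p i o u)" for u
 define W where "W = {z \<in> ?B. i + 1 < g --> 5/32 < norm (z - 1/2)}"
 have \<psi>: "path_functional (top_of_set (chart_dom g i)) \<psi>" using pf_compose[OF \<zeta> chart_cont[OF less.prems]] by (simp add: \<psi>_def[abs_def])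
 have oW: "open W" unfolding W_def ball_def by (cases "i + 1 < g"; simp; intro open_Collect_conj open_Collect_less continuous_intros)
 have CW: "chart_dom g i \<subseteq> W" by (auto simp: chart_dom_def W_def)
 have circle_in: "pathin (top_of_set S) (\<lambda>t. c + of_real r * cis (2 * pi * t))" if "\<And>z. norm (z - c) = r ==> z \<in> S" "r > 0" for S c r
  using that by (auto simp: pathin_top_of_set path_def path_image_def norm_mult intro!: continuous_intros)
 obtain \<Psi> where \<Psi>: "path_functional (top_of_set W) \<Psi>" "\<And>u. pathin (top_of_set (chart_dom g i)) u ==> \<Psi> u = \<psi> u"
 proof (cases i)
  case 0
  then have "chart_dom g i = W" by (auto simp: chart_dom_def W_def)
  then show ?thesis using that[of \<psi>] \<psi> by simp
 next
  case (Suc k)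
  from less.IH[of k] less.prems Suc obtain f
   where f: "potential (top_of_set (chart_dom g k)) (\<lambda>u. \<zeta> (p k o u)) f" by fastforce
  have W: "chart_dom g i \<union> ball (-1/2) (2/5) = W"
  proof (rule Set.set_eqI)
   fix z :: complex
   have "norm (z + 1/2) < 2/5 ==> norm z < 10/9 & 5/32 < norm (z - 1/2)" using norm_half_cases[of z] by simp
   then show "z \<in> chart_dom g i \<union> ball (-1/2) (2/5) \<longleftrightarrow> z \<in> W"
    unfolding Un_iff ball_half W_def chart_dom_def mem_Collect_eq mem_ball_0 by (cases "5/32 < norm (z + 1/2)") auto
  qed
  have Lint: "chart_dom g i \<inter> ball (-1/2) (2/5) = {z. 5/32 < norm (z - (-1/2)) & norm (z - (-1/2)) < 2/5}"
  proof (rule Set.set_eqI)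
   fix z :: complex
   have "norm (z + 1/2) < 2/5 ==> norm z < 10/9 & 5/32 < norm (z - 1/2)" using norm_half_cases[of z] by simp
   then show "z \<in> chart_dom g i \<inter> ball (-1/2) (2/5) \<longleftrightarrow> z \<in> {z. 5/32 < norm (z - (-1/2)) & norm (z - (-1/2)) < 2/5}"
    unfolding Int_iff ball_half chart_dom_def mem_Collect_eq using Suc by auto
  qed
  let ?c = "\<lambda>t. - 1/2 + complex_of_real (1/4) * cis (2 * pi * t)"
  have c: "pathin (top_of_set left_annulus) ?c" by (rule circle_in) (auto simp: left_annulus_def)
  have v: "pathin (top_of_set right_annulus) (tube_inv o ?c)"
   by (rule pathin_compose[OF c]) (use continuous_transitions(3) tube_inv_right in "auto simp: continuous_map_in_subtopology")
  have "p i (?c t) = p k (tube_inv (?c t))" if "t \<in> {0..1}" for t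
  proof -
   have "?c t \<in> left_annulus" using c that unfolding pathin_top_of_set path_image_def by blast
   then show ?thesis using chart_tube[of k "tube_inv (?c t)"] tube_inv_right less.prems Suc by (simp add: tube_map_tube_inv)
  qed
  then have "\<psi> ?c = \<zeta> (p k o (tube_inv o ?c))" unfolding \<psi>_def
   by (intro pf_cong[OF \<zeta> pathin_chart_subset[OF less.prems c]]) (auto intro: annuli_chart_dom)
  also have "\<dots> = - f ((tube_inv o ?c) 0) + f ((tube_inv o ?c) 1)" using f v annuli_chart_dom unfolding potential_def pathin_top_of_set by blast
  finally have "\<psi> ?c = 0" by simp
  from fill_hole[OF open_annuli(4) Lint _ _ _ \<psi> this] obtain \<Psi>
   where \<Psi>: "path_functional (top_of_set W) \<Psi>" "\<And>u. pathin (top_of_set (chart_dom g i)) u ==> \<Psi> u = \<psi> u" unfolding W by auto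
  then show ?thesis by (rule that)
 qed
 obtain \<Omega> where \<Omega>: "path_functional (top_of_set ?B) \<Omega>" "\<And>u. pathin (top_of_set W) u ==> \<Omega> u = \<Psi> u"
 proof (cases "i + 1 < g")
  case False
  then have "W = ?B" by (auto simp: W_def)
  then show ?thesis using that[of \<Psi>] \<Psi> by simp
 next
  case True
  have B: "W \<union> ball (1/2) (2/5) = ?B"
  proof (rule Set.set_eqI)
   fix z :: complex
   have "norm (z - 1/2) < 2/5 ==> norm z < 10/9" using norm_half_cases[of z] by simp
   then show "z \<in> W \<union> ball (1/2) (2/5) \<longleftrightarrow> z \<in> ?B"
    unfolding Un_iff ball_half W_def mem_Collect_eq mem_ball_0 by (cases "5/32 < norm (z - 1/2)") auto
  qed
  have Rint: "W \<inter> ball (1/2) (2/5) = {z. 5/32 < norm (z - 1/2) & norm (z - 1/2) < 2/5}"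
  proof (rule Set.set_eqI)
   fix z :: complex
   have "norm (z - 1/2) < 2/5 ==> norm z < 10/9" using norm_half_cases[of z] by simp
   then show "z \<in> W \<inter> ball (1/2) (2/5) \<longleftrightarrow> z \<in> {z. 5/32 < norm (z - 1/2) & norm (z - 1/2) < 2/5}"
    unfolding Int_iff ball_half W_def mem_Collect_eq mem_ball_0 using True by auto
  qed
  let ?c = "\<lambda>t. 1/2 + complex_of_real (1/4) * cis (2 * pi * t)"
  text \<open>The boundary circle of the disc is twice the core of the crosscap.\<close>
  let ?a = "\<lambda>t. cis (pi * t)"
  have a: "pathin (top_of_set (chart_dom g i)) ?a" "pathin (top_of_set (chart_dom g i)) (\<lambda>t. - ?a t)"
   using annuli_chart_dom(1) by (auto simp: pathin_top_of_set path_def path_image_def outer_annulus_def intro!: continuous_intros)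
  have cc: "loop_concat ?a (\<lambda>t. - ?a t) = (\<lambda>t. cis (2 * pi * t))"
  proof
   fix t :: real
   have "cis (pi * (2 * t - 1)) = - cis (2 * pi * t)" by (simp add: right_diff_distrib cis_divide[symmetric] mult.commute mult.left_commute)
   then show "loop_concat ?a (\<lambda>t. - ?a t) t = cis (2 * pi * t)" by (simp add: loop_concat_def mult_ac)
  qed
  have "\<psi> (\<lambda>t. - ?a t) = \<psi> ?a" unfolding \<psi>_def using chart_minus[OF less.prems]
   by (intro pf_cong[OF \<zeta> pathin_chart[OF less.prems a(2)]]) auto
  then have "\<psi> (\<lambda>t. cis (2 * pi * t)) = 0" using pf_concat[OF \<psi> a] unfolding cc by (simp add: two)
  moreover have "pathin (top_of_set (chart_dom g i)) (\<lambda>t. cis (2 * pi * t))" using pathin_loop_concat[OF a] unfolding cc by simp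
  ultimately have outer: "\<Psi> (\<lambda>t. cis (2 * pi * t)) = 0" using \<Psi>(2) by simp
  \<comment> \<open>Circles with centre \<open>s / 2\<close> and radius
    \<open>1 - 3 * s / 4\<close>, from the unit circle to the circle of radius 1/4 around 1/2. Their
    distance from 1/2 is at least the radius minus \<open>(1 - s) / 2\<close>, hence at least
    1/4.\<close>
  define F where "F z = of_real (fst z / 2) + of_real (1 - 3 * fst z / 4) * cis (2 * pi * snd z)" for z :: "real \<times> real"
  have FW: "F z \<in> W" if "z \<in> {0..1} \<times> {0..1}" for z
  proof -
   obtain s t where z0: "z = (s, t)" by (cases z)
   then have z: "z = (s, t)" "0 <= s" "s <= 1" using that by auto
   have "norm (F z) <= norm (complex_of_real (s/2)) + norm (of_real (1 - 3 * s / 4) * cis (2 * pi * t))"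
    unfolding F_def z fst_conv snd_conv by (rule norm_triangle_ineq)
   also have "\<dots> = s/2 + (1 - 3 * s / 4)" using z by (simp add: norm_mult del: of_real_divide of_real_diff of_real_mult)
   finally have 1: "norm (F z) < 10/9" using z by simp
   have e: "F z - 1/2 = of_real (1 - 3 * s / 4) * cis (2 * pi * t) - of_real ((1 - s) / 2)" by (simp add: F_def z diff_divide_distrib)
   have n1: "norm (of_real (1 - 3 * s / 4) * cis (2 * pi * t)) - norm (complex_of_real ((1 - s) / 2)) <= norm (F z - 1/2)"
    unfolding e by (rule norm_triangle_ineq2)
   have n2: "norm (of_real (1 - 3 * s / 4) * cis (2 * pi * t)) = 1 - 3 * s / 4" "norm (complex_of_real ((1 - s) / 2)) = (1 - s) / 2"
    using z by (simp_all add: norm_mult del: of_real_divide of_real_diff of_real_mult)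
   have "1 - 3 * s / 4 - (1 - s) / 2 <= norm (F z - 1/2)" using n1 unfolding n2 .
   moreover have "1/4 <= 1 - 3 * s / 4 - (1 - s) / 2" using z(3) by (simp add: field_simps)
   ultimately have "1/4 <= norm (F z - 1/2)" by (rule order_trans[rotated])
   then have "5/32 < norm (F z - 1/2)" by linarith
   with 1 show ?thesis by (simp add: W_def)
  qed
  have "continuous_map (top_of_set ({0..1} \<times> {0..1})) (top_of_set W) F"
   using FW by (auto simp: continuous_map_in_subtopology F_def intro!: continuous_intros)
  from path_functional_free_homotopy[OF \<Psi>(1) this]
  have "\<Psi> (\<lambda>t. F (0, t)) = \<Psi> (\<lambda>t. F (1, t))" by (simp add: F_def)
  moreover have "(\<lambda>t. F (0, t)) = (\<lambda>t. cis (2 * pi * t))" "(\<lambda>t. F (1, t)) = ?c" by (auto simp: F_def)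
  ultimately have "\<Psi> ?c = 0" using outer by simp
  from fill_hole[OF oW Rint _ _ _ \<Psi>(1) this] obtain \<Omega>
   where \<Omega>: "path_functional (top_of_set ?B) \<Omega>" "\<And>u. pathin (top_of_set W) u ==> \<Omega> u = \<Psi> u" unfolding B by auto
  then show ?thesis by (rule that)
 qed
 obtain f where f: "potential (top_of_set ?B) \<Omega> f" using potential_convex[OF convex_ball \<Omega>(1)] .
 have "potential (top_of_set (chart_dom g i)) \<psi> f" unfolding potential_def
 proof (intro allI impI)
  fix u assume u: "pathin (top_of_set (chart_dom g i)) u"
  then have "pathin (top_of_set W) u" using CW by (auto simp: pathin_top_of_set)
  moreover from this have "pathin (top_of_set ?B) u" by (auto simp: pathin_top_of_set W_def)
  ultimately have "\<Omega> u = - f (u 0) + f (u 1)" "\<Omega> u = \<Psi> u" using f \<Omega>(2)[of u] unfolding potential_def by blast+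
  then show "\<psi> u = - f (u 0) + f (u 1)" using \<Psi>(2)[OF u] by (simp only:)
 qed
 then show ?case unfolding \<psi>_def by blast
qed

text \<open>The potentials of the charts are matched. Across the antipodal collar of a copy they
  differ by the value on its crosscap, which is zero. Across each tube they differ by a constant,
  and as the tubes form a chain without cycles, partial sums absorb these constants.\<close>

theorem surface_potential: fixes \<zeta> :: "(real => 'a) => 'g::ab_group_add"
 assumes \<zeta>: "path_functional U \<zeta>" and two: "\<And>a::'g. a + a = 0" and core: "\<And>i. i < g ==> \<zeta> (crosscap i) = 0"
 obtains f where "potential U \<zeta> f"
proof -
 have "ALL i:{..<g}. EX f. potential (top_of_set (chart_dom g i)) (\<lambda>u. \<zeta> (p i o u)) f" using chart_potential[OF \<zeta> two] by blast
 then obtain f where "\<And>i. i < g ==> potential (top_of_set (chart_dom g i)) (\<lambda>u. \<zeta> (p i o u)) (f i)" by (metis lessThan_iff)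
 then have f: "\<zeta> (p i o u) = - f i (u 0) + f i (u 1)" if "i < g" "pathin (top_of_set (chart_dom g i)) u" for i u
  using that unfolding potential_def by blast
 \<comment> \<open>Two potentials of one functional differ by a constant on a path connected overlap
   \<open>A\<close>; \<open>T\<close> is the change of coordinates.\<close>
 have trans: "f j (T z) - f i z = f j (T w) - f i w"
  if A: "path_connected A" "A \<subseteq> chart_dom g i" "T ` A \<subseteq> chart_dom g j" and T: "continuous_on A T" and ij: "i < g" "j < g"
   and eq: "\<And>z. z \<in> A ==> p j (T z) = p i z" and zw: "z \<in> A" "w \<in> A" for A T i j z w
 proof -
  obtain u where u: "pathin (top_of_set A) u" "u 0 = z" "u 1 = w" using path_connectedE[OF A(1) zw] by blast
  have uA: "u t \<in> A" if "0 <= t" "t <= 1" for t using u(1) that by (auto simp: pathin_top_of_set path_image_def)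
  have u': "pathin (top_of_set (chart_dom g i)) u" using u(1) A(2) by (auto simp: pathin_top_of_set)
  have Tu: "pathin (top_of_set (chart_dom g j)) (T o u)" by (rule pathin_compose[OF u(1)]) (use A T in "auto simp: continuous_map_in_subtopology")
  have "\<zeta> (p i o u) = \<zeta> (p j o (T o u))" by (rule pf_cong[OF \<zeta> pathin_chart[OF ij(1) u']]) (simp add: eq uA)
  then have "- f i z + f i w = - f j (T z) + f j (T w)" using f[OF ij(1) u'] f[OF ij(2) Tu] u by simp
  then show ?thesis by (simp add: algebra_simps)
 qed
 have anti: "f i (antipode z) = f i z" if i: "i < g" and z: "z \<in> outer_annulus" for i z
 proof -
  have "f i (antipode z) - f i z = f i (antipode \<i>) - f i \<i>"
   by (rule trans[OF path_connected_annuli(1) _ _ continuous_transitions(1) i i chart_antipode[OF i] z])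
    (use annuli_chart_dom antipode_outer in "auto simp: outer_annulus_def")
  also have "antipode \<i> = - \<i>" by (rule antipode_circle) simp
  also have "f i (- \<i>) - f i \<i> = 0"
  proof -
   have "pathin (top_of_set (chart_dom g i)) (linepath (- \<i>) \<i>)"
    using pathin_linepath[OF strip_convex imaginary_strip(2,1)] strip_chart_dom by (auto simp: pathin_top_of_set)
   then have "- f i (- \<i>) + f i \<i> = 0" using f[OF i] core[OF i] by (simp add: crosscap_def)
   then show ?thesis by (simp add: algebra_simps)
  qed
  finally show ?thesis by simp
 qed
 define v :: complex where "v = 1/2 + 3/10"
 have v: "v \<in> right_annulus" by (simp add: v_def right_annulus_def)
 define c where "c i = f (Suc i) (tube_map v) - f i v" for i
 have tube: "f (Suc i) (tube_map z) = f i z + c i" if "Suc i < g" "z \<in> right_annulus" for i z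
 proof -
  have "f (Suc i) (tube_map z) - f i z = f (Suc i) (tube_map v) - f i v"
   by (rule trans[OF path_connected_annuli(2) _ _ continuous_transitions(2) _ that(1) chart_tube[OF that(1)] that(2) v])
    (use annuli_chart_dom tube_map_left that in auto)
  then show ?thesis by (simp add: c_def algebra_simps)
 qed
 \<comment> \<open>The corrected potentials depend only on the point of the surface and not on its
   coordinates.\<close>
 define F where "F i z = f i z - (\<Sum>j<i. c j)" for i z
 have F_rel: "F i z = F j w" if "chart_rel g i z j w" for i z j w
 proof -
  have *: "F (Suc j) (tube_map w) = F j w" if "Suc j < g" "w \<in> right_annulus" for j w using tube[OF that] by (simp add: F_def)
  show ?thesis using that anti * by (auto simp: chart_rel_def F_def)
 qed
 define h where "h x = (let (i, z) = (SOME (i, z). i < g & z \<in> chart_dom g i & p i z = x) in F i z)" for x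
 have h: "h (p i z) = F i z" if "i < g" "z \<in> chart_dom g i" for i z
 proof -
  let ?P = "\<lambda>(j, w). j < g & w \<in> chart_dom g j & p j w = p i z"
  obtain j w where jw: "(SOME s. ?P s) = (j, w)" by (cases "SOME s. ?P s")
  have "?P (SOME s. ?P s)" by (rule someI[of ?P "(i, z)"]) (use that in simp)
  then have "j < g" "w \<in> chart_dom g j" "p j w = p i z" unfolding jw by auto
  then have "chart_rel g j w i z" using chart_eq that by auto
  then show ?thesis using F_rel jw by (simp add: h_def)
 qed
 have "potential U \<zeta> h"
 proof (rule potential_local[OF \<zeta>])
  fix x assume "x \<in> topspace U"
  then obtain i z where iz: "i < g" "z \<in> chart_dom g i" "p i z = x" using chart_cover' by blast
  obtain V where V: "openin U V" "p i z \<in> V"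
   "\<And>q. pathin (subtopology U V) q ==>
    EX u. pathin (top_of_set (chart_dom g i \<inter> UNIV)) u & (ALL t. 0 <= t & t <= 1 --> p i (u t) = q t)" using chart_lift[OF iz(1,2) open_UNIV] by blast
  have "potential (subtopology U V) \<zeta> h" unfolding potential_def
  proof (intro allI impI)
   fix q assume "pathin (subtopology U V) q"
   then obtain u where u: "pathin (top_of_set (chart_dom g i)) u" "\<And>t. 0 <= t ==> t <= 1 ==> p i (u t) = q t" using V(3)[of q] by auto
   have ends: "u 0 \<in> chart_dom g i" "u 1 \<in> chart_dom g i" using path_start_in_topspace[OF u(1)] path_finish_in_topspace[OF u(1)] by auto
   have "\<zeta> q = \<zeta> (p i o u)" by (rule pf_cong[OF \<zeta> pathin_chart[OF iz(1) u(1)], symmetric]) (simp add: u(2))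
   also have "\<dots> = - h (p i (u 0)) + h (p i (u 1))" using f[OF iz(1) u(1)] h[OF iz(1) ends(1)] h[OF iz(1) ends(2)] by (simp add: F_def)
   finally show "\<zeta> q = - h (q 0) + h (q 1)" using u(2)[of 0] u(2)[of 1] by simp
  qed
  then show "EX V. openin U V & x \<in> V & potential (subtopology U V) \<zeta> h" using V iz(3) by blast
 qed
 then show ?thesis by (rule that)
qed

end

section \<open>Unordered configurations as finite sets\<close>

text \<open>The set of all enumerations of \<open>S\<close>, which is the orbit of any one of them
  under the symmetric group. It names a point of the unordered configuration space by the finite set
  alone, and \<open>supp\<close> recovers that set.\<close>

definition cfg :: "nat => 'a set => (nat => 'a) set" where "cfg n S = {c \<in> extensional {..<n}. bij_betw c {..<n} S}"

definition supp :: "nat => (nat => 'a) set => 'a set" where "supp n P = (SOME c. c \<in> P) ` {..<n}"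

lemma supp_cfg: assumes "finite S" "card S = n" shows "supp n (cfg n S) = S"
proof -
 obtain c where "bij_betw c {..<n} S" using assms ex_bij_betw_nat_finite[of S] by (auto simp: lessThan_atLeast0)
 then have "restrict c {..<n} \<in> cfg n S" by (simp add: cfg_def bij_betw_restrict_eq)
 then have "(SOME c. c \<in> cfg n S) \<in> cfg n S" by (rule someI[of "\<lambda>c. c \<in> cfg n S"])
 then show ?thesis by (simp add: supp_def cfg_def bij_betw_def)
qed

lemma topspace_ordered_config: "topspace (ordered_config n X) = {c \<in> {..<n} \<rightarrow>\<^sub>E topspace X. inj_on c {..<n}}"
 by (auto simp: ordered_config_def topspace_product_topology)

lemma orbit_cfg: assumes "c \<in> topspace (ordered_config n X)" shows "{c o \<sigma> |\<sigma>. \<sigma> permutes {..<n}} = cfg n (c ` {..<n})"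
proof (intro Set.set_eqI iffI)
 have c: "c \<in> extensional {..<n}" "inj_on c {..<n}" using assms by (auto simp: topspace_ordered_config PiE_def)
 fix d
 {
  assume "d \<in> {c o \<sigma> |\<sigma>. \<sigma> permutes {..<n}}"
  then obtain \<sigma> where \<sigma>: "d = c o \<sigma>" "\<sigma> permutes {..<n}" by blast
  have "bij_betw c {..<n} (c ` {..<n})" using c by (simp add: bij_betw_def)
  then have "bij_betw d {..<n} (c ` {..<n})" unfolding \<sigma>(1) using permutes_imp_bij[OF \<sigma>(2)] by (rule bij_betw_trans[rotated])
  moreover have "d i = undefined" if "i ~: {..<n}" for i using permutes_not_in[OF \<sigma>(2) that] c(1) that by (simp add: \<sigma>(1) extensional_def)
  ultimately show "d \<in> cfg n (c ` {..<n})" by (simp add: cfg_def extensional_def)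
 next
  assume "d \<in> cfg n (c ` {..<n})"
  then have d: "d \<in> extensional {..<n}" "bij_betw d {..<n} (c ` {..<n})" by (auto simp: cfg_def)
  define \<sigma> where "\<sigma> i = (if i \<in> {..<n} then inv_into {..<n} c (d i) else i)" for i
  have "bij_betw (inv_into {..<n} c) (c ` {..<n}) {..<n}" using c(2) by (simp add: inj_on_imp_bij_betw bij_betw_inv_into)
  then have "bij_betw (inv_into {..<n} c o d) {..<n} {..<n}" using d(2) by (rule bij_betw_trans[rotated])
  then have "bij_betw \<sigma> {..<n} {..<n}" by (rule bij_betw_cong[THEN iffD1, rotated]) (simp add: \<sigma>_def)
  then have "\<sigma> permutes {..<n}" by (rule bij_imp_permutes) (simp add: \<sigma>_def)
  moreover have "d i = (c o \<sigma>) i" for i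
  proof (cases "i \<in> {..<n}")
   case True
   then have "d i \<in> c ` {..<n}" using d(2) by (auto simp: bij_betw_def)
   then show ?thesis using True by (simp add: \<sigma>_def f_inv_into_f)
  next
   case False
   then show ?thesis using c(1) d(1) by (simp add: \<sigma>_def extensional_def)
  qed
  ultimately show "d \<in> {c o \<sigma> |\<sigma>. \<sigma> permutes {..<n}}" by blast
 }
qed

lemma quotient_unordered_config: "quotient_map (ordered_config n X) (unordered_config n X) (\<lambda>c. {c o \<sigma> |\<sigma>. \<sigma> permutes {..<n}})"
 unfolding unordered_config_def by (rule quotient_map_quotient_topology)

lemma ordered_config_enum: assumes "S \<subseteq> topspace X" "finite S" "card S = n" obtains c where "c \<in> topspace (ordered_config n X)" "c ` {..<n} = S"
proof -
 obtain c where c: "bij_betw c {..<n} S" using assms ex_bij_betw_nat_finite[of S] by (auto simp: lessThan_atLeast0)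
 show ?thesis by (rule that[of "restrict c {..<n}"]) (use c assms(1) in "auto simp: topspace_ordered_config bij_betw_def inj_on_def")
qed

lemma topspace_unordered_config: "topspace (unordered_config n X) = {cfg n S |S. S \<subseteq> topspace X & finite S & card S = n}" (is "?L = ?R")
proof (intro Set.set_eqI iffI)
 fix P assume "P \<in> ?L"
 then obtain c where c0: "c \<in> topspace (ordered_config n X)" "P = {c o \<sigma> |\<sigma>. \<sigma> permutes {..<n}}" by (auto simp: unordered_config_def)
 then have c: "c \<in> topspace (ordered_config n X)" "P = cfg n (c ` {..<n})" using orbit_cfg by blast+
 then have "c ` {..<n} \<subseteq> topspace X" "inj_on c {..<n}" by (auto simp: topspace_ordered_config)
 then show "P \<in> ?R" using c(2) by (intro CollectI exI[of _ "c ` {..<n}"]) (simp add: card_image)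
next
 fix P assume "P \<in> ?R"
 then obtain S where S: "P = cfg n S" "S \<subseteq> topspace X" "finite S" "card S = n" by blast
 obtain c where c: "c \<in> topspace (ordered_config n X)" "c ` {..<n} = S" using ordered_config_enum[OF S(2-4)] .
 then have "P = {c o \<sigma> |\<sigma>. \<sigma> permutes {..<n}}" using orbit_cfg[OF c(1)] S(1) by simp
 then show "P \<in> ?L" using c(1) by (auto simp: unordered_config_def)
qed

lemma continuous_map_ordered: assumes "\<And>k. k < n ==> continuous_map Y X (a k)" "\<And>y. y \<in> topspace Y ==> inj_on (\<lambda>k. a k y) {..<n}"
 shows "continuous_map Y (ordered_config n X) (\<lambda>y. restrict (\<lambda>k. a k y) {..<n})"
 unfolding ordered_config_def continuous_map_in_subtopology continuous_map_componentwise
proof (intro conjI ballI)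
 show "continuous_map Y X (\<lambda>y. restrict (\<lambda>k. a k y) {..<n} k)" if "k \<in> {..<n}" for k using assms(1)[of k] that by simp
 show "(\<lambda>y. restrict (\<lambda>k. a k y) {..<n}) ` topspace Y \<subseteq> extensional {..<n}" by auto
 show "(\<lambda>y. restrict (\<lambda>k. a k y) {..<n}) \<in> topspace Y \<rightarrow> {c. inj_on c {..<n}}" using assms(2) by (auto simp: inj_on_def)
qed

lemma continuous_map_cfg: assumes "finite I" "card I = n" "\<And>x. x \<in> I ==> continuous_map Y X (a x)"
  "\<And>y. y \<in> topspace Y ==> inj_on (\<lambda>x. a x y) I" shows "continuous_map Y (unordered_config n X) (\<lambda>y. cfg n ((\<lambda>x. a x y) ` I))"
proof -
 obtain e where e: "bij_betw e {..<n} I" using assms(1,2) ex_bij_betw_nat_finite[of I] by (auto simp: lessThan_atLeast0)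
 let ?c = "\<lambda>y. restrict (\<lambda>k. a (e k) y) {..<n}"
 have 1: "continuous_map Y (ordered_config n X) ?c"
 proof (rule continuous_map_ordered)
  show "continuous_map Y X (a (e k))" if "k < n" for k using e that by (intro assms(3)) (auto simp: bij_betw_def)
  show "inj_on (\<lambda>k. a (e k) y) {..<n}" if "y \<in> topspace Y" for y
   using e assms(4)[OF that] comp_inj_on[of e "{..<n}" "\<lambda>x. a x y"] by (auto simp: bij_betw_def o_def)
 qed
 have 2: "continuous_map (ordered_config n X) (unordered_config n X) (\<lambda>c. {c o \<sigma> |\<sigma>. \<sigma> permutes {..<n}})"
  using quotient_unordered_config by (rule quotient_imp_continuous_map)
 show ?thesis
 proof (rule continuous_map_eq[OF continuous_map_compose[OF 1 2]])
  fix y assume y: "y \<in> topspace Y"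
  then have "?c y \<in> topspace (ordered_config n X)" using 1 by (auto simp: continuous_map_def)
  moreover have "?c y ` {..<n} = (\<lambda>x. a x y) ` I" using e by (auto simp: bij_betw_def image_image[of "\<lambda>x. a x y" e, symmetric])
  ultimately show "((\<lambda>c. {c o \<sigma> |\<sigma>. \<sigma> permutes {..<n}}) o ?c) y = cfg n ((\<lambda>x. a x y) ` I)"
   unfolding o_apply[of _ ?c] by (simp only: orbit_cfg)
 qed
qed

lemma continuous_map_cfg_union: assumes J: "finite J" and T: "finite T" "T \<subseteq> topspace X" "card J + card T = n"
  and a: "\<And>x. x \<in> J ==> continuous_map Y X (a x)"
  and inj: "\<And>y. y \<in> topspace Y ==> inj_on (\<lambda>x. a x y) J & (\<lambda>x. a x y) ` J \<inter> T = {}"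
 shows "continuous_map Y (unordered_config n X) (\<lambda>y. cfg n ((\<lambda>x. a x y) ` J \<union> T))"
proof -
 define b where "b s y = (case s of Inl x => a x y | Inr t => t)" for s y
 have "continuous_map Y (unordered_config n X) (\<lambda>y. cfg n ((\<lambda>s. b s y) ` (J <+> T)))"
 proof (rule continuous_map_cfg)
  show "card (J <+> T) = n" using J T by (simp add: card_Plus)
  show "continuous_map Y X (b s)" if "s \<in> J <+> T" for s using that a T by (auto simp: b_def[abs_def])
  show "inj_on (\<lambda>s. b s y) (J <+> T)" if "y \<in> topspace Y" for y using inj[OF that] by (fastforce simp: inj_on_def b_def)
 qed (use J T in auto)
 moreover have "(\<lambda>s. b s y) ` (J <+> T) = (\<lambda>x. a x y) ` J \<union> T" for y by (force simp: b_def image_iff)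
 ultimately show ?thesis by simp
qed

lemma continuous_map_strand: assumes "finite T" "T \<subseteq> topspace X" "Suc (card T) = n"
 shows "continuous_map (subtopology X (- T)) (unordered_config n X) (\<lambda>x. cfg n (insert x T))"
 using continuous_map_cfg_union[of "{()}" T X n "subtopology X (- T)" "\<lambda>_ x. x"] assms by (simp add: continuous_map_from_subtopology)

lemma continuous_map_two_strands: assumes T: "finite T" "T \<subseteq> topspace X" "Suc (Suc (card T)) = n"
  and "continuous_map Y X \<alpha>" "continuous_map Y X \<beta>"
  and "\<And>y. y \<in> topspace Y ==> \<alpha> y ~= \<beta> y & \<alpha> y ~: T & \<beta> y ~: T"
 shows "continuous_map Y (unordered_config n X) (\<lambda>y. cfg n (insert (\<alpha> y) (insert (\<beta> y) T)))"
proof -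
 have "continuous_map Y (unordered_config n X) (\<lambda>y. cfg n ((\<lambda>b. if b then \<alpha> y else \<beta> y) ` UNIV \<union> T))"
 proof (rule continuous_map_cfg_union[OF _ T(1,2)])
  show "continuous_map Y X (\<lambda>y. if b then \<alpha> y else \<beta> y)" for b using assms(4,5) by (cases b) auto
  fix y assume "y \<in> topspace Y"
  then have "\<alpha> y ~= \<beta> y" "\<beta> y ~= \<alpha> y" "\<alpha> y ~: T" "\<beta> y ~: T" using assms(6) by force+
  then show "inj_on (\<lambda>b. if b then \<alpha> y else \<beta> y) UNIV & (\<lambda>b. if b then \<alpha> y else \<beta> y) ` UNIV \<inter> T = {}"
   by (auto simp: inj_on_def)
 qed (use T in auto)
 then show ?thesis by (simp add: UNIV_bool insert_commute)
qed

text \<open>Pulled back to ordered tuples, the set is the union over the coordinates of open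
  conditions on one coordinate.\<close>

lemma openin_supp_meets: assumes "openin X G"
 shows "openin (unordered_config n X) {P \<in> topspace (unordered_config n X). supp n P \<inter> G ~= {}}" (is "openin ?C ?S")
proof -
 let ?q = "\<lambda>c. {c o \<sigma> |\<sigma>. \<sigma> permutes {..<n}}"
 have supp: "supp n (?q c) = c ` {..<n}" if "c \<in> topspace (ordered_config n X)" for c
  using that unfolding orbit_cfg[OF that] by (intro supp_cfg) (auto simp: topspace_ordered_config card_image)
 have "openin (ordered_config n X) {c \<in> topspace (ordered_config n X). ?q c \<in> ?S}"
 proof -
  have "{c \<in> topspace (ordered_config n X). ?q c \<in> ?S} = (\<Union>k<n. {c \<in> topspace (ordered_config n X). c k \<in> G})"
  proof (intro Set.set_eqI iffI)
   fix c assume "c \<in> {c \<in> topspace (ordered_config n X). ?q c \<in> ?S}"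
   then show "c \<in> (\<Union>k<n. {c \<in> topspace (ordered_config n X). c k \<in> G})" using supp[of c] by auto
  next
   fix c assume "c \<in> (\<Union>k<n. {c \<in> topspace (ordered_config n X). c k \<in> G})"
   then show "c \<in> {c \<in> topspace (ordered_config n X). ?q c \<in> ?S}" using supp[of c] by (auto simp: unordered_config_def)
  qed
  also have "openin (ordered_config n X) \<dots>"
  proof (intro openin_Union, clarify)
   fix k assume "k < n"
   then have "continuous_map (ordered_config n X) X (\<lambda>c. c k)"
    unfolding ordered_config_def by (intro continuous_map_from_subtopology continuous_map_product_projection) auto
   then show "openin (ordered_config n X) {c \<in> topspace (ordered_config n X). c k \<in> G}" using assms by (rule openin_continuous_map_preimage)
  qed
  finally show ?thesis .
 qed
 then show ?thesis using quotient_unordered_config[of n X] unfolding quotient_map_def by (elim conjE allE[of _ ?S]) simp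
qed

lemma Hausdorff_separate_finite: assumes "Hausdorff_space X" "finite S" "S \<subseteq> topspace X"
 obtains V where "\<And>x. x \<in> S ==> openin X (V x) & x \<in> V x" "\<And>x y. x \<in> S ==> y \<in> S ==> x ~= y ==> V x \<inter> V y = {}"
proof -
 have "ALL x:S. ALL y:S. EX A B. x ~= y --> openin X A & openin X B & x \<in> A & y \<in> B & A \<inter> B = {}"
  using assms unfolding Hausdorff_space_def disjnt_def by (meson subsetD)
 then obtain A B where AB: "\<And>x y. x \<in> S ==> y \<in> S ==> x ~= y ==> openin X (A x y) & openin X (B x y) & x \<in> A x y & y \<in> B x y & A x y \<inter> B x y = {}"
  by metis
 define V where "V x = topspace X \<inter> (\<Inter>y\<in>S - {x}. A x y \<inter> B y x)" for x
 show ?thesis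
 proof (rule that[of V])
  fix x assume x: "x \<in> S"
  have "openin X (V x)"
  proof (cases "S - {x} = {}")
   case True then show ?thesis by (simp only: V_def) simp
  next
   case False
   then have "openin X (\<Inter>y\<in>S - {x}. A x y \<inter> B y x)" by (intro openin_INT2) (use assms(2) x AB in auto)
   then show ?thesis unfolding V_def by (intro openin_Int openin_topspace)
  qed
  then show "openin X (V x) & x \<in> V x" using x AB assms(3) by (auto simp: V_def)
 next
  fix x y assume xy: "x \<in> S" "y \<in> S" "x ~= y"
  then have "V x \<subseteq> A x y" "V y \<subseteq> B x y" by (auto simp: V_def)
  then show "V x \<inter> V y = {}" using AB[OF xy] by blast
 qed
qed

text \<open>
 Near a configuration the points move in disjoint neighbourhoods; moving the coordinates one
 after the other gives a homotopic path. So a functional is determined by its values on the moves of one point.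
\<close>
lemma potential_unordered_config: fixes \<Phi> :: "(real => (nat => 'a) set) => 'g::group_add"
 assumes haus: "Hausdorff_space X" and \<Phi>: "path_functional (unordered_config n X) \<Phi>"
  and strand: "\<And>T \<gamma>. finite T ==> T \<subseteq> topspace X ==> Suc (card T) = n ==> pathin (subtopology X (- T)) \<gamma> ==>
   \<Phi> (\<lambda>t. cfg n (insert (\<gamma> t) T)) = - f (insert (\<gamma> 0) T) + f (insert (\<gamma> 1) T)"
 shows "potential (unordered_config n X) \<Phi> (\<lambda>P. f (supp n P))"
proof (rule potential_local[OF \<Phi>])
 let ?C = "unordered_config n X"
 fix P0 assume "P0 \<in> topspace ?C"
 then obtain S where S: "P0 = cfg n S" "S \<subseteq> topspace X" "finite S" "card S = n" by (auto simp: topspace_unordered_config)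
 obtain V where V: "\<And>x. x \<in> S ==> openin X (V x) & x \<in> V x" "\<And>x y. x \<in> S ==> y \<in> S ==> x ~= y ==> V x \<inter> V y = {}"
  using Hausdorff_separate_finite[OF haus S(3,2)] by blast
 have inj: "inj_on (\<lambda>x. a x) S" if "\<And>x. x \<in> S ==> a x \<in> V x" for a
 proof (rule inj_onI, rule ccontr)
  fix x y assume "x \<in> S" "y \<in> S" "a x = a y" "x ~= y"
  then show False using V(2)[of x y] that[of x] that[of y] by auto
 qed
 have move: "\<Phi> (\<lambda>t. cfg n ((\<lambda>x. r x t) ` S)) = - f ((\<lambda>x. r x 0) ` S) + f ((\<lambda>x. r x 1) ` S)"
  if "finite M" "M \<subseteq> S" "\<And>x. x \<in> S ==> pathin (subtopology X (V x)) (r x)"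
   "\<And>x t. x \<in> S - M ==> 0 <= t ==> t <= 1 ==> r x t = r x 0" for M r using that
 proof (induction M arbitrary: r rule: finite_induct)
  case empty
  have rV: "r x t \<in> V x" "r x t \<in> topspace X" if "x \<in> S" "0 <= t" "t <= 1" for x t
   using empty(2)[OF that(1)] that by (auto simp: pathin_subtopology pathin_def continuous_map_def)
  let ?P = "cfg n ((\<lambda>x. r x 0) ` S)"
  have "inj_on (\<lambda>x. r x 0) S" by (rule inj) (simp add: rV)
  then have "?P \<in> topspace ?C" using S(3,4) rV(2) by (auto simp: topspace_unordered_config card_image intro!: exI[of _ "(\<lambda>x. r x 0) ` S"])
  have const: "(\<lambda>x. r x t) ` S = (\<lambda>x. r x 0) ` S" if "0 <= t" "t <= 1" for t by (rule image_cong[OF HOL.refl], rule empty(3)) (use that in auto)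
  have "\<Phi> (\<lambda>_. ?P) = \<Phi> (\<lambda>t. cfg n ((\<lambda>x. r x t) ` S))"
  proof (rule pf_cong[OF \<Phi>])
   show "pathin ?C (\<lambda>_. ?P)" using \<open>?P \<in> topspace ?C\<close> by simp
   show "?P = cfg n ((\<lambda>x. r x t) ` S)" if "0 <= t" "t <= 1" for t by (simp only: const[OF that])
  qed
  then have "\<Phi> (\<lambda>t. cfg n ((\<lambda>x. r x t) ` S)) = \<Phi> (\<lambda>_. ?P)" by simp
  also have "\<dots> = 0" by (rule pf_const[OF \<Phi>]) fact
  finally show ?case using const[of 1] by simp
 next
  case (insert z M)
  have rV: "r x t \<in> V x" "r x t \<in> topspace X" if "x \<in> S" "0 <= t" "t <= 1" for x t
   using insert.prems(2)[OF that(1)] that by (auto simp: pathin_subtopology pathin_def continuous_map_def)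
  have rc: "continuous_map (top_of_set {0..1}) X (r x)" if "x \<in> S" for x
   using insert.prems(2)[OF that] unfolding pathin_subtopology by (simp add: pathin_def)
  let ?Q = "{0..1::real} \<times> {0..1::real}"
  \<comment> \<open>In this square \<open>z\<close> moves with the first parameter and all other
    points with the second. The diagonal is the given motion, and along two sides \<open>z\<close>
    moves before the others.\<close>
  define F where "F ab = cfg n ((\<lambda>y. r y (if y = z then fst ab else snd ab)) ` S)" for ab :: "real \<times> real"
  have cF: "continuous_map (top_of_set ?Q) ?C F" unfolding F_def
  proof (rule continuous_map_cfg[OF S(3,4)])
   fix x assume x: "x \<in> S"
   have "continuous_map (top_of_set ?Q) (top_of_set {0..1}) (\<lambda>ab. if x = z then fst ab else snd ab)"
    by (cases "x = z") (auto simp: continuous_map_in_subtopology intro!: continuous_intros)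
   from continuous_map_compose[OF this rc[OF x]]
   show "continuous_map (top_of_set ?Q) X (\<lambda>ab. r x (if x = z then fst ab else snd ab))" by (simp add: o_def)
  next
   fix ab assume "ab \<in> topspace (top_of_set ?Q)"
   then show "inj_on (\<lambda>x. r x (if x = z then fst ab else snd ab)) S" by (intro inj rV) auto
  qed
  have cQ: "convex ?Q" by (intro convex_Times convex_real_interval)
  have pin: "pathin (top_of_set ?Q) (linepath a b)" if "a \<in> ?Q" "b \<in> ?Q" for a b by (rule pathin_linepath[OF cQ that])
  have Q: "(0,0) \<in> ?Q" "(1,0) \<in> ?Q" "(1,1) \<in> ?Q" by auto
  have "path_homotopic ?C (F o linepath (0,0) (1,1)) (F o loop_concat (linepath (0,0) (1,0)) (linepath (1,0) (1,1)))"
   by (rule path_homotopic_convex[OF cQ cF]) (use Q in "auto intro!: pin pathin_loop_concat")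
  then have "\<Phi> (F o linepath (0,0) (1,1)) = \<Phi> (F o linepath (0,0) (1,0)) + \<Phi> (F o linepath (1,0) (1,1))"
   using pf_homotopic[OF \<Phi>] pf_concat[OF \<Phi> pathin_compose[OF pin cF] pathin_compose[OF pin cF]] Q by (simp add: loop_concat_compose)
  moreover have "F o linepath (0,0) (1,1) = (\<lambda>t. cfg n ((\<lambda>x. r x t) ` S))"
  proof
   fix t
   have "(\<lambda>y. r y (if y = z then t else t)) ` S = (\<lambda>x. r x t) ` S" by simp
   then show "(F o linepath (0,0) (1,1)) t = cfg n ((\<lambda>x. r x t) ` S)" by (simp add: F_def linepath_def cong: if_cong)
  qed
  moreover have "\<Phi> (F o linepath (0,0) (1,0)) = - f ((\<lambda>x. r x 0) ` S) + f (insert (r z 1) ((\<lambda>x. r x 0) ` (S - {z})))"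
  proof -
   let ?T = "(\<lambda>x. r x 0) ` (S - {z})"
   have z: "z \<in> S" using insert.prems by blast
   have "F o linepath (0,0) (1,0) = (\<lambda>t. cfg n (insert (r z t) ?T))"
   proof
    fix t
    have "(\<lambda>y. r y (if y = z then t else 0)) ` S = insert (r z t) ?T" using z by force
    then show "(F o linepath (0,0) (1,0)) t = cfg n (insert (r z t) ?T)" by (simp add: F_def linepath_def cong: if_cong)
   qed
   moreover have "inj_on (\<lambda>x. r x 0) (S - {z})" using inj[of "\<lambda>x. r x 0"] rV by (auto intro: inj_on_subset)
   then have "Suc (card ?T) = n" using S(4) card_Suc_Diff1[OF S(3) z] by (simp add: card_image)
   moreover have "pathin (subtopology X (- ?T)) (r z)"
   proof -
    have "r z t ~: ?T" if "0 <= t" "t <= 1" for t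
    proof
     assume "r z t \<in> ?T"
     then obtain x where "x \<in> S" "x ~= z" "r z t = r x 0" by blast
     then show False using V(2)[of x z] rV(1)[of x 0] rV(1)[of z t] that z by auto
    qed
    then show ?thesis using insert.prems(2)[OF z] unfolding pathin_subtopology by auto
   qed
   moreover have "insert (r z 0) ?T = (\<lambda>x. r x 0) ` S" using z by blast
   ultimately show ?thesis using strand[of ?T "r z"] S(3) rV(2) by (auto simp: image_subset_iff)
  qed
  moreover have "\<Phi> (F o linepath (1,0) (1,1)) = - f (insert (r z 1) ((\<lambda>x. r x 0) ` (S - {z}))) + f ((\<lambda>x. r x 1) ` S)"
  proof -
   define r' where "r' y = (if y = z then (\<lambda>_. r z 1) else r y)" for y
   have z: "z \<in> S" using insert.prems by blast
   have "F o linepath (1,0) (1,1) = (\<lambda>t. cfg n ((\<lambda>x. r' x t) ` S))"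
   proof
    fix t
    have "(\<lambda>y. r y (if y = z then 1 else t)) ` S = (\<lambda>x. r' x t) ` S" by (rule image_cong) (auto simp: r'_def)
    then show "(F o linepath (1,0) (1,1)) t = cfg n ((\<lambda>x. r' x t) ` S)" by (simp add: F_def linepath_def cong: if_cong)
   qed
   moreover have "\<Phi> (\<lambda>t. cfg n ((\<lambda>x. r' x t) ` S)) = - f ((\<lambda>x. r' x 0) ` S) + f ((\<lambda>x. r' x 1) ` S)"
   proof (rule insert.IH)
    show "pathin (subtopology X (V x)) (r' x)" if "x \<in> S" for x using insert.prems(2)[OF that] rV[OF z, of 1] by (auto simp: r'_def)
    show "r' x t = r' x 0" if "x \<in> S - M" "0 <= t" "t <= 1" for x t using insert.prems(3)[of x t] that by (auto simp: r'_def)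
   qed (use insert.prems in auto)
   moreover have "(\<lambda>x. r' x 0) ` S = insert (r z 1) ((\<lambda>x. r x 0) ` (S - {z}))" using z by (force simp: r'_def)
   moreover have "(\<lambda>x. r' x 1) ` S = (\<lambda>x. r x 1) ` S" by (auto simp: r'_def)
   ultimately show ?thesis by simp
  qed
  ultimately show ?case by (simp add: add.assoc)
 qed
 define N where "N = topspace ?C \<inter> (\<Inter>x\<in>S. {P \<in> topspace ?C. supp n P \<inter> V x ~= {}})"
 have "openin ?C N"
 proof (cases "S = {}")
  case True then show ?thesis by (simp only: N_def) simp
 next
  case False
  then have "openin ?C (\<Inter>x\<in>S. {P \<in> topspace ?C. supp n P \<inter> V x ~= {}})"
   by (intro openin_INT2 S(3)) (use openin_supp_meets[OF conjunct1[OF V(1)]] in auto)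
  then show ?thesis unfolding N_def by (intro openin_Int openin_topspace)
 qed
 moreover have "P0 \<in> N" using \<open>P0 \<in> topspace ?C\<close> V(1) supp_cfg[OF S(3,4)] by (auto simp: N_def S(1))
 moreover have "potential (subtopology ?C N) \<Phi> (\<lambda>P. f (supp n P))" unfolding potential_def
 proof (intro allI impI)
  fix q assume q: "pathin (subtopology ?C N) q"
  then have qC: "pathin ?C q" and qN: "\<And>t. 0 <= t ==> t <= 1 ==> q t \<in> N" by (auto simp: pathin_subtopology)
  \<comment> \<open>There are as many disjoint neighbourhoods as points, so each contains exactly
    one point of a configuration in \<open>N\<close>, and the choice is forced.\<close>
  define s where "s x t = (SOME y. y \<in> supp n (q t) \<inter> V x)" for x t
  have s: "s x t \<in> supp n (q t)" "s x t \<in> V x" if "x \<in> S" "0 <= t" "t <= 1" for x t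
  proof -
   have "supp n (q t) \<inter> V x ~= {}" using qN[OF that(2,3)] that(1) by (auto simp: N_def)
   then have "s x t \<in> supp n (q t) \<inter> V x" unfolding s_def by (rule some_in_eq[THEN iffD2])
   then show "s x t \<in> supp n (q t)" "s x t \<in> V x" by auto
  qed
  have qs: "q t = cfg n ((\<lambda>x. s x t) ` S)" "supp n (q t) = (\<lambda>x. s x t) ` S" "supp n (q t) \<subseteq> topspace X" if t01: "0 <= t" "t <= 1" for t
  proof -
   obtain R where R: "q t = cfg n R" "R \<subseteq> topspace X" "finite R" "card R = n" using qN[OF t01] by (auto simp: N_def topspace_unordered_config)
   have sR: "supp n (q t) = R" using R supp_cfg by simp
   have "inj_on (\<lambda>x. s x t) S" by (rule inj) (use s t01 in blast)
   then have "card ((\<lambda>x. s x t) ` S) = card R" using S R by (simp add: card_image)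
   moreover have "(\<lambda>x. s x t) ` S \<subseteq> R" using s t01 sR by blast
   ultimately have "(\<lambda>x. s x t) ` S = R" using R(3) card_subset_eq by blast
   then show "q t = cfg n ((\<lambda>x. s x t) ` S)" "supp n (q t) = (\<lambda>x. s x t) ` S" "supp n (q t) \<subseteq> topspace X" using R sR by auto
  qed
  have ps: "pathin (subtopology X (V x)) (s x)" if x: "x \<in> S" for x
  proof -
   have "continuous_map (top_of_set {0..1}) X (s x)" unfolding continuous_map_def
   proof (intro conjI allI impI)
    show "s x \<in> topspace (top_of_set {0..1}) \<rightarrow> topspace X" using s(1)[OF x] qs(3) by auto (meson subsetD)
    fix G assume G: "openin X G"
    \<comment> \<open>Continuity of the selected point: it lies in \<open>G\<close> iff the support
      meets \<open>G \<inter> V x\<close>, which is an open condition on the configuration.\<close>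
    have "{t \<in> topspace (top_of_set {0..1}). s x t \<in> G} =
     {t \<in> topspace (top_of_set {0..1}). q t \<in> {P \<in> topspace ?C. supp n P \<inter> (G \<inter> V x) ~= {}}}"
    proof (rule Collect_cong)
     fix t :: real
     show "t \<in> topspace (top_of_set {0..1}) & s x t \<in> G \<longleftrightarrow>
      t \<in> topspace (top_of_set {0..1}) & q t \<in> {P \<in> topspace ?C. supp n P \<inter> (G \<inter> V x) ~= {}}"
     proof (cases "0 <= t & t <= 1")
      case True
      then have t: "0 <= t" "t <= 1" by auto
      have "supp n (q t) \<inter> V x = {s x t}" unfolding qs(2)[OF t] using s(2)[OF _ t] V(2) x by fastforce
      moreover have "q t \<in> topspace ?C" using qN[OF t] by (simp add: N_def)
      moreover have "supp n (q t) \<inter> (G \<inter> V x) = (supp n (q t) \<inter> V x) \<inter> G" by blast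
      ultimately show ?thesis using t by auto
     qed auto
    qed
    moreover have "openin (top_of_set {0..1}) {t \<in> topspace (top_of_set {0..1}). q t \<in> {P \<in> topspace ?C. supp n P \<inter> (G \<inter> V x) ~= {}}}"
     using qC unfolding pathin_def by (rule openin_continuous_map_preimage) (intro openin_supp_meets openin_Int G V(1)[OF x, THEN conjunct1])
    ultimately show "openin (top_of_set {0..1}) {t \<in> topspace (top_of_set {0..1}). s x t \<in> G}" by simp
   qed
   then show ?thesis using s(2)[OF x] unfolding pathin_subtopology by (auto simp: pathin_def)
  qed
  have "\<Phi> q = \<Phi> (\<lambda>t. cfg n ((\<lambda>x. s x t) ` S))" by (rule pf_cong[OF \<Phi> qC]) (rule qs(1))
  also have "\<dots> = - f ((\<lambda>x. s x 0) ` S) + f ((\<lambda>x. s x 1) ` S)" by (rule move[OF S(3)]) (use ps in auto)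
  also have "\<dots> = - f (supp n (q 0)) + f (supp n (q 1))" using qs(2)[of 0] qs(2)[of 1] by simp
  finally show "\<Phi> q = - f (supp n (q 0)) + f (supp n (q 1))" .
 qed
 ultimately show "EX V. openin ?C V & P0 \<in> V & potential (subtopology ?C V) \<Phi> (\<lambda>P. f (supp n P))" by blast
qed

section \<open>Connectivity of configurations\<close>

text \<open>Any injective tuple can be moved to any other one point at a time, via a tuple of fresh points.\<close>
lemma tuple_moves: fixes R :: "(nat => 'a) => (nat => 'a) => bool" assumes V: "infinite V"
  and step: "\<And>c k v. c \<in> {..<m} \<rightarrow>\<^sub>E V ==> inj_on c {..<m} ==> k < m ==> v \<in> V ==> v ~: c ` {..<m} ==> R c (c(k := v))"
  and refl: "\<And>c. c \<in> {..<m} \<rightarrow>\<^sub>E V ==> inj_on c {..<m} ==> R c c" and trans: "\<And>c d e. R c d ==> R d e ==> R c e"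
  and c: "c \<in> {..<m} \<rightarrow>\<^sub>E V" "inj_on c {..<m}" and d: "d \<in> {..<m} \<rightarrow>\<^sub>E V" "inj_on d {..<m}" shows "R c d"
proof -
 have disj: "R c d" if c: "c \<in> {..<m} \<rightarrow>\<^sub>E V" "inj_on c {..<m}" and d: "d \<in> {..<m} \<rightarrow>\<^sub>E V" "inj_on d {..<m}"
  and cd: "c ` {..<m} \<inter> d ` {..<m} = {}" for c d
 proof -
  define mix where "mix j = (\<lambda>k. if k < j then d k else c k)" for j
  have ne: "c x ~= d y" "d y ~= c x" if "x < m" "y < m" for x y using cd that by (auto simp: disjoint_iff)
  have Rm: "R c (mix j)" if "j <= m" for j using that
  proof (induction j)
   case 0 then show ?case using refl[OF c] by (simp add: mix_def)
  next
   case (Suc j)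
   have 1: "mix j \<in> {..<m} \<rightarrow>\<^sub>E V" using c d Suc.prems by (auto simp: mix_def PiE_def extensional_def)
   have 2: "inj_on (mix j) {..<m}"
   proof (rule inj_onI)
    fix x y assume "x \<in> {..<m}" "y \<in> {..<m}" "mix j x = mix j y"
    then show "x = y" using c(2) d(2) ne by (auto simp: mix_def inj_on_def split: if_splits)
   qed
   have 3: "d j ~: mix j ` {..<m}"
   proof
    assume "d j \<in> mix j ` {..<m}"
    then obtain k where k: "k < m" "d j = mix j k" by auto
    show False
    proof (cases "k < j")
     case True
     then have "j = k" using k Suc.prems inj_onD[OF d(2), of j k] by (simp add: mix_def)
     with True show False by simp
    next
     case False
     then show False using ne(2)[of k j] k Suc.prems by (simp add: mix_def)
    qed
   qed
   have "mix (Suc j) = (mix j)(j := d j)" by (auto simp: mix_def)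
   moreover have "R (mix j) ((mix j)(j := d j))" by (rule step[OF 1 2 _ _ 3]) (use Suc.prems PiE_mem[OF d(1), of j] in auto)
   moreover have "R c (mix j)" using Suc by simp
   ultimately show ?case using trans[of c "mix j" "(mix j)(j := d j)"] by (simp only:)
  qed
  have "mix m = d" using c d by (auto simp: mix_def PiE_def extensional_def)
  then show ?thesis using Rm[of m] by simp
 qed
 \<comment> \<open>\<open>c\<close> and \<open>d\<close> may share values, which would obstruct
   replacing one coordinate after the other. Passing through a tuple disjoint from both avoids
   this.\<close>
 have "infinite (V - (c ` {..<m} \<union> d ` {..<m}))" using V by simp
 then obtain E where E: "finite E" "card E = m" "E \<subseteq> V - (c ` {..<m} \<union> d ` {..<m})" using infinite_arbitrarily_large by blast
 then obtain e where "bij_betw e {..<m} E" using ex_bij_betw_nat_finite[of E] by (auto simp: lessThan_atLeast0)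
 then have e: "restrict e {..<m} \<in> {..<m} \<rightarrow>\<^sub>E V" "inj_on (restrict e {..<m}) {..<m}" "restrict e {..<m} ` {..<m} = E"
  using E(3) by (auto simp: bij_betw_def inj_on_def)
 have "R c (restrict e {..<m})" by (rule disj[OF c e(1,2)]) (use E e(3) in auto)
 moreover have "R (restrict e {..<m}) d" by (rule disj[OF e(1,2) d]) (use E e(3) in auto)
 ultimately show ?thesis by (rule trans)
qed

context surface
begin

lemma path_connected_ordered_config: assumes "c \<in> topspace (ordered_config m U)" "d \<in> topspace (ordered_config m U)"
 shows "EX q. pathin (ordered_config m U) q & q 0 = c & q 1 = d"
proof (rule tuple_moves[OF infinite_topspace, where R = "\<lambda>c d. EX q. pathin (ordered_config m U) q & q 0 = c & q 1 = d"])
 fix c k v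
 assume c: "c \<in> {..<m} \<rightarrow>\<^sub>E topspace U" "inj_on c {..<m}" and k: "k < m" and v: "v \<in> topspace U" "v ~: c ` {..<m}"
 let ?F = "c ` ({..<m} - {k})"
 have "c k \<in> topspace U - ?F" using c k by (auto simp: inj_on_def)
 moreover have "v \<in> topspace U - ?F" using v by blast
 ultimately obtain q where q: "pathin (subtopology U (- ?F)) q" "q 0 = c k" "q 1 = v" using path_in_complement[of ?F "c k" v] by blast
 have qF: "q t ~: ?F" if "t \<in> {0..1}" for t using q(1) that by (auto simp: pathin_subtopology)
 let ?a = "\<lambda>j t. if j = k then q t else c j"
 have "pathin (ordered_config m U) (\<lambda>t. restrict (\<lambda>j. ?a j t) {..<m})" unfolding pathin_def
 proof (rule continuous_map_ordered)
  show "continuous_map (top_of_set {0..1}) U (?a j)" if "j < m" for j using q(1) c that unfolding pathin_subtopology by (cases "j = k") (auto simp: pathin_def)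
  show "inj_on (\<lambda>j. ?a j t) {..<m}" if "t \<in> topspace (top_of_set {0..1})" for t
  proof -
   have F: "c j \<in> ?F" if "j < m" "j ~= k" for j using that by auto
   have "q t ~: ?F" using qF[of t] \<open>t \<in> topspace (top_of_set {0..1})\<close> by (simp del: image_iff)
   then have "q t ~= c j" "c j ~= q t" if "j < m" "j ~= k" for j using F[OF that] by metis+
   then show ?thesis using c(2) by (auto simp: inj_on_def)
  qed
 qed
 moreover have "restrict (\<lambda>j. ?a j 0) {..<m} = c" "restrict (\<lambda>j. ?a j 1) {..<m} = c(k := v)" using q k c by (auto simp: PiE_def extensional_def)
 ultimately show "EX q. pathin (ordered_config m U) q & q 0 = c & q 1 = c(k := v)" by (intro exI[of _ "\<lambda>t. restrict (\<lambda>j. ?a j t) {..<m}"]) auto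
next
 fix c assume "c \<in> {..<m} \<rightarrow>\<^sub>E topspace U" "inj_on c {..<m}"
 then show "EX q. pathin (ordered_config m U) q & q 0 = c & q 1 = c" by (intro exI[of _ "\<lambda>_. c"]) (auto simp: topspace_ordered_config)
next
 fix c d e
 assume "EX q. pathin (ordered_config m U) q & q 0 = c & q 1 = d" "EX q. pathin (ordered_config m U) q & q 0 = d & q 1 = e"
 then obtain q r where "pathin (ordered_config m U) q" "q 0 = c" "q 1 = d" "pathin (ordered_config m U) r" "r 0 = d" "r 1 = e" by blast
 then show "EX q. pathin (ordered_config m U) q & q 0 = c & q 1 = e" by (intro exI[of _ "loop_concat q r"]) (simp add: pathin_loop_concat)
qed (use assms in "auto simp: topspace_ordered_config")

lemma path_connected_unordered_config: assumes "P \<in> topspace (unordered_config n U)" "Q \<in> topspace (unordered_config n U)"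
 shows "EX q. pathin (unordered_config n U) q & q 0 = P & q 1 = Q"
proof -
 let ?q = "\<lambda>c. {c o \<sigma> |\<sigma>. \<sigma> permutes {..<n}}"
 obtain c d where cd: "c \<in> topspace (ordered_config n U)" "P = ?q c" "d \<in> topspace (ordered_config n U)" "Q = ?q d"
  using assms by (auto simp: unordered_config_def)
 obtain r where r: "pathin (ordered_config n U) r" "r 0 = c" "r 1 = d" using path_connected_ordered_config[OF cd(1,3)] by blast
 have "pathin (unordered_config n U) (?q o r)" by (rule pathin_compose[OF r(1) quotient_imp_continuous_map[OF quotient_unordered_config]])
 then show ?thesis using r cd by (intro exI[of _ "?q o r"]) auto
qed

end

text \<open>
 The complex of \<open>n\<close>-subsets (the Johnson graph with its triangles) is simply connected: a system of
 values on its edges that vanishes on the triangles is a coboundary. Induction on \<open>n\<close> by coning to the sets that contain a fixed point.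
\<close>
lemma johnson_potential: fixes F :: "'a set => 'a => 'a => 'g::ab_group_add" assumes V: "infinite V"
  and add: "\<And>S x y z. finite S ==> S \<subseteq> V ==> card S = k ==> x \<in> V - S ==> y \<in> V - S ==> z \<in> V - S ==>
   F S x y + F S y z = F S x z" and triangle: "\<And>T x y z. finite T ==> T \<subseteq> V ==> Suc (card T) = k ==> {x, y, z} \<subseteq> V - T ==>
   x ~= y ==> y ~= z ==> x ~= z ==> F (insert y T) x z + F (insert z T) y x + F (insert x T) z y = 0"
 shows "EX f. ALL S x y. finite S --> S \<subseteq> V --> card S = k --> x \<in> V - S --> y \<in> V - S -->
   F S x y = f (insert y S) - f (insert x S)" using assms
proof (induction k arbitrary: V F)
 case 0
 obtain x0 where x0: "x0 \<in> V" using 0(1) by fastforce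
 show ?case
 proof (intro exI[of _ "\<lambda>S. F {} x0 (the_elem S)"] allI impI)
  fix S x y assume "finite S" "S \<subseteq> V" "card S = 0" "x \<in> V - S" "y \<in> V - S"
  then show "F S x y = F {} x0 (the_elem (insert y S)) - F {} x0 (the_elem (insert x S))" using 0(2)[of "{}" x0 x y] x0 by (simp add: algebra_simps)
 qed
next
 case (Suc k)
 \<comment> \<open>The apex of the cone. The sets that contain \<open>z\<close> form the complex of
   the induction hypothesis for the remaining points.\<close>
 obtain z where z: "z \<in> V" using Suc.prems(1) by fastforce
 let ?V = "V - {z}"
 have "EX f. ALL S x y. finite S --> S \<subseteq> ?V --> card S = k --> x \<in> ?V - S --> y \<in> ?V - S -->
   F (insert z S) x y = f (insert y S) - f (insert x S)"
 proof (rule Suc.IH[of ?V "\<lambda>S. F (insert z S)"])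
  show "infinite ?V" using Suc.prems(1) by simp
  show "F (insert z S) x y + F (insert z S) y w = F (insert z S) x w"
   if "finite S" "S \<subseteq> ?V" "card S = k" "x \<in> ?V - S" "y \<in> ?V - S" "w \<in> ?V - S" for S x y w
   using that z by (intro Suc.prems(2)) (auto simp: card_insert_if)
  show "F (insert z (insert y T)) x w + F (insert z (insert w T)) y x + F (insert z (insert x T)) w y = 0"
   if "finite T" "T \<subseteq> ?V" "Suc (card T) = k" "{x, y, w} \<subseteq> ?V - T" "x ~= y" "y ~= w" "x ~= w" for T x y w
  proof -
   have "z ~: T" using that(2) by blast
   then show ?thesis using Suc.prems(3)[of "insert z T" x y w] that z by (auto simp: insert_commute subset_iff)
  qed
 qed
 then obtain h where h: "\<And>S x y. finite S ==> S \<subseteq> ?V ==> card S = k ==> x \<in> ?V - S ==> y \<in> ?V - S ==>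
   F (insert z S) x y = h (insert y S) - h (insert x S)" by blast
 have self: "F S x x = 0" if "finite S" "S \<subseteq> V" "card S = Suc k" "x \<in> V - S" for S x using Suc.prems(2)[of S x x x] that by simp
 have indep: "h (R - {u}) + F (R - {u}) z u = h (R - {v}) + F (R - {v}) z v"
  if R: "finite R" "R \<subseteq> ?V" "card R = Suc (Suc k)" "u \<in> R" "v \<in> R" for R u v
 proof (cases "u = v")
  case False
  define Q where "Q = R - {u, v}"
  have Q: "finite Q" "Q \<subseteq> ?V" "card Q = k" "R - {u} = insert v Q" "R - {v} = insert u Q" "u ~: Q" "v ~: Q"
   using R False by (auto simp: Q_def card_Diff_subset)
  have uv: "u \<in> ?V" "v \<in> ?V" using R by auto
  have "F (insert v Q) z u + F (insert u Q) v z + F (insert z Q) u v = 0" using Q(1-3,6,7) uv z False by (intro Suc.prems(3)) auto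
  moreover have "F (insert z Q) u v = h (insert v Q) - h (insert u Q)" using Q uv by (intro h) auto
  moreover have "F (insert u Q) v z + F (insert u Q) z v = F (insert u Q) v v" using Q uv z False by (intro Suc.prems(2)) auto
  moreover have "F (insert u Q) v v = 0" using Q uv False by (intro self) auto
  ultimately show ?thesis unfolding Q(4,5) by (simp add: algebra_simps add_eq_0_iff)
 qed simp
 \<comment> \<open>\<open>F S x y\<close> belongs to the edge from \<open>insert x S\<close> to
   \<open>insert y S\<close>. For a set without \<open>z\<close>, the value is reached by one edge
   from a set in which \<open>z\<close> replaces some \<open>u\<close>; by \<open>indep\<close>, a
   consequence of the triangle relation, the choice of \<open>u\<close> does not matter.\<close>
 define f where "f R = (if z \<in> R then h (R - {z}) else (let u = SOME u. u \<in> R in h (R - {u}) + F (R - {u}) z u))" for R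
 have fz: "f (insert z S) = h S" if "z ~: S" for S using that by (simp add: f_def)
 have fn: "f (insert u S) = h S + F S z u" if "finite S" "S \<subseteq> ?V" "card S = Suc k" "u \<in> ?V - S" for S u
 proof -
  define v where "v = (SOME v. v \<in> insert u S)"
  have v: "v \<in> insert u S" unfolding v_def by (rule someI[of "\<lambda>v. v \<in> insert u S" u]) simp
  have "f (insert u S) = h (insert u S - {v}) + F (insert u S - {v}) z v" using that by (auto simp: f_def v_def Let_def)
  also have "\<dots> = h (insert u S - {u}) + F (insert u S - {u}) z u" using that v by (intro indep) auto
  also have "insert u S - {u} = S" using that by auto
  finally show ?thesis .
 qed
 show ?case
 proof (intro exI[of _ f] allI impI)
  fix S x y assume S: "finite S" "S \<subseteq> V" "card S = Suc k" and x: "x \<in> V - S" and y: "y \<in> V - S"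
  show "F S x y = f (insert y S) - f (insert x S)"
  proof (cases "z \<in> S")
   case True
   define Q where "Q = S - {z}"
   have Q: "S = insert z Q" "finite Q" "Q \<subseteq> ?V" "card Q = k" "z ~: Q" using S True by (auto simp: Q_def)
   have "F (insert z Q) x y = h (insert y Q) - h (insert x Q)" using Q x y by (intro h) auto
   moreover have "f (insert w S) = h (insert w Q)" if "w \<in> V - S" for w using fz[of "insert w Q"] that Q by (auto simp: insert_commute)
   ultimately show ?thesis using x y Q(1) by simp
  next
   case False
   have val: "f (insert w S) = h S + F S z w" if w: "w \<in> V - S" for w
   proof (cases "w = z")
    case True then show ?thesis using fz[OF False] self[OF S] z False by simp
   next
    case wz: False then show ?thesis using fn[of S w] S w False by blast
   qed
   show ?thesis unfolding val[OF x] val[OF y] using Suc.prems(2)[OF S, of z x y] x y z False by (simp add: algebra_simps)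
  qed
 qed
qed

section \<open>One moving strand\<close>

context surface
begin

lemma continuous_map_pair: assumes i: "i < g" and b: "b \<subseteq> chart_dom g i" "inj_on (p i) b" "p i ` b \<inter> B = {}"
  and B: "finite B" "B \<subseteq> topspace U" "Suc (Suc (card B)) = n" and D: "D \<subseteq> {v \<in> b \<times> b. fst v ~= snd v}"
 shows "continuous_map (top_of_set D) (unordered_config n U) (\<lambda>v. cfg n (insert (p i (fst v)) (insert (p i (snd v)) B)))"
proof (rule continuous_map_two_strands[OF B])
 have "continuous_map (top_of_set D) (top_of_set (chart_dom g i)) fst" "continuous_map (top_of_set D) (top_of_set (chart_dom g i)) snd"
  using D b(1) by (auto simp: continuous_map_in_subtopology intro!: continuous_intros)
 from this[THEN continuous_map_compose[OF _ chart_cont[OF i]]]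
 show "continuous_map (top_of_set D) U (\<lambda>v. p i (fst v))" "continuous_map (top_of_set D) U (\<lambda>v. p i (snd v))" by (simp_all add: o_def)
 fix v assume "v \<in> topspace (top_of_set D)"
 then have v: "fst v \<in> b" "snd v \<in> b" "fst v ~= snd v" using D by auto
 then show "p i (fst v) ~= p i (snd v) & p i (fst v) ~: B & p i (snd v) ~: B" using inj_onD[OF b(2)] b(3) by blast
qed

lemma open_chart_avoiding: assumes "i < g" "finite B" shows "open {z \<in> chart_dom g i. p i z ~: B}"
proof -
 have "{z \<in> chart_dom g i. p i z ~: B} = chart_dom g i - {z \<in> chart_dom g i. p i z \<in> B}" by blast
 then show ?thesis using open_annuli(4) finite_imp_closed[OF finite_chart_preimage[OF assms]] by (simp add: open_Diff)
qed

lemma openin_complement_path: assumes "pathin U \<gamma>" "finite B" "B \<subseteq> topspace U" shows "openin U (topspace U - (\<gamma> ` {0..1} \<union> B))"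
proof -
 have "compactin U (\<gamma> ` {0..1})" by (rule image_compactin[OF _ assms(1)[unfolded pathin_def]]) (simp add: compactin_subtopology)
 then have "closedin U (\<gamma> ` {0..1})" using Hausdorff compactin_imp_closedin by blast
 moreover have "closedin U B" using Hausdorff assms(2,3) closedin_Hausdorff_finite by blast
 ultimately show ?thesis by (intro openin_diff closedin_Un) auto
qed

text \<open>A finite set excludes only finitely many of the possible ends on the circle. Once the
  ends are chosen, the rest of the diameter is bent around the finite set, which does not disconnect
  the strip.\<close>

lemma crosscap_path_avoiding: assumes r: "r < g" and T: "finite T"
 obtains u z where "pathin (top_of_set strip) u" "u 0 = - z" "u 1 = z" "norm z = 1" "\<bar>Re z\<bar> < 1/3" "Im z > 0"
  "pathin (subtopology U (- T)) (p r o u)" "p r (u 0) = p r (u 1)"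
proof -
 let ?B = "{z \<in> chart_dom g r. p r z \<in> T}"
 have B: "finite ?B" by (rule finite_chart_preimage[OF r T])
 let ?w = "\<lambda>x. Complex x (sqrt (1 - x\<^sup>2))"
 \<comment> \<open>Any bound below 1/3 would keep the ends in the strip.\<close>
 have "infinite {-1/4<..<1/4::real}" by simp
 moreover have "finite (Re ` ?B)" using B by simp
 ultimately obtain x where x: "x \<in> {-1/4<..<1/4}" "x ~: Re ` ?B" by (metis (no_types, lifting) finite_subset subsetI)
 have x2: "x\<^sup>2 < 1" using x by (auto simp: abs_square_less_1)
 have n: "norm (?w x) = 1" "\<bar>Re (?w x)\<bar> < 1/3" "Im (?w x) > 0" using x x2 by (auto simp: cmod_def)
 have s: "?w x \<in> strip" "- ?w x \<in> strip" using n by (auto simp: strip_def)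
 have w: "p r (?w x) ~: T"
 proof
  assume "p r (?w x) \<in> T"
  then have "?w x \<in> ?B" using subsetD[OF strip_chart_dom s(1)] by (intro CollectI conjI)
  then have "Re (?w x) \<in> Re ` ?B" by (rule imageI)
  then show False using x(2) unfolding complex.sel by (rule notE[rotated])
 qed
 have nB: "?w x \<in> strip - ?B" "- ?w x \<in> strip - ?B" using s w chart_minus[OF r n(1)] by auto
 have "2 <= DIM(complex)" by simp
 then have "connected (strip - ?B)" by (rule connected_open_delete_finite[OF open_strip convex_connected[OF strip_convex] _ B])
 moreover have "open (strip - ?B)" using open_strip finite_imp_closed[OF B] by blast
 ultimately have "path_connected (strip - ?B)" by (simp add: connected_open_path_connected)
 from path_connectedE[OF this nB(2,1)] obtain u where u: "pathin (top_of_set (strip - ?B)) u" "u 0 = - ?w x" "u 1 = ?w x" .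
 have us: "pathin (top_of_set strip) u" using u(1) by (auto simp: pathin_top_of_set)
 have "p r (u t) ~: T" if "t \<in> {0..1}" for t
 proof -
  have "u ` {0..1} \<subseteq> strip - ?B" using u(1) unfolding pathin_top_of_set path_image_def by (rule conjunct2)
  then have "u t \<in> strip - ?B" using that by (rule subsetD[OF _ imageI])
  then show ?thesis using subsetD[OF strip_chart_dom[of g r], of "u t"] by simp
 qed
 moreover have "pathin U (p r o u)" by (rule pathin_chart_subset[OF r us strip_chart_dom])
 ultimately have "pathin (subtopology U (- T)) (p r o u)" by (auto simp: pathin_subtopology)
 then show ?thesis using that[OF us u(2,3) n] chart_minus[OF r n(1)] u by simp
qed

end

locale config_functional = surface U g p for U :: "'a topology" and g :: nat and p :: "nat => complex => 'a" +
 fixes n :: nat and \<zeta> :: "(real => (nat => 'a) set) => 'g::ab_group_add"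
 assumes \<zeta>: "path_functional (unordered_config n U) \<zeta>" and two: "\<And>a::'g. a + a = 0"
begin

definition strand :: "'a set => (real => 'a) => 'g" where "strand T \<gamma> = \<zeta> (\<lambda>t. cfg n (insert (\<gamma> t) T))"

lemma strand_functional: assumes "finite T" "T \<subseteq> topspace U" "Suc (card T) = n" shows "path_functional (subtopology U (- T)) (strand T)"
 using pf_compose[OF \<zeta> continuous_map_strand[OF assms]] by (simp add: strand_def[abs_def] o_def)

text \<open>Shift the centre of the circle to the midpoint of the two points: the full rotation is twice the half rotation.\<close>
lemma strand_circle: assumes i: "i < g" and b: "ball z e \<subseteq> chart_dom g i" "inj_on (p i) (ball z e)" "p i ` ball z e \<inter> B = {}" and e: "e > 0"
  and B: "finite B" "B \<subseteq> topspace U" "Suc (Suc (card B)) = n"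
 shows "strand (insert (p i z) B) (\<lambda>t. p i (z + of_real (e/2) * cis (2 * pi * t))) = 0"
proof -
 let ?D = "{v \<in> ball z e \<times> ball z e. fst v ~= snd v}"
 define M where "M v = cfg n (insert (p i (fst v)) (insert (p i (snd v)) B))" for v
 have M: "continuous_map (top_of_set ?D) (unordered_config n U) M" unfolding M_def by (rule continuous_map_pair[OF i b B]) simp
 define E where "E st = (z + of_real (e/2 * (1 - fst st / 2)) * cis (2 * pi * snd st), z - of_real (e/2 * (fst st / 2)) * cis (2 * pi * snd st))" for st :: "real \<times> real"
 have ED: "E st \<in> ?D" if "st \<in> {0..1} \<times> {0..1}" for st
 proof -
  obtain s t where "st = (s, t)" by (cases st)
  with that have st: "st = (s, t)" "0 <= s" "s <= 1" by auto
  have "e * (1 - s/2) <= e * 1" "e * (s / 2) <= e * 1" "0 <= e * (1 - s/2)" "0 <= e * (s/2)" using st e by (intro mult_left_mono mult_nonneg_nonneg; simp)+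
  then have "\<bar>e / 2 * (1 - s/2)\<bar> < e" "\<bar>e / 2 * (s / 2)\<bar> < e" using e by (auto simp: field_simps)
  then have 1: "fst (E st) \<in> ball z e" "snd (E st) \<in> ball z e"
   by (simp_all only: E_def st fst_conv snd_conv mem_ball dist_norm) (simp_all add: norm_mult del: of_real_mult of_real_divide of_real_diff)
  have "fst (E st) - snd (E st) = of_real (e/2) * cis (2 * pi * t)" by (simp add: E_def st algebra_simps)
  moreover have "of_real (e/2) * cis (2 * pi * t) ~= 0" using e by simp
  ultimately have "fst (E st) ~= snd (E st)" by (metis right_minus_eq)
  with 1 show ?thesis by (simp add: mem_Times_iff)
 qed
 have cE: "continuous_map (top_of_set ({0..1} \<times> {0..1})) (top_of_set ?D) E"
  using ED by (auto simp: continuous_map_in_subtopology E_def[abs_def] intro!: continuous_intros simp del: mem_Collect_eq)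
 have "\<zeta> (\<lambda>t. (M o E) (0, t)) = \<zeta> (\<lambda>t. (M o E) (1, t))"
  by (rule path_functional_free_homotopy[OF \<zeta> continuous_map_compose[OF cE M]]) (simp add: E_def)
 moreover have "(\<lambda>t. (M o E) (0, t)) = (\<lambda>t. cfg n (insert (p i (z + of_real (e/2) * cis (2 * pi * t))) (insert (p i z) B)))"
  by (simp add: M_def E_def)
 moreover have "\<zeta> (\<lambda>t. (M o E) (1, t)) = 0"
 proof -
  define h where "h t = (M o E) (1, t / 2)" for t
  have "pathin (top_of_set ({0..1} \<times> {0..1})) (\<lambda>t. (1::real, t / 2))"
   by (auto simp: pathin_top_of_set path_def path_image_def intro!: continuous_intros)
  from pathin_compose[OF this continuous_map_compose[OF cE M]]
  have h: "pathin (unordered_config n U) h" by (simp add: h_def[abs_def] o_def)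
  \<comment> \<open>At \<open>s = 1\<close> both points lie opposite each other at distance
    \<open>e / 4\<close> from \<open>z\<close>, so half a period exchanges them and the
    configuration returns. The full turn is therefore a closed path traversed twice.\<close>
  have shift: "(M o E) (1, t + 1/2) = (M o E) (1, t)" for t
  proof -
   have "cis (2 * pi * (t + 1/2)) = - cis (2 * pi * t)" by (simp add: distrib_left cis_mult[symmetric])
   then show ?thesis by (simp add: M_def E_def insert_commute)
  qed
  have "(\<lambda>t. (M o E) (1, t)) = loop_concat h h"
  proof
   fix t show "(M o E) (1, t) = loop_concat h h t" using shift[of "t - 1/2"] by (simp add: loop_concat_def h_def diff_divide_distrib)
  qed
  moreover have "h 1 = h 0" using shift[of 0] by (simp add: h_def)
  ultimately show ?thesis using pf_concat[OF \<zeta> h h] two by simp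
 qed
 ultimately show ?thesis by (simp add: strand_def)
qed

text \<open>Small circles of the strand around a point at rest have value zero, so the functional of
  the strand extends over that point. It becomes a functional on the whole surface, to which
  \<open>surface_potential\<close> can be applied.\<close>

lemma strand_extend: assumes T: "finite T" "T \<subseteq> topspace U" "Suc (card T) = n"
 obtains \<Psi> where "path_functional U \<Psi>" "\<And>\<gamma>. pathin (subtopology U (- T)) \<gamma> ==> \<Psi> \<gamma> = strand T \<gamma>"
proof -
 \<comment> \<open>The points of \<open>F\<close> are those already filled in; one more is filled in
   each step of the induction.\<close>
 have "EX \<Psi>. path_functional (subtopology U (- (T - F))) \<Psi> & (ALL \<gamma>. pathin (subtopology U (- T)) \<gamma> --> \<Psi> \<gamma> = strand T \<gamma>)"
  if "F \<subseteq> T" for F using finite_subset[OF that T(1)] that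
 proof (induction F rule: finite_induct)
  case empty
  then show ?case using strand_functional[OF T] by auto
 next
  case (insert s F)
  then obtain \<Psi> where \<Psi>: "path_functional (subtopology U (- (T - F))) \<Psi>" "\<And>\<gamma>. pathin (subtopology U (- T)) \<gamma> ==> \<Psi> \<gamma> = strand T \<gamma>"
   by auto
  define B where "B = T - {s}"
  have s: "s \<in> T" "s \<in> topspace U" using insert.prems T by auto
  have B: "finite B" "B \<subseteq> topspace U" "insert s B = T" "s ~: B" using T s by (auto simp: B_def)
  moreover have "Suc (Suc (card B)) = n" unfolding B_def card_Suc_Diff1[OF T(1) s(1)] by (rule T(3))
  ultimately have B: "finite B" "B \<subseteq> topspace U" "insert s B = T" "s ~: B" "Suc (Suc (card B)) = n" by auto
  obtain i z where iz: "i < g" "z \<in> chart_dom g i" "p i z = s" using chart_cover' s by blast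
  have "z \<in> {z \<in> chart_dom g i. p i z ~: B}" using iz B by simp
  from chart_ball[OF iz(1,2) open_chart_avoiding[OF iz(1) B(1)] this]
  obtain e where e: "e > 0" "ball z e \<subseteq> chart_dom g i" "ball z e \<subseteq> {z \<in> chart_dom g i. p i z ~: B}" "inj_on (p i) (ball z e)"
   "openin U (p i ` ball z e)" "p i z \<in> p i ` ball z e" .
  let ?N = "p i ` ball z e" and ?A = "topspace U - (T - F)" and ?X = "subtopology U (- (T - insert s F))"
  have NB: "?N \<inter> B = {}" using e(3) by blast
  let ?P = "{w. 0 < norm (w - z) & norm (w - z) < e}"
  have P: "?P \<subseteq> ball z e" by (auto simp: dist_norm norm_minus_commute)
  have NP: "p i w ~: T" if "w \<in> ?P" for w
  proof -
   have "p i w ~= p i z" using inj_onD[OF e(4), of w z] that P e(1) by auto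
   then show ?thesis using that P NB iz(3) B(3) by blast
  qed
  have cP: "continuous_map (top_of_set ?P) (subtopology U (- T)) (p i)"
   using continuous_map_from_subtopology_mono[OF chart_cont[OF iz(1)] order_trans[OF P e(2)]] NP by (auto simp: continuous_map_in_subtopology)
  have circ: "strand T (p i o (\<lambda>t. z + complex_of_real (e/2) * cis (2 * pi * t))) = 0"
   using strand_circle[OF iz(1) e(2,4) NB e(1) B(1,2,5)] iz(3) B(3) by (simp add: o_def)
  have "path_functional (top_of_set ?P) (\<lambda>u. strand T (p i o u))" by (rule pf_compose[OF strand_functional[OF T] cP])
  from potential_annulus[OF order.refl _ _ HOL.refl this circ] e(1)
  obtain h where h: "potential (top_of_set ?P) (\<lambda>u. strand T (p i o u)) h" by (metis field_sum_of_halves less_add_same_cancel1 half_gt_zero)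
  have "potential (subtopology ?X (?A \<inter> ?N)) \<Psi> (\<lambda>x. h (inv_into (ball z e) (p i) x))" unfolding potential_def
  proof (intro allI impI)
   fix q assume "pathin (subtopology ?X (?A \<inter> ?N)) q"
   then have q: "pathin U q" "\<And>t. t \<in> {0..1} ==> q t \<in> ?A \<inter> ?N" by (auto simp: pathin_subtopology)
   have qT: "q t \<in> - T" if "t \<in> {0..1}" for t
   proof -
    have "q t \<in> ?N" "q t ~: T - F" using q(2)[OF that] by auto
    moreover have "s \<in> T - F" using insert.hyps s by blast
    ultimately show ?thesis using NB B(3) by blast
   qed
   let ?u = "inv_into (ball z e) (p i) o q"
   have qN: "pathin (subtopology U ?N) q" using q by (auto simp: pathin_subtopology)
   have u: "pathin (top_of_set (ball z e)) ?u" by (rule pathin_compose[OF qN chart_section[OF iz(1) _ e(2,4)]]) simp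
   have pu: "p i (?u t) = q t" if "t \<in> {0..1}" for t using q(2)[OF that] by (simp add: f_inv_into_f)
   have "?u t ~= z" if "t \<in> {0..1}" for t using pu[OF that] qT[OF that] iz(3) s by auto
   then have uP: "pathin (top_of_set ?P) ?u" using u unfolding pathin_top_of_set path_image_def by (auto simp: dist_norm norm_minus_commute subset_iff)
   have "\<Psi> q = strand T q" using q qT by (intro \<Psi>(2)) (auto simp: pathin_subtopology)
   also have "\<dots> = strand T (p i o ?u)" by (rule pf_cong[OF strand_functional[OF T]]) (use q qT pu in "auto simp: pathin_subtopology")
   also have "\<dots> = - h (?u 0) + h (?u 1)" using h uP unfolding potential_def by blast
   finally show "\<Psi> q = - h (inv_into (ball z e) (p i) (q 0)) + h (inv_into (ball z e) (p i) (q 1))" by simp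
  qed
  moreover have XA: "subtopology ?X ?A = subtopology U (- (T - F))"
  proof -
   have "subtopology ?X ?A = subtopology U ((- (T - F)) \<inter> topspace U)" unfolding subtopology_subtopology by (rule arg_cong[where f="subtopology U"]) auto
   then show ?thesis by (metis subtopology_restrict Int_commute)
  qed
  moreover have "openin ?X ?A"
  proof -
   have "closedin U (T - F)" by (rule closedin_Hausdorff_finite[OF Hausdorff]) (use T in auto)
   then have "openin U ?A" by blast
   moreover have "?A = ?A \<inter> - (T - insert s F)" by auto
   ultimately show ?thesis unfolding openin_subtopology by blast
  qed
  moreover have "openin ?X ?N"
  proof -
   have "?N = ?N \<inter> - (T - insert s F)" using NB B(3) by blast
   then show ?thesis unfolding openin_subtopology using e(5) by blast
  qed
  moreover have "topspace ?X \<subseteq> ?A \<union> ?N" using iz(3) e(6) by auto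
  ultimately obtain \<Omega> where "path_functional ?X \<Omega>" "\<And>\<gamma>. pathin (subtopology ?X ?A) \<gamma> ==> \<Omega> \<gamma> = \<Psi> \<gamma>"
   using path_functional_extend[of ?X ?A ?N \<Psi>] \<Psi>(1) unfolding XA by metis
  moreover have "\<Omega> \<gamma> = strand T \<gamma>" if \<gamma>: "pathin (subtopology U (- T)) \<gamma>" for \<gamma>
  proof -
   have "pathin (subtopology U (- (T - F))) \<gamma>" using \<gamma> by (auto simp: pathin_subtopology)
   then show ?thesis using calculation(2) \<Psi>(2)[OF \<gamma>] unfolding XA by simp
  qed
  ultimately show ?case by blast
 qed
 from this[of T] obtain \<Psi> where "path_functional U \<Psi>" "\<And>\<gamma>. pathin (subtopology U (- T)) \<gamma> ==> \<Psi> \<gamma> = strand T \<gamma>"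
  by auto
 then show ?thesis by (rule that)
qed

end

text \<open>Strands on disjoint tracks can be moved independently, so the two orders of moving bound
  a square of configurations.\<close>

lemma two_strand_square: fixes \<Phi> :: "(real => (nat => 'a) set) => 'g::group_add" assumes \<Phi>: "path_functional (unordered_config n X) \<Phi>"
  and B: "finite B" "B \<subseteq> topspace X" "Suc (Suc (card B)) = n"
  and \<gamma>: "pathin (subtopology X (- B)) \<gamma>" and \<delta>: "pathin (subtopology X (- B)) \<delta>"
  and disj: "\<gamma> ` {0..1} \<inter> \<delta> ` {0..1} = {}"
 shows "\<Phi> (\<lambda>t. cfg n (insert (\<delta> t) (insert (\<gamma> 0) B))) + \<Phi> (\<lambda>t. cfg n (insert (\<gamma> t) (insert (\<delta> 1) B))) =
  \<Phi> (\<lambda>t. cfg n (insert (\<gamma> t) (insert (\<delta> 0) B))) + \<Phi> (\<lambda>t. cfg n (insert (\<delta> t) (insert (\<gamma> 1) B)))"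
proof -
 let ?Q = "top_of_set ({0..1::real} \<times> {0..1::real})"
 have "continuous_map ?Q (unordered_config n X) (\<lambda>v. cfg n (insert (\<gamma> (fst v)) (insert (\<delta> (snd v)) B)))"
 proof (rule continuous_map_two_strands[OF B])
  have 1: "continuous_map ?Q (top_of_set {0..1}) fst" and 2: "continuous_map ?Q (top_of_set {0..1}) snd"
   by (auto simp: continuous_map_in_subtopology intro!: continuous_intros)
  have 3: "continuous_map (top_of_set {0..1}) X \<gamma>" and 4: "continuous_map (top_of_set {0..1}) X \<delta>"
   using \<gamma> \<delta> unfolding pathin_subtopology by (auto simp: pathin_def)
  show "continuous_map ?Q X (\<lambda>v. \<gamma> (fst v))" using continuous_map_compose[OF 1 3] by (simp add: o_def)
  show "continuous_map ?Q X (\<lambda>v. \<delta> (snd v))" using continuous_map_compose[OF 2 4] by (simp add: o_def)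
  fix v assume "v \<in> topspace ?Q"
  then have v: "fst v \<in> {0..1}" "snd v \<in> {0..1}" by auto
  then have "\<gamma> (fst v) \<in> \<gamma> ` {0..1}" "\<delta> (snd v) \<in> \<delta> ` {0..1}" by blast+
  moreover have "\<gamma> (fst v) ~: B" "\<delta> (snd v) ~: B" using \<gamma> \<delta> v unfolding pathin_subtopology by auto
  ultimately show "\<gamma> (fst v) ~= \<delta> (snd v) & \<gamma> (fst v) ~: B & \<delta> (snd v) ~: B" using disj by (metis disjoint_iff)
 qed
 from path_functional_square[OF \<Phi> this] show ?thesis by (simp add: insert_commute)
qed

lemma image_update: assumes "k \<in> A" shows "c ` A = insert (c k) (c ` (A - {k}))" "c(k := v) ` A = insert v (c ` (A - {k}))" using assms by auto

context config_functional
begin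

lemma strand_square: assumes "finite B" "B \<subseteq> topspace U" "Suc (Suc (card B)) = n"
  and "pathin (subtopology U (- B)) \<gamma>" "pathin (subtopology U (- B)) \<delta>" "\<gamma> ` {0..1} \<inter> \<delta> ` {0..1} = {}"
 shows "strand (insert (\<gamma> 0) B) \<delta> + strand (insert (\<delta> 1) B) \<gamma> = strand (insert (\<delta> 0) B) \<gamma> + strand (insert (\<gamma> 1) B) \<delta>"
 unfolding strand_def by (rule two_strand_square[OF \<zeta> assms])

definition rest :: "'a set => bool" where "rest T \<longleftrightarrow> finite T & T \<subseteq> topspace U & Suc (card T) = n"

definition extension :: "'a set => (real => 'a) => 'g" where
 "extension T = (SOME \<Psi>. path_functional U \<Psi> & (ALL \<gamma>. pathin (subtopology U (- T)) \<gamma> --> \<Psi> \<gamma> = strand T \<gamma>))"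

text \<open>Taken from the extended functional, since the diameter itself may run into points of
  \<open>T\<close>. By \<open>core_path\<close>, strands through the crosscap that avoid
  \<open>T\<close> have this value.\<close>

definition core :: "'a set => nat => 'g" where "core T r = extension T (crosscap r)"

lemma extension: assumes "rest T" shows "path_functional U (extension T)" "pathin (subtopology U (- T)) \<gamma> ==> extension T \<gamma> = strand T \<gamma>"
proof -
 have "EX \<Psi>. path_functional U \<Psi> & (ALL \<gamma>. pathin (subtopology U (- T)) \<gamma> --> \<Psi> \<gamma> = strand T \<gamma>)"
  using strand_extend[of T] assms unfolding rest_def by metis
 from someI_ex[OF this]
 show "path_functional U (extension T)" "pathin (subtopology U (- T)) \<gamma> ==> extension T \<gamma> = strand T \<gamma>" unfolding extension_def by blast+
qed

lemma core_path: assumes T: "rest T" and r: "r < g" and u: "pathin (top_of_set strip) u" "u 0 = - z" "u 1 = z" "norm z = 1" "\<bar>Re z\<bar> < 1/3" "Im z > 0"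
  and "pathin (subtopology U (- T)) (p r o u)" shows "strand T (p r o u) = core T r"
 using crosscap_value[OF extension(1)[OF T] r u(4-6) u(1-3)] extension(2)[OF T assms(9)] by (simp add: core_def)

text \<open>One point at rest is moved from \<open>s\<close> to \<open>s'\<close>. Near each of its
  positions a closed crosscap strand is chosen off that position, and the square of independent
  motions compares the values before and after. The other two sides of the square agree because the
  strand is closed.\<close>

lemma core_exchange: assumes r: "r < g" and B: "finite B" "B \<subseteq> topspace U" "Suc (Suc (card B)) = n"
  and s: "s \<in> topspace U" "s ~: B" and s': "s' \<in> topspace U" "s' ~: B" shows "core (insert s B) r = core (insert s' B) r"
proof -
 let ?X = "subtopology U (- B)"
 have rest: "rest (insert x B)" if "x \<in> topspace U" "x ~: B" for x using that B by (simp add: rest_def)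
 obtain q where q: "pathin ?X q" "q 0 = s" "q 1 = s'" using path_in_complement[OF B(1), of s s'] s s' by blast
 have "core (insert (q 0) B) r = core (insert (q 1) B) r"
 proof (rule path_local_induct[OF _ _ _ q(1), where Q = "\<lambda>q. core (insert (q 0) B) r = core (insert (q 1) B) r"])
  fix x assume "x \<in> topspace ?X"
  then have x: "x \<in> topspace U" "x ~: B" by auto
  have "finite (insert x B)" using B by simp
  from crosscap_path_avoiding[OF r this]
  obtain u z where u: "pathin (top_of_set strip) u" "u 0 = - z" "u 1 = z" "norm z = 1" "\<bar>Re z\<bar> < 1/3" "Im z > 0"
   "pathin (subtopology U (- insert x B)) (p r o u)" "p r (u 0) = p r (u 1)" .
  define \<gamma> where "\<gamma> = p r o u"
  have \<gamma>: "pathin U \<gamma>" "\<And>t. t \<in> {0..1} ==> \<gamma> t ~= x & \<gamma> t ~: B"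
   using u(7) unfolding \<gamma>_def[symmetric] pathin_subtopology by auto
  \<comment> \<open>The positions of the resting point for which this particular strand remains
    usable.\<close>
  let ?V = "topspace U - (\<gamma> ` {0..1} \<union> B)"
  have "?V = ?V \<inter> - B" by blast
  then have "openin ?X ?V" unfolding openin_subtopology using openin_complement_path[OF \<gamma>(1) B(1,2)] by blast
  moreover have "x \<in> ?V" using x \<gamma>(2) by force
  moreover have "core (insert (\<delta> 0) B) r = core (insert (\<delta> 1) B) r" if \<delta>: "pathin (subtopology ?X ?V) \<delta>" for \<delta>
  proof -
   have \<delta>B: "pathin (subtopology U (- B)) \<delta>" using \<delta> by (simp add: pathin_subtopology)
   have \<delta>V: "\<delta> t \<in> ?V" if "t \<in> {0..1}" for t using \<delta> that by (auto simp: pathin_subtopology)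
   have \<gamma>B: "pathin (subtopology U (- B)) \<gamma>" using \<gamma> by (auto simp: pathin_subtopology)
   have "\<gamma> ` {0..1} \<inter> \<delta> ` {0..1} = {}"
   proof (rule equals0I)
    fix y assume "y \<in> \<gamma> ` {0..1} \<inter> \<delta> ` {0..1}"
    then obtain t where "t \<in> {0..1}" "y = \<delta> t" "y \<in> \<gamma> ` {0..1}" by blast
    then show False using \<delta>V[of t] by simp
   qed
   from strand_square[OF B \<gamma>B \<delta>B this]
   have 1: "strand (insert (\<gamma> 0) B) \<delta> + strand (insert (\<delta> 1) B) \<gamma> = strand (insert (\<delta> 0) B) \<gamma> + strand (insert (\<gamma> 1) B) \<delta>" .
   have 2: "strand (insert (\<delta> t) B) \<gamma> = core (insert (\<delta> t) B) r" if t: "t \<in> {0..1}" for t unfolding \<gamma>_def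
   proof (rule core_path[OF rest r u(1-6)])
    show "\<delta> t \<in> topspace U" "\<delta> t ~: B" using \<delta>V[OF t] by auto
    have "\<gamma> x ~= \<delta> t" if "x \<in> {0..1}" for x using \<delta>V[OF t] imageI[OF that, of \<gamma>] by auto
    then show "pathin (subtopology U (- insert (\<delta> t) B)) (p r o u)" using \<gamma> unfolding \<gamma>_def[symmetric] pathin_subtopology by auto
   qed
   have 3: "\<gamma> 0 = \<gamma> 1" using u(8) by (simp add: \<gamma>_def)
   show ?thesis using 1 2[of 0] 2[of 1] unfolding 3 by (simp add: add.commute)
  qed
  ultimately show "EX V. openin ?X V & x \<in> V & (ALL \<delta>. pathin (subtopology ?X V) \<delta> -->
   core (insert (\<delta> 0) B) r = core (insert (\<delta> 1) B) r)" by blast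
 next
  fix u v :: "real => 'a" assume "path_homotopic ?X u v" "core (insert (u 0) B) r = core (insert (u 1) B) r"
  then show "core (insert (v 0) B) r = core (insert (v 1) B) r" using path_homotopic_ends by metis
 qed auto
 then show ?thesis using q by simp
qed

text \<open>Exchanging one point at a time leads from any set at rest to any other.\<close>

lemma core_independent: assumes r: "r < g" and T: "rest T" "rest T'" shows "core T r = core T' r"
proof -
 define m where "m = card T"
 have m: "card T' = m" "Suc m = n" using T by (auto simp: rest_def m_def)
 obtain c where c: "c \<in> topspace (ordered_config m U)" "c ` {..<m} = T" using ordered_config_enum[of T U m] T by (auto simp: rest_def m_def)
 obtain d where d: "d \<in> topspace (ordered_config m U)" "d ` {..<m} = T'" using ordered_config_enum[of T' U m] T m by (auto simp: rest_def)
 have "core (c ` {..<m}) r = core (d ` {..<m}) r"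
 proof (rule tuple_moves[OF infinite_topspace, where R = "\<lambda>c d. core (c ` {..<m}) r = core (d ` {..<m}) r"])
  fix c k v
  assume c: "c \<in> {..<m} \<rightarrow>\<^sub>E topspace U" "inj_on c {..<m}" and k: "k < m" and v: "v \<in> topspace U" "v ~: c ` {..<m}"
  have k': "k \<in> {..<m}" using k by simp
  have inj: "inj_on c ({..<m} - {k})" using c(2) by (rule inj_on_subset) blast
  show "core (c ` {..<m}) r = core (c(k := v) ` {..<m}) r" unfolding image_update[OF k', of c]
  proof (rule core_exchange[OF r])
   show "Suc (Suc (card (c ` ({..<m} - {k})))) = n" using k m(2) inj by (simp add: card_image)
   show "c ` ({..<m} - {k}) \<subseteq> topspace U" "c k \<in> topspace U" using c(1) k by auto
   show "c k ~: c ` ({..<m} - {k})" using c(2) k by (auto simp: inj_on_def)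
   show "v \<in> topspace U" "v ~: c ` ({..<m} - {k})" using v by auto
  qed simp
 qed (use c d in "auto simp: topspace_ordered_config")
 then show ?thesis using c d by simp
qed

end

section \<open>Functionals that vanish on all crosscap strands\<close>

locale coreless_functional = config_functional + assumes core: "rest T ==> r < g ==> core T r = 0"
begin

definition pot :: "'a set => 'a => 'b" where "pot T = (SOME f. potential (subtopology U (- T)) (strand T) f)"

lemma pot: assumes T: "rest T" and \<gamma>: "pathin (subtopology U (- T)) \<gamma>" shows "strand T \<gamma> = pot T (\<gamma> 1) - pot T (\<gamma> 0)"
proof -
 obtain f where f: "potential U (extension T) f" using surface_potential[OF extension(1)[OF T] two] core[OF T] unfolding core_def by metis
 have "potential (subtopology U (- T)) (strand T) f" unfolding potential_def
 proof (intro allI impI)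
  fix q assume q: "pathin (subtopology U (- T)) q"
  then have "pathin U q" by (simp add: pathin_subtopology)
  then show "strand T q = - f (q 0) + f (q 1)" using f extension(2)[OF T q] unfolding potential_def by metis
 qed
 then have "EX f. potential (subtopology U (- T)) (strand T) f" by blast
 from someI_ex[OF this] have "potential (subtopology U (- T)) (strand T) (pot T)" unfolding pot_def .
 then show ?thesis using \<gamma> by (simp add: potential_def)
qed

text \<open>The value of moving a strand from \<open>x\<close> to \<open>y\<close> while
  \<open>T\<close> rests. It does not depend on the track, and the choice of the potential cancels
  in the difference.\<close>

definition D :: "'a set => 'a => 'a => 'b" where "D T x y = pot T y - pot T x"

text \<open>For disjoint tracks this is the square of independent motions. With one track fixed in
  advance, a track of the second point may be forced to meet it; so the failure of the equation is
  shown to be locally constant in \<open>t\<close>, with the first track chosen anew near each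
  position.\<close>

lemma D_exchange: assumes B: "finite B" "B \<subseteq> topspace U" "Suc (Suc (card B)) = n"
  and xz: "x \<in> topspace U - B" "z \<in> topspace U - B" and t: "t \<in> topspace U - B" "t' \<in> topspace U - B"
  and ne: "x ~= t" "x ~= t'" "z ~= t" "z ~= t'" shows "D (insert t B) x z + D (insert z B) t t' = D (insert x B) t t' + D (insert t' B) x z"
proof -
 let ?F = "insert x (insert z B)"
 let ?X = "subtopology U (- ?F)"
 \<comment> \<open>The terms of the equation that involve \<open>t\<close>. The corresponding terms
   for \<open>t'\<close> are \<open>k t'\<close>, so the claim is \<open>k t = k t'\<close>.\<close>
 define k where "k t = pot (insert t B) z - pot (insert t B) x - pot (insert z B) t + pot (insert x B) t" for t
 have rest: "rest (insert x B)" if "x \<in> topspace U" "x ~: B" for x using that B by (simp add: rest_def)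
 have "finite ?F" using B by simp
 from path_in_complement[OF this, of t t'] t ne
 obtain q where q: "pathin ?X q" "q 0 = t" "q 1 = t'" by blast
 have "k (q 0) = k (q 1)"
 proof (rule path_local_induct[OF _ _ _ q(1), where Q = "\<lambda>q. k (q 0) = k (q 1)"])
  fix y assume "y \<in> topspace ?X"
  then have y: "y \<in> topspace U" "y ~: B" "y ~= x" "y ~= z" by auto
  have "finite (insert y B)" using B by simp
  from path_in_complement[OF this, of x z] xz y
  obtain \<gamma> where \<gamma>: "pathin (subtopology U (- insert y B)) \<gamma>" "\<gamma> 0 = x" "\<gamma> 1 = z" by blast
  have \<gamma>U: "pathin U \<gamma>" "\<And>t. t \<in> {0..1} ==> \<gamma> t ~= y & \<gamma> t ~: B" using \<gamma>(1) unfolding pathin_subtopology by auto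
  let ?V = "topspace U - (\<gamma> ` {0..1} \<union> B)"
  have "x \<in> \<gamma> ` {0..1}" "z \<in> \<gamma> ` {0..1}" unfolding \<gamma>(2,3)[symmetric] by simp_all
  then have "?V = ?V \<inter> - ?F" by blast
  then have "openin ?X ?V" unfolding openin_subtopology using openin_complement_path[OF \<gamma>U(1) B(1,2)] by blast
  moreover have "y \<in> ?V" using y \<gamma>U(2) by force
  moreover have "k (\<delta> 0) = k (\<delta> 1)" if \<delta>: "pathin (subtopology ?X ?V) \<delta>" for \<delta>
  proof -
   have \<delta>V: "\<delta> t \<in> ?V" "\<delta> t ~= x" "\<delta> t ~= z" if "t \<in> {0..1}" for t using \<delta> that by (auto simp: pathin_subtopology)
   have \<delta>B: "pathin (subtopology U (- B)) \<delta>" "pathin (subtopology U (- insert x B)) \<delta>" "pathin (subtopology U (- insert z B)) \<delta>"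
    using \<delta> by (auto simp: pathin_subtopology)
   have \<gamma>B: "pathin (subtopology U (- B)) \<gamma>" using \<gamma>U by (auto simp: pathin_subtopology)
   have \<gamma>\<delta>: "strand (insert (\<delta> t) B) \<gamma> = pot (insert (\<delta> t) B) z - pot (insert (\<delta> t) B) x" if t: "t \<in> {0..1}" for t
   proof -
    have "\<gamma> x ~= \<delta> t" if "x \<in> {0..1}" for x using \<delta>V(1)[OF t] imageI[OF that, of \<gamma>] by auto
    then have "pathin (subtopology U (- insert (\<delta> t) B)) \<gamma>" using \<gamma>U unfolding pathin_subtopology by auto
    from pot[OF _ this] show ?thesis using rest[of "\<delta> t"] \<delta>V(1)[OF t] by (simp add: \<gamma>(2,3))
   qed
   have "\<gamma> ` {0..1} \<inter> \<delta> ` {0..1} = {}"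
   proof (rule equals0I)
    fix y assume "y \<in> \<gamma> ` {0..1} \<inter> \<delta> ` {0..1}"
    then obtain t where "t \<in> {0..1}" "y = \<delta> t" "y \<in> \<gamma> ` {0..1}" by blast
    then show False using \<delta>V[of t] by simp
   qed
   from strand_square[OF B \<gamma>B \<delta>B(1) this]
   have "strand (insert x B) \<delta> + strand (insert (\<delta> 1) B) \<gamma> = strand (insert (\<delta> 0) B) \<gamma> + strand (insert z B) \<delta>"
    unfolding \<gamma>(2,3) .
   moreover have "strand (insert x B) \<delta> = pot (insert x B) (\<delta> 1) - pot (insert x B) (\<delta> 0)"
    "strand (insert z B) \<delta> = pot (insert z B) (\<delta> 1) - pot (insert z B) (\<delta> 0)"
    using pot[OF _ \<delta>B(2)] pot[OF _ \<delta>B(3)] rest xz by auto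
   ultimately have "pot (insert x B) (\<delta> 1) - pot (insert x B) (\<delta> 0) + (pot (insert (\<delta> 1) B) z - pot (insert (\<delta> 1) B) x)
    = pot (insert (\<delta> 0) B) z - pot (insert (\<delta> 0) B) x + (pot (insert z B) (\<delta> 1) - pot (insert z B) (\<delta> 0))" (is "?L = ?R")
    using \<gamma>\<delta>[of 0] \<gamma>\<delta>[of 1] by simp
   moreover have "k (\<delta> 1) - k (\<delta> 0) = ?L - ?R" by (simp add: k_def algebra_simps)
   ultimately show ?thesis by (metis right_minus_eq)
  qed
  ultimately show "EX V. openin ?X V & y \<in> V & (ALL \<delta>. pathin (subtopology ?X V) \<delta> --> k (\<delta> 0) = k (\<delta> 1))" by blast
 next
  fix u v :: "real => 'a" assume "path_homotopic ?X u v" "k (u 0) = k (u 1)"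
  then show "k (v 0) = k (v 1)" using path_homotopic_ends by metis
 qed auto
 then have "k t = k t'" using q by simp
 moreover have "(D (insert t B) x z + D (insert z B) t t') - (D (insert x B) t t' + D (insert t' B) x z) = k t - k t'" by (simp add: D_def k_def algebra_simps)
 ultimately show ?thesis by simp
qed

text \<open>The sum over a triangle of the Johnson graph. From \<open>x\<close> and \<open>y\<close>
  occupied, \<open>x\<close> moves to \<open>z\<close>, then \<open>y\<close> to \<open>x\<close>,
  then \<open>z\<close> to \<open>y\<close>; the same two places are occupied again, with the
  strands exchanged.\<close>

definition G :: "'a set => 'a => 'a => 'a => 'b" where "G T x y z = D (insert y T) x z + D (insert z T) y x + D (insert x T) z y"

lemma G_cyclic: "G T x y z = G T z x y" by (simp add: G_def algebra_simps)

lemma G_move: assumes T: "finite T" "T \<subseteq> topspace U" "Suc (Suc (card T)) = n"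
  and xyz: "{x, y, z, x'} \<subseteq> topspace U - T" "x ~= y" "x ~= z" "x' ~= y" "x' ~= z" shows "G T x y z = G T x' y z"
proof -
 have "D (insert x T) z y + D (insert y T) x x' = D (insert z T) x x' + D (insert x' T) z y" by (rule D_exchange[OF T]) (use xyz in auto)
 moreover have "G T x y z - G T x' y z = (D (insert x T) z y + D (insert y T) x x') - (D (insert z T) x x' + D (insert x' T) z y)"
  by (simp add: G_def D_def algebra_simps)
 ultimately show ?thesis by simp
qed

text \<open>By \<open>D_exchange\<close> each of the three terms changes by a difference of moves of
  the resting point. In the total every such move occurs twice with opposite signs.\<close>

lemma G_move_rest: assumes B: "finite B" "B \<subseteq> topspace U" "Suc (Suc (Suc (card B))) = n"
  and xyz: "{x, y, z, t, t'} \<subseteq> topspace U - B" "x ~= y" "x ~= z" "y ~= z" "t ~: {x, y, z}" "t' ~: {x, y, z}"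
 shows "G (insert t B) x y z = G (insert t' B) x y z"
proof -
 have sub: "a + b = c + d ==> a - d = c - b" for a b c d :: 'b by (simp add: algebra_simps)
 have e: "D (insert t (insert w B)) u v - D (insert t' (insert w B)) u v =
   D (insert u (insert w B)) t t' - D (insert v (insert w B)) t t'" if "u ~= w" "v ~= w" "u \<in> {x, y, z}" "v \<in> {x, y, z}" "w \<in> {x, y, z}" for u v w
  by (rule sub, rule D_exchange) (use that B xyz in auto)
 have "G (insert t B) x y z - G (insert t' B) x y z =
   (D (insert t (insert y B)) x z - D (insert t' (insert y B)) x z) +
   (D (insert t (insert z B)) y x - D (insert t' (insert z B)) y x) +
   (D (insert t (insert x B)) z y - D (insert t' (insert x B)) z y)" by (simp add: G_def insert_commute[of _ t] insert_commute[of _ t'] algebra_simps)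
 also have "\<dots> = (D (insert x (insert y B)) t t' - D (insert z (insert y B)) t t') +
   (D (insert y (insert z B)) t t' - D (insert x (insert z B)) t t') +
   (D (insert z (insert x B)) t t' - D (insert y (insert x B)) t t')" using e[of x y z] e[of y z x] e[of z x y] xyz by auto
 also have "\<dots> = 0" by (simp add: insert_commute[of y x] insert_commute[of z x] insert_commute[of z y] algebra_simps)
 finally show ?thesis by simp
qed

text \<open>\<open>G\<close> does not change when any one of the \<open>n + 1\<close> points
  involved is moved, so it is constant. The coordinates 0, 1, 2 hold the triangle and those from 3
  on the points at rest.\<close>

lemma G_tuple: assumes n: "n >= 2" and c: "c \<in> {..<Suc n} \<rightarrow>\<^sub>E topspace U" "inj_on c {..<Suc n}"
  and d: "d \<in> {..<Suc n} \<rightarrow>\<^sub>E topspace U" "inj_on d {..<Suc n}"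
 shows "G (c ` {3..<Suc n}) (c 0) (c 1) (c 2) = G (d ` {3..<Suc n}) (d 0) (d 1) (d 2)"
proof (rule tuple_moves[OF infinite_topspace _ _ _ c d,
   where R = "\<lambda>c d. G (c ` {3..<Suc n}) (c 0) (c 1) (c 2) = G (d ` {3..<Suc n}) (d 0) (d 1) (d 2)"])
 fix c k v
 assume c: "c \<in> {..<Suc n} \<rightarrow>\<^sub>E topspace U" "inj_on c {..<Suc n}" and k: "k < Suc n" and v: "v \<in> topspace U" "v ~: c ` {..<Suc n}"
 let ?T = "c ` {3..<Suc n}"
 have cU: "c i \<in> topspace U" if "i < Suc n" for i using c(1) that by auto
 have ne: "c i ~= c j" if "i < Suc n" "j < Suc n" "i ~= j" for i j using c(2) that by (auto simp: inj_on_def)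
 have nv: "c i ~= v" if "i < Suc n" for i using v(2) that by auto
 have n3: "0 < Suc n" "1 < Suc n" "2 < Suc n" using n by auto
 have ck: "card (c ` A) = card A" if "A \<subseteq> {..<Suc n}" for A using that c(2) by (meson card_image inj_on_subset)
 have T: "finite ?T" "?T \<subseteq> topspace U" "Suc (Suc (card ?T)) = n" using cU n ck[of "{3..<Suc n}"] by (auto simp: subset_iff)
 have cT: "c i ~: ?T" if "i < 3" for i
 proof
  assume "c i \<in> ?T"
  then obtain j where "j \<in> {3..<Suc n}" "c i = c j" by blast
  then show False using ne[of i j] that n by auto
 qed
 have vT: "v ~: ?T" using v(2) by auto
 have up: "c(k := v) ` {3..<Suc n} = ?T" if "k < 3" using that by auto
 consider "k = 0" | "k = 1" | "k = 2" | "3 <= k" by linarith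
 then show "G (c ` {3..<Suc n}) (c 0) (c 1) (c 2) =
  G (c(k := v) ` {3..<Suc n}) ((c(k := v)) 0) ((c(k := v)) 1) ((c(k := v)) 2)"
 proof cases
  case 1
  have "G ?T (c 0) (c 1) (c 2) = G ?T v (c 1) (c 2)" by (rule G_move[OF T]) (use cU n3 v cT vT nv ne in auto)
  then show ?thesis using up 1 by simp
 next
  case 2
  have "G ?T (c 1) (c 2) (c 0) = G ?T v (c 2) (c 0)" by (rule G_move[OF T]) (use cU n3 v cT vT nv ne in auto)
  then show ?thesis using up 2 G_cyclic[of ?T "c 1" "c 2" "c 0"] G_cyclic[of ?T v "c 2" "c 0"] by simp
 next
  case 3
  have "G ?T (c 2) (c 0) (c 1) = G ?T v (c 0) (c 1)" by (rule G_move[OF T]) (use cU n3 v cT vT nv ne in auto)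
  then show ?thesis using up 3 G_cyclic[of ?T "c 0" "c 1" "c 2"] G_cyclic[of ?T "c 0" "c 1" v] by simp
 next
  case 4
  define B where "B = c ` ({3..<Suc n} - {k})"
  have kT: "k \<in> {3..<Suc n}" using 4 k by simp
  have "G (insert (c k) B) (c 0) (c 1) (c 2) = G (insert v B) (c 0) (c 1) (c 2)"
  proof (rule G_move_rest)
   show "finite B" "B \<subseteq> topspace U" using cU by (auto simp: B_def)
   have "card ({3..<Suc n} - {k}) = n - 3" using kT by (simp add: card_Diff_singleton)
   moreover have "card B = card ({3..<Suc n} - {k})" unfolding B_def by (rule ck) auto
   ultimately show "Suc (Suc (Suc (card B))) = n" using 4 k by simp
   have "c k ~: B" using c(2) k by (auto simp: B_def inj_on_def)
   moreover have "B \<subseteq> ?T" by (auto simp: B_def)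
   ultimately show "{c 0, c 1, c 2, c k, v} \<subseteq> topspace U - B" using cU[OF n3(1)] cU[OF n3(2)] cU[OF n3(3)] cU[OF k] v(1) cT[of 0] cT[of 1] cT[of 2] vT by auto
   show "c 0 ~= c 1" "c 0 ~= c 2" "c 1 ~= c 2" by (rule ne; use n3 in simp)+
   show "c k ~: {c 0, c 1, c 2}" using ne[OF k n3(1)] ne[OF k n3(2)] ne[OF k n3(3)] 4 by auto
   show "v ~: {c 0, c 1, c 2}" using nv[OF n3(1)] nv[OF n3(2)] nv[OF n3(3)] by auto
  qed
  then show ?thesis using image_update[OF kT, of c] 4 unfolding B_def by simp
 qed
qed auto

lemma G_constant: assumes n: "n >= 2"
  and T: "finite T" "T \<subseteq> topspace U" "Suc (Suc (card T)) = n" "{x, y, z} \<subseteq> topspace U - T" "x ~= y" "y ~= z" "x ~= z"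
  and T': "finite T'" "T' \<subseteq> topspace U" "Suc (Suc (card T')) = n" "{x', y', z'} \<subseteq> topspace U - T'" "x' ~= y'" "y' ~= z'" "x' ~= z'"
 shows "G T x y z = G T' x' y' z'"
proof -
 have ex: "EX c. c \<in> {..<Suc n} \<rightarrow>\<^sub>E topspace U & inj_on c {..<Suc n} & c 0 = x & c 1 = y & c 2 = z & c ` {3..<Suc n} = T"
  if T: "finite T" "T \<subseteq> topspace U" "Suc (Suc (card T)) = n" "{x, y, z} \<subseteq> topspace U - T" "x ~= y" "y ~= z" "x ~= z" for T x y z
 proof -
  obtain e where e: "bij_betw e {3..<Suc n} T"
   using T(1,3) by (metis card_atLeastLessThan diff_Suc_Suc diff_Suc_eq_diff_pred eval_nat_numeral(3) finite_atLeastLessThan finite_same_card_bij numeral_2_eq_2 diff_zero diff_Suc_1)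
  define c where "c k = (if k = 0 then x else if k = 1 then y else if k = 2 then z else if k < Suc n then e k else undefined)" for k
  have img: "c ` {3..<Suc n} = T" using e by (auto simp: c_def bij_betw_def)
  have eT: "e k \<in> T" if "3 <= k" "k < Suc n" for k using e that by (auto simp: bij_betw_def)
  have "c k \<in> topspace U" if "k < Suc n" for k
  proof (cases "3 <= k")
   case True then show ?thesis using eT[OF True that] T(2) that by (auto simp: c_def)
  next
   case False then show ?thesis using T(4) by (auto simp: c_def)
  qed
  moreover have "c k = undefined" if "\<not> k < Suc n" for k using that n by (simp add: c_def)
  ultimately have 1: "c \<in> {..<Suc n} \<rightarrow>\<^sub>E topspace U" by (auto simp: PiE_def extensional_def)
  have split: "{..<Suc n} = {0, 1, 2} \<union> {3..<Suc n}" using n by auto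
  have "inj_on c {3..<Suc n}" using e by (auto simp: c_def bij_betw_def inj_on_def)
  moreover have "inj_on c {0, 1, 2}" using T(5-7) by (auto simp: c_def inj_on_def)
  moreover have "c ` {0, 1, 2} \<inter> c ` {3..<Suc n} = {}" unfolding img using T(4) by (auto simp: c_def)
  ultimately have "inj_on c {..<Suc n}" unfolding split by (auto simp: inj_on_Un)
  then show ?thesis using 1 img by (intro exI[of _ c]) (simp add: c_def)
 qed
 obtain c where c: "c \<in> {..<Suc n} \<rightarrow>\<^sub>E topspace U" "inj_on c {..<Suc n}" "c 0 = x" "c 1 = y" "c 2 = z" "c ` {3..<Suc n} = T"
  using ex[OF T] by blast
 obtain d where d: "d \<in> {..<Suc n} \<rightarrow>\<^sub>E topspace U" "inj_on d {..<Suc n}" "d 0 = x'" "d 1 = y'" "d 2 = z'" "d ` {3..<Suc n} = T'"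
  using ex[OF T'] by blast
 show ?thesis using G_tuple[OF n c(1,2) d(1,2)] c(3-6) d(3-6) by (simp only:)
qed

text \<open>Vanishing on triangles makes the moves a coboundary on finite sets, and moves of single
  points determine the functional.\<close>

lemma exact_of_G: assumes n: "n >= 1"
  and G: "\<And>T x y z. finite T ==> T \<subseteq> topspace U ==> Suc (Suc (card T)) = n ==> {x, y, z} \<subseteq> topspace U - T ==>
   x ~= y ==> y ~= z ==> x ~= z ==> G T x y z = 0" obtains f where "potential (unordered_config n U) \<zeta> f"
proof -
 have "EX f. ALL S x y. finite S --> S \<subseteq> topspace U --> card S = n - 1 --> x \<in> topspace U - S --> y \<in> topspace U - S -->
   D S x y = f (insert y S) - f (insert x S)"
 proof (rule johnson_potential[OF infinite_topspace])
  show "D S x y + D S y z = D S x z" for S x y z by (simp add: D_def)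
  show "D (insert y T) x z + D (insert z T) y x + D (insert x T) z y = 0"
   if "finite T" "T \<subseteq> topspace U" "Suc (card T) = n - 1" "{x, y, z} \<subseteq> topspace U - T" "x ~= y" "y ~= z" "x ~= z" for T x y z
   using G[of T x y z] that by (simp add: G_def)
 qed
 then obtain f where f: "\<And>S x y. finite S ==> S \<subseteq> topspace U ==> card S = n - 1 ==> x \<in> topspace U - S ==> y \<in> topspace U - S ==>
   D S x y = f (insert y S) - f (insert x S)" by blast
 have "potential (unordered_config n U) \<zeta> (\<lambda>P. f (supp n P))"
 proof (rule potential_unordered_config[OF Hausdorff \<zeta>])
  fix T \<gamma> assume T: "finite T" "T \<subseteq> topspace U" "Suc (card T) = n" and \<gamma>: "pathin (subtopology U (- T)) \<gamma>"
  then have "rest T" by (simp add: rest_def)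
  from pot[OF this \<gamma>] have "\<zeta> (\<lambda>t. cfg n (insert (\<gamma> t) T)) = D T (\<gamma> 0) (\<gamma> 1)" by (simp add: D_def strand_def)
  moreover have "\<gamma> t \<in> topspace U - T" if "t \<in> {0..1}" for t
   using \<gamma> that path_start_in_topspace unfolding pathin_subtopology by (auto simp: pathin_def continuous_map_def)
  then have "D T (\<gamma> 0) (\<gamma> 1) = f (insert (\<gamma> 1) T) - f (insert (\<gamma> 0) T)" using T by (intro f) auto
  ultimately show "\<zeta> (\<lambda>t. cfg n (insert (\<gamma> t) T)) = - f (insert (\<gamma> 0) T) + f (insert (\<gamma> 1) T)" by simp
 qed
 then show ?thesis by (rule that)
qed

end

section \<open>The quaternion group and the half twist\<close>

text \<open>An extension of \<open>'r \<times> 'r\<close> by \<open>'r\<close>; over the field with two elements it is the quaternion group.\<close>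
datatype 'r q8 = Q8 (qs: 'r) (qa: 'r) (qb: 'r)

instantiation q8 :: (comm_ring) group_add
begin
definition "0 = Q8 0 0 0"
text \<open>The cocycle is bilinear. On the diagonal it is \<open>qa^2 + qa * qb + qb^2\<close>,
  which over the field of two elements vanishes only at zero; so there only central elements have
  square one.\<close>

definition "x + y = Q8 (qs x + qs y + (qb x * qa y + qa x * qa y + qb x * qb y)) (qa x + qa y) (qb x + qb y)" for x y :: "'a q8"
definition "- x = Q8 (qb x * qa x + qa x * qa x + qb x * qb x - qs x) (- qa x) (- qb x)" for x :: "'a q8"
definition "x - y = x + - y" for x y :: "'a q8"
instance by standard (simp_all add: zero_q8_def plus_q8_def uminus_q8_def minus_q8_def algebra_simps)
end

lemma q8_hom [simp]: "qa (x + y) = qa x + qa y" "qb (x + y) = qb x + qb y" "qa (0 :: 'r q8) = 0" "qb (0 :: 'r q8) = 0" for x y :: "'r::comm_ring q8"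
 by (simp_all add: plus_q8_def zero_q8_def)

lemma linear_combination_add: "a * (x + x') + b * (y + y') = (a * x + b * y) + (a * x' + b * y')" for a :: "'r::comm_ring" by (simp add: algebra_simps)

text \<open>The symmetric part of the cocycle drops out of the commutator, which leaves a
  determinant.\<close>

lemma q8_commute_iff: "x + y = y + x \<longleftrightarrow> qb x * qa y = qb y * qa x" for x y :: "'r::comm_ring q8" by (auto simp: plus_q8_def algebra_simps)

lemma q8_double_eq_0: fixes x :: "bit q8" assumes "x + x = 0" shows "qa x = 0" "qb x = 0"
 using assms by (cases "qa x"; cases "qb x"; simp add: plus_q8_def zero_q8_def)+

text \<open>For \<open>d\<close> of norm one, part of a thin rhombus with vertices at
  \<open>d\<close>, \<open>- d\<close> and at distance 1/3 to the sides. It is convex, contains the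
  diameter and meets the unit circle only at its two tips. Hence points of two such rhombi with
  different tips have the same image in the surface only if they coincide.\<close>

definition diamond :: "complex => complex set" where "diamond d = {x \<in> strip. \<bar>Re (x * cnj d)\<bar> + 3 * \<bar>Im (x * cnj d)\<bar> <= 1}"

text \<open>The Pythagorean triple 7, 24, 25 provides unit vectors with rational coordinates, and
  7/25 is less than 1/3.\<close>

definition dir1 :: complex where "dir1 = Complex (7/25) (24/25)"
definition dir2 :: complex where "dir2 = Complex (- 7/25) (24/25)"

lemma convex_diamond: "convex (diamond d)"
proof -
 let ?f = "\<lambda>x. \<bar>Re (x * cnj d)\<bar> + 3 * \<bar>Im (x * cnj d)\<bar>"
 have "convex {x. ?f x <= 1}"
 proof (rule convexI)
  fix x y :: complex and u v :: real
  assume xy: "x \<in> {x. ?f x <= 1}" "y \<in> {x. ?f x <= 1}" and uv: "0 <= u" "0 <= v" "u + v = 1"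
  have e: "Re ((u *\<^sub>R x + v *\<^sub>R y) * cnj d) = u * Re (x * cnj d) + v * Re (y * cnj d)"
   "Im ((u *\<^sub>R x + v *\<^sub>R y) * cnj d) = u * Im (x * cnj d) + v * Im (y * cnj d)" by (simp_all add: algebra_simps)
  have "\<bar>u * a + v * b\<bar> <= u * \<bar>a\<bar> + v * \<bar>b\<bar>" for a b :: real
   using abs_triangle_ineq[of "u * a" "v * b"] uv by (simp add: abs_mult)
  from this[of "Re (x * cnj d)" "Re (y * cnj d)"] this[of "Im (x * cnj d)" "Im (y * cnj d)"]
  have "?f (u *\<^sub>R x + v *\<^sub>R y) <= u * ?f x + v * ?f y" unfolding e by (simp add: algebra_simps)
  also have "\<dots> <= u * 1 + v * 1" using xy uv by (intro add_mono mult_left_mono) auto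
  finally show "u *\<^sub>R x + v *\<^sub>R y \<in> {x. ?f x <= 1}" using uv by simp
 qed
 moreover have "diamond d = strip \<inter> {x. ?f x <= 1}" by (auto simp: diamond_def)
 ultimately show ?thesis using strip_convex by (simp add: convex_Int)
qed

lemma diamond_norm: assumes "norm d = 1" "x \<in> diamond d" shows "norm x <= 1" "norm x = 1 ==> x = d \<or> x = - d" "x \<in> strip"
proof -
 let ?y = "x * cnj d"
 have y: "\<bar>Re ?y\<bar> + 3 * \<bar>Im ?y\<bar> <= 1" "x \<in> strip" using assms by (simp_all only: diamond_def mem_Collect_eq)
 have n: "norm ?y = norm x" using assms(1) by (simp add: norm_mult)
 show "norm x <= 1" using cmod_le[of ?y] y n by linarith
 show "x \<in> strip" by (rule y(2))
 have "cnj d * d = 1" using assms(1) complex_norm_square[of d] by (simp add: mult.commute)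
 then have x: "x = ?y * d" by (simp add: mult.assoc)
 assume "norm x = 1"
 then have "Im ?y = 0" "\<bar>Re ?y\<bar> = 1" using cmod_le[of ?y] y n by linarith+
 then have "?y = 1 \<or> ?y = - 1" by (auto simp: complex_eq_iff abs_if split: if_splits)
 then show "x = d \<or> x = - d"
 proof
  assume "?y = 1" then have "x = 1 * d" using x by (simp only:)
  then show ?thesis by simp
 next
  assume "?y = - 1" then have "x = - 1 * d" using x by (simp only:)
  then show ?thesis by simp
 qed
qed

lemma norm_dir: "norm dir1 = 1" "norm dir2 = 1" by (simp_all add: dir1_def dir2_def cmod_def power2_eq_square)

lemma diamond_points: "dir1 \<in> diamond dir1" "- dir1 \<in> diamond dir1" "dir2 \<in> diamond dir2" "- dir2 \<in> diamond dir2"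
 "Complex (7/50) 0 \<in> diamond dir1" "Complex (- 7/50) 0 \<in> diamond dir1" "Complex (7/50) 0 \<in> diamond dir2" "Complex (- 7/50) 0 \<in> diamond dir2"
 "Complex 0 (12/25) \<in> diamond dir1" "Complex 0 (- 12/25) \<in> diamond dir1" "Complex 0 (12/25) \<in> diamond dir2" "Complex 0 (- 12/25) \<in> diamond dir2"
 using norm_dir by (simp_all add: diamond_def strip_def) (simp_all add: dir1_def dir2_def cmod_def)

text \<open>Pairs of distinct points do not form a convex set, but those whose difference lies in a
  fixed open half plane do. Four half planes surround the diagonal.\<close>

definition region :: "complex => (complex \<times> complex) set" where "region e = {v \<in> diamond dir1 \<times> diamond dir2. 0 < Im ((fst v - snd v) * e)}"

lemma convex_region: "convex (region e)"
proof -
 have "convex {v :: complex \<times> complex. 0 < Im ((fst v - snd v) * e)}"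
 proof (rule convexI)
  fix x y :: "complex \<times> complex" and u v :: real
  assume xy: "x \<in> {v. 0 < Im ((fst v - snd v) * e)}" "y \<in> {v. 0 < Im ((fst v - snd v) * e)}" and uv: "0 <= u" "0 <= v" "u + v = 1"
  have e: "Im ((fst (u *\<^sub>R x + v *\<^sub>R y) - snd (u *\<^sub>R x + v *\<^sub>R y)) * e) =
    u * Im ((fst x - snd x) * e) + v * Im ((fst y - snd y) * e)" by (simp add: algebra_simps)
  have "0 < u \<or> 0 < v" using uv by linarith
  moreover have "0 <= u * Im ((fst x - snd x) * e)" "0 <= v * Im ((fst y - snd y) * e)" using xy uv by simp_all
  moreover have "0 < u ==> 0 < u * Im ((fst x - snd x) * e)" "0 < v ==> 0 < v * Im ((fst y - snd y) * e)" using xy by simp_all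
  ultimately show "u *\<^sub>R x + v *\<^sub>R y \<in> {v. 0 < Im ((fst v - snd v) * e)}" unfolding mem_Collect_eq e by linarith
 qed
 moreover have "region e = (diamond dir1 \<times> diamond dir2) \<inter> {v. 0 < Im ((fst v - snd v) * e)}" by (auto simp: region_def)
 ultimately show ?thesis by (simp add: convex_Int convex_Times convex_diamond)
qed

definition corner1 where "corner1 = (- dir1, - dir2)"
definition corner2 where "corner2 = (dir1, - dir2)"
definition corner3 where "corner3 = (dir1, dir2)"
definition corner4 where "corner4 = (- dir1, dir2)"
text \<open>Each centre is the pair with sum zero whose difference is half that of the corner of the
  same number. From one centre to the next the difference turns around the origin; after two steps
  the points have been exchanged.\<close>

definition centre1 where "centre1 = (Complex (- 7/50) 0, Complex (7/50) 0)"
definition centre2 where "centre2 = (Complex 0 (12/25), Complex 0 (- 12/25))"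
definition centre3 where "centre3 = (Complex (7/50) 0, Complex (- 7/50) 0)"
definition centre4 where "centre4 = (Complex 0 (- 12/25), Complex 0 (12/25))"
text \<open>Intermediate pairs of a tour around the triangle with vertices -7/50, 7/50 and
  \<open>12/25 * \<i>\<close>, in which only one point moves at a time.\<close>

definition mid1 where "mid1 = (Complex 0 (12/25), Complex (7/50) 0)"
definition mid2 where "mid2 = (Complex 0 (12/25), Complex (- 7/50) 0)"

lemmas points_defs = corner1_def corner2_def corner3_def corner4_def centre1_def centre2_def centre3_def centre4_def
 mid1_def mid2_def

lemma region_points:
 "{corner1, corner2, centre1, centre2, mid1} \<subseteq> region (cnj dir1)"
 "{corner2, corner3, centre2, centre3, mid2} \<subseteq> region (- cnj dir2)"
 "{corner3, corner4, centre3, centre4} \<subseteq> region (- cnj dir1)"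
 "{corner4, corner1, centre4, centre1} \<subseteq> region (cnj dir2)"
 "{centre2, mid1, mid2} \<subseteq> region 1" using diamond_points by (simp_all add: region_def points_defs) (simp_all add: dir1_def dir2_def)

context surface
begin

definition base :: "nat => 'a set => bool" where
 "base n T \<longleftrightarrow> finite T & T \<subseteq> topspace U & Suc (Suc (card T)) = n & (ALL r<g. p r ` (strip \<inter> cball 0 1) \<inter> T = {})"

text \<open>Copy 0 has no hole around -1/2. A small disc there leaves room for any number of points
  at rest, outside the vertical strip.\<close>

lemma exists_base: assumes "n >= 2" obtains T where "base n T"
proof -
 let ?b = "ball (- 1/2) (1/16) :: complex set"
 have nb: "norm (z + 1/2) < 1/16" if "z \<in> ?b" for z using that ball_half(2)[of z "1/16"] by simp
 have bd: "z \<in> chart_dom g 0" if "z \<in> ?b" for z using nb[OF that] norm_half_cases(2)[of z] norm_half_cases(6)[of z] unfolding chart_dom_def by auto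
 have g: "0 < g" using g_pos by simp
 have "inj_on (p 0) ?b"
 proof (rule inj_onI)
  fix z w assume zw: "z \<in> ?b" "w \<in> ?b" "p 0 z = p 0 w"
  have "dist z w < 2" using zw(1,2) dist_triangle2[of z w "- 1/2"] by (simp add: dist_commute)
  then show "z = w" using chart_inj[OF g bd bd] zw by blast
 qed
 moreover have "infinite ?b"
 proof
  assume "finite ?b"
  then have "?b = {}" using finite_imp_not_open[of ?b] open_ball by blast
  then show False by simp
 qed
 ultimately have "infinite (p 0 ` ?b)" using finite_imageD by blast
 then obtain T where T: "finite T" "card T = n - 2" "T \<subseteq> p 0 ` ?b" using infinite_arbitrarily_large by blast
 have "p r w ~= p 0 z" if r: "r < g" and w: "w \<in> strip" and z: "z \<in> ?b" for r w z
 proof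
  assume "p r w = p 0 z"
  then have "chart_rel g r w 0 z" using chart_eq[OF r g _ bd[OF z]] w strip_chart_dom by blast
  moreover have "z ~: outer_annulus" using nb[OF z] norm_half_cases(2)[of z] by (auto simp: outer_annulus_def)
  moreover have "z ~: right_annulus" using nb[OF z] norm_half_cases(6)[of z] by (auto simp: right_annulus_def)
  ultimately have "r = 0 & (w = z \<or> w \<in> outer_annulus & z = antipode w)" by (auto simp: chart_rel_def)
  then have "w = z" using \<open>z ~: outer_annulus\<close> antipode_outer by blast
  then have "\<bar>Re z\<bar> < 1/3" using w by (simp add: strip_def)
  moreover have "\<bar>Re z + 1/2\<bar> < 1/16" using nb[OF z] abs_Re_le_cmod[of "z + 1/2"] by simp
  ultimately show False by linarith
 qed
 then have "ALL r<g. p r ` (strip \<inter> cball 0 1) \<inter> T = {}" using T(3) by blast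
 moreover have "T \<subseteq> topspace U" using T(3) bd chart_topspace[OF g] by blast
 ultimately show ?thesis using T assms by (intro that[of T]) (simp add: base_def)
qed

lemma base_avoids: assumes "base n T" "r < g" "z \<in> strip" "norm z <= 1" shows "p r z ~: T"
proof -
 have "p r ` (strip \<inter> cball 0 1) \<inter> T = {}" using assms(1,2) by (simp add: base_def)
 moreover have "p r z \<in> p r ` (strip \<inter> cball 0 1)" using assms(3,4) by (intro imageI) simp
 ultimately show ?thesis by blast
qed

definition pair_cfg :: "nat => 'a set => complex \<times> complex => (nat => 'a) set" where
 "pair_cfg n T v = cfg n (insert (p 0 (fst v)) (insert (p 0 (snd v)) T))"

text \<open>On the closed disc a chart identifies only antipodal points of the circle. The two
  rhombi touch the circle in different antipodal pairs.\<close>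

lemma region_distinct: assumes T: "base n T" and v: "v \<in> region e"
 shows "p 0 (fst v) ~= p 0 (snd v)" "p 0 (fst v) ~: T" "p 0 (snd v) ~: T" "fst v \<in> strip" "snd v \<in> strip"
proof -
 have g: "0 < g" using g_pos by simp
 obtain x y where xy: "v = (x, y)" by (cases v)
 have x: "x \<in> diamond dir1" and y: "y \<in> diamond dir2" and ne: "x ~= y" using v by (auto simp: region_def xy)
 have nx: "norm x <= 1" "norm x = 1 ==> x = dir1 \<or> x = - dir1" "x \<in> strip" using diamond_norm[OF norm_dir(1) x] by auto
 have ny: "norm y <= 1" "norm y = 1 ==> y = dir2 \<or> y = - dir2" "y \<in> strip" using diamond_norm[OF norm_dir(2) y] by auto
 have d: "x \<in> chart_dom g 0" "y \<in> chart_dom g 0" using nx(3) ny(3) strip_chart_dom by blast+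
 show "p 0 (fst v) ~= p 0 (snd v)"
 proof
  assume "p 0 (fst v) = p 0 (snd v)"
  then have eq: "p 0 x = p 0 y" by (simp add: xy)
  have "norm x = 1"
  proof (rule ccontr)
   assume "norm x ~= 1"
   then show False using chart_inj_disc[OF g d eq _ ny(1)] nx(1) ne by simp
  qed
  moreover have "norm y = 1"
  proof (rule ccontr)
   assume "norm y ~= 1"
   then show False using chart_inj_disc[OF g d(2,1) eq[symmetric] _ nx(1)] ny(1) ne by simp
  qed
  ultimately have "dist x y < 2" using nx(2) ny(2) by (auto simp: dist_norm dir1_def dir2_def cmod_def power2_eq_square real_sqrt_less_iff[of _ 4, simplified])
  then show False using chart_inj[OF g d eq] ne by simp
 qed
 show "p 0 (fst v) ~: T" "p 0 (snd v) ~: T" using base_avoids[OF T g nx(3,1)] base_avoids[OF T g ny(3,1)] by (simp_all add: xy)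
 show "fst v \<in> strip" "snd v \<in> strip" using nx(3) ny(3) by (simp_all add: xy)
qed

definition pair_value :: "nat => 'a set => ((real => (nat => 'a) set) => 'g) => complex \<times> complex => complex \<times> complex => 'g" where
 "pair_value n T \<Phi> v w = \<Phi> (pair_cfg n T o linepath v w)"

lemma pair_cfg_linepath: "pair_cfg n T o linepath (x, y) (x', y') =
  (\<lambda>t. cfg n (insert (p 0 (linepath x x' t)) (insert (p 0 (linepath y y' t)) T)))" by (simp add: fun_eq_iff pair_cfg_def linepath_def)

lemma pair_value_add: fixes \<Phi> :: "(real => (nat => 'a) set) => 'g::group_add"
 assumes \<Phi>: "path_functional (unordered_config n U) \<Phi>" and T: "base n T" and uvw: "u \<in> region e" "v \<in> region e" "w \<in> region e"
 shows "pair_value n T \<Phi> u w = pair_value n T \<Phi> u v + pair_value n T \<Phi> v w"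
proof -
 have g: "0 < g" using g_pos by simp
 have "continuous_map (top_of_set (region e)) (unordered_config n U) (\<lambda>v. cfg n (insert (p 0 (fst v)) (insert (p 0 (snd v)) T)))"
 proof (rule continuous_map_two_strands)
  show "finite T" "T \<subseteq> topspace U" "Suc (Suc (card T)) = n" using T by (auto simp: base_def)
  have "continuous_map (top_of_set (region e)) (top_of_set (chart_dom g 0)) fst" "continuous_map (top_of_set (region e)) (top_of_set (chart_dom g 0)) snd"
   using region_distinct(4,5)[OF T] strip_chart_dom[of g 0] by (auto simp: continuous_map_in_subtopology intro!: continuous_intros)
  from this[THEN continuous_map_compose[OF _ chart_cont[OF g]]]
  show "continuous_map (top_of_set (region e)) U (\<lambda>v. p 0 (fst v))" "continuous_map (top_of_set (region e)) U (\<lambda>v. p 0 (snd v))"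
   by (simp_all add: o_def)
 qed (use region_distinct(1-3)[OF T] in auto)
 then have "continuous_map (top_of_set (region e)) (unordered_config n U) (pair_cfg n T)" by (simp add: pair_cfg_def[abs_def])
 from potential_convex[OF convex_region pf_compose[OF \<Phi> this]]
 obtain h where h: "potential (top_of_set (region e)) (\<lambda>q. \<Phi> (pair_cfg n T o q)) h" .
 have "pair_value n T \<Phi> x y = - h x + h y" if "x \<in> region e" "y \<in> region e" for x y
  using h pathin_linepath[OF convex_region that] by (simp add: potential_def pair_value_def)
 then show ?thesis using uvw by (simp add: add.assoc del: add_uminus_conv_diff)
qed

lemma pair_value_minus: fixes \<Phi> :: "(real => (nat => 'a) set) => 'g::group_add"
 assumes \<Phi>: "path_functional (unordered_config n U) \<Phi>" and T: "base n T" and uv: "u \<in> region e" "v \<in> region e"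
 shows "pair_value n T \<Phi> v u = - pair_value n T \<Phi> u v"
proof -
 have "pair_value n T \<Phi> u u = 0" using pair_value_add[OF \<Phi> T uv(1) uv(1) uv(1)] by (metis add_left_imp_eq add_0_right)
 then have "pair_value n T \<Phi> u v + pair_value n T \<Phi> v u = 0" using pair_value_add[OF \<Phi> T uv(1,2,1)] by simp
 then show ?thesis by (rule minus_unique[symmetric])
qed

text \<open>In the third centre the two points of the first are exchanged, so this is the value of a
  closed path of unordered configurations.\<close>

definition half_twist :: "nat => 'a set => ((real => (nat => 'a) set) => 'g::group_add) => 'g" where
 "half_twist n T \<Phi> = pair_value n T \<Phi> centre1 centre2 + pair_value n T \<Phi> centre2 centre3"

text \<open>
 Two strands through the crosscap along the diameters \<open>dir1\<close> and \<open>dir2\<close> sweep out a square punctured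
 at its centre; its boundary is the commutator, and the loop around the puncture is a full twist.
\<close>
lemma half_twist_double: fixes \<Phi> :: "(real => (nat => 'a) set) => 'g::group_add"
 assumes \<Phi>: "path_functional (unordered_config n U) \<Phi>" and T: "base n T"
  and a: "a = \<Phi> (\<lambda>t. cfg n (insert (p 0 (linepath (- dir1) dir1 t)) (insert (p 0 (- dir2)) T)))"
  and b: "b = \<Phi> (\<lambda>t. cfg n (insert (p 0 (linepath (- dir2) dir2 t)) (insert (p 0 (- dir1)) T)))" and ab: "a + b = b + a"
 shows "half_twist n T \<Phi> + half_twist n T \<Phi> = 0"
proof -
 let ?N = "pair_value n T \<Phi>"
 have g: "0 < g" using g_pos by simp
 have add: "?N u w = ?N u x + (?N x y + ?N y w)" if "{u, x, y, w} \<subseteq> region e" for u x y w e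
  using pair_value_add[OF \<Phi> T, of u e x w] pair_value_add[OF \<Phi> T, of x e y w] that by simp
 have minus: "?N v u = - ?N u v" if "{u, v} \<subseteq> region e" for u v e using pair_value_minus[OF \<Phi> T, of u e v] that by simp
 have a1: "?N corner1 corner2 = a" by (simp add: a pair_value_def corner1_def corner2_def pair_cfg_linepath linepath_refl)
 \<comment> \<open>Opposite sides of the square coincide in the surface, as \<open>dir2\<close> and
   \<open>- dir2\<close> are the same point.\<close>
 have a2: "?N corner4 corner3 = a" by (simp add: a pair_value_def corner3_def corner4_def pair_cfg_linepath linepath_refl chart_minus[OF g norm_dir(2)])
 have b1: "?N corner2 corner3 = b"
  by (simp add: b pair_value_def corner2_def corner3_def pair_cfg_linepath linepath_refl chart_minus[OF g norm_dir(1)] insert_commute)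
 have b2: "?N corner1 corner4 = b" by (simp add: b pair_value_def corner1_def corner4_def pair_cfg_linepath linepath_refl insert_commute)
 have s1: "?N centre3 centre4 = ?N centre1 centre2" and s2: "?N centre4 centre1 = ?N centre2 centre3"
  by (simp_all add: pair_value_def centre1_def centre2_def centre3_def centre4_def pair_cfg_linepath insert_commute)
 note r = region_points
 have "a = ?N corner1 centre1 + (?N centre1 centre2 + ?N centre2 corner2)" unfolding a1[symmetric] by (rule add) (use r(1) in blast)
 moreover have "b = ?N corner2 centre2 + (?N centre2 centre3 + ?N centre3 corner3)" unfolding b1[symmetric] by (rule add) (use r(2) in blast)
 moreover have "b = ?N corner1 centre1 + (?N centre1 centre4 + ?N centre4 corner4)" unfolding b2[symmetric] by (rule add) (use r(4) in blast)
 moreover have "a = ?N corner4 centre4 + (?N centre4 centre3 + ?N centre3 corner3)" unfolding a2[symmetric] by (rule add) (use r(3) in blast)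
 moreover have "?N centre2 corner2 = - ?N corner2 centre2" by (rule minus) (use r(1) in blast)
 moreover have "?N centre4 corner4 = - ?N corner4 centre4" by (rule minus) (use r(3) in blast)
 moreover have "?N centre1 centre4 = - ?N centre2 centre3" unfolding s2[symmetric] by (rule minus) (use r(4) in blast)
 moreover have "?N centre4 centre3 = - ?N centre1 centre2" unfolding s1[symmetric] by (rule minus) (use r(3) in blast)
 \<comment> \<open>Here \<open>x\<close>, \<open>y\<close>, \<open>w\<close> lead from the corners
   1, 2, 4 to their centres, \<open>z\<close> from centre 3 to its corner, and \<open>s\<close>,
   \<open>t\<close> are quarter turns. Both sides start with \<open>x\<close> and end with
   \<open>z\<close>; what is left says that \<open>s + t\<close> equals its own inverse.\<close>
 moreover have "(x + (s + - y)) + (y + (t + z)) = (x + (- t + - w)) + (w + (- s + z)) ==> (s + t) + (s + t) = 0" for x y z w s t :: 'g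
 proof -
  assume "(x + (s + - y)) + (y + (t + z)) = (x + (- t + - w)) + (w + (- s + z))"
  then have "x + ((s + t) + z) = x + (- (s + t) + z)" by (simp add: add.assoc minus_add del: add_uminus_conv_diff)
  then have "s + t = - (s + t)" by simp
  then show ?thesis by (metis add.right_inverse)
 qed
 ultimately show ?thesis using ab unfolding half_twist_def by metis
qed

text \<open>The cores of distinct crosscaps are disjoint: different copies overlap only in tubes,
  and these stay away from the imaginary axis.\<close>

lemma crosscaps_commute: fixes \<Phi> :: "(real => (nat => 'a) set) => 'g::group_add"
 assumes \<Phi>: "path_functional (unordered_config n U) \<Phi>" and T: "base n T" and rs: "r < g" "s < g" "r ~= s"
 defines "a \<equiv> \<Phi> (\<lambda>t. cfg n (insert (crosscap r t) (insert (crosscap s 0) T)))"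
  and "b \<equiv> \<Phi> (\<lambda>t. cfg n (insert (crosscap s t) (insert (crosscap r 0) T)))"
 shows "a + b = b + a" "pathin (subtopology U (- insert (crosscap s 0) T)) (crosscap r)"
proof -
 have B: "finite T" "T \<subseteq> topspace U" "Suc (Suc (card T)) = n" using T by (auto simp: base_def)
 have seg: "linepath (- \<i>) \<i> t \<in> strip \<inter> cball 0 1 & Re (linepath (- \<i>) \<i> t) = 0" if t: "t \<in> {0..1}" for t
 proof -
  have "linepath (- \<i>) \<i> t = Complex 0 (2 * t - 1)" by (simp add: linepath_def complex_eq_iff)
  moreover have "\<bar>2 * t - 1\<bar> <= 1" using t by auto
  ultimately show ?thesis by (simp add: strip_def cmod_def)
 qed
 have T': "crosscap r t ~: T" if "r < g" "t \<in> {0..1}" for r t using base_avoids[OF T that(1)] seg[OF that(2)] by (simp add: crosscap_def)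
 then have sub: "pathin (subtopology U (- T)) (crosscap r)" if "r < g" for r using crosscap_loop(1)[OF that] that by (auto simp: pathin_subtopology)
 have "crosscap r t ~= crosscap s t'" if tt: "t \<in> {0..1}" "t' \<in> {0..1}" for t t'
 proof
  let ?z = "linepath (- \<i>) \<i> t" and ?w = "linepath (- \<i>) \<i> t'"
  assume "crosscap r t = crosscap s t'"
  then have "chart_rel g r ?z s ?w" using chart_eq[OF rs(1,2)] seg[OF tt(1)] seg[OF tt(2)] strip_chart_dom unfolding crosscap_def o_def by blast
  then have "?z \<in> right_annulus \<or> ?w \<in> right_annulus" using rs(3) by (auto simp: chart_rel_def)
  moreover have "v ~: right_annulus" if "Re v = 0" for v using abs_Re_le_cmod[of "v - 1/2"] that by (auto simp: right_annulus_def)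
  ultimately show False using seg[OF tt(1)] seg[OF tt(2)] by blast
 qed
 then have dis: "crosscap r ` {0..1} \<inter> crosscap s ` {0..1} = {}" and "crosscap r t ~= crosscap s 0" if "t \<in> {0..1}" for t using that by force+
 then show "pathin (subtopology U (- insert (crosscap s 0) T)) (crosscap r)" using sub[OF rs(1)] by (auto simp: pathin_subtopology)
 have "crosscap r 1 = crosscap r 0" "crosscap s 1 = crosscap s 0" using crosscap_loop(2) rs by simp_all
 then show "a + b = b + a" using two_strand_square[OF \<Phi> B sub[OF rs(1)] sub[OF rs(2)] dis[of 0]] unfolding a_def b_def by simp
qed

end

context coreless_functional
begin

text \<open>As \<open>G\<close> is constant, one triangle decides. For the triangle of
  \<open>mid1\<close> and \<open>mid2\<close> the tour is homotopic to the half twist, since a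
  direct step between the two passes on the same side of the diagonal as the detour through
  \<open>centre2\<close>.\<close>

lemma exact_of_half_twist: assumes n: "n >= 2" and T: "base n T" and tw: "half_twist n T \<zeta> = 0"
 obtains f where "potential (unordered_config n U) \<zeta> f"
proof -
 have g: "0 < g" using g_pos by simp
 have B: "finite T" "T \<subseteq> topspace U" "Suc (Suc (card T)) = n" using T by (auto simp: base_def)
 let ?N = "pair_value n T \<zeta>"
 have top: "p 0 (fst v) \<in> topspace U" "p 0 (snd v) \<in> topspace U" if "v \<in> region e" for v e
  using chart_topspace[OF g] region_distinct(4,5)[OF T that] strip_chart_dom by blast+
 have strip: "pathin (subtopology U (- insert y T)) (p 0 o linepath x x')"
  if "x \<in> strip" "x' \<in> strip" "\<And>t. t \<in> {0..1} ==> p 0 (linepath x x' t) ~: insert y T" for x x' y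
  using pathin_chart_subset[OF g pathin_linepath[OF strip_convex that(1,2)] strip_chart_dom] that(3) by (auto simp: pathin_subtopology)
 have line: "linepath v w t \<in> region e" if "v \<in> region e" "w \<in> region e" "t \<in> {0..1}" for v w e t
  using pathin_linepath[OF convex_region that(1,2)] that(3) by (auto simp: pathin_top_of_set path_image_def)
 have fs: "fst (linepath v w t) = linepath (fst v) (fst w) t" "snd (linepath v w t) = linepath (snd v) (snd w) t" for v w :: "complex \<times> complex" and t
  by (simp_all add: linepath_def)
 have D1: "D (insert (p 0 y) T) (p 0 x) (p 0 x') = ?N (x, y) (x', y)" if r: "(x, y) \<in> region e" "(x', y) \<in> region e" for x x' y e
 proof -
  have "p 0 (linepath x x' t) ~: insert (p 0 y) T" if "t \<in> {0..1}" for t using region_distinct(1,2)[OF T line[OF r that]] by (simp add: fs linepath_refl)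
  then have "pathin (subtopology U (- insert (p 0 y) T)) (p 0 o linepath x x')" using strip region_distinct(4)[OF T r(1)] region_distinct(4)[OF T r(2)] by simp
  moreover have "rest (insert (p 0 y) T)" using region_distinct(3)[OF T r(1)] top[OF r(1)] B by (simp add: rest_def)
  ultimately have "strand (insert (p 0 y) T) (p 0 o linepath x x') = D (insert (p 0 y) T) (p 0 x) (p 0 x')" using pot by (simp add: D_def)
  then show ?thesis by (simp add: pair_value_def pair_cfg_linepath linepath_refl strand_def)
 qed
 have D2: "D (insert (p 0 x) T) (p 0 y) (p 0 y') = ?N (x, y) (x, y')" if r: "(x, y) \<in> region e" "(x, y') \<in> region e" for x y y' e
 proof -
  have "p 0 (linepath y y' t) ~: insert (p 0 x) T" if "t \<in> {0..1}" for t using region_distinct(1,3)[OF T line[OF r that]] by (auto simp: fs linepath_refl)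
  then have "pathin (subtopology U (- insert (p 0 x) T)) (p 0 o linepath y y')" using strip region_distinct(5)[OF T r(1)] region_distinct(5)[OF T r(2)] by simp
  moreover have "rest (insert (p 0 x) T)" using region_distinct(2)[OF T r(1)] top[OF r(1)] B by (simp add: rest_def)
  ultimately have "strand (insert (p 0 x) T) (p 0 o linepath y y') = D (insert (p 0 x) T) (p 0 y) (p 0 y')" using pot by (simp add: D_def)
  then show ?thesis by (simp add: pair_value_def pair_cfg_linepath linepath_refl strand_def insert_commute)
 qed
 note r = region_points
 let ?x = "Complex (- 7/50) 0" and ?y = "Complex (7/50) 0" and ?z = "Complex 0 (12/25)"
 have "G T (p 0 ?x) (p 0 ?y) (p 0 ?z) = ?N centre1 mid1 + ?N mid1 mid2 + ?N mid2 centre3"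
 proof -
  have "D (insert (p 0 ?y) T) (p 0 ?x) (p 0 ?z) = ?N centre1 mid1" unfolding centre1_def mid1_def by (rule D1) (use r(1) in "auto simp: centre1_def mid1_def")
  moreover have "D (insert (p 0 ?z) T) (p 0 ?y) (p 0 ?x) = ?N mid1 mid2" unfolding mid1_def mid2_def by (rule D2) (use r(5) in "auto simp: mid1_def mid2_def")
  moreover have "D (insert (p 0 ?x) T) (p 0 ?z) (p 0 ?y) = ?N mid2 centre3"
   unfolding mid2_def centre3_def by (rule D1) (use r(2) in "auto simp: mid2_def centre3_def")
  ultimately show ?thesis by (simp add: G_def)
 qed
 also have "?N mid1 mid2 = ?N mid1 centre2 + ?N centre2 mid2" by (rule pair_value_add[OF \<zeta> T]) (use r(5) in auto)
 also have "?N centre1 mid1 + (?N mid1 centre2 + ?N centre2 mid2) + ?N mid2 centre3 =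
   (?N centre1 mid1 + ?N mid1 centre2) + (?N centre2 mid2 + ?N mid2 centre3)" by (simp add: add.assoc)
 also have "?N centre1 mid1 + ?N mid1 centre2 = ?N centre1 centre2" by (rule pair_value_add[OF \<zeta> T, symmetric]) (use r(1) in auto)
 also have "?N centre2 mid2 + ?N mid2 centre3 = ?N centre2 centre3" by (rule pair_value_add[OF \<zeta> T, symmetric]) (use r(2) in auto)
 finally have 0: "G T (p 0 ?x) (p 0 ?y) (p 0 ?z) = 0" using tw by (simp add: half_twist_def)
 have R: "centre1 \<in> region (cnj dir1)" "mid1 \<in> region (cnj dir1)" "mid2 \<in> region (- cnj dir2)" using r by auto
 have "{p 0 ?x, p 0 ?y, p 0 ?z} \<subseteq> topspace U - T" "p 0 ?x ~= p 0 ?y" "p 0 ?y ~= p 0 ?z" "p 0 ?x ~= p 0 ?z"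
  using top[OF R(1)] top[OF R(2)] region_distinct(1-3)[OF T R(1)] region_distinct(1-3)[OF T R(2)] region_distinct(1-3)[OF T R(3)]
  by (auto simp: centre1_def mid1_def mid2_def)
 from G_constant[OF n _ _ _ _ _ _ _ B this] 0
 have "G S x y z = 0" if "finite S" "S \<subseteq> topspace U" "Suc (Suc (card S)) = n" "{x, y, z} \<subseteq> topspace U - S" "x ~= y" "y ~= z" "x ~= z" for S x y z
  using that by simp
 then show ?thesis using exact_of_G[of thesis] n that by simp
qed

end

section \<open>Characters of braid groups with two or more strands and with one strand\<close>

context surface
begin

text \<open>A functional to the quaternion group cannot separate: the two crosscap values are parallel and the half twist is central.\<close>
theorem quaternion_character: assumes n: "n >= 2" and \<Phi>: "path_functional (unordered_config n U) (\<Phi> :: (real => (nat => 'a) set) => bit q8)"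
 obtains \<alpha> \<beta> :: bit where "\<alpha> ~= 0 \<or> \<beta> ~= 0" "\<And>q. pathin (unordered_config n U) q ==> q 0 = q 1 ==> \<alpha> * qa (\<Phi> q) + \<beta> * qb (\<Phi> q) = 0"
proof -
 have g: "0 < g" using g_pos by simp
 have two: "a + a = 0" for a :: bit by simp
 obtain T where T: "base n T" using exists_base[OF n] .
 have B: "finite T" "T \<subseteq> topspace U" "Suc (Suc (card T)) = n" using T by (auto simp: base_def)
 interpret A: config_functional U g p n "\<lambda>q. qa (\<Phi> q)" by unfold_locales (rule pf_hom[OF \<Phi> q8_hom(1)], rule two)
 interpret B: config_functional U g p n "\<lambda>q. qb (\<Phi> q)" by unfold_locales (rule pf_hom[OF \<Phi> q8_hom(2)], rule two)
 define S where "S = insert (p 0 (- dir2)) T"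
 define S' where "S' = insert (p 0 (- dir1)) T"
 define a where "a = \<Phi> (\<lambda>t. cfg n (insert (p 0 (linepath (- dir1) dir1 t)) S))"
 define b where "b = \<Phi> (\<lambda>t. cfg n (insert (p 0 (linepath (- dir2) dir2 t)) S'))"
 have R: "corner1 \<in> region (cnj dir1)" "corner2 \<in> region (cnj dir1)" "corner1 \<in> region (cnj dir2)" "corner4 \<in> region (cnj dir2)" using region_points by auto
 have line: "linepath v w t \<in> region e" if "v \<in> region e" "w \<in> region e" "t \<in> {0..1}" for v w e t
  using pathin_linepath[OF convex_region that(1,2)] that(3) by (auto simp: pathin_top_of_set path_image_def)
 have fs: "fst (linepath v w t) = linepath (fst v) (fst w) t" "snd (linepath v w t) = linepath (snd v) (snd w) t" for v w :: "complex \<times> complex" and t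
  by (simp_all add: linepath_def)
 have strip: "dir1 \<in> strip" "- dir1 \<in> strip" "dir2 \<in> strip" "- dir2 \<in> strip" using diamond_points by (auto simp: diamond_def)
 have dirs: "\<bar>Re dir1\<bar> < 1/3" "Im dir1 > 0" "\<bar>Re dir2\<bar> < 1/3" "Im dir2 > 0" by (simp_all add: dir1_def dir2_def)
 have rest: "A.rest S" "A.rest S'" "B.rest S" "B.rest S'" using region_distinct[OF T R(1)] strip chart_topspace[OF g] strip_chart_dom B
  by (auto simp: A.rest_def B.rest_def S_def S'_def corner1_def)
 have pa: "pathin (subtopology U (- S)) (p 0 o linepath (- dir1) dir1)"
 proof -
  have "p 0 (linepath (- dir1) dir1 t) ~: S" if "t \<in> {0..1}" for t
   using region_distinct(1,2)[OF T line[OF R(1,2) that]] by (simp add: fs corner1_def corner2_def linepath_refl S_def)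
  then show ?thesis using pathin_chart_subset[OF g pathin_linepath[OF strip_convex strip(2,1)] strip_chart_dom] by (auto simp: pathin_subtopology)
 qed
 have pb: "pathin (subtopology U (- S')) (p 0 o linepath (- dir2) dir2)"
 proof -
  have "p 0 (linepath (- dir2) dir2 t) ~: S'" if "t \<in> {0..1}" for t
   using region_distinct(1,3)[OF T line[OF R(3,4) that]] by (auto simp: fs corner1_def corner4_def linepath_refl S'_def)
  then show ?thesis using pathin_chart_subset[OF g pathin_linepath[OF strip_convex strip(4,3)] strip_chart_dom] by (auto simp: pathin_subtopology)
 qed
 note l1 = pathin_linepath[OF strip_convex strip(2,1)] and l2 = pathin_linepath[OF strip_convex strip(4,3)]
 \<comment> \<open>Modulo the centre, both strands have the value attached to crosscap 0,
   irrespective of what rests; therefore they commute in the quaternion group.\<close>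
 have "qa a = A.core S 0" "qb a = B.core S 0" "qa b = A.core S' 0" "qb b = B.core S' 0"
  using A.core_path[OF rest(1) g l1 _ _ norm_dir(1) dirs(1,2) pa] B.core_path[OF rest(3) g l1 _ _ norm_dir(1) dirs(1,2) pa]
   A.core_path[OF rest(2) g l2 _ _ norm_dir(2) dirs(3,4) pb] B.core_path[OF rest(4) g l2 _ _ norm_dir(2) dirs(3,4) pb]
  by (simp_all add: a_def b_def A.strand_def B.strand_def)
 then have "qa a = qa b" "qb a = qb b" using A.core_independent[OF g rest(1,2)] B.core_independent[OF g rest(3,4)] by auto
 then have "a + b = b + a" unfolding q8_commute_iff by simp
 from half_twist_double[OF \<Phi> T a_def[unfolded S_def] b_def[unfolded S'_def] this] have tw: "qa (half_twist n T \<Phi>) = 0" "qb (half_twist n T \<Phi>) = 0"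
  by (rule q8_double_eq_0)+
 \<comment> \<open>For distinct crosscaps, commuting strands have parallel vectors.\<close>
 have det: "B.core S r * A.core S s = B.core S s * A.core S r" if rs: "r < g" "s < g" for r s
 proof (cases "r = s")
  case False
  have ic: "- \<i> \<in> strip" "\<i> \<in> strip" by (rule imaginary_strip)+
  note l = pathin_linepath[OF strip_convex ic]
  have val: "A.core S r = qa (\<Phi> (\<lambda>t. cfg n (insert (crosscap r t) (insert (crosscap s 0) T))))"
   "B.core S r = qb (\<Phi> (\<lambda>t. cfg n (insert (crosscap r t) (insert (crosscap s 0) T))))" if rs: "r < g" "s < g" "r ~= s" for r s
  proof -
   have av: "pathin (subtopology U (- insert (crosscap s 0) T)) (p r o linepath (- \<i>) \<i>)"
    using crosscaps_commute(2)[OF \<Phi> T rs] by (simp add: crosscap_def)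
   have "crosscap s 0 \<in> topspace U" using crosscap_loop(1)[OF rs(2)] path_start_in_topspace by blast
   moreover have "crosscap s 0 ~: T" using base_avoids[OF T rs(2) ic(1)] by (simp add: crosscap_def)
   ultimately have re: "A.rest (insert (crosscap s 0) T)" "B.rest (insert (crosscap s 0) T)" using B by (auto simp: A.rest_def B.rest_def)
   show "A.core S r = qa (\<Phi> (\<lambda>t. cfg n (insert (crosscap r t) (insert (crosscap s 0) T))))"
    using A.core_independent[OF rs(1) rest(1) re(1)] A.core_path[OF re(1) rs(1) l _ _ _ _ _ av] by (simp add: A.strand_def crosscap_def)
   show "B.core S r = qb (\<Phi> (\<lambda>t. cfg n (insert (crosscap r t) (insert (crosscap s 0) T))))"
    using B.core_independent[OF rs(1) rest(3) re(2)] B.core_path[OF re(2) rs(1) l _ _ _ _ _ av] by (simp add: B.strand_def crosscap_def)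
  qed
  show ?thesis using crosscaps_commute(1)[OF \<Phi> T rs False] val[OF rs False] val[OF rs(2,1)] False unfolding q8_commute_iff by auto
 qed simp
 obtain \<alpha> \<beta> :: bit where ab: "\<alpha> ~= 0 \<or> \<beta> ~= 0" "\<And>r. r < g ==> \<alpha> * A.core S r + \<beta> * B.core S r = 0"
 proof (cases "EX s<g. A.core S s ~= 0 \<or> B.core S s ~= 0")
  case True
  then obtain s where s: "s < g" "A.core S s ~= 0 \<or> B.core S s ~= 0" by blast
  show ?thesis
  proof (rule that[of "B.core S s" "A.core S s"])
   fix r assume r: "r < g"
   have eq: "A.core S s * B.core S r = B.core S s * A.core S r" by (subst mult.commute) (rule det[OF r s(1)])
   show "B.core S s * A.core S r + A.core S s * B.core S r = 0" unfolding eq by (rule two)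
  qed (use s(2) in auto)
 next
  case False
  then show ?thesis by (intro that[of 1 1]) auto
 qed
 let ?\<chi> = "\<lambda>x. \<alpha> * qa x + \<beta> * qb x"
 have hom: "?\<chi> (x + y) = ?\<chi> x + ?\<chi> y" for x y unfolding q8_hom by (rule linear_combination_add)
 interpret C: config_functional U g p n "\<lambda>q. ?\<chi> (\<Phi> q)" by unfold_locales (rule pf_hom[OF \<Phi> hom], rule two)
 have C0: "C.core S r = 0" if r: "r < g" for r
 proof -
  have "finite S" using B by (simp add: S_def)
  from crosscap_path_avoiding[OF r this]
  obtain u z where u: "pathin (top_of_set strip) u" "u 0 = - z" "u 1 = z" "norm z = 1" "\<bar>Re z\<bar> < 1/3" "Im z > 0"
   "pathin (subtopology U (- S)) (p r o u)" "p r (u 0) = p r (u 1)" .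
  have "C.core S r = \<alpha> * A.core S r + \<beta> * B.core S r"
   unfolding C.core_path[OF rest(1) r u(1-7), symmetric] A.core_path[OF rest(1) r u(1-7), symmetric]
    B.core_path[OF rest(1) r u(1-7), symmetric] C.strand_def A.strand_def B.strand_def ..
  also have "\<dots> = 0" by (rule ab(2)[OF r])
  finally show ?thesis .
 qed
 interpret C: coreless_functional U g p n "\<lambda>q. ?\<chi> (\<Phi> q)"
 proof unfold_locales
  fix S' r assume S': "C.rest S'" and r: "r < g"
  show "C.core S' r = 0" unfolding C.core_independent[OF r S' rest(1)] by (rule C0[OF r])
 qed
 have "half_twist n T (\<lambda>q. ?\<chi> (\<Phi> q)) = ?\<chi> (half_twist n T \<Phi>)" unfolding half_twist_def hom pair_value_def ..
 then have "half_twist n T (\<lambda>q. ?\<chi> (\<Phi> q)) = 0" unfolding tw by simp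
 then obtain f where "potential (unordered_config n U) (\<lambda>q. ?\<chi> (\<Phi> q)) f" using C.exact_of_half_twist[OF n T] by blast
 then have "?\<chi> (\<Phi> q) = 0" if "pathin (unordered_config n U) q" "q 0 = q 1" for q using that unfolding potential_def by simp
 then show ?thesis using that[of \<alpha> \<beta>] ab(1) by blast
qed

text \<open>The mod 2 cohomology of the surface has dimension at most \<open>g\<close>.\<close>
theorem functionals_dependent: fixes \<zeta> :: "'k => (real => (nat => 'a) set) => bit"
 assumes K: "finite K" "card K > g" and \<zeta>: "\<And>k. k \<in> K ==> path_functional (unordered_config 1 U) (\<zeta> k)"
 obtains A where "A \<subseteq> K" "A ~= {}" "\<And>q. pathin (unordered_config 1 U) q ==> q 0 = q 1 ==> (\<Sum>k\<in>A. \<zeta> k q) = 0"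
proof -
 have two: "a + a = 0" for a :: bit by simp
 define sm where "sm A q = (\<Sum>k\<in>A. \<zeta> k q)" for A q
 have pf: "path_functional (unordered_config 1 U) (sm A)" if "A \<subseteq> K" for A unfolding path_functional_def sm_def
 proof (intro conjI allI impI)
  fix q r assume "pathin (unordered_config 1 U) q" "pathin (unordered_config 1 U) r" "q 1 = r 0"
  then have "\<zeta> k (loop_concat q r) = \<zeta> k q + \<zeta> k r" if "k \<in> A" for k using pf_concat[OF \<zeta>] that \<open>A \<subseteq> K\<close> by blast
  then have "(\<Sum>k\<in>A. \<zeta> k (loop_concat q r)) = (\<Sum>k\<in>A. \<zeta> k q + \<zeta> k r)" by (rule sum.cong[OF HOL.refl])
  then show "(\<Sum>k\<in>A. \<zeta> k (loop_concat q r)) = (\<Sum>k\<in>A. \<zeta> k q) + (\<Sum>k\<in>A. \<zeta> k r)" by (simp only: sum.distrib)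
 next
  fix q r assume "path_homotopic (unordered_config 1 U) q r"
  then show "(\<Sum>k\<in>A. \<zeta> k q) = (\<Sum>k\<in>A. \<zeta> k r)" using pf_homotopic[OF \<zeta>] that by (intro sum.cong) auto
 qed
 have cf: "config_functional U g p 1 (sm A)" if "A \<subseteq> K" for A by unfold_locales (rule pf[OF that], rule two)
 \<comment> \<open>The crosscaps on which the sum over \<open>A\<close> does not vanish. There are
   more subsets of \<open>K\<close> than subsets of crosscaps, so two of them share these; in
   characteristic two the difference of their sums is the sum over the symmetric difference.\<close>
 define v where "v A = {r \<in> {..<g}. sm A (\<lambda>t. cfg 1 {crosscap r t}) ~= 0}" for A
 have "\<not> inj_on v (Pow K)"
 proof
  assume "inj_on v (Pow K)"
  then have "card (Pow K) <= card (Pow {..<g})" by (rule card_inj_on_le) (auto simp: v_def)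
  then show False using K by (simp add: card_Pow)
 qed
 then obtain A1 A2 where A: "A1 \<subseteq> K" "A2 \<subseteq> K" "A1 ~= A2" "v A1 = v A2" by (auto simp: inj_on_def)
 define A where "A = (A1 - A2) \<union> (A2 - A1)"
 have AK: "A \<subseteq> K" "A ~= {}" using A by (auto simp: A_def)
 have fin: "finite A1" "finite A2" using finite_subset[OF A(1) K(1)] finite_subset[OF A(2) K(1)] .
 have smA: "sm A q = sm A1 q + sm A2 q" for q
 proof -
  have "sm A q = sm (A1 - A2) q + sm (A2 - A1) q" unfolding A_def sm_def using fin by (intro sum.union_disjoint) auto
  moreover have "sm A1 q = sm (A1 - A2) q + sm (A1 \<inter> A2) q" "sm A2 q = sm (A2 - A1) q + sm (A1 \<inter> A2) q"
   unfolding sm_def using fin sum.Int_Diff[of A1 "\<lambda>k. \<zeta> k q" A2] sum.Int_Diff[of A2 "\<lambda>k. \<zeta> k q" A1]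
   by (simp_all only: Int_commute add.commute)
  moreover have "(x + y) + (z + y) = x + z" for x y z :: bit by (cases x; cases y; cases z; simp)
  ultimately show ?thesis by (simp only:)
 qed
 interpret C: config_functional U g p 1 "sm A" by (rule cf[OF AK(1)])
 \<comment> \<open>With a single strand nothing rests. There are no triangles either, so vanishing
   on the crosscaps already makes the sum exact.\<close>
 have rest: "C.rest T \<longleftrightarrow> T = {}" for T unfolding C.rest_def by (auto simp: card_eq_0_iff)
 interpret C: coreless_functional U g p 1 "sm A"
 proof unfold_locales
  fix T r assume T: "C.rest T" and r: "r < g"
  have "T = {}" using T unfolding rest .
  have "finite T" using \<open>T = {}\<close> by simp
  have ic: "- \<i> \<in> strip" "\<i> \<in> strip" by (rule imaginary_strip)+
  have "pathin (subtopology U (- T)) (p r o linepath (- \<i>) \<i>)"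
   using crosscap_loop(1)[OF r] \<open>T = {}\<close> by (simp add: crosscap_def pathin_subtopology)
  then have "C.core T r = C.strand T (crosscap r)" using C.core_path[OF T r pathin_linepath[OF strip_convex ic]] by (simp add: crosscap_def)
  also have "\<dots> = sm A1 (\<lambda>t. cfg 1 {crosscap r t}) + sm A2 (\<lambda>t. cfg 1 {crosscap r t})"
   by (simp only: C.strand_def \<open>T = {}\<close> smA)
  also have "sm A1 (\<lambda>t. cfg 1 {crosscap r t}) = sm A2 (\<lambda>t. cfg 1 {crosscap r t})"
  proof -
   have "sm A1 (\<lambda>t. cfg 1 {crosscap r t}) ~= 0 \<longleftrightarrow> sm A2 (\<lambda>t. cfg 1 {crosscap r t}) ~= 0" using A(4) r by (auto simp: v_def)
   moreover have "(x ~= 0 \<longleftrightarrow> y ~= 0) ==> x = y" for x y :: bit by (cases x; cases y; simp)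
   ultimately show ?thesis by blast
  qed
  also have "sm A2 (\<lambda>t. cfg 1 {crosscap r t}) + sm A2 (\<lambda>t. cfg 1 {crosscap r t}) = 0" by (rule two)
  finally show "C.core T r = 0" .
 qed
 obtain f where "potential (unordered_config 1 U) (sm A) f" using C.exact_of_G[of thesis] by auto
 then have "sm A q = 0" if "pathin (unordered_config 1 U) q" "q 0 = q 1" for q using that unfolding potential_def by simp
 then show ?thesis using that[OF AK] unfolding sm_def by blast
qed

end

section \<open>Monodromy of free actions of finite groups\<close>

text \<open>The level sets of \<open>d\<close> are closed, finite in number and disjoint, and the
  interval is connected.\<close>

lemma finite_orbit_constant: fixes op :: "'g::group_add => 'v::t2_space => 'v" and f f' :: "real => 'v"
 assumes fin: "finite (UNIV :: 'g set)" and cont: "\<And>a. continuous_on UNIV (op a)" and f: "continuous_on {0..1} f" "continuous_on {0..1} f'"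
  and d: "\<And>t k. t \<in> {0..1} ==> f t = op k (f' t) \<longleftrightarrow> k = d t" shows "d 0 = d 1"
proof -
 define E where "E k = {t \<in> {0..1}. f t = op k (f' t)}" for k
 have E: "E k = {t \<in> {0..1}. k = d t}" for k using d by (auto simp: E_def)
 have cl: "closedin (top_of_set {0..1}) (E k)" for k
 proof -
  have "E k = {0..1} \<inter> (\<lambda>t. (f t, op k (f' t))) -` {y. EX x. y = (x, x)}" by (auto simp: E_def)
  moreover have "continuous_on {0..1} (\<lambda>t. (f t, op k (f' t)))" by (intro continuous_on_Pair f continuous_on_compose2[OF cont f(2)]) auto
  ultimately show ?thesis using continuous_closedin_preimage[OF _ closed_diagonal] by (simp only:)
 qed
 have cl': "closedin (top_of_set {0..1}) (\<Union>k\<in>-{d 0}. E k)" by (rule closedin_Union) (use finite_subset[OF subset_UNIV fin] cl in auto)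
 have "E (d 0) = {} \<or> (\<Union>k\<in>-{d 0}. E k) = {}"
 proof (rule ccontr)
  assume "\<not> ?thesis"
  moreover have "E (d 0) \<inter> (\<Union>k\<in>-{d 0}. E k) = {}" "{0..1} \<subseteq> E (d 0) \<union> (\<Union>k\<in>-{d 0}. E k)" unfolding E by auto
  ultimately show False using connected_Icc[of 0 "1::real"] cl[of "d 0"] cl' unfolding connected_closedin by metis
 qed
 moreover have "0 \<in> E (d 0)" unfolding E by simp
 ultimately have "1 ~: E (d 1) \<or> d 1 = d 0" by blast
 then show ?thesis unfolding E by simp
qed

text \<open>The monodromy of a principal bundle with finite structure group, given by local sections of an orbit-valued map.\<close>
theorem torsor_functional: fixes op :: "'g::group_add => 'v::t2_space => 'v" and \<psi> :: "'a => 'v"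
 assumes fin: "finite (UNIV :: 'g set)" and cont: "\<And>a. continuous_on UNIV (op a)" and op_add: "\<And>a b v. op (a + b) v = op a (op b v)"
  and free: "\<And>a x. x \<in> topspace X ==> op a (\<psi> x) = \<psi> x ==> a = 0" and op_zero: "\<And>v. op 0 v = v"
  and sections: "\<And>x. x \<in> topspace X ==> EX V \<sigma>. openin X V & x \<in> V &
   continuous_map (subtopology X V) euclidean \<sigma> & (ALL y:V. EX k. \<sigma> y = op k (\<psi> y))" obtains \<Theta> where "path_functional X \<Theta>"
  "\<And>q \<sigma> a b. pathin X q ==> continuous_on {0..1} \<sigma> ==> (\<And>t. t \<in> {0..1} ==> EX k. \<sigma> t = op k (\<psi> (q t))) ==>
   \<sigma> 0 = op a (\<psi> (q 0)) ==> \<sigma> 1 = op b (\<psi> (q 1)) ==> \<Theta> q = - a + b"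
proof -
 have inj: "a = b" if "x \<in> topspace X" "op a (\<psi> x) = op b (\<psi> x)" for a b x
 proof -
  have "op (- b + a) (\<psi> x) = \<psi> x" using that(2) op_add[of "- b" a] op_add[of "- b" b] op_zero by simp
  then have "- b + a = 0" using free[OF that(1)] by blast
  then show ?thesis by (metis add.inverse_inverse minus_unique)
 qed
 \<comment> \<open>\<psi> selects a point of each orbit without any continuity, and \<open>h\<close>
   measures a section against it. Two sections over one path differ by a constant left factor, which
   cancels in \<open>- h (q 0) + h (q 1)\<close>; so the local functionals agree on
   overlaps.\<close>
 define h where "h \<sigma> y = (SOME k. \<sigma> y = op k (\<psi> y))" for \<sigma> y
 define I where "I = {(V, \<sigma>). openin X V & continuous_map (subtopology X V) euclidean \<sigma> & (ALL y:V. EX k. \<sigma> y = op k (\<psi> y))}"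
 have h: "\<sigma> y = op (h \<sigma> y) (\<psi> y)" if "(V, \<sigma>) \<in> I" "y \<in> V" for V \<sigma> y
  unfolding h_def by (rule someI_ex) (use that in "auto simp: I_def")
 have VX: "V \<subseteq> topspace X" if "(V, \<sigma>) \<in> I" for V \<sigma> using that openin_subset by (auto simp: I_def)
 have along: "f t = op k (f' t) \<longleftrightarrow> k = c - c'" if "y \<in> topspace X" "f t = op c (\<psi> y)" "f' t = op c' (\<psi> y)" for f f' :: "real => 'v" and t c c' y k
 proof -
  have "f t = op k (f' t) \<longleftrightarrow> c = k + c'" unfolding that(2,3) op_add[symmetric] using inj[OF that(1)] by metis
  then show ?thesis by (metis add_diff_cancel diff_add_cancel)
 qed
 have path: "continuous_on {0..1} (\<lambda>t. \<sigma> (q t))" if "(V, \<sigma>) \<in> I" "pathin (subtopology X V) q" for V \<sigma> q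
 proof -
  have "continuous_map (top_of_set {0..1}) euclidean (\<sigma> o q)" using that unfolding pathin_def I_def by (blast intro: continuous_map_compose)
  then show ?thesis by (simp add: o_def)
 qed
 obtain \<Theta> where \<Theta>: "path_functional X \<Theta>"
  "\<And>i q. i \<in> I ==> pathin (subtopology X (fst i)) q ==> \<Theta> q = - h (snd i) (q 0) + h (snd i) (q 1)"
 proof (rule path_functional_glue[of X I fst "\<lambda>i q. - h (snd i) (q 0) + h (snd i) (q 1)"])
  show "EX i:I. x \<in> fst i" if "x \<in> topspace X" for x using sections[OF that] unfolding I_def by fastforce
  show "openin X (fst i)" if "i \<in> I" for i using that by (auto simp: I_def)
  show "path_functional (subtopology X (fst i)) (\<lambda>q. - h (snd i) (q 0) + h (snd i) (q 1))" for i by (rule path_functional_coboundary)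
  fix i j q assume ij: "i \<in> I" "j \<in> I" and q: "pathin (subtopology X (fst i)) q" "pathin (subtopology X (fst j)) q"
  obtain V \<sigma> V' \<sigma>' where e: "i = (V, \<sigma>)" "j = (V', \<sigma>')" by (cases i; cases j) auto
  have qV: "q t \<in> V" "q t \<in> V'" if "t \<in> {0..1}" for t using q that unfolding e by (auto simp: pathin_subtopology)
  define d where "d t = h \<sigma> (q t) - h \<sigma>' (q t)" for t
  have "d 0 = d 1"
  proof (rule finite_orbit_constant[OF fin cont])
   show "continuous_on {0..1} (\<lambda>t. \<sigma> (q t))" "continuous_on {0..1} (\<lambda>t. \<sigma>' (q t))" using path ij q unfolding e fst_conv by blast+
   show "\<sigma> (q t) = op k (\<sigma>' (q t)) \<longleftrightarrow> k = d t" if t: "t \<in> {0..1}" for t k unfolding d_def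
    by (rule along[of "q t"]) (use h[OF ij(1)[unfolded e]] h[OF ij(2)[unfolded e]] qV[OF t] VX[OF ij(1)[unfolded e]] in auto)
  qed
  moreover have "h \<sigma> (q t) = d t + h \<sigma>' (q t)" for t by (simp add: d_def)
  ultimately show "- h (snd i) (q 0) + h (snd i) (q 1) = - h (snd j) (q 0) + h (snd j) (q 1)"
   unfolding e snd_conv by (simp add: minus_add add.assoc del: add_uminus_conv_diff)
 qed blast
 show ?thesis
 proof (rule that[OF \<Theta>(1)])
  fix q \<sigma> a b
  assume q: "pathin X q" and \<sigma>: "continuous_on {0..1} \<sigma>" "\<And>t. t \<in> {0..1} ==> EX k. \<sigma> t = op k (\<psi> (q t))"
   and ends: "\<sigma> 0 = op a (\<psi> (q 0))" "\<sigma> 1 = op b (\<psi> (q 1))"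
  have qX: "q t \<in> topspace X" if "t \<in> {0..1}" for t using q that by (auto simp: pathin_def continuous_map_def)
  \<comment> \<open>A continuous selection along the whole path is compared with the local sections,
    piece by piece, again by constancy of the left factor.\<close>
  define f where "f t = (SOME k. \<sigma> t = op k (\<psi> (q t)))" for t
  have f: "\<sigma> t = op (f t) (\<psi> (q t))" if "t \<in> {0..1}" for t unfolding f_def by (rule someI_ex) (rule \<sigma>(2)[OF that])
  have q': "continuous_map (top_of_set {0..1}) X q" using q by (simp add: pathin_def)
  have "potential (top_of_set {0..1}) (\<lambda>u. \<Theta> (q o u)) f"
  proof (rule potential_local[OF pf_compose[OF \<Theta>(1) q']])
   fix t0 :: real assume "t0 \<in> topspace (top_of_set {0..1})"
   then have t0: "t0 \<in> {0..1}" by simp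
   obtain V \<sigma>' where V: "openin X V" "q t0 \<in> V" and i: "(V, \<sigma>') \<in> I" using sections[OF qX[OF t0]] unfolding I_def by blast
   let ?W = "{t \<in> topspace (top_of_set {0..1}). q t \<in> V}"
   have "openin (top_of_set {0..1}) ?W" by (rule openin_continuous_map_preimage[OF q' V(1)])
   moreover have "t0 \<in> ?W" using t0 V(2) by simp
   moreover have "potential (subtopology (top_of_set {0..1}) ?W) (\<lambda>u. \<Theta> (q o u)) f" unfolding potential_def
   proof (intro allI impI)
    fix u assume "pathin (subtopology (top_of_set {0..1}) ?W) u"
    then have u: "pathin (top_of_set {0..1}) u" "\<And>s. s \<in> {0..1} ==> u s \<in> ?W" by (auto simp: pathin_subtopology)
    have u01: "u s \<in> {0..1}" "q (u s) \<in> V" if "s \<in> {0..1}" for s using u(2)[OF that] by auto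
    have qu: "pathin (subtopology X V) (q o u)" using pathin_compose[OF u(1) q'] u01(2) by (auto simp: pathin_subtopology)
    have "continuous_on {0..1} u" using u(1) by (simp add: pathin_top_of_set path_def)
    then have su: "continuous_on {0..1} (\<lambda>s. \<sigma> (u s))" by (rule continuous_on_compose2[OF \<sigma>(1)]) (use u01 in auto)
    define d where "d s = f (u s) - h \<sigma>' (q (u s))" for s
    have "d 0 = d 1"
    proof (rule finite_orbit_constant[OF fin cont su])
     show "continuous_on {0..1} (\<lambda>t. \<sigma>' (q (u t)))" using path[OF i qu] by simp
     show "\<sigma> (u s) = op k (\<sigma>' (q (u s))) \<longleftrightarrow> k = d s" if s: "s \<in> {0..1}" for s k unfolding d_def
      by (rule along[of "q (u s)"]) (use f[OF u01(1)[OF s]] h[OF i u01(2)[OF s]] qX[OF u01(1)[OF s]] in auto)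
    qed
    moreover have "f (u s) = d s + h \<sigma>' (q (u s))" for s by (simp add: d_def)
    moreover have "\<Theta> (q o u) = - h \<sigma>' (q (u 0)) + h \<sigma>' (q (u 1))" using \<Theta>(2)[OF i] qu by simp
    ultimately show "\<Theta> (q o u) = - f (u 0) + f (u 1)" by (simp add: minus_add add.assoc del: add_uminus_conv_diff)
   qed
   ultimately show "EX V. openin (top_of_set {0..1}) V & t0 \<in> V &
    potential (subtopology (top_of_set {0..1}) V) (\<lambda>u. \<Theta> (q o u)) f" by blast
  qed
  moreover have "pathin (top_of_set {0..1}) (linepath 0 (1::real))" by (rule pathin_linepath) auto
  ultimately have "\<Theta> (q o linepath 0 1) = - f 0 + f 1" unfolding potential_def by fastforce
  moreover have "q o linepath 0 1 = q" by (simp add: linepath_id o_def)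
  moreover have "f 0 = a" by (rule inj[OF qX[of 0]]) (use f[of 0] ends in auto)
  moreover have "f 1 = b" by (rule inj[OF qX[of 1]]) (use f[of 1] ends in auto)
  ultimately show "\<Theta> q = - a + b" by simp
 qed
qed

definition sign_act :: "bit => 'v::real_normed_vector => 'v" where "sign_act k v = (if k = 0 then v else - v)"

text \<open>Left multiplication on quaternions, with a pair of complex numbers standing for
  \<open>fst v + snd v * j\<close>: the entry \<open>qb\<close> multiplies by \<open>i\<close>, then
  \<open>qa\<close> by \<open>j\<close>, and \<open>qs\<close> is the sign.\<close>

definition spin_act :: "bit q8 => complex \<times> complex => complex \<times> complex" where "spin_act k v = sign_act (qs k)
   (let v' = (if qb k = 0 then v else (\<i> * fst v, \<i> * snd v))
   in if qa k = 0 then v' else (- cnj (snd v'), cnj (fst v')))"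

lemma finite_bit: "finite (UNIV :: bit set)"
proof -
 have "x \<in> {0, 1}" for x :: bit by (cases x) simp_all
 then have "(UNIV :: bit set) \<subseteq> {0, 1}" by blast
 then show ?thesis by (rule finite_subset) simp
qed

lemma finite_q8: "finite (UNIV :: bit q8 set)"
proof -
 have "(UNIV :: bit q8 set) = (\<lambda>(s, a, b). Q8 s a b) ` (UNIV \<times> UNIV \<times> UNIV)"
 proof (intro Set.set_eqI iffI)
  fix x :: "bit q8"
  show "x \<in> (\<lambda>(s, a, b). Q8 s a b) ` (UNIV \<times> UNIV \<times> UNIV)" by (rule image_eqI[where x = "(qs x, qa x, qb x)"]) simp_all
 qed simp
 moreover have "finite ((\<lambda>(s, a, b). Q8 s a b :: bit q8) ` (UNIV \<times> UNIV \<times> UNIV))"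
  by (intro finite_imageI finite_cartesian_product finite_bit)
 ultimately show ?thesis by (simp only:)
qed

lemma spin_act_zero: "spin_act 0 v = v" by (simp add: spin_act_def sign_act_def zero_q8_def)

lemma spin_act_add: "spin_act (x + y) v = spin_act x (spin_act y v)"
proof -
 have "spin_act (Q8 s a b + Q8 s' a' b') v = spin_act (Q8 s a b) (spin_act (Q8 s' a' b') v)" for s a b s' a' b'
  by (cases s; cases a; cases b; cases s'; cases a'; cases b'; simp add: spin_act_def sign_act_def plus_q8_def uminus_prod_def)
 from this[of "qs x" "qa x" "qb x" "qs y" "qa y" "qb y"] show ?thesis unfolding q8.collapse .
qed

lemma spin_act_free: assumes "v ~= 0" "spin_act x v = v" shows "x = 0"
proof -
 obtain z w where v: "v = (z, w)" by (cases v)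
 have *: "s = 0 & a = 0 & b = 0" if "spin_act (Q8 s a b) (z, w) = (z, w)" for s a b using that assms(1) unfolding v
  by (cases s; cases a; cases b; simp add: spin_act_def sign_act_def complex_eq_iff zero_prod_def; linarith?)
 have "qs x = 0 & qa x = 0 & qb x = 0" by (rule *) (use assms(2) in "simp add: v")
 then show ?thesis using q8.collapse[of x] by (simp add: zero_q8_def)
qed

lemma continuous_spin_act: "continuous_on UNIV (spin_act k)" unfolding spin_act_def sign_act_def Let_def
 by (cases "qs k = 0"; cases "qa k = 0"; cases "qb k = 0"; simp; intro continuous_intros)

lemma sign_act_rules: "sign_act 0 v = v" "sign_act (x + y) v = sign_act x (sign_act y v)" "v ~= 0 ==> sign_act x v = v ==> x = 0"
 "continuous_on UNIV (sign_act x :: 'v::real_normed_vector => 'v)" for v :: "'v::real_normed_vector"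
proof -
 show "sign_act (x + y) v = sign_act x (sign_act y v)" by (cases x; cases y; simp add: sign_act_def)
 show "sign_act x v = v ==> x = 0" if "v ~= 0"
 proof (cases x)
  assume a: "sign_act x v = v" "x = 1"
  then have "- v = v" by (simp add: sign_act_def)
  then have "2 *\<^sub>R v = 0" by (metis add.right_inverse scaleR_2)
  with \<open>v ~= 0\<close> show ?thesis by simp
 qed
 show "continuous_on UNIV (sign_act x :: 'v => 'v)" by (cases "x = 0") (simp_all add: sign_act_def[abs_def] continuous_on_minus)
qed (simp add: sign_act_def)

text \<open>Smaller than a chart domain. By \<open>20/19 * 19/20 = 1\<close> and
  \<open>3/16 * 1/3 = 1/16\<close>, a collar can overlap a closed piece nontrivially only where both
  coordinates have norm above 19/20, or are closer than 1/3 to the centres of the tube. The fields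
  below need to be controlled only in these zones.\<close>

definition collar :: "nat => nat => complex set" where
 "collar g i = {z. norm z < 20/19 & (0 < i --> 3/16 < norm (z + 1/2)) & (i + 1 < g --> 3/16 < norm (z - 1/2))}"

lemma collar: "open (collar g i)" "collar g i \<subseteq> chart_dom g i" "disc_piece g i \<subseteq> collar g i"
proof -
 have "collar g i = {z. norm z < 20/19} \<inter> (if 0 < i then {z. 3/16 < norm (z + 1/2)} else UNIV) \<inter>
   (if i + 1 < g then {z. 3/16 < norm (z - 1/2)} else UNIV)" by (auto simp: collar_def)
 moreover have "open {z::complex. norm z < 20/19}" "open {z::complex. 3/16 < norm (z + 1/2)}" "open {z::complex. 3/16 < norm (z - 1/2)}"
  by (intro open_Collect_less continuous_intros)+
 ultimately show "open (collar g i)" by auto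
qed (auto simp: collar_def chart_dom_def disc_piece_def)

context surface
begin

lemma collar_eq: assumes ij: "i < g" "j < g" and z: "z \<in> collar g i" and w: "w \<in> disc_piece g j" and eq: "p i z = p j w"
 shows "i = j & z = w \<or> i = j & 19/20 < norm z & 19/20 < norm w & w = antipode z & z ~= 0 \<or>
  j = Suc i & norm (z - 1/2) < 1/3 & norm (w + 1/2) < 1/3 & 0 < norm (z - 1/2) & w = tube_map z \<or>
  i = Suc j & norm (w - 1/2) < 1/3 & norm (z + 1/2) < 1/3 & 0 < norm (w - 1/2) & z = tube_map w"
proof -
 have zd: "z \<in> chart_dom g i" "w \<in> chart_dom g j" using z w collar disc_piece_chart_dom by blast+
 have "chart_rel g i z j w" using chart_eq[OF ij zd] eq by simp
 then consider "i = j" "z = w" | "i = j" "z \<in> outer_annulus" "w = antipode z" | "j = Suc i" "z \<in> right_annulus" "w = tube_map z"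
  | "i = Suc j" "w \<in> right_annulus" "z = tube_map w" unfolding chart_rel_def by blast
 then show ?thesis
 proof cases
  case 2
  have n: "norm w * norm z = 1" "0 < norm z" using 2 by (auto simp: norm_antipode outer_annulus_def)
  have zw: "norm z < 20/19" "norm w <= 1" using z w by (auto simp: collar_def disc_piece_def)
  have "19/20 < norm w"
  proof (rule ccontr)
   assume "\<not> 19/20 < norm w"
   then have "norm w * norm z <= 19/20 * norm z" using n(2) by (intro mult_right_mono) auto
   then show False using zw n by linarith
  qed
  moreover have "1 * norm z >= norm w * norm z" using zw n by (intro mult_right_mono) auto
  ultimately show ?thesis using 2 n by auto
 next
  case 3
  have n: "norm (w + 1/2) = 1 / (16 * norm (z - 1/2))" "0 < norm (z - 1/2)"
  proof -
   have "5/32 < norm (z - 1/2)" using 3(2) unfolding right_annulus_def by (simp only: mem_Collect_eq)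
   then show "0 < norm (z - 1/2)" by linarith
  qed (simp only: 3(3) norm_tube_map)
  have b: "3/16 < norm (z - 1/2)" "1/4 <= norm (w + 1/2)" using z w 3 ij by (auto simp: collar_def disc_piece_def)
  have "norm (w + 1/2) < 1/3" unfolding n(1) using b(1) n(2) by (simp add: field_simps)
  moreover have "norm (z - 1/2) < 1/3" using b(2) n(2) unfolding n(1) by (simp add: field_simps)
  ultimately show ?thesis using 3 n by auto
 next
  case 4
  have n: "norm (z + 1/2) = 1 / (16 * norm (w - 1/2))" "0 < norm (w - 1/2)"
  proof -
   have "5/32 < norm (w - 1/2)" using 4(2) unfolding right_annulus_def by (simp only: mem_Collect_eq)
   then show "0 < norm (w - 1/2)" by linarith
  qed (simp only: 4(3) norm_tube_map)
  have b: "3/16 < norm (z + 1/2)" "1/4 <= norm (w - 1/2)" using z w 4 ij by (auto simp: collar_def disc_piece_def)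
  have "norm (z + 1/2) < 1/3" unfolding n(1) using b(2) n(2) by (simp add: field_simps)
  moreover have "norm (w - 1/2) < 1/3" using b(1) n(2) unfolding n(1) by (simp add: field_simps)
  ultimately show ?thesis using 4 n by auto
 qed auto
qed

text \<open>The value is determined only up to conjugation, because the starting value of the
  selection differs from the chosen representative by an element of the group.\<close>

definition field_monodromy :: "('g::group_add => 'v::real_normed_vector => 'v) => (nat => complex => 'v set) => ((real => 'a) => 'g) => bool" where
 "field_monodromy op R \<Theta> \<longleftrightarrow> (ALL i u \<sigma> k. i < g --> pathin (top_of_set (disc_piece g i)) u --> p i (u 0) = p i (u 1) -->
   continuous_on {0..1} \<sigma> --> (ALL t:{0..1}. \<sigma> t \<in> R i (u t)) --> \<sigma> 1 = op k (\<sigma> 0) --> (EX a. \<Theta> (p i o u) = - a + k + a))"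

lemma field_monodromyD: "field_monodromy op R \<Theta> ==> i < g ==> pathin (top_of_set (disc_piece g i)) u ==> p i (u 0) = p i (u 1) ==>
  continuous_on {0..1} \<sigma> ==> (\<And>t. t \<in> {0..1} ==> \<sigma> t \<in> R i (u t)) ==> \<sigma> 1 = op k (\<sigma> 0) ==> EX a. \<Theta> (p i o u) = - a + k + a"
 unfolding field_monodromy_def by blast

text \<open>Here \<open>R i z\<close> consists of the admissible values at \<open>p i z\<close>; they form part of one orbit.\<close>
theorem field_functional: fixes op :: "'g::group_add => 'v::real_normed_vector => 'v" and R :: "nat => complex => 'v set"
 assumes fin: "finite (UNIV :: 'g set)" and cont: "\<And>a. continuous_on UNIV (op a)"
  and op_add: "\<And>a b v. op (a + b) v = op a (op b v)" and op_zero: "\<And>v. op 0 v = v"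
  and free: "\<And>a v. v ~= 0 ==> op a v = v ==> a = 0" and R0: "\<And>i z. i < g ==> z \<in> collar g i ==> 0 ~: R i z"
  and sections: "\<And>i z. i < g ==> z \<in> collar g i ==>
   EX W \<sigma>. open W & z \<in> W & W \<subseteq> collar g i & continuous_on W \<sigma> & (ALL w:W. \<sigma> w \<in> R i w)"
  and orbit: "\<And>i z v v'. i < g ==> z \<in> collar g i ==> v \<in> R i z ==> v' \<in> R i z ==> EX k. v' = op k v"
  and antipodal: "\<And>i z v v'. i < g ==> z \<in> collar g i ==> 19/20 < norm z ==> 19/20 < norm (antipode z) ==>
   v \<in> R i z ==> v' \<in> R i (antipode z) ==> EX k. v' = op k v"
  and tubes: "\<And>i z v v'. Suc i < g ==> 0 < norm (z - 1/2) ==> norm (z - 1/2) < 1/3 ==> norm (tube_map z + 1/2) < 1/3 ==>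
   v \<in> R i z ==> v' \<in> R (Suc i) (tube_map z) ==> EX k. v' = op k v" obtains \<Theta> where "path_functional U \<Theta>" "field_monodromy op R \<Theta>"
proof -
 have inv: "EX k. v = op k v'" if "v' = op k v" for v v' k using that op_add[of "- k" k v] op_zero by (intro exI[of _ "- k"]) simp
 have ne: "EX v. v \<in> R i z" if "i < g" "z \<in> collar g i" for i z using sections[OF that] by blast
 define \<psi> where "\<psi> x = (SOME v. EX i<g. EX z:disc_piece g i. p i z = x & v \<in> R i z)" for x
 have \<psi>: "EX j<g. EX w:disc_piece g j. p j w = x & \<psi> x \<in> R j w" if x: "x \<in> topspace U" for x unfolding \<psi>_def
 proof (rule someI_ex)
  obtain j w where "j < g" "w \<in> disc_piece g j" "p j w = x" using chart_cover[OF x] by blast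
  moreover from this obtain v where "v \<in> R j w" using ne collar(3) by blast
  ultimately show "EX v. EX i<g. EX z:disc_piece g i. p i z = x & v \<in> R i z" by blast
 qed
 have R: "EX k. v = op k (\<psi> (p i z))" if i: "i < g" and z: "z \<in> collar g i" and v: "v \<in> R i z" for i z v
 proof -
  have "p i z \<in> topspace U" using chart_topspace i z collar(2) by blast
  from \<psi>[OF this] obtain j w where j: "j < g" "w \<in> disc_piece g j" "p j w = p i z" "\<psi> (p i z) \<in> R j w" by blast
  have wc: "w \<in> collar g j" using j(2) collar(3) by blast
  from collar_eq[OF i j(1) z j(2) j(3)[symmetric]] have "EX k. \<psi> (p i z) = op k v \<or> v = op k (\<psi> (p i z))"
  proof (elim disjE conjE, goal_cases)
   case 1
   have "\<psi> (p i z) \<in> R i z" using j(4) unfolding 1[symmetric] .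
   then show ?case using orbit[OF i z v] by blast
  next
   case 2
   have "\<psi> (p i z) \<in> R i (antipode z)" using j(4) unfolding 2(1,4)[symmetric] .
   moreover have "19/20 < norm (antipode z)" using 2(3,4) by (simp only:)
   ultimately show ?case using antipodal[OF i z 2(2) _ v] by blast
  next
   case 3
   have "\<psi> (p i z) \<in> R (Suc i) (tube_map z)" using j(4) unfolding 3(1,5) .
   moreover have "Suc i < g" "norm (tube_map z + 1/2) < 1/3" using j(1) 3(1,3,5) by (simp_all only:)
   ultimately show ?case using tubes[of i z v "\<psi> (p i z)"] v 3(2,4) by blast
  next
   case 4
   have "v \<in> R (Suc j) (tube_map w)" using v unfolding 4(1,5) .
   moreover have "Suc j < g" "norm (tube_map w + 1/2) < 1/3" using i 4(1,3,5) by (simp_all only:)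
   ultimately show ?case using tubes[of j w "\<psi> (p i z)" v] 4(2,4) j(4) by blast
  qed
  then show ?thesis using inv by blast
 qed
 obtain \<Theta> where \<Theta>: "path_functional U \<Theta>"
  "\<And>q \<sigma> a b. pathin U q ==> continuous_on {0..1} \<sigma> ==> (\<And>t. t \<in> {0..1} ==> EX k. \<sigma> t = op k (\<psi> (q t))) ==>
   \<sigma> 0 = op a (\<psi> (q 0)) ==> \<sigma> 1 = op b (\<psi> (q 1)) ==> \<Theta> q = - a + b"
 proof (rule torsor_functional[of op U \<psi>, OF fin cont op_add _ op_zero])
  fix a x assume x: "x \<in> topspace U" and a: "op a (\<psi> x) = \<psi> x"
  obtain j w where "j < g" "w \<in> disc_piece g j" "\<psi> x \<in> R j w" using \<psi>[OF x] by blast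
  then have "\<psi> x ~= 0" using R0[of j w] collar(3) by (metis subsetD)
  then show "a = 0" using free a by blast
 next
  fix x assume x: "x \<in> topspace U"
  obtain i z where i: "i < g" "z \<in> disc_piece g i" "p i z = x" using chart_cover[OF x] by blast
  have zc: "z \<in> collar g i" using i(2) collar(3) by blast
  obtain W \<sigma> where W: "open W" "z \<in> W" "W \<subseteq> collar g i" "continuous_on W \<sigma>" "\<And>w. w \<in> W ==> \<sigma> w \<in> R i w"
   using sections[OF i(1) zc] by blast
  have "z \<in> chart_dom g i" using zc collar(2) by blast
  from chart_ball[OF i(1) this W(1,2)] obtain e where e: "e > 0" "ball z e \<subseteq> chart_dom g i" "ball z e \<subseteq> W" "inj_on (p i) (ball z e)"
   "openin U (p i ` ball z e)" "p i z \<in> p i ` ball z e" .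
  have "continuous_map (top_of_set (ball z e)) euclidean \<sigma>" using continuous_on_subset[OF W(4) e(3)] by simp
  from continuous_map_compose[OF chart_section[OF i(1) open_ball e(2,4)] this]
  have "continuous_map (subtopology U (p i ` ball z e)) euclidean (\<sigma> o inv_into (ball z e) (p i))" .
  moreover have "EX k. (\<sigma> o inv_into (ball z e) (p i)) y = op k (\<psi> y)" if y: "y \<in> p i ` ball z e" for y
  proof -
   obtain w where w: "w \<in> ball z e" "y = p i w" using y by blast
   then have "inv_into (ball z e) (p i) y = w" using e(4) by simp
   moreover have "w \<in> W" "w \<in> collar g i" using w(1) e(3) W(3) by blast+
   ultimately show ?thesis using R[OF i(1) _ W(5), of w] w(2) by simp
  qed
  ultimately show "EX V \<sigma>. openin U V & x \<in> V & continuous_map (subtopology U V) euclidean \<sigma> & (ALL y:V. EX k. \<sigma> y = op k (\<psi> y))"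
   using e(5,6) i(3) by blast
 qed blast
 show ?thesis
 proof (rule that[OF \<Theta>(1)], unfold field_monodromy_def, intro allI impI)
  fix i u \<sigma> k
  assume i: "i < g" and u: "pathin (top_of_set (disc_piece g i)) u" "p i (u 0) = p i (u 1)" and \<sigma>: "continuous_on {0..1} \<sigma>"
   "ALL t:{0..1}. \<sigma> t \<in> R i (u t)" and k: "\<sigma> 1 = op k (\<sigma> 0)"
  have uc: "u t \<in> collar g i" if "t \<in> {0..1}" for t using u(1) that collar(3) unfolding pathin_top_of_set path_image_def by blast
  have R': "EX k. \<sigma> t = op k (\<psi> ((p i o u) t))" if "t \<in> {0..1}" for t using R[OF i uc[OF that] bspec[OF \<sigma>(2) that]] by simp
  obtain a where a: "\<sigma> 0 = op a (\<psi> ((p i o u) 0))" using R'[of 0] by auto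
  have "\<sigma> 1 = op (k + a) (\<psi> ((p i o u) 1))" using k a u(2) op_add by simp
  from \<Theta>(2)[OF pathin_chart_subset[OF i u(1) disc_piece_chart_dom] \<sigma>(1) R' a this]
  show "EX a. \<Theta> (p i o u) = - a + k + a" by (metis add.assoc)
 qed
qed

end

section \<open>Explicit fields on the surface\<close>

text \<open>Zero up to \<open>5/6 = 1/2 + 1/3\<close>, which covers the tube zones, and one from
  17/18 on, which is less than 19/20 and so covers the antipodal zone.\<close>

definition bump :: "complex => real" where "bump z = min 1 (max 0 (9 * (norm z - 5/6)))"

lemma bump: "0 <= bump z" "bump z <= 1" "19/20 < norm z ==> bump z = 1" "norm z <= 5/6 ==> bump z = 0" by (auto simp: bump_def)

lemma bump_tube: "norm (z - 1/2) < 1/3 ==> bump z = 0" "norm (z + 1/2) < 1/3 ==> bump z = 0" using norm_half_cases(1,2)[of z] by (auto intro!: bump(4))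

lemma continuous_bump [continuous_intros]: "continuous_on A f ==> continuous_on A (\<lambda>x. bump (f x))" unfolding bump_def by (intro continuous_intros)

text \<open>Up to a factor of two these are the horizontal coordinates of the stereographic image on
  the sphere, where \<open>antipode\<close> is the antipodal map.\<close>

lemma antipode_scaled: assumes "z ~= 0" shows "antipode z / of_real (1 + (norm (antipode z))\<^sup>2) = - (z / of_real (1 + (norm z)\<^sup>2))"
proof -
 have z: "cnj z ~= 0" "norm z > 0" using assms by auto
 have "antipode z = - (z / of_real ((norm z)\<^sup>2))" using z assms unfolding antipode_def complex_norm_square by (simp add: field_simps)
 moreover have "1 + (norm (antipode z))\<^sup>2 = (1 + (norm z)\<^sup>2) / (norm z)\<^sup>2" using z by (simp add: norm_antipode field_simps)
 ultimately show ?thesis using z by simp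
qed

lemma sgn_of_real_mult: "0 < r ==> sgn (of_real r * z) = sgn z" for z :: complex
 by (cases "z = 0") (simp_all add: sgn_div_norm norm_mult scaleR_conv_of_real field_simps)

lemma sgn_antipode: "sgn (antipode z) = - sgn z"
proof (cases "z = 0")
 case False
 then have "cnj z ~= 0" by simp
 then have "antipode z = of_real (1 / (norm z)\<^sup>2) * (- z)"
  using False unfolding antipode_def of_real_divide complex_norm_square by (simp add: field_simps)
 moreover have "0 < 1 / (norm z)\<^sup>2" using False by simp
 ultimately have "sgn (antipode z) = sgn (- z)" by (simp only: sgn_of_real_mult)
 then show ?thesis by (simp add: sgn_minus)
qed (simp add: antipode_def)

text \<open>Where the principal root meets its cut, the root of \<open>- A\<close> times
  \<open>\<i>\<close> is used.\<close>

lemma root_section: fixes A :: "'x::topological_space => complex" assumes S: "open S" "x \<in> S" and A: "continuous_on S A" "\<And>y. y \<in> S ==> A y ~= 0"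
 obtains W \<rho> where "open W" "x \<in> W" "W \<subseteq> S" "continuous_on W \<rho>" "\<And>y. y \<in> W ==> (\<rho> y)\<^sup>2 = A y"
proof (cases "A x \<in> \<real>\<^sub>\<le>\<^sub>0")
 case False
 let ?W = "S \<inter> A -` (- \<real>\<^sub>\<le>\<^sub>0)"
 have "open ?W" by (rule continuous_open_preimage[OF A(1) S(1)]) (simp add: open_Compl closed_nonpos_Reals_complex)
 moreover have "continuous_on ?W (\<lambda>y. csqrt (A y))" by (rule continuous_on_compose2[OF continuous_on_csqrt continuous_on_subset[OF A(1)]]) auto
 ultimately show ?thesis using S(2) False by (intro that[of ?W "\<lambda>y. csqrt (A y)"]) auto
next
 case True
 have "- A x ~: \<real>\<^sub>\<le>\<^sub>0" using True A(2)[OF S(2)] by (auto simp: complex_nonpos_Reals_iff complex_eq_iff)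
 let ?W = "S \<inter> (\<lambda>y. - A y) -` (- \<real>\<^sub>\<le>\<^sub>0)"
 have "open ?W" by (rule continuous_open_preimage[OF continuous_on_minus[OF A(1)] S(1)]) (simp add: open_Compl closed_nonpos_Reals_complex)
 moreover have "continuous_on ?W (\<lambda>y. \<i> * csqrt (- A y))"
  by (intro continuous_on_mult continuous_on_const continuous_on_compose2[OF continuous_on_csqrt continuous_on_minus[OF continuous_on_subset[OF A(1)]]]) auto
 ultimately show ?thesis using S(2) \<open>- A x ~: \<real>\<^sub>\<le>\<^sub>0\<close>
  by (intro that[of ?W "\<lambda>y. \<i> * csqrt (- A y)"]) (auto simp: power_mult_distrib)
qed

text \<open>The unit quaternion that rotates by the argument of \<open>\<rho>\<^sup>2\<close> about an axis given by the unit complex number \<open>n\<close>.\<close>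
definition spinor :: "complex => complex => complex \<times> complex" where
 "spinor \<rho> n = (Complex (Re \<rho>) (Re n * Im \<rho>), of_real (Im n * Im \<rho>))"

lemma square_eq_iff: "\<rho>'\<^sup>2 = \<rho>\<^sup>2 \<longleftrightarrow> \<rho>' = \<rho> \<or> \<rho>' = - \<rho>" "\<rho>'\<^sup>2 = - \<rho>\<^sup>2 \<longleftrightarrow> \<rho>' = \<i> * \<rho> \<or> \<rho>' = - (\<i> * \<rho>)" for \<rho> :: complex
 using power2_eq_iff[of \<rho>' \<rho>] power2_eq_iff[of \<rho>' "\<i> * \<rho>"] by (auto simp: power_mult_distrib)

lemma spinor_same: assumes "\<rho>'\<^sup>2 = \<rho>\<^sup>2" shows "EX s. spinor \<rho>' n = spin_act (Q8 s 0 0) (spinor \<rho> n)"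
 using assms unfolding square_eq_iff
proof
 assume "\<rho>' = \<rho>" then show ?thesis by (intro exI[of _ 0]) (simp add: spin_act_def sign_act_def)
next
 assume "\<rho>' = - \<rho>" then show ?thesis by (intro exI[of _ 1]) (simp add: spin_act_def sign_act_def spinor_def complex_eq_iff)
qed

text \<open>For the axes 1 and \<open>\<i>\<close> the spinor is \<rho> placed in the plane of
  quaternions spanned by 1 and \<open>i\<close>, or by 1 and \<open>j\<close>. There a quarter turn
  of \<rho> is left multiplication by \<open>i\<close>, or by \<open>j\<close>.\<close>

lemma spinor_opposite: assumes "\<rho>'\<^sup>2 = - \<rho>\<^sup>2"
 shows "EX s. spinor \<rho>' 1 = spin_act (Q8 s 0 1) (spinor \<rho> 1)" "EX s. spinor \<rho>' \<i> = spin_act (Q8 s 1 0) (spinor \<rho> \<i>)"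
proof -
 from assms have "\<rho>' = \<i> * \<rho> \<or> \<rho>' = - (\<i> * \<rho>)" unfolding square_eq_iff .
 then have "(spinor \<rho>' 1 = spin_act (Q8 0 0 1) (spinor \<rho> 1) & spinor \<rho>' \<i> = spin_act (Q8 0 1 0) (spinor \<rho> \<i>)) \<or>
  (spinor \<rho>' 1 = spin_act (Q8 1 0 1) (spinor \<rho> 1) & spinor \<rho>' \<i> = spin_act (Q8 1 1 0) (spinor \<rho> \<i>))"
  by (auto simp: spin_act_def sign_act_def spinor_def complex_eq_iff)
 then show "EX s. spinor \<rho>' 1 = spin_act (Q8 s 0 1) (spinor \<rho> 1)" "EX s. spinor \<rho>' \<i> = spin_act (Q8 s 1 0) (spinor \<rho> \<i>)" by blast+
qed

lemma continuous_spinor: assumes "continuous_on S f" "continuous_on S h" shows "continuous_on S (\<lambda>x. spinor (f x) (h x))"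
 unfolding spinor_def Complex_eq by (intro continuous_intros assms)

lemma spinor_nonzero: "\<rho> ~= 0 ==> n ~= 0 ==> spinor \<rho> n ~= 0" by (auto simp: spinor_def complex_eq_iff zero_prod_def)

text \<open>Collapses the zone of the right tube to the point 1/2, so that fields composed with it
  are constant there and extend as constants to the later copies. It is the identity from
  \<open>4/9 = 1/3 + 1/9\<close> on, which includes the zone of the left tube and the antipodal
  zone.\<close>

definition shrink :: "complex => complex" where "shrink w = 1/2 + (w - 1/2) * of_real (min 1 (max 0 (9 * (norm (w - 1/2) - 1/3))))"

lemma shrink: "norm (w - 1/2) < 1/3 ==> shrink w = 1/2" "4/9 <= norm (w - 1/2) ==> shrink w = w" by (simp_all add: shrink_def max_def min_def)

text \<open>The contraction towards 1/2 cannot increase the distance from 1/2, and at distance 4/9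
  or more it does not move points; -1/2 has distance 1.\<close>

lemma shrink_avoids: "w ~= - 1/2 ==> shrink w ~= - 1/2"
proof (cases "4/9 <= norm (w - 1/2)")
 case False
 define m where "m = min 1 (max 0 (9 * (norm (w - 1/2) - 1/3)))"
 have m: "\<bar>m\<bar> <= 1" by (auto simp: m_def)
 assume "w ~= - 1/2"
 show "shrink w ~= - 1/2"
 proof
  assume "shrink w = - 1/2"
  then have "1/2 + (w - 1/2) * of_real m = - 1/2" by (simp only: shrink_def m_def)
  moreover have "X = - 1" if "1/2 + X = - 1/2" for X :: complex using that by (simp add: complex_eq_iff)
  ultimately have "(w - 1/2) * of_real m = - 1" by blast
  then have "norm (w - 1/2) * \<bar>m\<bar> = 1" by (metis norm_minus_cancel norm_mult norm_of_real norm_one)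
  moreover have "norm (w - 1/2) * \<bar>m\<bar> <= norm (w - 1/2) * 1" using m by (intro mult_left_mono) auto
  ultimately show False using False by linarith
 qed
qed (simp add: shrink(2))

lemma continuous_shrink [continuous_intros]: "continuous_on A f ==> continuous_on A (\<lambda>x. shrink (f x))"
 unfolding shrink_def by (intro continuous_intros)

text \<open>Near the tube it is the direction from the hole of copy 0, near the unit circle the odd
  function \<open>z\<close>. Its only zero, 1/2, lies in the removed disc. In copy 1
  \<open>phase1\<close> continues it, because the tube map is an inversion followed by a reflection;
  meanwhile \<open>axis1\<close> turns the axis from 1 at the tube to \<open>\<i>\<close> at the
  unit circle.\<close>

definition phase0 :: "complex => complex" where "phase0 z = z - of_real ((1 - bump z) / 2)"
definition phase1 :: "complex => complex" where "phase1 w = - cnj (w + of_real ((1 - bump w) / 2))"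
definition axis1 :: "complex => complex" where "axis1 w = of_real (max 0 (19/20 - norm w)) + \<i> * of_real (max 0 (norm (w + 1/2) - 1/3))"

lemma phase_nonzero: "z ~= 1/2 ==> phase0 z ~= 0" "z ~= - 1/2 ==> phase1 z ~= 0"
proof -
 have small: "bump z = 0" if "z = of_real e" "\<bar>e\<bar> <= 1/2" for e using that by (intro bump(4)) simp
 have b: "\<bar>(1 - bump z) / 2\<bar> <= 1/2" "\<bar>- ((1 - bump z) / 2)\<bar> <= 1/2" using bump(1,2)[of z] by auto
 {
  assume z: "z ~= 1/2"
  show "phase0 z ~= 0"
  proof
   assume "phase0 z = 0"
   then have e: "z = of_real ((1 - bump z) / 2)" by (simp add: phase0_def)
   with small[OF e b(1)] have "z = of_real (1/2)" by simp
   then show False using z by simp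
  qed
 next
  assume z: "z ~= - 1/2"
  show "phase1 z ~= 0"
  proof
   assume "phase1 z = 0"
   then have "z + of_real ((1 - bump z) / 2) = 0" unfolding phase1_def by (metis complex_cnj_zero_iff neg_equal_0_iff_equal)
   then have e: "z = of_real (- ((1 - bump z) / 2))" by (metis add_eq_0_iff2 of_real_minus)
   with small[OF e b(2)] have "z = of_real (- (1/2))" by simp
   then show False using z by simp
  qed
 }
qed

lemma axis1_nonzero: "axis1 w ~= 0" using norm_half_cases(8)[of w] by (auto simp: axis1_def complex_eq_iff max_def)

lemma conjugate_commutative: "- a + l + a = l" for a l :: "'g::ab_group_add" by simp

lemma q8_conjugate: "qa (- a + x + a) = qa x" "qb (- a + x + a) = qb x" for a x :: "'r::comm_ring q8" by (simp_all add: uminus_q8_def)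

text \<open>From copy 2 on these are the constants that copy 1 has at its right tube.\<close>

definition phase :: "nat => complex => complex" where "phase i z = sgn (if i = 0 then phase0 z else if i = 1 then phase1 (shrink z) else phase1 (1/2))"
definition rotation_axis :: "nat => complex => complex" where "rotation_axis i z = sgn (if i = 0 then 1 else if i = 1 then axis1 (shrink z) else axis1 (1/2))"

lemma phase_axis_nonzero: assumes "g >= 2" "z \<in> collar g i" shows "phase i z ~= 0" "rotation_axis i z ~= 0"
proof -
 have "z ~= 1/2" if "i = 0"
 proof
  assume e: "z = 1/2"
  have "3/16 < norm (z - 1/2)" using assms that unfolding collar_def by simp
  then have "3/16 < norm (0 :: complex)" unfolding e by (simp only: diff_self)
  then show False by simp
 qed
 moreover have "z ~= - 1/2" if "i = 1"
 proof
  assume e: "z = - 1/2"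
  have "3/16 < norm (z + 1/2)" using assms that unfolding collar_def by simp
  then show False unfolding e by simp
 qed
 then have "phase1 (shrink z) ~= 0" if "i = 1" using that shrink_avoids phase_nonzero(2) by blast
 ultimately show "phase i z ~= 0" using phase_nonzero by (auto simp: phase_def sgn_zero_iff)
 show "rotation_axis i z ~= 0" using axis1_nonzero by (auto simp: rotation_axis_def sgn_zero_iff)
qed

lemma phase_axis_continuous: assumes g: "g >= 2" shows "continuous_on (collar g i) (phase i)" "continuous_on (collar g i) (rotation_axis i)"
proof -
 have nz: "phase i z ~= 0" "rotation_axis i z ~= 0" if "z \<in> collar g i" for z using phase_axis_nonzero[OF g that] by auto
 have 0: "continuous_on (collar g i) (\<lambda>z. sgn (phase0 z))" if "i = 0"
  by (rule continuous_on_sgn) (use nz that in "auto simp: phase0_def[abs_def] phase_def sgn_zero_iff intro!: continuous_intros")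
 have 1: "continuous_on (collar g i) (\<lambda>z. sgn (phase1 (shrink z)))" if "i = 1"
  by (rule continuous_on_sgn) (use nz that in "auto simp: phase1_def[abs_def] phase_def sgn_zero_iff intro!: continuous_intros")
 have 2: "continuous_on (collar g i) (\<lambda>z. sgn (axis1 (shrink z)))"
  by (rule continuous_on_sgn) (use axis1_nonzero in "auto simp: axis1_def[abs_def] intro!: continuous_intros")
 show "continuous_on (collar g i) (phase i)" using 0 1 by (cases "i = 0"; cases "i = 1") (simp_all add: phase_def[abs_def])
 show "continuous_on (collar g i) (rotation_axis i)" using 2 by (cases "i = 0"; cases "i = 1") (simp_all add: rotation_axis_def[abs_def])
qed

lemma phase_axis_antipode: assumes "19/20 < norm z" "19/20 < norm (antipode z)"
 shows "i <= 1 ==> phase i (antipode z) = - phase i z" "i >= 2 ==> phase i (antipode z) = phase i z"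
  "i = 0 ==> rotation_axis i z = 1" "i = 1 ==> rotation_axis i z = \<i>" "i >= 2 ==> rotation_axis i (antipode z) = rotation_axis i z"
proof -
 have sh: "shrink w = w" if "19/20 < norm w" for w using that norm_half_cases(7)[of w] by (intro shrink(2)) linarith
 have p0: "phase 0 w = sgn w" and p1: "phase 1 w = - cnj (sgn w)" if "19/20 < norm w" for w
  using that by (simp_all add: phase_def phase0_def phase1_def bump(3) sh sgn_minus) (simp add: sgn_div_norm scaleR_conv_of_real)
 show "phase i (antipode z) = - phase i z" if "i <= 1"
 proof -
  have "i = 0 \<or> i = 1" using that by auto
  then show ?thesis using p0[OF assms(1)] p0[OF assms(2)] p1[OF assms(1)] p1[OF assms(2)] by (auto simp: sgn_antipode)
 qed
 show "i >= 2 ==> phase i (antipode z) = phase i z" "i >= 2 ==> rotation_axis i (antipode z) = rotation_axis i z" by (simp_all add: phase_def rotation_axis_def)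
 show "i = 0 ==> rotation_axis i z = 1" by (simp add: rotation_axis_def)
 show "rotation_axis i z = \<i>" if "i = 1"
 proof -
  have "axis1 z = of_real (norm (z + 1/2) - 1/3) * \<i>" "0 < norm (z + 1/2) - 1/3" using assms(1) norm_half_cases(8)[of z] by (simp_all add: axis1_def max_def)
  then have "sgn (axis1 z) = sgn \<i>" by (simp only: sgn_of_real_mult)
  then show ?thesis using that sh[OF assms(1)] by (simp add: rotation_axis_def sgn_div_norm)
 qed
qed

text \<open>Between copies 0 and 1 both phases are positive multiples of \<open>z - 1/2\<close>, so
  they agree after normalisation. Beyond copy 1 everything is constant near the tubes.\<close>

lemma phase_axis_tube: assumes "0 < norm (z - 1/2)" "norm (z - 1/2) < 1/3" "norm (tube_map z + 1/2) < 1/3"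
 shows "phase (Suc i) (tube_map z) = phase i z & rotation_axis (Suc i) (tube_map z) = rotation_axis i z"
proof -
 let ?w = "tube_map z"
 have "norm (?w - 1/2) >= 4/9" using assms(3) norm_half_cases(6)[of ?w] by linarith
 then have sw: "shrink ?w = ?w" by (rule shrink(2))
 have sz: "shrink z = 1/2" by (rule shrink(1)[OF assms(2)])
 have bz: "bump z = 0" "bump ?w = 0" using bump_tube assms by auto
 consider "i = 0" | "i = 1" | "i >= 2" by linarith
 then show ?thesis
 proof cases
  case 1
  have "phase1 ?w = of_real (1 / (16 * (norm (z - 1/2))\<^sup>2)) * (z - 1/2)"
  proof -
   have nz: "z - 1/2 ~= 0" using assms(1) unfolding zero_less_norm_iff .
   have cancel: "1 / (16 * cnj x) = x / (16 * (x * cnj x))" if "x ~= 0" for x :: complex using that by (simp add: field_simps)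
   have "phase1 ?w = 1 / (16 * cnj (z - 1/2))" unfolding phase1_def bz by (simp add: tube_map_def)
   also have "\<dots> = (z - 1/2) / (16 * ((z - 1/2) * cnj (z - 1/2)))" by (rule cancel[OF nz])
   also have "\<dots> = of_real (1 / (16 * (norm (z - 1/2))\<^sup>2)) * (z - 1/2)" unfolding complex_norm_square[symmetric] by simp
   finally show ?thesis .
  qed
  moreover have "0 < 1 / (16 * (norm (z - 1/2))\<^sup>2)" using assms(1) by simp
  ultimately have "sgn (phase1 ?w) = sgn (z - 1/2)" by (simp only: sgn_of_real_mult)
  moreover have "axis1 ?w = of_real (19/20 - norm ?w) * 1" "0 < 19/20 - norm ?w" using assms(3) norm_half_cases(2)[of ?w] by (simp_all add: axis1_def max_def)
  then have "sgn (axis1 ?w) = sgn 1" by (simp only: sgn_of_real_mult)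
  ultimately show ?thesis using 1 by (simp add: phase_def rotation_axis_def phase0_def bz sw)
 next
  case 2
  then show ?thesis unfolding phase_def rotation_axis_def sz by simp
 qed (simp add: phase_def rotation_axis_def)
qed

context surface
begin

lemma crosscap_disc_piece: "pathin (top_of_set (disc_piece g i)) (linepath (- \<i>) \<i>)"
proof -
 have "linepath (- \<i>) \<i> t \<in> disc_piece g i" if t: "t \<in> {0..1}" for t
 proof -
  have e: "linepath (- \<i>) \<i> t = Complex 0 (2 * t - 1)" by (simp add: linepath_def complex_eq_iff)
  have "norm (Complex 0 (2 * t - 1)) <= 1" using t by (simp add: cmod_def abs_le_iff)
  moreover have "1/2 <= norm (z + 1/2)" "1/2 <= norm (z - 1/2)" if "Re z = 0" for z using abs_Re_le_cmod[of "z + 1/2"] abs_Re_le_cmod[of "z - 1/2"] that by auto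
  from this[of "Complex 0 (2 * t - 1)"] have "1/4 <= norm (Complex 0 (2 * t - 1) + 1/2)" "1/4 <= norm (Complex 0 (2 * t - 1) - 1/2)" by simp_all
  ultimately show ?thesis unfolding e disc_piece_def by blast
 qed
 then show ?thesis by (auto simp: pathin_top_of_set path_image_def)
qed

text \<open>The sign monodromy of a field that is continuous up to sign and reverses only across
  crosscap \<open>k\<close>.\<close>

theorem crosscap_dual: assumes k: "k < g"
 obtains \<Theta> :: "(real => 'a) => bit" where "path_functional U \<Theta>" "\<And>i. i < g ==> \<Theta> (crosscap i) = (if i = k then 1 else 0)"
proof -
 \<comment> \<open>Near the tubes of copy \<open>k\<close> it is the constant \<open>(0, 1)\<close>,
   which continues to the other copies; near the unit circle its second entry vanishes and the first
   is odd under the antipodal map. In between at least one entry is nonzero.\<close>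
 define f :: "nat => complex => complex \<times> real" where
  "f i z = (if i = k then (of_real (bump z) * (z / of_real (1 + (norm z)\<^sup>2)), 1 - bump z) else (0, 1))" for i z
 have cf: "continuous_on S (f i)" for S i
 proof -
  have "1 + (norm z)\<^sup>2 ~= 0" for z :: complex using zero_le_power2[of "norm z"] by linarith
  then have "complex_of_real (1 + (norm z)\<^sup>2) ~= 0" for z :: complex by (metis of_real_eq_0_iff)
  then show ?thesis by (cases "i = k") (simp_all add: f_def[abs_def] continuous_intros del: of_real_add of_real_power)
 qed
 have far: "f i (antipode z) = - f i z" if "i = k" "19/20 < norm z" "19/20 < norm (antipode z)" for i z
 proof -
  have "z ~= 0" using that(2) by auto
  from antipode_scaled[OF this] show ?thesis using that by (simp add: f_def bump(3) del: of_real_add of_real_power)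
 qed
 have near: "f i z = (0, 1)" if "bump z = 0" for i z using that by (simp add: f_def)
 obtain \<Theta> where \<Theta>: "path_functional U \<Theta>" "field_monodromy sign_act (\<lambda>i z. {f i z}) \<Theta>"
 proof (rule field_functional[of sign_act "\<lambda>i z. {f i z}", OF finite_bit sign_act_rules(4,2,1)])
  show "a = 0" if "v ~= 0" "sign_act a v = v" for a and v :: "complex \<times> real" by (rule sign_act_rules(3)[OF that])
  show "0 ~: {f i z}" for i z
  proof -
   have "of_real (bump z) * (z / of_real (1 + (norm z)\<^sup>2)) ~= 0" if "bump z = 1"
   proof -
    have "z ~= 0" using that by (auto simp: bump_def)
    moreover have "1 + (norm z)\<^sup>2 ~= 0" using zero_le_power2[of "norm z"] by linarith
    then have "complex_of_real (1 + (norm z)\<^sup>2) ~= 0" by (metis of_real_eq_0_iff)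
    ultimately show ?thesis using that by (simp del: of_real_add of_real_power)
   qed
   then show ?thesis by (auto simp: f_def zero_prod_def)
  qed
  show "EX W \<sigma>. open W & z \<in> W & W \<subseteq> collar g i & continuous_on W \<sigma> & (ALL w:W. \<sigma> w \<in> {f i w})" if "z \<in> collar g i" for i z
   by (rule exI[of _ "collar g i"], rule exI[of _ "f i"]) (use that collar(1) cf in auto)
  show "EX l. v' = sign_act l v" if "v \<in> {f i z}" "v' \<in> {f i z}" for i z v v' by (rule exI[of _ 0]) (use that in "simp add: sign_act_def")
  show "EX l. v' = sign_act l v" if "19/20 < norm z" "19/20 < norm (antipode z)" "v \<in> {f i z}" "v' \<in> {f i (antipode z)}" for i z v v'
  proof (cases "i = k")
   case True
   then show ?thesis using far[OF True that(1,2)] that by (intro exI[of _ 1]) (simp add: sign_act_def)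
  next
   case False
   then show ?thesis using that by (intro exI[of _ 0]) (simp add: sign_act_def f_def)
  qed
  show "EX l. v' = sign_act l v" if "norm (z - 1/2) < 1/3" "norm (tube_map z + 1/2) < 1/3" "v \<in> {f i z}" "v' \<in> {f (Suc i) (tube_map z)}" for i z v v'
   using that near[OF bump_tube(1)[OF that(1)], of i] near[OF bump_tube(2)[OF that(2)], of "Suc i"] by (intro exI[of _ 0]) (simp add: sign_act_def)
 qed blast
 show ?thesis
 proof (rule that[OF \<Theta>(1)])
  fix i assume i: "i < g"
  define l :: bit where "l = (if i = k then 1 else 0)"
  have c: "continuous_on {0..1} (\<lambda>t. f i (linepath (- \<i>) \<i> t))"
   by (rule continuous_on_compose2[OF cf[of UNIV]]) (auto intro: continuous_on_linepath)
  have l: "f i (linepath (- \<i>) \<i> 1) = sign_act l (f i (linepath (- \<i>) \<i> 0))" by (simp add: f_def l_def sign_act_def bump_def)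
  have e: "p i (linepath (- \<i>) \<i> 0) = p i (linepath (- \<i>) \<i> 1)" using chart_minus[OF i, of \<i>] by simp
  have "EX a. \<Theta> (p i o linepath (- \<i>) \<i>) = - a + l + a" by (rule field_monodromyD[OF \<Theta>(2) i crosscap_disc_piece e c _ l]) simp
  then have "\<Theta> (crosscap i) = l" unfolding crosscap_def[symmetric] conjugate_commutative by blast
  then show "\<Theta> (crosscap i) = (if i = k then 1 else 0)" by (simp only: l_def)
 qed
qed

text \<open>Up to sign and conjugation the first two crosscaps go to \<open>i\<close> and
  \<open>j\<close>. The field consists of the spinors that rotate by \<open>phase\<close> about
  \<open>rotation_axis\<close>: the phase is reversed across crosscaps 0 and 1, where the axis is 1
  and \<open>\<i>\<close> respectively.\<close>

theorem quaternion_functional: assumes g: "g >= 2" obtains \<Theta> :: "(real => 'a) => bit q8" where "path_functional U \<Theta>"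
  "qa (\<Theta> (crosscap 0)) = 0" "qb (\<Theta> (crosscap 0)) = 1" "qa (\<Theta> (crosscap 1)) = 1" "qb (\<Theta> (crosscap 1)) = 0"
proof -
 define R where "R i z = {spinor \<rho> (rotation_axis i z) | \<rho>. \<rho>\<^sup>2 = phase i z}" for i z
 have same: "EX l. v' = spin_act l v" if "phase j w = phase i z" "rotation_axis j w = rotation_axis i z" and vR: "v \<in> R i z" "v' \<in> R j w" for i j z w v v'
 proof -
  obtain \<rho> \<rho>' where \<rho>: "v = spinor \<rho> (rotation_axis i z)" "\<rho>\<^sup>2 = phase i z" "v' = spinor \<rho>' (rotation_axis j w)" "\<rho>'\<^sup>2 = phase j w"
   using vR by (auto simp: R_def)
  then have "\<rho>'\<^sup>2 = \<rho>\<^sup>2" using that(1) by simp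
  from spinor_same[OF this, of "rotation_axis i z"] show ?thesis unfolding \<rho>(1,3) that(2) by blast
 qed
 have opp: "EX s. v' = spin_act (if i = 0 then Q8 s 0 1 else Q8 s 1 0) v"
  if "i <= 1" "19/20 < norm z" "19/20 < norm (antipode z)" and vR: "v \<in> R i z" "v' \<in> R i (antipode z)" for i z v v'
 proof -
  obtain \<rho> \<rho>' where \<rho>: "v = spinor \<rho> (rotation_axis i z)" "\<rho>\<^sup>2 = phase i z" "v' = spinor \<rho>' (rotation_axis i (antipode z))" "\<rho>'\<^sup>2 = phase i (antipode z)"
   using vR by (auto simp: R_def)
  have "\<rho>'\<^sup>2 = - \<rho>\<^sup>2" using phase_axis_antipode(1)[OF that(2,3,1)] \<rho>(2,4) by simp
  note o = spinor_opposite[OF this]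
  have "i = 0 \<or> i = 1" using that(1) by auto
  then show ?thesis
  proof
   assume "i = 0"
   then show ?thesis using o(1) phase_axis_antipode(3)[OF that(2,3)] phase_axis_antipode(3)[of "antipode z" i] that(2,3) \<rho>(1,3) by simp
  next
   assume "i = 1"
   then show ?thesis using o(2) phase_axis_antipode(4)[OF that(2,3)] phase_axis_antipode(4)[of "antipode z" i] that(2,3) \<rho>(1,3) by simp
  qed
 qed
 obtain \<Theta> where \<Theta>: "path_functional U \<Theta>" "field_monodromy spin_act R \<Theta>"
 proof (rule field_functional[of spin_act R, OF finite_q8 continuous_spin_act spin_act_add spin_act_zero])
  show "a = 0" if "v ~= 0" "spin_act a v = v" for a v by (rule spin_act_free[OF that])
  show "0 ~: R i z" if z: "z \<in> collar g i" for i z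
  proof
   assume "0 \<in> R i z"
   then obtain \<rho> where \<rho>: "0 = spinor \<rho> (rotation_axis i z)" "\<rho>\<^sup>2 = phase i z" by (auto simp: R_def)
   then have "\<rho> ~= 0" using phase_axis_nonzero(1)[OF g z] by auto
   then show False using spinor_nonzero[OF _ phase_axis_nonzero(2)[OF g z]] \<rho>(1) by metis
  qed
  show "EX W \<sigma>. open W & z \<in> W & W \<subseteq> collar g i & continuous_on W \<sigma> & (ALL w:W. \<sigma> w \<in> R i w)" if z: "z \<in> collar g i" for i z
  proof -
   obtain W \<rho> where W: "open W" "z \<in> W" "W \<subseteq> collar g i" "continuous_on W \<rho>" "\<And>y. y \<in> W ==> (\<rho> y)\<^sup>2 = phase i y"
    using root_section[OF collar(1) z phase_axis_continuous(1)[OF g] phase_axis_nonzero(1)[OF g]] by blast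
   have "continuous_on W (\<lambda>w. spinor (\<rho> w) (rotation_axis i w))"
    by (rule continuous_spinor[OF W(4) continuous_on_subset[OF phase_axis_continuous(2)[OF g] W(3)]])
   moreover have "ALL w:W. spinor (\<rho> w) (rotation_axis i w) \<in> R i w" using W(5) by (auto simp: R_def)
   ultimately show ?thesis using W(1-3) by (intro exI[of _ W] exI[of _ "\<lambda>w. spinor (\<rho> w) (rotation_axis i w)"]) simp
  qed
  show "EX l. v' = spin_act l v" if "v \<in> R i z" "v' \<in> R i z" for i z v v' by (rule same[OF _ _ that]) auto
  show "EX l. v' = spin_act l v" if "19/20 < norm z" "19/20 < norm (antipode z)" "v \<in> R i z" "v' \<in> R i (antipode z)" for i z v v'
  proof (cases "i <= 1")
   case True then show ?thesis using opp[OF True that] by blast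
  next
   case False
   then show ?thesis using same[OF phase_axis_antipode(2,5)[OF that(1,2)] that(3,4)] by simp
  qed
  show "EX l. v' = spin_act l v" if "0 < norm (z - 1/2)" "norm (z - 1/2) < 1/3" "norm (tube_map z + 1/2) < 1/3" "v \<in> R i z" "v' \<in> R (Suc i) (tube_map z)" for i z v v'
   using same[OF _ _ that(4,5)] phase_axis_tube[OF that(1-3), of i] by blast
 qed blast
 have val: "EX a s. \<Theta> (crosscap i) = - a + (if i = 0 then Q8 s 0 1 else Q8 s 1 0) + a" if i: "i <= 1" for i
 proof -
  have ig: "i < g" using i g by simp
  let ?l = "linepath (- \<i>) \<i>"
  \<comment> \<open>On the imaginary axis the phase has real part at most zero and does not vanish,
    so the principal root of its negative is continuous along the crosscap.\<close>
  define \<sigma> where "\<sigma> t = spinor (\<i> * csqrt (- phase i (?l t))) (rotation_axis i (?l t))" for t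
  have lc: "?l t \<in> collar g i" if "t \<in> {0..1}" for t using crosscap_disc_piece[of i] that collar(3) unfolding pathin_top_of_set path_image_def by blast
  have ln: "- phase i (?l t) ~: \<real>\<^sub>\<le>\<^sub>0" if t: "t \<in> {0..1}" for t
  proof -
   define y where "y = 2 * t - 1"
   have l: "?l t = Complex 0 y" by (simp add: linepath_def complex_eq_iff y_def)
   have "1/2 <= norm (Complex 0 y - 1/2)" using abs_Re_le_cmod[of "Complex 0 y - 1/2"] by simp
   then have "shrink (Complex 0 y) = Complex 0 y" by (intro shrink(2)) linarith
   moreover have "phase1 (Complex 0 y) = phase0 (Complex 0 y)" by (simp add: phase0_def phase1_def complex_eq_iff)
   ultimately have e: "phase i (?l t) = sgn (phase0 (Complex 0 y))" using i unfolding l by (cases "i = 0") (auto simp: phase_def)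
   define v where "v = phase0 (Complex 0 y)"
   have v: "Re v = - ((1 - bump (Complex 0 y)) / 2)" "Im v = y" unfolding v_def phase0_def
    by (simp_all only: minus_complex.sel complex.sel Re_complex_of_real Im_complex_of_real)
   have "sgn v ~= 0" using phase_axis_nonzero(1)[OF g lc[OF t]] unfolding e v_def .
   then have "v ~= 0" by (simp add: sgn_zero_iff)
   then have nv: "norm v > 0" by simp
   have s: "Re (sgn v) = Re v / norm v" "Im (sgn v) = Im v / norm v" by (simp_all add: sgn_div_norm divide_inverse mult.commute)
   show ?thesis
   proof
    assume "- phase i (?l t) \<in> \<real>\<^sub>\<le>\<^sub>0"
    then have 2: "0 <= Re v / norm v" "Im v / norm v = 0" unfolding e v_def[symmetric] complex_nonpos_Reals_iff s[symmetric] by auto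
    have "0 <= Re v" using 2(1) nv by (simp add: zero_le_divide_iff)
    have "y = 0" using 2(2) nv v(2) by simp
    have "bump (Complex 0 y) = 0" using \<open>y = 0\<close> by (intro bump(4)) (simp add: cmod_def)
    then show False using v(1) \<open>0 <= Re v\<close> by simp
   qed
  qed
  have "continuous_on {0..1} (\<lambda>t. phase i (?l t))"
   by (rule continuous_on_compose2[OF phase_axis_continuous(1)[OF g]]) (use lc in "auto intro: continuous_on_linepath")
  then have "continuous_on {0..1} (\<lambda>t. csqrt (- phase i (?l t)))"
   using ln by (intro continuous_on_compose2[OF continuous_on_csqrt] continuous_on_minus) auto
  moreover have "continuous_on {0..1} (\<lambda>t. rotation_axis i (?l t))"
   by (rule continuous_on_compose2[OF phase_axis_continuous(2)[OF g]]) (use lc in "auto intro: continuous_on_linepath")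
  ultimately have \<sigma>: "continuous_on {0..1} \<sigma>" unfolding \<sigma>_def[abs_def] by (intro continuous_spinor continuous_intros)
  have \<sigma>R: "\<sigma> t \<in> R i (?l t)" for t unfolding \<sigma>_def R_def by (auto simp: power_mult_distrib)
  have "antipode (- \<i>) = \<i>" by (simp add: antipode_def)
  then obtain s where "\<sigma> 1 = spin_act (if i = 0 then Q8 s 0 1 else Q8 s 1 0) (\<sigma> 0)"
   using opp[OF i, of "- \<i>" "\<sigma> 0" "\<sigma> 1"] \<sigma>R[of 0] \<sigma>R[of 1] by auto
  moreover have "p i (?l 0) = p i (?l 1)" using chart_minus[OF ig, of \<i>] by simp
  ultimately show ?thesis using field_monodromyD[OF \<Theta>(2) ig crosscap_disc_piece _ \<sigma> \<sigma>R] unfolding crosscap_def by blast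
 qed
 obtain a s a' s' where v: "\<Theta> (crosscap 0) = - a + Q8 s 0 1 + a" "\<Theta> (crosscap 1) = - a' + Q8 s' 1 0 + a'" using val[of 0] val[of 1] by auto
 show ?thesis by (rule that[OF \<Theta>(1)]) (simp_all only: v q8_conjugate q8.sel)
qed

lemma strand_loop: assumes j: "j < m" and \<gamma>: "pathin U \<gamma>" "\<gamma> 0 = \<gamma> 1"
  and e: "inj_on e ({..<m} - {j})" "e ` ({..<m} - {j}) \<subseteq> topspace U - \<gamma> ` {0..1}"
 obtains q where "pathin (ordered_config m U) q" "q 0 = q 1" "\<And>t. q t = restrict (\<lambda>k. if k = j then \<gamma> t else e k) {..<m}"
proof -
 let ?a = "\<lambda>k t. if k = j then \<gamma> t else e k"
 have "pathin (ordered_config m U) (\<lambda>t. restrict (\<lambda>k. ?a k t) {..<m})" unfolding pathin_def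
 proof (rule continuous_map_ordered)
  show "continuous_map (top_of_set {0..1}) U (?a k)" if "k < m" for k using \<gamma>(1) e(2) that by (cases "k = j") (auto simp: pathin_def)
  show "inj_on (\<lambda>k. ?a k t) {..<m}" if t: "t \<in> topspace (top_of_set {0..1})" for t
  proof -
   have "\<gamma> t \<in> \<gamma> ` {0..1}" using t by simp
   then have "\<gamma> t ~= e k" "e k ~= \<gamma> t" if "k < m" "k ~= j" for k using e(2) that by auto
   then show ?thesis using e(1) by (auto simp: inj_on_def)
  qed
 qed
 then show ?thesis by (rule that) (simp_all only: \<gamma>(2))
qed

lemma crosscap_strand: assumes j: "j < m" and r: "r < g"
 shows "EX q. pathin (ordered_config m U) q & q 0 = q 1 & (ALL t. q t j = crosscap r t & (ALL k<m. k ~= j --> q t k = q 0 k))"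
proof -
 obtain T where T: "base (Suc m) T" using exists_base[of "Suc m"] j by auto
 have "Suc (card T) = m" using T by (simp add: base_def)
 then have "card ({..<m} - {j}) = card T" using j by auto
 then obtain e where e: "bij_betw e ({..<m} - {j}) T" using T by (metis base_def finite_Diff finite_lessThan finite_same_card_bij)
 have "crosscap r t ~: T" if t: "t \<in> {0..1}" for t
 proof -
  have "linepath (- \<i>) \<i> t = Complex 0 (2 * t - 1)" by (simp add: linepath_def complex_eq_iff)
  moreover have "\<bar>2 * t - 1\<bar> <= 1" using t by auto
  ultimately have "linepath (- \<i>) \<i> t \<in> strip" "norm (linepath (- \<i>) \<i> t) <= 1" by (simp_all add: strip_def cmod_def)
  then show ?thesis using base_avoids[OF T r] by (simp add: crosscap_def)
 qed
 then have "crosscap r ` {0..1} \<inter> T = {}" by auto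
 moreover have "e ` ({..<m} - {j}) = T" "T \<subseteq> topspace U" using e T by (simp_all add: bij_betw_def base_def)
 ultimately have "e ` ({..<m} - {j}) \<subseteq> topspace U - crosscap r ` {0..1}" by blast
 moreover have "inj_on e ({..<m} - {j})" using e by (simp add: bij_betw_def)
 ultimately obtain q where q: "pathin (ordered_config m U) q" "q 0 = q 1"
  "\<And>t. q t = restrict (\<lambda>k. if k = j then crosscap r t else e k) {..<m}" using strand_loop[OF j crosscap_loop[OF r]] by blast
 show ?thesis by (rule exI[of _ q]) (use q(1,2) j in "simp add: q(3)")
qed

end

section \<open>Two points of the projective plane\<close>

text \<open>The argument of \<open>cnj (w - z) * (1 + cnj z * w)\<close> is minus that of the image of \<open>w\<close> under the rotation of the sphere that moves \<open>z\<close> to \<open>0\<close>.\<close>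
definition two_point :: "complex => complex => complex" where "two_point z w = cnj (w - z) * (1 + cnj z * w)"

text \<open>A lift of a frame to the unit quaternions: the quaternion \<open>(1, z)\<close>,
  normalised, stands for the rotation that moves \<open>z\<close> to 0, and \<nu>, a square root of
  the direction of \<open>two_point\<close>, for the remaining turn about that axis. Changing a
  point to its antipode changes the frame by signs, hence the lift by an element of the quaternion
  group.\<close>

definition pair_spinor :: "complex => complex => complex \<times> complex" where
 "pair_spinor \<nu> z = (\<nu> / of_real (sqrt (1 + (norm z)\<^sup>2)), \<nu> * z / of_real (sqrt (1 + (norm z)\<^sup>2)))"

lemma sqrt_pos: "0 < sqrt (1 + (norm z)\<^sup>2)" for z :: complex by (simp add: add_pos_nonneg)

lemma two_point_nonzero: assumes "w ~= z" "z = 0 \<or> w ~= antipode z" shows "two_point z w ~= 0"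
proof -
 have "1 + cnj z * w ~= 0"
 proof
  assume "1 + cnj z * w = 0"
  then have e: "cnj z * w = - 1" by (simp add: add_eq_0_iff)
  then have "z ~= 0" by auto
  then have "w = antipode z" using e unfolding antipode_def by (simp add: field_simps)
  with \<open>z ~= 0\<close> assms(2) show False by simp
 qed
 then show ?thesis using assms(1) by (simp add: two_point_def)
qed

lemma two_point_antipode_right: assumes "w ~= 0" shows "two_point z (antipode w) = of_real (1 / (norm w)\<^sup>2) * (- two_point z w)"
proof -
 have "cnj w ~= 0" using assms by simp
 then show ?thesis using assms unfolding two_point_def antipode_def of_real_divide complex_norm_square by (simp add: field_simps)
qed

lemma two_point_antipode_left: assumes "z ~= 0" shows "two_point (antipode z) w = (- 1 / z\<^sup>2) * cnj (two_point z w)"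
proof -
 have "cnj z ~= 0" using assms by simp
 then show ?thesis using assms unfolding two_point_def antipode_def by (simp add: field_simps power2_eq_square)
qed

lemma sgn_cnj: "sgn (cnj z) = cnj (sgn z)" by (simp add: sgn_div_norm scaleR_conv_of_real)

lemma pair_spinor_same: assumes "\<nu>'\<^sup>2 = \<nu>\<^sup>2" shows "EX s. pair_spinor \<nu>' z = spin_act (Q8 s 0 0) (pair_spinor \<nu> z)"
 using assms unfolding square_eq_iff
proof
 assume "\<nu>' = \<nu>" then show ?thesis by (intro exI[of _ 0]) (simp add: spin_act_def sign_act_def)
next
 assume "\<nu>' = - \<nu>" then show ?thesis by (intro exI[of _ 1]) (simp add: spin_act_def sign_act_def pair_spinor_def)
qed

lemma pair_spinor_right: assumes "w ~= 0" "\<nu>\<^sup>2 = sgn (two_point z w)" "\<nu>'\<^sup>2 = sgn (two_point z (antipode w))"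
 shows "EX s. pair_spinor \<nu>' z = spin_act (Q8 s 0 1) (pair_spinor \<nu> z)"
proof -
 have "0 < 1 / (norm w)\<^sup>2" using assms(1) by simp
 then have "\<nu>'\<^sup>2 = - \<nu>\<^sup>2" unfolding assms(2,3) two_point_antipode_right[OF assms(1)] by (simp only: sgn_of_real_mult sgn_minus)
 then have "\<nu>' = \<i> * \<nu> \<or> \<nu>' = - (\<i> * \<nu>)" unfolding square_eq_iff .
 then show ?thesis
 proof
  assume "\<nu>' = \<i> * \<nu>" then show ?thesis by (intro exI[of _ 0]) (simp add: spin_act_def sign_act_def pair_spinor_def mult.assoc)
 next
  assume "\<nu>' = - (\<i> * \<nu>)" then show ?thesis by (intro exI[of _ 1]) (simp add: spin_act_def sign_act_def pair_spinor_def mult.assoc)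
 qed
qed

text \<open>Passing to the antipode of \<open>z\<close> conjugates \<open>two_point\<close> up to
  the factor \<open>- 1 / z^2\<close>, so the new root is \<nu> conjugated, turned by a quarter and
  by the direction of \<open>z\<close>.\<close>

lemma pair_spinor_left: assumes z: "z ~= 0" and "\<nu>\<^sup>2 = sgn (two_point z w)" "\<nu>'\<^sup>2 = sgn (two_point (antipode z) w)"
 shows "EX s. pair_spinor \<nu>' (antipode z) = spin_act (Q8 s 1 1) (pair_spinor \<nu> z)"
proof -
 let ?N = "of_real (norm z) :: complex" and ?S = "of_real (sqrt (1 + (norm z)\<^sup>2)) :: complex"
 have nz: "cnj z ~= 0" "norm z > 0" "?N ~= 0" using z by auto
 have N2: "?N * ?N = z * cnj z" using complex_norm_square[of z] by (simp add: power2_eq_square)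
 have S: "?S ~= 0" using sqrt_pos[of z] by (metis less_irrefl of_real_eq_0_iff)
 \<comment> \<open>\<nu>' with the direction of \<open>z\<close> removed. Then the new lift is a
   multiple of \<open>(\<mu> * cnj z, - \<mu>)\<close>, and \<open>\<mu> = \<i> * cnj \<nu>\<close>
   up to sign makes it the image of the old lift under \<open>j\<close> times
   \<open>i\<close>.\<close>
 define \<mu> where "\<mu> = \<nu>' * ?N / cnj z"
 have "sgn (- 1 / z\<^sup>2) = - (?N * ?N / z\<^sup>2)" using nz z by (simp add: sgn_div_norm norm_divide norm_mult scaleR_conv_of_real power2_eq_square)
 then have "\<nu>'\<^sup>2 = - (?N * ?N / z\<^sup>2) * cnj (\<nu>\<^sup>2)" unfolding assms(2,3) two_point_antipode_left[OF z] sgn_mult sgn_cnj by (simp only:)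
 then have "\<nu>'\<^sup>2 * (?N * ?N) / (cnj z * cnj z) = - (?N * ?N * (?N * ?N) / (z * cnj z)\<^sup>2) * cnj (\<nu>\<^sup>2)"
  using nz z by (simp add: power2_eq_square mult_ac)
 then have "\<mu>\<^sup>2 = - (?N * ?N * (?N * ?N) / (z * cnj z)\<^sup>2) * cnj (\<nu>\<^sup>2)"
  unfolding \<mu>_def by (simp add: power2_eq_square mult.assoc mult.left_commute mult.commute)
 also have "\<dots> = - (cnj \<nu>)\<^sup>2" unfolding N2 using z by (simp add: power2_eq_square)
 finally have \<mu>: "\<mu> = \<i> * cnj \<nu> \<or> \<mu> = - (\<i> * cnj \<nu>)" unfolding square_eq_iff .
 have "sqrt (1 + (norm (antipode z))\<^sup>2) = sqrt (1 + (norm z)\<^sup>2) / norm z"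
 proof -
  have "1 + (norm (antipode z))\<^sup>2 = (1 + (norm z)\<^sup>2) / (norm z)\<^sup>2" using nz by (simp add: norm_antipode field_simps)
  then show ?thesis by (simp add: real_sqrt_divide)
 qed
 then have S': "complex_of_real (sqrt (1 + (norm (antipode z))\<^sup>2)) = ?S / ?N" by simp
 have "\<nu>' / (?S / ?N) = \<mu> * cnj z / ?S" "\<nu>' * antipode z / (?S / ?N) = - \<mu> / ?S" using nz S by (simp_all add: \<mu>_def antipode_def)
 then have e: "pair_spinor \<nu>' (antipode z) = (\<mu> * cnj z / ?S, - \<mu> / ?S)" unfolding pair_spinor_def S' by simp
 show ?thesis using \<mu>
 proof
  assume "\<mu> = \<i> * cnj \<nu>" then show ?thesis unfolding e by (intro exI[of _ 0]) (simp add: spin_act_def sign_act_def pair_spinor_def mult.assoc)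
 next
  assume "\<mu> = - (\<i> * cnj \<nu>)" then show ?thesis unfolding e by (intro exI[of _ 1]) (simp add: spin_act_def sign_act_def pair_spinor_def mult.assoc)
 qed
qed

lemma pair_spinor_nonzero: "\<nu> ~= 0 ==> pair_spinor \<nu> z ~= 0" using sqrt_pos[of z] by (simp add: pair_spinor_def zero_prod_def)

lemma continuous_two_point: "continuous_on A f ==> continuous_on A h ==> continuous_on A (\<lambda>x. two_point (f x) (h x))"
 unfolding two_point_def by (intro continuous_intros)

lemma continuous_pair_spinor: assumes "continuous_on A f" "continuous_on A h" shows "continuous_on A (\<lambda>x. pair_spinor (f x) (h x))"
proof -
 have "complex_of_real (sqrt (1 + (norm z)\<^sup>2)) ~= 0" for z :: complex using sqrt_pos[of z] by (metis less_irrefl of_real_eq_0_iff)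
 then show ?thesis unfolding pair_spinor_def by (intro continuous_intros assms) auto
qed

lemma continuous_map_ordered_eval: "k < m ==> continuous_map (ordered_config m X) X (\<lambda>c. c k)"
 unfolding ordered_config_def by (intro continuous_map_from_subtopology continuous_map_product_projection) simp

context surface
begin

lemma chart_eq_disc: "i < g ==> z \<in> chart_dom g i ==> w \<in> chart_dom g i ==> p i z = p i w ==> w = z \<or> z ~= 0 & w = antipode z"
 using chart_eq[of i i z w] by (auto simp: chart_rel_def outer_annulus_def)

text \<open>In the projective plane there is no hole around 1/2, so one of the first two points can
  rest there while the other follows the crosscap; the remaining points come from a base
  set.\<close>

lemma pair_loop: assumes m: "m >= 2" and j: "j < 2" and g1: "g = 1"
 obtains q where "pathin (ordered_config m U) q" "q 0 = q 1" "\<And>t. q t j = crosscap 0 t" "\<And>t. q t (1 - j) = p 0 (1/2)"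
proof -
 have g: "0 < g" using g1 by simp
 obtain T where T: "base (Suc m) T" using exists_base[of "Suc m"] m by auto
 let ?x = "p 0 (1/2)"
 have half: "1/2 \<in> chart_dom g 0" using g1 by (simp add: chart_dom_def norm_divide)
 have cT: "finite T" "Suc (card T) = m" "T \<subseteq> topspace U" using T by (auto simp: base_def)
 have "card T - 1 <= card (T - {?x})" using cT(1) by (simp add: card_Diff_singleton_if)
 then have "m - 2 <= card (T - {?x})" using cT(2) by linarith
 then obtain T' where T': "T' \<subseteq> T - {?x}" "card T' = m - 2" "finite T'" by (rule obtain_subset_with_card_n)
 have "card ({..<m} - {0, 1}) = m - 2" using m by (subst card_Diff_subset) auto
 then obtain e where e: "bij_betw e ({..<m} - {0, 1}) T'" using T'(2,3) by (metis finite_Diff finite_lessThan finite_same_card_bij)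
 define e' where "e' k = (if k \<in> {0, 1} then ?x else e k)" for k
 have eT: "e k \<in> T'" if "k < m" "k ~: {0, 1}" for k using e that by (auto simp: bij_betw_def)
 have "inj_on e' ({..<m} - {j})"
 proof (rule inj_onI)
  fix k l assume kl: "k \<in> {..<m} - {j}" "l \<in> {..<m} - {j}" "e' k = e' l"
  have "?x ~: T'" using T'(1) by blast
  then have "k \<in> {0, 1} \<longleftrightarrow> l \<in> {0, 1}" using kl eT[of k] eT[of l] by (auto simp: e'_def split: if_splits)
  then show "k = l"
  proof (cases "k \<in> {0, 1}")
   case True
   then show ?thesis using kl j \<open>k \<in> {0, 1} \<longleftrightarrow> l \<in> {0, 1}\<close> by auto
  next
   case False
   then have "e k = e l" using kl(3) \<open>k \<in> {0, 1} \<longleftrightarrow> l \<in> {0, 1}\<close> unfolding e'_def by (simp only: if_False)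
   then show ?thesis using inj_onD[OF bij_betw_imp_inj_on[OF e], of k l] kl False \<open>k \<in> {0, 1} \<longleftrightarrow> l \<in> {0, 1}\<close> by blast
  qed
 qed
 moreover have "e' ` ({..<m} - {j}) \<subseteq> topspace U - crosscap 0 ` {0..1}"
 proof -
  have "crosscap 0 t ~: insert ?x T" if t: "t \<in> {0..1}" for t
  proof -
   have l: "linepath (- \<i>) \<i> t = Complex 0 (2 * t - 1)" by (simp add: linepath_def complex_eq_iff)
   moreover have "\<bar>2 * t - 1\<bar> <= 1" using t by auto
   ultimately have s: "linepath (- \<i>) \<i> t \<in> strip" "norm (linepath (- \<i>) \<i> t) <= 1" by (simp_all add: strip_def cmod_def)
   have "?x ~= p 0 (linepath (- \<i>) \<i> t)"
   proof
    assume "?x = p 0 (linepath (- \<i>) \<i> t)"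
    then have "1/2 = linepath (- \<i>) \<i> t" using s strip_chart_dom[of g 0] by (intro chart_inj_disc[OF g half]) (auto simp: norm_divide)
    then show False unfolding l by (simp add: complex_eq_iff)
   qed
   then show ?thesis using base_avoids[OF T g s] by (simp add: crosscap_def)
  qed
  then have "crosscap 0 ` {0..1} \<inter> insert ?x T = {}" by blast
  moreover have "insert ?x T \<subseteq> topspace U" using cT chart_topspace[OF g half] by blast
  moreover have "e' ` ({..<m} - {j}) \<subseteq> insert ?x T" using eT T'(1) by (auto simp: e'_def)
  ultimately show ?thesis by blast
 qed
 moreover have "j < m" using j m by simp
 ultimately obtain q where q: "pathin (ordered_config m U) q" "q 0 = q 1"
  "\<And>t. q t = restrict (\<lambda>k. if k = j then crosscap 0 t else e' k) {..<m}" using strand_loop[OF _ crosscap_loop[OF g]] by blast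
 show ?thesis
 proof (rule that[OF q(1,2)])
  show "q t j = crosscap 0 t" "q t (1 - j) = ?x" for t using j m by (auto simp: q(3) e'_def)
 qed
qed

text \<open>The admissible values at a configuration are the lifts for all coordinates of its first
  two points. They form part of one orbit, and the monodromy is read off when one of the two points
  runs through the crosscap and its coordinate becomes the antipode.\<close>

theorem quaternion_functional_pair: assumes m: "m >= 2" and g1: "g = 1"
 obtains \<Theta> :: "(real => nat => 'a) => bit q8" and q q' where "path_functional (ordered_config m U) \<Theta>"
  "pathin (ordered_config m U) q" "q 0 = q 1" "qa (\<Theta> q) = 1" "qb (\<Theta> q) = 1"
  "pathin (ordered_config m U) q'" "q' 0 = q' 1" "qa (\<Theta> q') = 0" "qb (\<Theta> q') = 1"
proof -
 let ?X = "ordered_config m U" and ?d = "chart_dom g 0"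
 have g: "0 < g" using g1 by simp
 have m01: "0 < m" "1 < m" using m by auto
 define R where "R c = {pair_spinor \<nu> z |\<nu> z w. z \<in> ?d & w \<in> ?d & p 0 z = c 0 & p 0 w = c 1 & \<nu>\<^sup>2 = sgn (two_point z w)}" for c :: "nat => 'a"
 have ne: "c 0 ~= c 1" "c 0 \<in> topspace U" "c 1 \<in> topspace U" if "c \<in> topspace ?X" for c
  using that m01 by (auto simp: topspace_ordered_config inj_on_def)
 have two: "two_point z w ~= 0" if "z \<in> ?d" "w \<in> ?d" "p 0 z ~= p 0 w" for z w
 proof (rule two_point_nonzero)
  show "w ~= z" using that by auto
  show "z = 0 \<or> w ~= antipode z"
  proof (rule ccontr)
   assume "\<not> ?thesis"
   then have a: "z ~= 0" "w = antipode z" by auto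
   then have "norm w * norm z = 1" by (simp add: norm_antipode)
   moreover have "norm z < 10/9" "norm w < 10/9" using that by (auto simp: chart_dom_def)
   ultimately have "9/10 < norm z"
   proof -
    assume h: "norm w * norm z = 1" "norm w < 10/9"
    show ?thesis
    proof (rule ccontr)
     assume "\<not> 9/10 < norm z"
     then have "norm w * norm z <= norm w * (9/10)" by (intro mult_left_mono) auto
     then show False using h by linarith
    qed
   qed
   then have "z \<in> outer_annulus" using \<open>norm z < 10/9\<close> by (simp add: outer_annulus_def)
   then show False using chart_antipode[OF g] a(2) that(3) by metis
  qed
 qed
 have R0: "0 ~: R c" if "c \<in> topspace ?X" for c
 proof
  assume "0 \<in> R c"
  then obtain \<nu> z w where h: "0 = pair_spinor \<nu> z" "z \<in> ?d" "w \<in> ?d" "p 0 z = c 0" "p 0 w = c 1" "\<nu>\<^sup>2 = sgn (two_point z w)"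
   unfolding R_def by blast
  have "sgn (two_point z w) ~= 0" using two[OF h(2,3)] ne(1)[OF that] h(4,5) by (simp add: sgn_zero_iff)
  then have "\<nu> ~= 0" using h(6) by auto
  then show False using pair_spinor_nonzero h(1) by metis
 qed
 have Rne: "EX v. v \<in> R c" if c: "c \<in> topspace ?X" for c
 proof -
  obtain z w where "z \<in> ?d" "p 0 z = c 0" "w \<in> ?d" "p 0 w = c 1" using chart_cover'[OF ne(2)[OF c]] chart_cover'[OF ne(3)[OF c]] g1 by auto
  moreover have "(csqrt (sgn (two_point z w)))\<^sup>2 = sgn (two_point z w)" by simp
  ultimately show ?thesis unfolding R_def by blast
 qed
 have orbit: "EX k. v' = spin_act k v" if v: "v \<in> R c" and v': "v' \<in> R c" for c v v'
 proof -
  obtain \<nu> z w where h: "v = pair_spinor \<nu> z" "z \<in> ?d" "w \<in> ?d" "p 0 z = c 0" "p 0 w = c 1" "\<nu>\<^sup>2 = sgn (two_point z w)"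
   using v unfolding R_def by blast
  obtain \<nu>' z' w' where h': "v' = pair_spinor \<nu>' z'" "z' \<in> ?d" "w' \<in> ?d" "p 0 z' = c 0" "p 0 w' = c 1" "\<nu>'\<^sup>2 = sgn (two_point z' w')"
   using v' unfolding R_def by blast
  \<comment> \<open>An intermediate lift: the coordinate of the second point is changed first, then
    that of the first point.\<close>
  define \<mu> where "\<mu> = csqrt (sgn (two_point z w'))"
  have \<mu>: "\<mu>\<^sup>2 = sgn (two_point z w')" by (simp add: \<mu>_def)
  have "w' = w \<or> w ~= 0 & w' = antipode w" using chart_eq_disc[OF g h(3) h'(3)] h(5) h'(5) by simp
  then have "EX k. pair_spinor \<mu> z = spin_act k (pair_spinor \<nu> z)"
  proof
   assume "w' = w"
   then show ?thesis using pair_spinor_same[of \<mu> \<nu> z] \<mu> h(6) by auto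
  next
   assume "w ~= 0 & w' = antipode w"
   then show ?thesis using pair_spinor_right[of w \<nu> z \<mu>] \<mu> h(6) by auto
  qed
  then obtain k where k: "pair_spinor \<mu> z = spin_act k (pair_spinor \<nu> z)" by blast
  have "z' = z \<or> z ~= 0 & z' = antipode z" using chart_eq_disc[OF g h(2) h'(2)] h(4) h'(4) by simp
  then have "EX l. pair_spinor \<nu>' z' = spin_act l (pair_spinor \<mu> z)"
  proof
   assume "z' = z"
   then show ?thesis using pair_spinor_same[of \<nu>' \<mu> z] \<mu> h'(6) by auto
  next
   assume "z ~= 0 & z' = antipode z"
   then show ?thesis using pair_spinor_left[of z \<mu> w' \<nu>'] \<mu> h'(6) by auto
  qed
  then obtain l where "pair_spinor \<nu>' z' = spin_act l (pair_spinor \<mu> z)" by blast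
  then have "v' = spin_act (l + k) v" unfolding h(1) h'(1) spin_act_add k by simp
  then show ?thesis by blast
 qed
 define \<psi> where "\<psi> c = (SOME v. v \<in> R c)" for c
 have \<psi>: "\<psi> c \<in> R c" if "c \<in> topspace ?X" for c unfolding \<psi>_def by (rule someI_ex[OF Rne[OF that]])
 have toR: "EX k. v = spin_act k (\<psi> c)" if "c \<in> topspace ?X" "v \<in> R c" for c v using orbit[OF \<psi>[OF that(1)] that(2)] .
 obtain \<Theta> where \<Theta>: "path_functional ?X \<Theta>"
  "\<And>q \<sigma> a b. pathin ?X q ==> continuous_on {0..1} \<sigma> ==> (\<And>t. t \<in> {0..1} ==> EX k. \<sigma> t = spin_act k (\<psi> (q t))) ==>
   \<sigma> 0 = spin_act a (\<psi> (q 0)) ==> \<sigma> 1 = spin_act b (\<psi> (q 1)) ==> \<Theta> q = - a + b"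
 proof (rule torsor_functional[of spin_act ?X \<psi>, OF finite_q8 continuous_spin_act spin_act_add _ spin_act_zero])
  show "a = 0" if "c \<in> topspace ?X" "spin_act a (\<psi> c) = \<psi> c" for a c
   by (rule spin_act_free[OF _ that(2)]) (use R0[OF that(1)] \<psi>[OF that(1)] in metis)
  fix c assume c: "c \<in> topspace ?X"
  obtain z w where zw: "z \<in> ?d" "p 0 z = c 0" "w \<in> ?d" "p 0 w = c 1" using chart_cover'[OF ne(2)[OF c]] chart_cover'[OF ne(3)[OF c]] g1 by auto
  let ?S = "(?d \<times> ?d) \<inter> (\<lambda>v. two_point (fst v) (snd v)) -` (- {0})"
  have cont: "continuous_on S (\<lambda>v. two_point (fst v) (snd v))" for S by (intro continuous_two_point continuous_intros)
  have oS: "open ?S" by (rule continuous_open_preimage[OF cont]) (simp_all add: open_Times open_annuli open_Compl)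
  have zS: "(z, w) \<in> ?S" using zw two[OF zw(1,3)] ne(1)[OF c] by simp
  have cS: "continuous_on ?S (\<lambda>v. sgn (two_point (fst v) (snd v)))" by (rule continuous_on_sgn[OF cont]) auto
  have nS: "sgn (two_point (fst v) (snd v)) ~= 0" if "v \<in> ?S" for v using that by (simp add: sgn_zero_iff)
  obtain W \<rho> where W: "open W" "(z, w) \<in> W" "W \<subseteq> ?S" "continuous_on W \<rho>" "\<And>v. v \<in> W ==> (\<rho> v)\<^sup>2 = sgn (two_point (fst v) (snd v))"
   using root_section[OF oS zS cS nS] by blast
  from open_prod_elim[OF W(1,2)] obtain A B where AB: "open A" "open B" "(z, w) \<in> A \<times> B" "A \<times> B \<subseteq> W" .
  have zA: "z \<in> A" "w \<in> B" using AB(3) by auto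
  from chart_ball[OF g zw(1) AB(1) zA(1)] obtain d where d: "d > 0" "ball z d \<subseteq> ?d" "ball z d \<subseteq> A" "inj_on (p 0) (ball z d)"
   "openin U (p 0 ` ball z d)" "p 0 z \<in> p 0 ` ball z d" .
  from chart_ball[OF g zw(3) AB(2) zA(2)] obtain e where e: "e > 0" "ball w e \<subseteq> ?d" "ball w e \<subseteq> B" "inj_on (p 0) (ball w e)"
   "openin U (p 0 ` ball w e)" "p 0 w \<in> p 0 ` ball w e" .
  define V where "V = {c \<in> topspace ?X. c 0 \<in> p 0 ` ball z d} \<inter> {c \<in> topspace ?X. c 1 \<in> p 0 ` ball w e}"
  have V: "openin ?X V" unfolding V_def by (intro openin_Int openin_continuous_map_preimage[OF continuous_map_ordered_eval] m01 d(5) e(5))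
  define f where "f c = (inv_into (ball z d) (p 0) (c 0), inv_into (ball w e) (p 0) (c 1))" for c :: "nat => 'a"
  have "continuous_map (subtopology ?X V) (subtopology U (p 0 ` ball z d)) (\<lambda>c. c 0)"
   "continuous_map (subtopology ?X V) (subtopology U (p 0 ` ball w e)) (\<lambda>c. c 1)"
   using continuous_map_from_subtopology[OF continuous_map_ordered_eval[OF m01(1)]] continuous_map_from_subtopology[OF continuous_map_ordered_eval[OF m01(2)]]
   by (auto simp: continuous_map_in_subtopology V_def)
  from continuous_map_compose[OF this(1) chart_section[OF g open_ball d(2,4)]] continuous_map_compose[OF this(2) chart_section[OF g open_ball e(2,4)]]
  have "continuous_map (subtopology ?X V) (prod_topology (top_of_set (ball z d)) (top_of_set (ball w e))) f"
   unfolding f_def[abs_def] by (intro continuous_map_pairedI) (simp_all add: o_def)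
  then have f: "continuous_map (subtopology ?X V) (top_of_set (ball z d \<times> ball w e)) f" by (simp only: prod_topology_subtopology_eu)
  have sub: "ball z d \<times> ball w e \<subseteq> W" using d(3) e(3) AB(4) by blast
  have "continuous_map (top_of_set (ball z d \<times> ball w e)) euclidean (\<lambda>v. pair_spinor (\<rho> v) (fst v))"
   unfolding continuous_map_iff_continuous by (intro continuous_pair_spinor continuous_intros continuous_on_subset[OF W(4) sub])
  from continuous_map_compose[OF f this]
  have cm: "continuous_map (subtopology ?X V) euclidean (\<lambda>c. pair_spinor (\<rho> (f c)) (fst (f c)))" by (simp add: o_def)
  have "EX k. pair_spinor (\<rho> (f y)) (fst (f y)) = spin_act k (\<psi> y)" if y: "y \<in> V" for y
  proof (rule toR)
   show "y \<in> topspace ?X" using y by (simp add: V_def)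
   have "f y \<in> ball z d \<times> ball w e" using f y V openin_subset[OF V] by (auto simp: continuous_map_def)
   moreover have "p 0 (fst (f y)) = y 0" "p 0 (snd (f y)) = y 1" using y by (simp_all add: V_def f_def f_inv_into_f)
   ultimately show "pair_spinor (\<rho> (f y)) (fst (f y)) \<in> R y"
    unfolding R_def using W(5)[of "f y"] sub d(2) e(2) by (intro CollectI exI[of _ "\<rho> (f y)"] exI[of _ "fst (f y)"] exI[of _ "snd (f y)"]) auto
  qed
  moreover have "c \<in> V" using c d(6) e(6) zw by (simp add: V_def)
  ultimately show "EX V \<sigma>. openin ?X V & c \<in> V & continuous_map (subtopology ?X V) euclidean \<sigma> & (ALL y:V. EX k. \<sigma> y = spin_act k (\<psi> y))"
   using V cm by (intro exI[of _ V] exI[of _ "\<lambda>c. pair_spinor (\<rho> (f c)) (fst (f c))"]) blast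
 qed blast
 have val: "qa (\<Theta> q) = qa k & qb (\<Theta> q) = qb k"
  if q: "pathin ?X q" "q 0 = q 1" and \<sigma>: "continuous_on {0..1} \<sigma>" "\<And>t. t \<in> {0..1} ==> \<sigma> t \<in> R (q t)" "\<sigma> 1 = spin_act k (\<sigma> 0)" for q \<sigma> k
 proof -
  have qX: "q t \<in> topspace ?X" if "t \<in> {0..1}" for t using q(1) that by (auto simp: pathin_def continuous_map_def)
  have R': "EX k. \<sigma> t = spin_act k (\<psi> (q t))" if "t \<in> {0..1}" for t using toR[OF qX[OF that] \<sigma>(2)[OF that]] .
  obtain a where a: "\<sigma> 0 = spin_act a (\<psi> (q 0))" using R'[of 0] by auto
  have "\<sigma> 1 = spin_act (k + a) (\<psi> (q 1))" using \<sigma>(3) a q(2) by (simp add: spin_act_add)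
  from \<Theta>(2)[OF q(1) \<sigma>(1) R' a this] have "\<Theta> q = - a + k + a" by (simp only: add.assoc)
  then show ?thesis by (simp only: q8_conjugate)
 qed
 let ?l = "linepath (- \<i>) \<i>"
 have l: "?l t = Complex 0 (2 * t - 1)" for t by (simp add: linepath_def complex_eq_iff)
 have ld: "?l t \<in> ?d" if t: "t \<in> {0..1}" for t
  using crosscap_disc_piece[of 0] that disc_piece_chart_dom unfolding pathin_top_of_set path_image_def by blast
 have half: "1/2 \<in> ?d" using g1 by (simp add: chart_dom_def norm_divide)
 have anti: "antipode (?l 0) = ?l 1" "?l 0 ~= 0" by (simp_all add: antipode_def)
 have re: "sgn v ~: \<real>\<^sub>\<le>\<^sub>0" if "0 < Re v \<or> 0 <= Re v & Im v ~= 0" for v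
 proof -
  have nv: "norm v > 0" using that by auto
  have s: "Re (sgn v) = Re v / norm v" "Im (sgn v) = Im v / norm v" by (simp_all add: sgn_div_norm divide_inverse mult.commute)
  show ?thesis unfolding complex_nonpos_Reals_iff s using that nv by (auto simp: divide_le_0_iff)
 qed
 have cl: "continuous_on {0..1} ?l" by (rule continuous_on_linepath)
 obtain q where q: "pathin ?X q" "q 0 = q 1" "\<And>t. q t 0 = crosscap 0 t" "\<And>t. q t 1 = p 0 (1/2)" using pair_loop[OF m _ g1, of 0] by auto
 obtain q' where q': "pathin ?X q'" "q' 0 = q' 1" "\<And>t. q' t 1 = crosscap 0 t" "\<And>t. q' t 0 = p 0 (1/2)" using pair_loop[OF m _ g1, of 1] by auto
 have "EX s. qa (\<Theta> q) = qa (Q8 s 1 1) & qb (\<Theta> q) = qb (Q8 s 1 1 :: bit q8)"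
 proof -
  \<comment> \<open>Along this loop \<open>two_point\<close> has positive real part, so the
    principal root is continuous.\<close>
  define \<rho> where "\<rho> t = csqrt (sgn (two_point (?l t) (1/2)))" for t
  have \<rho>2: "(\<rho> t)\<^sup>2 = sgn (two_point (?l t) (1/2))" for t by (simp add: \<rho>_def)
  have tp: "two_point (?l t) (1/2) = Complex ((1 + (2 * t - 1)\<^sup>2) / 2) (3 * (2 * t - 1) / 4)" for t
   unfolding l two_point_def by (simp add: complex_eq_iff power2_eq_square field_simps)
  have pos: "0 < Re (two_point (?l t) (1/2))" for t unfolding tp using zero_le_power2[of "2 * t - 1"] by (simp add: add_pos_nonneg)
  have "continuous_on {0..1} (\<lambda>t. sgn (two_point (?l t) (1/2)))"
  proof (rule continuous_on_sgn)
   show "ALL t:{0..1}. two_point (?l t) (1/2) ~= 0" using pos by (metis less_irrefl zero_complex.sel(1))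
  qed (intro continuous_two_point cl continuous_intros)
  then have "continuous_on {0..1} \<rho>" unfolding \<rho>_def[abs_def] by (rule continuous_on_compose2[OF continuous_on_csqrt]) (use re pos in auto)
  then have c: "continuous_on {0..1} (\<lambda>t. pair_spinor (\<rho> t) (?l t))" by (rule continuous_pair_spinor[OF _ cl])
  have r: "pair_spinor (\<rho> t) (?l t) \<in> R (q t)" if "t \<in> {0..1}" for t
   unfolding R_def using ld[OF that] half \<rho>2[of t] q(3,4) by (intro CollectI exI[of _ "\<rho> t"] exI[of _ "?l t"] exI[of _ "1/2"]) (simp add: crosscap_def)
  obtain s where "pair_spinor (\<rho> 1) (?l 1) = spin_act (Q8 s 1 1) (pair_spinor (\<rho> 0) (?l 0))"
   using pair_spinor_left[OF anti(2) \<rho>2[of 0], of "\<rho> 1"] \<rho>2[of 1] unfolding anti(1) by blast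
  from val[OF q(1,2) c r this] show ?thesis by blast
 qed
 moreover have "EX s. qa (\<Theta> q') = qa (Q8 s 0 1) & qb (\<Theta> q') = qb (Q8 s 0 1 :: bit q8)"
 proof -
  \<comment> \<open>Here it is the negative of \<open>two_point\<close> that stays off the cut: its
    real part is nonnegative, and at the ends, where that vanishes, the imaginary part does
    not.\<close>
  define \<rho> where "\<rho> t = \<i> * csqrt (sgn (- two_point (1/2) (?l t)))" for t
  have \<rho>2: "(\<rho> t)\<^sup>2 = sgn (two_point (1/2) (?l t))" for t by (simp add: \<rho>_def power_mult_distrib sgn_minus)
  have tp: "- two_point (1/2) (?l t) = Complex ((1 - (2 * t - 1)\<^sup>2) / 2) (5 * (2 * t - 1) / 4)" for t
   unfolding l two_point_def by (simp add: complex_eq_iff power2_eq_square field_simps)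
  have pos: "0 < Re (- two_point (1/2) (?l t)) \<or> 0 <= Re (- two_point (1/2) (?l t)) & Im (- two_point (1/2) (?l t)) ~= 0" if t: "t \<in> {0..1}" for t
  proof -
   have "\<bar>2 * t - 1\<bar> <= 1" using t by auto
   then have "(2 * t - 1)\<^sup>2 <= 1" by (simp add: abs_square_le_1)
   then show ?thesis unfolding tp by (cases "2 * t - 1 = 0") auto
  qed
  have "continuous_on {0..1} (\<lambda>t. sgn (- two_point (1/2) (?l t)))"
  proof (rule continuous_on_sgn)
   show "ALL t:{0..1}. - two_point (1/2) (?l t) ~= 0"
   proof
    fix t :: real assume "t \<in> {0..1}"
    from pos[OF this] show "- two_point (1/2) (?l t) ~= 0" by (metis less_irrefl zero_complex.sel)
   qed
  qed (intro continuous_on_minus continuous_two_point cl continuous_intros)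
  then have "continuous_on {0..1} (\<lambda>t. csqrt (sgn (- two_point (1/2) (?l t))))"
   by (rule continuous_on_compose2[OF continuous_on_csqrt]) (use re pos in blast)
  then have "continuous_on {0..1} \<rho>" unfolding \<rho>_def[abs_def] by (intro continuous_intros)
  then have c: "continuous_on {0..1} (\<lambda>t. pair_spinor (\<rho> t) (1/2))" by (rule continuous_pair_spinor) (rule continuous_on_const)
  have r: "pair_spinor (\<rho> t) (1/2) \<in> R (q' t)" if "t \<in> {0..1}" for t
   unfolding R_def using ld[OF that] half \<rho>2[of t] q'(3,4) by (intro CollectI exI[of _ "\<rho> t"] exI[of _ "1/2"] exI[of _ "?l t"]) (simp add: crosscap_def)
  obtain s where "pair_spinor (\<rho> 1) (1/2) = spin_act (Q8 s 0 1) (pair_spinor (\<rho> 0) (1/2))"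
   using pair_spinor_right[OF anti(2) \<rho>2[of 0], of "\<rho> 1"] \<rho>2[of 1] unfolding anti(1) by blast
  from val[OF q'(1,2) c r this] show ?thesis by blast
 qed
 ultimately show ?thesis using that[OF \<Theta>(1) q(1,2) _ _ q'(1,2)] by (metis q8.sel(2,3))
qed

text \<open>For \<open>g \<ge> 2\<close> one strand suffices and the others are forgotten. The
  fundamental group of the projective plane has order two, so for \<open>g = 1\<close> the second
  strand is essential. The second property says that the values on loops span both coordinates
  modulo the centre.\<close>

theorem quaternion_quotient: assumes m: "m >= 1" and gm: "\<not> (g = 1 & m = 1)"
 obtains \<Theta> :: "(real => nat => 'a) => bit q8" where "path_functional (ordered_config m U) \<Theta>"
  "\<And>\<alpha> \<beta>. \<alpha> ~= 0 \<or> \<beta> ~= 0 ==> EX q. pathin (ordered_config m U) q & q 0 = q 1 & \<alpha> * qa (\<Theta> q) + \<beta> * qb (\<Theta> q) ~= 0"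
proof (cases "g = 1")
 case True
 then have m2: "m >= 2" using m gm by auto
 obtain \<Theta> :: "(real => nat => 'a) => bit q8" and q q' where \<Theta>: "path_functional (ordered_config m U) \<Theta>"
  and q: "pathin (ordered_config m U) q" "q 0 = q 1" "qa (\<Theta> q) = 1" "qb (\<Theta> q) = 1"
  and q': "pathin (ordered_config m U) q'" "q' 0 = q' 1" "qa (\<Theta> q') = 0" "qb (\<Theta> q') = 1" using quaternion_functional_pair[OF m2 True] by blast
 show ?thesis
 proof (rule that[OF \<Theta>])
  fix \<alpha> \<beta> :: bit assume "\<alpha> ~= 0 \<or> \<beta> ~= 0"
  then have "\<alpha> * qa (\<Theta> q) + \<beta> * qb (\<Theta> q) ~= 0 \<or> \<alpha> * qa (\<Theta> q') + \<beta> * qb (\<Theta> q') ~= 0"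
   unfolding q(3,4) q'(3,4) by (cases \<alpha>; cases \<beta>; simp)
  then show "EX q. pathin (ordered_config m U) q & q 0 = q 1 & \<alpha> * qa (\<Theta> q) + \<beta> * qb (\<Theta> q) ~= 0" using q(1,2) q'(1,2) by blast
 qed
next
 case False
 then have g2: "g >= 2" using g_pos by simp
 obtain \<Theta> :: "(real => 'a) => bit q8" where \<Theta>: "path_functional U \<Theta>"
  "qa (\<Theta> (crosscap 0)) = 0" "qb (\<Theta> (crosscap 0)) = 1" "qa (\<Theta> (crosscap 1)) = 1" "qb (\<Theta> (crosscap 1)) = 0"
  using quaternion_functional[OF g2] by blast
 have m0: "0 < m" and g01: "0 < g" "1 < g" using m g2 by auto
 show ?thesis
 proof (rule that[OF pf_compose[OF \<Theta>(1) continuous_map_ordered_eval[OF m0]]])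
  fix \<alpha> \<beta> :: bit assume "\<alpha> ~= 0 \<or> \<beta> ~= 0"
  then obtain r where r: "r < g" "\<alpha> * qa (\<Theta> (crosscap r)) + \<beta> * qb (\<Theta> (crosscap r)) ~= 0"
  proof
   assume "\<alpha> ~= 0"
   then show ?thesis using that[of 1] g01 \<Theta>(4,5) by simp
  next
   assume "\<beta> ~= 0"
   then show ?thesis using that[of 0] g01 \<Theta>(2,3) by simp
  qed
  obtain q where q: "pathin (ordered_config m U) q" "q 0 = q 1" "\<And>t. q t 0 = crosscap r t" using crosscap_strand[OF m0 r(1)] by blast
  have "(\<lambda>c. c 0) o q = crosscap r" using q(3) by (simp add: fun_eq_iff)
  then show "EX q. pathin (ordered_config m U) q & q 0 = q 1 &
   \<alpha> * qa (\<Theta> ((\<lambda>c. c 0) o q)) + \<beta> * qb (\<Theta> ((\<lambda>c. c 0) o q)) ~= 0" using q(1,2) r(2) by (intro exI[of _ q]) simp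
 qed
qed

end

section \<open>Existence and non-existence of epimorphisms\<close>

lemma pf_whisker_loop: fixes \<Phi> :: "(real => 'a) => 'g::ab_group_add" assumes "path_functional X \<Phi>" "pathin X d" "pathin X q" "d 1 = q 0" "q 0 = q 1"
 shows "\<Phi> (whisker d q d) = \<Phi> q"
proof -
 have r: "pathin X (loop_reverse d)" using assms(2) by (rule pathin_loop_reverse)
 have "\<Phi> (whisker d q d) = \<Phi> d + (\<Phi> q + - \<Phi> d)" unfolding whisker_def
  using pf_concat[OF assms(1,2) pathin_loop_concat[OF assms(3) r]] pf_concat[OF assms(1,3) r] pf_reverse[OF assms(1,2)] assms(4,5) by simp
 then show ?thesis by simp
qed

text \<open>Reduces an epimorphism of groups to a map on loops, additive and surjective up to
  homotopy, so that no classes need to be handled.\<close>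

lemma epi_of_loop_map: assumes f: "\<And>p. loop_at X x p ==> loop_at Y y (f p)"
  and cong: "\<And>p q. loop_at X x p ==> path_homotopic X p q ==> path_homotopic Y (f p) (f q)"
  and concat: "\<And>p q. loop_at X x p ==> loop_at X x q ==> path_homotopic Y (f (loop_concat p q)) (loop_concat (f p) (f q))"
  and surj: "\<And>q. loop_at Y y q ==> EX p. loop_at X x p & path_homotopic Y (f p) q"
 shows "EX \<phi>. \<phi> \<in> epi (fundamental_group X x) (fundamental_group Y y)"
proof -
 define \<phi> where "\<phi> A = loop_class Y y (f (SOME p. loop_at X x p & A = loop_class X x p))" for A
 have \<phi>: "\<phi> (loop_class X x p) = loop_class Y y (f p)" if p: "loop_at X x p" for p
 proof -
  let ?q = "SOME q. loop_at X x q & loop_class X x p = loop_class X x q"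
  have q: "loop_at X x ?q" "loop_class X x p = loop_class X x ?q" using someI[of "\<lambda>q. loop_at X x q & loop_class X x p = loop_class X x q" p] p by auto
  then have "path_homotopic X p ?q" using loop_class_eq_iff[OF p q(1)] by blast
  then have "path_homotopic Y (f p) (f ?q)" by (rule cong[OF p])
  then show ?thesis using loop_class_eq_iff[OF f[OF p] f[OF q(1)]] by (simp add: \<phi>_def)
 qed
 have "\<phi> \<in> hom (fundamental_group X x) (fundamental_group Y y)"
 proof (rule homI)
  show "\<phi> A \<in> carrier (fundamental_group Y y)" if "A \<in> carrier (fundamental_group X x)" for A
   using that \<phi> f unfolding carrier_fundamental_group by blast
  fix A B assume "A \<in> carrier (fundamental_group X x)" "B \<in> carrier (fundamental_group X x)"
  then obtain p q where p: "A = loop_class X x p" "loop_at X x p" and q: "B = loop_class X x q" "loop_at X x q" unfolding carrier_fundamental_group by blast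
  note pq = loop_at_concat[OF p(2) q(2)]
  have "loop_class Y y (f (loop_concat p q)) = loop_class Y y (loop_concat (f p) (f q))"
   using loop_class_eq_iff[OF f[OF pq] loop_at_concat[OF f[OF p(2)] f[OF q(2)]]] concat[OF p(2) q(2)] by blast
  then show "\<phi> (A \<otimes>\<^bsub>fundamental_group X x\<^esub> B) = \<phi> A \<otimes>\<^bsub>fundamental_group Y y\<^esub> \<phi> B"
   unfolding p(1) q(1) mult_fundamental_group[OF p(2) q(2)] \<phi>[OF pq] \<phi>[OF p(2)] \<phi>[OF q(2)]
    mult_fundamental_group[OF f[OF p(2)] f[OF q(2)]] .
 qed
 moreover have "carrier (fundamental_group Y y) \<subseteq> \<phi> ` carrier (fundamental_group X x)"
 proof
  fix B assume "B \<in> carrier (fundamental_group Y y)"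
  then obtain q where q: "B = loop_class Y y q" "loop_at Y y q" unfolding carrier_fundamental_group by blast
  obtain p where p: "loop_at X x p" "path_homotopic Y (f p) q" using surj[OF q(2)] by blast
  have "B = \<phi> (loop_class X x p)" using loop_class_eq_iff[OF f[OF p(1)] q(2)] p(2) \<phi>[OF p(1)] q(1) by simp
  then show "B \<in> \<phi> ` carrier (fundamental_group X x)" using p(1) unfolding carrier_fundamental_group by blast
 qed
 ultimately show ?thesis by (auto simp: epi_def hom_def)
qed

text \<open>Change of base point along \<open>d\<close> is inverse to change along its reverse: the
  two copies of \<open>d\<close> cancel at both ends.\<close>

lemma whisker_section: assumes d: "pathin Y d" and q: "loop_at Y (d 0) q" shows "path_homotopic Y (whisker d (whisker (loop_reverse d) q (loop_reverse d)) d) q"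
proof -
 let ?r = "loop_reverse d" and ?c = "loop_concat"
 have q': "pathin Y q" "q 0 = d 0" "q 1 = d 0" using q by (auto simp: loop_at_def)
 have r: "pathin Y ?r" using d by (rule pathin_loop_reverse)
 note H = path_homotopic_refl and C = path_homotopic_concat
 have qd: "pathin Y (?c q d)" and qdr: "pathin Y (?c (?c q d) ?r)" and rq: "pathin Y (?c ?r q)" using d q' r by (auto intro!: pathin_loop_concat)
 have "path_homotopic Y (?c (?c ?r (?c q d)) ?r) (?c ?r (?c (?c q d) ?r))" by (rule path_homotopic_assoc[OF r qd r]) (use q' in simp_all)
 also have "path_homotopic Y (?c ?r (?c (?c q d) ?r)) (?c ?r (?c q (?c d ?r)))" by (rule C[OF H[OF r] path_homotopic_assoc[OF q'(1) d r]]) (use q' in simp_all)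
 also have "path_homotopic Y (?c ?r (?c q (?c d ?r))) (?c ?r (?c q (\<lambda>_. q 1)))"
  by (rule C[OF H[OF r] C[OF H[OF q'(1)]]]) (use path_homotopic_rinv[OF d] q' in simp_all)
 also have "path_homotopic Y (?c ?r (?c q (\<lambda>_. q 1))) (?c ?r q)" by (rule C[OF H[OF r] path_homotopic_rid[OF q'(1)]]) (use q' in simp_all)
 finally have 1: "path_homotopic Y (?c (?c ?r (?c q d)) ?r) (?c ?r q)" .
 have "path_homotopic Y (?c d (?c (?c ?r (?c q d)) ?r)) (?c d (?c ?r q))" by (rule C[OF H[OF d] 1]) simp
 also have "path_homotopic Y (?c d (?c ?r q)) (?c (?c d ?r) q)" by (rule path_homotopic_sym[OF path_homotopic_assoc[OF d r q'(1)]]) (use q' in simp_all)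
 also have "path_homotopic Y (?c (?c d ?r) q) (?c (\<lambda>_. q 0) q)" by (rule C[OF _ H[OF q'(1)]]) (use path_homotopic_rinv[OF d] q' in simp_all)
 also have "path_homotopic Y (?c (\<lambda>_. q 0) q) q" by (rule path_homotopic_lid[OF q'(1)])
 finally show ?thesis by (simp add: whisker_def)
qed

text \<open>Describes a point of the projective plane by a nonzero vector of three-space up to sign;
  at the unit circle the third entry vanishes and the vector is odd. Written as a quadratic
  polynomial, such vectors can be multiplied over the points of a configuration: the product is
  symmetric and again nonzero.\<close>

definition field_poly :: "complex => nat => real" where "field_poly z s = poly [:Re z, Im z, 1 - (norm z)\<^sup>2:] (real s)"

lemma field_poly_minus: "norm z = 1 ==> field_poly (- z) s = - field_poly z s" by (simp add: field_poly_def algebra_simps)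

lemma finite_field_poly_zeros: assumes "norm z <= 1" shows "finite {s. field_poly z s = 0}"
proof -
 have "[:Re z, Im z, 1 - (norm z)\<^sup>2:] ~= 0"
 proof
  assume "[:Re z, Im z, 1 - (norm z)\<^sup>2:] = 0"
  then have "Re z = 0" "Im z = 0" "(norm z)\<^sup>2 = 1" by (auto split: if_splits)
  then have "z = 0" "(norm z)\<^sup>2 = 1" by (simp_all add: complex_eq_iff)
  then show False by simp
 qed
 from finite_vimageI[OF poly_roots_finite[OF this] inj_of_nat] show ?thesis by (simp add: field_poly_def vimage_def)
qed

lemma continuous_field_poly: "continuous_on A (\<lambda>z. field_poly z s)" unfolding field_poly_def by (simp, intro continuous_intros)

definition sign_fun :: "bit => (nat => real) => nat => real" where "sign_fun k F = (\<lambda>s. if k = 0 then F s else - F s)"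

context surface
begin

text \<open>The quaternion functional of the target, pulled back, is annihilated on loops by a
  nonzero form. By surjectivity the form then vanishes on the target too, where some loop
  contradicts it once it has been moved to the base point.\<close>

theorem no_epi_many_strands: assumes n: "n >= 2" and m: "m >= 1" and gm: "\<not> (g = 1 & m = 1)"
  and b: "b \<in> topspace (unordered_config n U)" and c: "c \<in> topspace (ordered_config m U)"
 shows "\<phi> ~: epi (braid_group n U b) (pure_braid_group m U c)"
proof
 assume "\<phi> \<in> epi (braid_group n U b) (pure_braid_group m U c)"
 then have epi: "\<phi> \<in> epi (fundamental_group (unordered_config n U) b) (fundamental_group (ordered_config m U) c)"
  by (simp add: braid_group_def pure_braid_group_def)
 obtain \<Theta> :: "(real => nat => 'a) => bit q8" where \<Theta>: "path_functional (ordered_config m U) \<Theta>"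
  "\<And>\<alpha> \<beta>. \<alpha> ~= 0 \<or> \<beta> ~= 0 ==> EX q. pathin (ordered_config m U) q & q 0 = q 1 & \<alpha> * qa (\<Theta> q) + \<beta> * qb (\<Theta> q) ~= 0"
  using quaternion_quotient[OF m gm] by blast
 obtain r where r: "\<And>q. loop_at (ordered_config m U) c q ==> EX p. loop_at (unordered_config n U) b p & path_homotopic (ordered_config m U) (r p) q"
  and \<Phi>0: "EX \<Phi>. path_functional (unordered_config n U) \<Phi> & (ALL p. loop_at (unordered_config n U) b p --> \<Phi> p = \<Theta> (r p))"
  by (rule epi_pullback[OF epi path_connected_unordered_config[OF b] b, where 'g = "bit q8"]) (use \<Theta>(1) in blast)+
 obtain \<Phi> where \<Phi>: "path_functional (unordered_config n U) \<Phi>" "\<And>p. loop_at (unordered_config n U) b p ==> \<Phi> p = \<Theta> (r p)"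
  using \<Phi>0 by blast
 obtain \<alpha> \<beta> :: bit where ab: "\<alpha> ~= 0 \<or> \<beta> ~= 0"
  "\<And>q. pathin (unordered_config n U) q ==> q 0 = q 1 ==> \<alpha> * qa (\<Phi> q) + \<beta> * qb (\<Phi> q) = 0"
  using quaternion_character[OF n \<Phi>(1)] by blast
 let ?\<chi> = "\<lambda>x. \<alpha> * qa x + \<beta> * qb x"
 have hom: "?\<chi> (x + y) = ?\<chi> x + ?\<chi> y" for x y unfolding q8_hom by (rule linear_combination_add)
 obtain q where q: "pathin (ordered_config m U) q" "q 0 = q 1" "?\<chi> (\<Theta> q) ~= 0" using \<Theta>(2)[OF ab(1)] by blast
 have "q 0 \<in> topspace (ordered_config m U)" using path_start_in_topspace[OF q(1)] .
 then obtain d where d: "pathin (ordered_config m U) d" "d 0 = c" "d 1 = q 0" using path_connected_ordered_config[OF c] by blast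
 have w: "loop_at (ordered_config m U) c (whisker d q d)" unfolding loop_at_def using pathin_whisker[OF d(1) q(1) d(1)] d q(2) by simp
 obtain p where p: "loop_at (unordered_config n U) b p" "path_homotopic (ordered_config m U) (r p) (whisker d q d)" using r[OF w] by blast
 have "?\<chi> (\<Theta> q) = ?\<chi> (\<Theta> (whisker d q d))" by (rule pf_whisker_loop[OF pf_hom[OF \<Theta>(1) hom] d(1) q(1) d(3) q(2), symmetric])
 also have "\<dots> = ?\<chi> (\<Phi> p)" using pf_homotopic[OF \<Theta>(1) p(2)] \<Phi>(2)[OF p(1)] by simp
 also have "\<dots> = 0" using p(1) by (intro ab(2)) (auto simp: loop_at_def)
 finally show False using q(3) by contradiction
qed

text \<open>The first strand alone contributes \<open>g\<close> independent classes with mod 2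
  coefficients, the second strand contributes another; the surface has room for only
  \<open>g\<close>.\<close>

theorem no_epi_one_strand: assumes m: "m >= 2" and b: "b \<in> topspace (unordered_config 1 U)" and c: "c \<in> topspace (ordered_config m U)"
 shows "\<phi> ~: epi (braid_group 1 U b) (pure_braid_group m U c)"
proof
 assume "\<phi> \<in> epi (braid_group 1 U b) (pure_braid_group m U c)"
 then have epi: "\<phi> \<in> epi (fundamental_group (unordered_config 1 U) b) (fundamental_group (ordered_config m U) c)"
  by (simp add: braid_group_def pure_braid_group_def)
 let ?X = "unordered_config 1 U" and ?Y = "ordered_config m U"
 have "EX \<Theta> :: (real => 'a) => bit. path_functional U \<Theta> & (ALL i<g. \<Theta> (crosscap i) = (if i = k then 1 else 0))" if "k < g" for k
  using crosscap_dual[OF that] by metis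
 then obtain \<Theta> :: "nat => (real => 'a) => bit" where \<Theta>: "\<And>k. k < g ==> path_functional U (\<Theta> k)"
  "\<And>k i. k < g ==> i < g ==> \<Theta> k (crosscap i) = (if i = k then 1 else 0)" by metis
 \<comment> \<open>A pair consists of a strand and the crosscap to which its class is dual: all
   crosscaps for strand 0 and one for strand 1, in total \<open>g + 1\<close>.\<close>
 define K where "K = {0::nat} \<times> {..<g} \<union> {(1, 0)}"
 have K: "finite K" "card K > g" "\<And>j k. (j, k) \<in> K ==> j < m & k < g"
 proof -
  show "finite K" by (simp add: K_def)
  have "card K = card ({0::nat} \<times> {..<g}) + 1" unfolding K_def by (subst card_Un_disjoint) auto
  then show "card K > g" by simp
  show "j < m & k < g" if "(j, k) \<in> K" for j k using that m g_pos by (auto simp: K_def)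
 qed
 define \<xi> where "\<xi> k q = \<Theta> (snd k) ((\<lambda>c. c (fst k)) o q)" for k :: "nat \<times> nat" and q :: "real => nat => 'a"
 have \<xi>: "path_functional ?Y (\<xi> k)" if "k \<in> K" for k
  unfolding \<xi>_def[abs_def] using K(3)[of "fst k" "snd k"] that pf_compose[OF \<Theta>(1) continuous_map_ordered_eval] by auto
 obtain r where r: "\<And>q. loop_at ?Y c q ==> EX p. loop_at ?X b p & path_homotopic ?Y (r p) q"
  "\<And>\<Theta> :: (real => nat => 'a) => bit. path_functional ?Y \<Theta> ==> EX \<Phi>. path_functional ?X \<Phi> & (ALL p. loop_at ?X b p --> \<Phi> p = \<Theta> (r p))"
  by (rule epi_pullback[OF epi path_connected_unordered_config[OF b] b, where 'g = bit]) blast+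
 have "EX \<Phi>. path_functional ?X \<Phi> & (ALL p. loop_at ?X b p --> \<Phi> p = \<xi> k (r p))" if "k \<in> K" for k by (rule r(2)[OF \<xi>[OF that]])
 then obtain \<Phi> where \<Phi>: "\<And>k. k \<in> K ==> path_functional ?X (\<Phi> k)" "\<And>k p. k \<in> K ==> loop_at ?X b p ==> \<Phi> k p = \<xi> k (r p)"
  by metis
 have "EX A. A \<subseteq> K & A ~= {} & (ALL q. pathin ?X q --> q 0 = q 1 --> (\<Sum>k\<in>A. \<Phi> k q) = 0)"
 proof (rule functionals_dependent[OF K(1,2) \<Phi>(1)])
  fix A assume "A \<subseteq> K" "A ~= {}" "\<And>q. pathin ?X q ==> q 0 = q 1 ==> (\<Sum>k\<in>A. \<Phi> k q) = 0"
  then show ?thesis by (intro exI[of _ A]) simp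
 qed
 then obtain A where A: "A \<subseteq> K" "A ~= {}" "ALL q. pathin ?X q --> q 0 = q 1 --> (\<Sum>k\<in>A. \<Phi> k q) = 0" by (elim exE conjE)
 \<comment> \<open>The loop dual to one member of the alleged relation pairs to one with it and to
   zero with all others, so the sum over \<open>A\<close> is one.\<close>
 obtain j k where jk: "(j, k) \<in> A" using A(2) by auto
 then have jk': "j < m" "k < g" using K(3) A(1) by blast+
 from crosscap_strand[OF jk']
 obtain q where "pathin ?Y q & q 0 = q 1 & (ALL t. q t j = crosscap k t & (ALL i<m. i ~= j --> q t i = q 0 i))" ..
 then have q: "pathin ?Y q" "q 0 = q 1" "\<And>t. q t j = crosscap k t" "\<And>i t. i < m ==> i ~= j ==> q t i = q 0 i" by blast+
 have \<xi>q: "\<xi> l q = (if l = (j, k) then 1 else 0)" if "l \<in> A" for l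
 proof -
  obtain i s where l: "l = (i, s)" by (cases l)
  have il: "i < m" "s < g" using K(3) A(1) that l by blast+
  show ?thesis
  proof (cases "i = j")
   case True
   have "(\<lambda>c. c j) o q = crosscap k" using q(3) by (simp add: fun_eq_iff)
   then show ?thesis using \<Theta>(2)[OF il(2) jk'(2)] True by (auto simp: \<xi>_def l)
  next
   case False
   have "(\<lambda>c. c i) o q = (\<lambda>_. q 0 i)" using q(4)[OF il(1) False] by (intro ext) (simp only: o_apply)
   moreover have "q 0 i \<in> topspace U" using path_start_in_topspace[OF q(1)] il(1) by (auto simp: topspace_ordered_config)
   ultimately show ?thesis using pf_const[OF \<Theta>(1)[OF il(2)]] False by (simp add: \<xi>_def l)
  qed
 qed
 have "q 0 \<in> topspace ?Y" using path_start_in_topspace[OF q(1)] .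
 then obtain d where d: "pathin ?Y d" "d 0 = c" "d 1 = q 0" using path_connected_ordered_config[OF c] by blast
 have w: "loop_at ?Y c (whisker d q d)" unfolding loop_at_def using pathin_whisker[OF d(1) q(1) d(1)] d q(2) by simp
 obtain p where p: "loop_at ?X b p" "path_homotopic ?Y (r p) (whisker d q d)" using r(1)[OF w] by blast
 have fA: "finite A" using finite_subset[OF A(1) K(1)] .
 have "\<Phi> l p = (if l = (j, k) then 1 else 0)" if "l \<in> A" for l
 proof -
  have l: "l \<in> K" using that A(1) by blast
  have "\<Phi> l p = \<xi> l (whisker d q d)" using \<Phi>(2)[OF l p(1)] pf_homotopic[OF \<xi>[OF l] p(2)] by simp
  also have "\<dots> = \<xi> l q" by (rule pf_whisker_loop[OF \<xi>[OF l] d(1) q(1) d(3) q(2)])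
  finally show ?thesis using \<xi>q[OF that] by simp
 qed
 then have "(\<Sum>l\<in>A. \<Phi> l p) = (\<Sum>l\<in>A. if l = (j, k) then 1 else 0)" by (rule sum.cong[OF HOL.refl])
 also have "\<dots> = (if (j, k) \<in> A then 1 else 0)" by (rule sum.delta[OF fA])
 finally have "(\<Sum>l\<in>A. \<Phi> l p) = 1" using jk by (simp only: if_True)
 moreover have "(\<Sum>l\<in>A. \<Phi> l p) = 0" using A(3) p(1) by (simp add: loop_at_def)
 ultimately show False by simp
qed

end

text \<open>Orbits of 1-tuples are singletons, so the quotient map is a homeomorphism. The two base
  points may differ, and the loops are carried over along a path between them.\<close>

lemma epi_one_strand: assumes conn: "\<And>c d. c \<in> topspace (ordered_config 1 U) ==> d \<in> topspace (ordered_config 1 U) ==>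
   EX q. pathin (ordered_config 1 U) q & q 0 = c & q 1 = d" and b: "b \<in> topspace (unordered_config 1 U)" and c: "c \<in> topspace (ordered_config 1 U)"
 shows "EX \<phi>. \<phi> \<in> epi (braid_group 1 U b) (pure_braid_group 1 U c)"
proof -
 let ?X = "unordered_config 1 U" and ?Y = "ordered_config 1 U"
 let ?F = "\<lambda>c. {c o \<sigma> |\<sigma>. \<sigma> permutes {..<1::nat}}" and ?G = "the_elem :: (nat => 'a) set => nat => 'a"
 have "{..<1::nat} = {0}" by auto
 then have "?F e = {e}" for e :: "nat => 'a" by (auto simp: permutes_sing)
 then have F: "?F = (\<lambda>e :: nat => 'a. {e})" by (rule ext)
 have qF: "quotient_map ?Y ?X (\<lambda>e. {e})" using quotient_unordered_config[of 1 U] unfolding F .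
 have cF: "continuous_map ?Y ?X (\<lambda>e. {e})" by (rule quotient_imp_continuous_map[OF qF])
 have cG: "continuous_map ?X ?Y ?G" by (rule continuous_compose_quotient_map[OF qF]) (simp add: o_def)
 have FG: "{?G P} = P" if "P \<in> topspace ?X" for P
 proof -
  have "P \<in> (\<lambda>e. {e}) ` topspace ?Y" using that quotient_imp_surjective_map[OF qF] by (simp only:)
  then show ?thesis by auto
 qed
 have Gb: "?G b \<in> topspace ?Y" using cG b by (auto simp: continuous_map_def)
 obtain d where d: "pathin ?Y d" "d 0 = c" "d 1 = ?G b" using conn[OF c Gb] by blast
 have dr: "pathin ?Y (loop_reverse d)" using d(1) by (rule pathin_loop_reverse)
 define f where "f q = whisker d (?G o q) d" for q
 have "EX \<phi>. \<phi> \<in> epi (fundamental_group ?X b) (fundamental_group ?Y c)"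
 proof (rule epi_of_loop_map[where f = f])
  have G: "loop_at ?Y (?G b) (?G o q)" if "loop_at ?X b q" for q using that pathin_compose[OF _ cG] by (simp add: loop_at_def)
  show "loop_at ?Y c (f q)" if "loop_at ?X b q" for q using G[OF that] pathin_whisker[OF d(1) _ d(1)] d unfolding f_def loop_at_def by simp
  show "path_homotopic ?Y (f q) (f q')" if "loop_at ?X b q" "path_homotopic ?X q q'" for q q'
   unfolding f_def by (rule whisker_cong[OF path_homotopic_compose[OF that(2) cG] d(1) d(1)]) (use G[OF that(1)] d in "auto simp: loop_at_def")
  show "path_homotopic ?Y (f (loop_concat q q')) (loop_concat (f q) (f q'))" if "loop_at ?X b q" "loop_at ?X b q'" for q q'
   unfolding f_def loop_concat_compose[symmetric]
   by (rule path_homotopic_sym[OF whisker_concat[OF d(1) d(1) d(1)]]) (use G[OF that(1)] G[OF that(2)] d in "auto simp: loop_at_def")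
  fix q assume q: "loop_at ?Y c q"
  let ?w = "whisker (loop_reverse d) q (loop_reverse d)"
  have w: "loop_at ?Y (?G b) ?w" using pathin_whisker[OF dr _ dr] q d unfolding loop_at_def by simp
  let ?p = "(\<lambda>e. {e}) o ?w"
  have "loop_at ?X b ?p" using w pathin_compose[OF _ cF] FG[OF b] by (simp add: loop_at_def)
  moreover have "?G o ?p = ?w" by (simp add: o_def)
  moreover have "path_homotopic ?Y (whisker d ?w d) q" by (rule whisker_section[OF d(1)]) (use q d(2) in simp)
  ultimately show "EX p. loop_at ?X b p & path_homotopic ?Y (f p) q" unfolding f_def by metis
 qed
 then show ?thesis by (simp add: braid_group_def pure_braid_group_def)
qed

section \<open>Loops and parity in the projective plane\<close>

context surface
begin

text \<open>In the projective plane every path is homotopic to one of these two, for any coordinates \<open>z\<close> and \<open>w\<close> of its ends.\<close>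
definition cell_path :: "bool => complex => complex => real => 'a" where "cell_path \<epsilon> z w =
   (if \<epsilon> then loop_concat (p 0 o linepath z \<i>) (p 0 o linepath (- \<i>) w) else p 0 o linepath z w)"

context assumes g1: "g = 1"
begin

lemma chart_pos: "0 < g" using g1 by simp

lemma convex_chart: "convex (chart_dom g 0)"
proof -
 have "chart_dom g 0 = ball 0 (10/9)" using g1 by (auto simp: chart_dom_def)
 then show ?thesis by simp
qed

lemma imaginary_chart: "\<i> \<in> chart_dom g 0" "- \<i> \<in> chart_dom g 0" "p 0 (- \<i>) = p 0 \<i>" "\<i> \<in> outer_annulus" "- \<i> \<in> outer_annulus"
 "antipode \<i> = - \<i>" "antipode (- \<i>) = \<i>"
 using imaginary_strip strip_chart_dom[of g 0] chart_minus[OF chart_pos, of \<i>] by (auto simp: outer_annulus_def antipode_def)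

lemma segment: assumes "z \<in> chart_dom g 0" "w \<in> chart_dom g 0" shows "pathin U (p 0 o linepath z w)"
 by (rule pathin_chart[OF chart_pos pathin_linepath[OF convex_chart assms]])

lemma segment_homotopic: assumes "pathin (top_of_set (chart_dom g 0)) u" shows "path_homotopic U (p 0 o u) (p 0 o linepath (u 0) (u 1))"
proof -
 have "u 0 \<in> chart_dom g 0" "u 1 \<in> chart_dom g 0"
  using assms pathin_top_of_set path_start_in_topspace[OF assms] path_finish_in_topspace[OF assms] by auto
 then show ?thesis by (intro path_homotopic_convex[OF convex_chart chart_cont[OF chart_pos] assms] pathin_linepath[OF convex_chart]) simp_all
qed

lemma segment_concat: assumes "z \<in> chart_dom g 0" "w \<in> chart_dom g 0" "v \<in> chart_dom g 0"
 shows "path_homotopic U (loop_concat (p 0 o linepath z w) (p 0 o linepath w v)) (p 0 o linepath z v)"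
proof -
 have "pathin (top_of_set (chart_dom g 0)) (loop_concat (linepath z w) (linepath w v))"
  by (rule pathin_loop_concat) (use assms pathin_linepath[OF convex_chart] in auto)
 from segment_homotopic[OF this] show ?thesis by (simp add: loop_concat_compose)
qed

text \<open>The segment itself may leave the annulus. It is replaced by a path inside it, whose
  antipodal image is the same path of the surface.\<close>

lemma segment_antipode: assumes "z \<in> outer_annulus" "w \<in> outer_annulus"
 shows "path_homotopic U (p 0 o linepath z w) (p 0 o linepath (antipode z) (antipode w))"
proof -
 have od: "outer_annulus \<subseteq> chart_dom g 0" using annuli_chart_dom(1) by blast
 obtain u where u: "pathin (top_of_set outer_annulus) u" "u 0 = z" "u 1 = w" using path_connectedE[OF path_connected_annuli(1) assms] by blast
 have uo: "u t \<in> outer_annulus" if "t \<in> {0..1}" for t using u(1) that unfolding pathin_top_of_set path_image_def by blast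
 have "continuous_map (top_of_set outer_annulus) (top_of_set outer_annulus) antipode"
  using continuous_transitions(1) antipode_outer by (auto simp: continuous_map_in_subtopology)
 from pathin_compose[OF u(1) this] have au: "pathin (top_of_set outer_annulus) (antipode o u)" .
 have ud: "pathin (top_of_set (chart_dom g 0)) u" "pathin (top_of_set (chart_dom g 0)) (antipode o u)" using u(1) au od unfolding pathin_top_of_set by blast+
 have "path_homotopic U (p 0 o linepath z w) (p 0 o u)" using path_homotopic_sym[OF segment_homotopic[OF ud(1)]] u(2,3) by simp
 also have "path_homotopic U (p 0 o u) (p 0 o (antipode o u))"
  by (rule path_homotopic_cong[OF pathin_chart[OF chart_pos ud(1)]]) (use chart_antipode[OF chart_pos] uo in auto)
 also have "path_homotopic U (p 0 o (antipode o u)) (p 0 o linepath (antipode z) (antipode w))" using segment_homotopic[OF ud(2)] u(2,3) by simp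
 finally show ?thesis .
qed

lemma cell_path_start_antipode: assumes z: "z \<in> outer_annulus" and w: "w \<in> chart_dom g 0"
 shows "path_homotopic U (cell_path True z w) (cell_path False (antipode z) w)"
proof -
 have d: "z \<in> chart_dom g 0" "antipode z \<in> chart_dom g 0" using z antipode_outer annuli_chart_dom(1) by blast+
 note i = imaginary_chart
 have "path_homotopic U (loop_concat (p 0 o linepath z \<i>) (p 0 o linepath (- \<i>) w))
   (loop_concat (p 0 o linepath (antipode z) (- \<i>)) (p 0 o linepath (- \<i>) w))"
  by (rule path_homotopic_concat[OF _ path_homotopic_refl[OF segment[OF i(2) w]]]) (use segment_antipode[OF z i(4)] i in simp_all)
 also have "path_homotopic U \<dots> (p 0 o linepath (antipode z) w)" by (rule segment_concat[OF d(2) i(2) w])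
 finally show ?thesis by (simp add: cell_path_def)
qed

text \<open>The other coordinate of the same point is the antipode, and passing to it toggles the
  passage through the crosscap.\<close>

lemma cell_path_start: assumes z: "z \<in> chart_dom g 0" "z' \<in> chart_dom g 0" "p 0 z = p 0 z'" and w: "w \<in> chart_dom g 0"
 shows "EX \<delta>. path_homotopic U (cell_path \<epsilon> z w) (cell_path \<delta> z' w)"
proof -
 have pc: "pathin U (cell_path \<epsilon> z w)" for \<epsilon>
  using segment[OF z(1) w] segment[OF z(1) imaginary_chart(1)] segment[OF imaginary_chart(2) w] imaginary_chart(3)
  by (auto simp: cell_path_def intro!: pathin_loop_concat)
 have "chart_rel g 0 z 0 z'" using chart_eq[OF chart_pos chart_pos z(1,2)] z(3) by simp
 then have "z' = z \<or> z \<in> outer_annulus & z' = antipode z" by (auto simp: chart_rel_def)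
 then show ?thesis
 proof
  assume "z' = z" then show ?thesis using path_homotopic_refl[OF pc] by blast
 next
  assume a: "z \<in> outer_annulus & z' = antipode z"
  show ?thesis
  proof (cases \<epsilon>)
   case True
   then show ?thesis using cell_path_start_antipode[OF _ w, of z] a by (intro exI[of _ False]) simp
  next
   case False
   have "path_homotopic U (cell_path True z' w) (cell_path False (antipode z') w)" using a antipode_outer by (intro cell_path_start_antipode[OF _ w]) simp
   then show ?thesis using a False path_homotopic_sym by (intro exI[of _ True]) simp
  qed
 qed
qed

text \<open>Passages through the crosscap are counted modulo two.\<close>

lemma cell_path_concat: assumes z: "z \<in> chart_dom g 0" and w: "w \<in> chart_dom g 0" and v: "v \<in> chart_dom g 0"
 shows "path_homotopic U (loop_concat (cell_path \<epsilon> z w) (cell_path \<delta> w v)) (cell_path (\<epsilon> ~= \<delta>) z v)"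
proof -
 let ?S = "\<lambda>z w. p 0 o linepath z w" and ?c = loop_concat
 note i = imaginary_chart
 note H = path_homotopic_refl and C = path_homotopic_concat and S = segment
 \<comment> \<open>The reason why two passages cancel: the crosscap loop is homotopic to its
   reverse, which is its antipodal image.\<close>
 have h: "path_homotopic U (?S (- \<i>) \<i>) (?S \<i> (- \<i>))" using segment_antipode[OF i(5,4)] i by simp
 consider "\<not> \<epsilon>" "\<not> \<delta>" | "\<epsilon>" "\<not> \<delta>" | "\<not> \<epsilon>" "\<delta>" | "\<epsilon>" "\<delta>" by blast
 then show ?thesis
 proof cases
  case 1
  then show ?thesis using segment_concat[OF z w v] by (simp add: cell_path_def)
 next
  case 2
  have "path_homotopic U (?c (?c (?S z \<i>) (?S (- \<i>) w)) (?S w v)) (?c (?S z \<i>) (?c (?S (- \<i>) w) (?S w v)))"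
   by (rule path_homotopic_assoc[OF S[OF z i(1)] S[OF i(2) w] S[OF w v]]) (use i in simp_all)
  also have "path_homotopic U \<dots> (?c (?S z \<i>) (?S (- \<i>) v))" by (rule C[OF H[OF S[OF z i(1)]] segment_concat[OF i(2) w v]]) (use i in simp)
  finally show ?thesis using 2 by (simp add: cell_path_def)
 next
  case 3
  have "path_homotopic U (?c (?S z w) (?c (?S w \<i>) (?S (- \<i>) v))) (?c (?c (?S z w) (?S w \<i>)) (?S (- \<i>) v))"
   by (rule path_homotopic_sym[OF path_homotopic_assoc[OF S[OF z w] S[OF w i(1)] S[OF i(2) v]]]) (use i in simp_all)
  also have "path_homotopic U \<dots> (?c (?S z \<i>) (?S (- \<i>) v))" by (rule C[OF segment_concat[OF z w i(1)] H[OF S[OF i(2) v]]]) (use i in simp)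
  finally show ?thesis using 3 by (simp add: cell_path_def)
 next
  case 4
  have p1: "pathin U (?c (?S w \<i>) (?S (- \<i>) v))" by (rule pathin_loop_concat[OF S[OF w i(1)] S[OF i(2) v]]) (use i in simp)
  have "path_homotopic U (?c (?c (?S z \<i>) (?S (- \<i>) w)) (?c (?S w \<i>) (?S (- \<i>) v)))
    (?c (?S z \<i>) (?c (?S (- \<i>) w) (?c (?S w \<i>) (?S (- \<i>) v))))" by (rule path_homotopic_assoc[OF S[OF z i(1)] S[OF i(2) w] p1]) (use i in simp_all)
  also have "path_homotopic U \<dots> (?c (?S z \<i>) (?c (?c (?S (- \<i>) w) (?S w \<i>)) (?S (- \<i>) v)))"
   by (rule C[OF H[OF S[OF z i(1)]] path_homotopic_sym[OF path_homotopic_assoc[OF S[OF i(2) w] S[OF w i(1)] S[OF i(2) v]]]]) (use i in simp_all)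
  also have "path_homotopic U \<dots> (?c (?S z \<i>) (?c (?S \<i> (- \<i>)) (?S (- \<i>) v)))"
   by (rule C[OF H[OF S[OF z i(1)]] C[OF path_homotopic_trans[OF segment_concat[OF i(2) w i(1)] h] H[OF S[OF i(2) v]]]]) (use i in simp_all)
  also have "path_homotopic U \<dots> (?c (?S z \<i>) (?S \<i> v))" by (rule C[OF H[OF S[OF z i(1)]] segment_concat[OF i(1,2) v]]) simp
  also have "path_homotopic U \<dots> (?S z v)" by (rule segment_concat[OF z i(1) v])
  finally show ?thesis using 4 by (simp add: cell_path_def)
 qed
qed

lemma cell_path_ends: "cell_path \<epsilon> z w 0 = p 0 z" "cell_path \<epsilon> z w 1 = p 0 w" by (simp_all add: cell_path_def)

lemma every_path_cell: assumes "pathin U q" shows "EX z:chart_dom g 0. EX w:chart_dom g 0. EX \<epsilon>. path_homotopic U q (cell_path \<epsilon> z w)"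
proof (rule path_local_induct[OF _ _ _ assms, where Q = "\<lambda>q. EX z:chart_dom g 0. EX w:chart_dom g 0. EX \<epsilon>. path_homotopic U q (cell_path \<epsilon> z w)"])
 fix x assume "x \<in> topspace U"
 then obtain z where z: "z \<in> chart_dom g 0" "p 0 z = x" using chart_cover' g1 by auto
 obtain V where V: "openin U V" "p 0 z \<in> V"
  "ALL q. pathin (subtopology U V) q --> (EX u. pathin (top_of_set (chart_dom g 0 \<inter> UNIV)) u & (ALL t. 0 <= t & t <= 1 --> p 0 (u t) = q t))"
  using chart_lift[OF chart_pos z(1) open_UNIV UNIV_I] by metis
 have "EX z:chart_dom g 0. EX w:chart_dom g 0. EX \<epsilon>. path_homotopic U q (cell_path \<epsilon> z w)" if q: "pathin (subtopology U V) q" for q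
 proof -
  obtain u where u: "pathin (top_of_set (chart_dom g 0)) u" "\<And>t. 0 <= t ==> t <= 1 ==> p 0 (u t) = q t" using V(3) q by auto
  have "path_homotopic U q (p 0 o u)" by (rule path_homotopic_cong) (use q u(2) in "auto simp: pathin_subtopology")
  also have "path_homotopic U \<dots> (cell_path False (u 0) (u 1))" using segment_homotopic[OF u(1)] by (simp add: cell_path_def)
  finally show ?thesis using path_start_in_topspace[OF u(1)] path_finish_in_topspace[OF u(1)] by auto
 qed
 then show "EX V. openin U V & x \<in> V & (ALL q. pathin (subtopology U V) q -->
   (EX z:chart_dom g 0. EX w:chart_dom g 0. EX \<epsilon>. path_homotopic U q (cell_path \<epsilon> z w)))" using V(1,2) z(2) by blast
next
 fix q r
 assume qr: "pathin U q" "pathin U r" "q 1 = r 0" and "EX z:chart_dom g 0. EX w:chart_dom g 0. EX \<epsilon>. path_homotopic U q (cell_path \<epsilon> z w)"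
  and "EX z:chart_dom g 0. EX w:chart_dom g 0. EX \<epsilon>. path_homotopic U r (cell_path \<epsilon> z w)"
 then obtain z w \<epsilon> z' w' \<epsilon>' where d: "z \<in> chart_dom g 0" "w \<in> chart_dom g 0" "z' \<in> chart_dom g 0" "w' \<in> chart_dom g 0"
  and q: "path_homotopic U q (cell_path \<epsilon> z w)" and r: "path_homotopic U r (cell_path \<epsilon>' z' w')" by blast
 have "p 0 z' = p 0 w" using path_homotopic_ends[OF q] path_homotopic_ends[OF r] qr(3) by (simp add: cell_path_ends)
 from cell_path_start[OF d(3,2) this d(4)] obtain \<delta> where "path_homotopic U (cell_path \<epsilon>' z' w') (cell_path \<delta> w w')" by blast
 then have "path_homotopic U (loop_concat q r) (loop_concat (cell_path \<epsilon> z w) (cell_path \<delta> w w'))"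
  by (intro path_homotopic_concat[OF q path_homotopic_trans[OF r]] qr(3))
 also have "path_homotopic U \<dots> (cell_path (\<epsilon> ~= \<delta>) z w')" by (rule cell_path_concat[OF d(1,2,4)])
 finally show "EX z:chart_dom g 0. EX w:chart_dom g 0. EX \<epsilon>. path_homotopic U (loop_concat q r) (cell_path \<epsilon> z w)" using d by blast
next
 fix q r
 assume "path_homotopic U q r" "EX z:chart_dom g 0. EX w:chart_dom g 0. EX \<epsilon>. path_homotopic U q (cell_path \<epsilon> z w)"
 then show "EX z:chart_dom g 0. EX w:chart_dom g 0. EX \<epsilon>. path_homotopic U r (cell_path \<epsilon> z w)"
  using path_homotopic_sym path_homotopic_trans by metis
qed

text \<open>Once both ends are given the coordinate \<open>z\<close>, only the flag of a
  \<open>cell_path\<close> remains, which leaves at most two classes.\<close>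

lemma projective_plane_loops: assumes x: "x \<in> topspace U" obtains H where "loop_at U x H" "path_homotopic U (loop_concat H H) (\<lambda>_. x)"
  "\<And>q. loop_at U x q ==> path_homotopic U q (\<lambda>_. x) \<or> path_homotopic U q H"
proof -
 obtain z where z: "z \<in> chart_dom g 0" "p 0 z = x" using chart_cover' x g1 by auto
 have const: "cell_path False z z = (\<lambda>_. x)" using z(2) by (simp add: cell_path_def linepath_refl fun_eq_iff)
 have HH: "path_homotopic U (loop_concat (cell_path True z z) (cell_path True z z)) (\<lambda>_. x)"
  using cell_path_concat[OF z(1) z(1) z(1), of True True] const by simp
 have TF: "path_homotopic U (loop_concat (cell_path True z z) (cell_path False z z)) (cell_path True z z)"
  using cell_path_concat[OF z(1) z(1) z(1), of True False] by simp
 have H: "loop_at U x (cell_path True z z)" using path_homotopic_pathin[OF TF] z(2) by (simp add: loop_at_def cell_path_ends)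
 have "path_homotopic U q (\<lambda>_. x) \<or> path_homotopic U q (cell_path True z z)" if "loop_at U x q" for q
 proof -
  have q: "pathin U q" "q 0 = x" "q 1 = x" using that by (auto simp: loop_at_def)
  obtain y w \<epsilon> where yw: "y \<in> chart_dom g 0" "w \<in> chart_dom g 0" "path_homotopic U q (cell_path \<epsilon> y w)"
   using every_path_cell[OF q(1)] by blast
  have ends: "p 0 y = x" "p 0 w = x" using path_homotopic_ends[OF yw(3)] q by (auto simp: cell_path_ends)
  obtain \<delta> where \<delta>: "path_homotopic U (cell_path False z z) (cell_path \<delta> w z)"
   using cell_path_start[OF z(1) yw(2) _ z(1)] z(2) ends by metis
  have "path_homotopic U q (loop_concat q (\<lambda>_. q 1))" by (rule path_homotopic_sym[OF path_homotopic_rid[OF q(1)]])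
  also have "path_homotopic U \<dots> (loop_concat (cell_path \<epsilon> y w) (cell_path \<delta> w z))"
   by (rule path_homotopic_concat[OF yw(3)]) (use \<delta> const q(3) in simp_all)
  also have "path_homotopic U \<dots> (cell_path (\<epsilon> ~= \<delta>) y z)" by (rule cell_path_concat[OF yw(1,2) z(1)])
  finally have "path_homotopic U q (cell_path (\<epsilon> ~= \<delta>) y z)" .
  moreover obtain \<epsilon>' where "path_homotopic U (cell_path (\<epsilon> ~= \<delta>) y z) (cell_path \<epsilon>' z z)"
   using cell_path_start[OF yw(1) z(1) _ z(1)] z(2) ends by metis
  ultimately have "path_homotopic U q (cell_path \<epsilon>' z z)" by (rule path_homotopic_trans)
  then show ?thesis using const by (cases \<epsilon>') auto
 qed
 then show ?thesis using that H HH by blast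
qed

text \<open>The product of the polynomials of all points of a configuration is defined up to sign.
  Its sign monodromy counts modulo two the passages of strands through the crosscap; it is invariant
  under permutation of the points, so it lives on the unordered space.\<close>

lemma parity_functional: assumes n: "n >= 1" obtains \<Xi> :: "(real => (nat => 'a) set) => bit" and q where "path_functional (unordered_config n U) \<Xi>"
  "pathin (unordered_config n U) q" "q 0 = q 1" "\<Xi> q = 1"
proof -
 let ?C = "unordered_config n U" and ?O = "ordered_config n U"
 have "ALL x. EX z. x \<in> topspace U --> z \<in> disc_piece g 0 & p 0 z = x" using chart_cover g1 by fastforce
 then obtain rep where rep: "\<And>x. x \<in> topspace U ==> rep x \<in> disc_piece g 0 & p 0 (rep x) = x" by metis
 define val where "val x s = field_poly (rep x) s" for x s
 have norm1: "norm z <= 1" if "z \<in> disc_piece g 0" for z using that by (simp add: disc_piece_def)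
 have val: "(ALL s. val (p 0 z) s = field_poly z s) \<or> (ALL s. val (p 0 z) s = - field_poly z s)" if z: "z \<in> disc_piece g 0" for z
 proof -
  have zd: "z \<in> chart_dom g 0" using z disc_piece_chart_dom by blast
  have r: "rep (p 0 z) \<in> disc_piece g 0" "p 0 (rep (p 0 z)) = p 0 z" using rep[OF chart_topspace[OF chart_pos zd]] by auto
  have "rep (p 0 z) \<in> chart_dom g 0" using r(1) disc_piece_chart_dom by blast
  from chart_eq_disc[OF chart_pos zd this] r(2) have "rep (p 0 z) = z \<or> z ~= 0 & rep (p 0 z) = antipode z" by simp
  then show ?thesis
  proof
   assume a: "z ~= 0 & rep (p 0 z) = antipode z"
   have "1 / norm z <= 1" using norm1[OF r(1)] a by (simp add: norm_antipode)
   then have "norm z = 1" using norm1[OF z] a by (simp add: divide_le_eq)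
   then show ?thesis using field_poly_minus[of z] antipode_circle[of z] a by (simp add: val_def)
  qed (simp add: val_def)
 qed
 \<comment> \<open>A single value depends on the representative through a sign; in a product of two
   values at the same point the signs cancel.\<close>
 have cval: "continuous_map U euclideanreal (\<lambda>x. val x s * val x s')" for s s'
 proof (rule continuous_on_pieces)
  fix i assume "i < g"
  then have "i = 0" using g1 by simp
  have "continuous_on (disc_piece g 0) (\<lambda>z. field_poly z s * field_poly z s')" by (intro continuous_on_mult continuous_field_poly)
  moreover have "val (p 0 z) s * val (p 0 z) s' = field_poly z s * field_poly z s'" if "z \<in> disc_piece g 0" for z using val[OF that] by auto
  ultimately show "continuous_on (disc_piece g i) (\<lambda>z. val (p i z) s * val (p i z) s')"
   unfolding \<open>i = 0\<close> by (simp cong: continuous_on_cong)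
 qed
 define \<mu> where "\<mu> P s = (\<Prod>x\<in>supp n P. val x s)" for P s
 have cont: "continuous_map ?C euclideanreal (\<lambda>P. \<mu> P s * \<mu> P s')" for s s'
 proof (rule continuous_compose_quotient_map[OF quotient_unordered_config], rule continuous_map_eq)
  show "continuous_map ?O euclideanreal (\<lambda>c. \<Prod>k<n. val (c k) s * val (c k) s')"
  proof (rule continuous_map_prod)
   fix k assume "k \<in> {..<n}"
   then show "continuous_map ?O euclideanreal (\<lambda>c. val (c k) s * val (c k) s')"
    using continuous_map_compose[OF continuous_map_ordered_eval cval, of k n s s'] by (simp add: o_def)
  qed simp
  fix c assume c: "c \<in> topspace ?O"
  then have inj: "inj_on c {..<n}" by (simp add: topspace_ordered_config)
  have "supp n {c o \<sigma> |\<sigma>. \<sigma> permutes {..<n}} = c ` {..<n}" unfolding orbit_cfg[OF c] by (rule supp_cfg) (simp_all add: card_image inj)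
  then show "(\<Prod>k<n. val (c k) s * val (c k) s') = ((\<lambda>P. \<mu> P s * \<mu> P s') o (\<lambda>c. {c o \<sigma> |\<sigma>. \<sigma> permutes {..<n}})) c"
   using inj by (simp add: \<mu>_def prod.reindex prod.distrib)
 qed
 have nonzero: "EX s. \<mu> P s ~= 0" if P: "P \<in> topspace ?C" for P
 proof -
  obtain S where S: "P = cfg n S" "S \<subseteq> topspace U" "finite S" "card S = n" using P by (auto simp: topspace_unordered_config)
  have "finite (\<Union>x\<in>S. {s. val x s = 0})"
  proof (rule finite_UN_I[OF S(3)])
   fix x assume "x \<in> S"
   then have "norm (rep x) <= 1" using rep S(2) norm1 by blast
   then show "finite {s. val x s = 0}" unfolding val_def by (rule finite_field_poly_zeros)
  qed
  then have "(\<Union>x\<in>S. {s. val x s = 0}) ~= UNIV" using infinite_UNIV_nat by metis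
  then obtain s where "ALL x:S. val x s ~= 0" by blast
  then have "\<mu> P s ~= 0" unfolding \<mu>_def S(1) supp_cfg[OF S(3,4)] using S(3) by simp
  then show ?thesis by blast
 qed
 obtain \<Xi> where \<Xi>: "path_functional ?C \<Xi>"
  "\<And>q \<sigma> a b. pathin ?C q ==> continuous_on {0..1} \<sigma> ==> (\<And>t. t \<in> {0..1} ==> EX k. \<sigma> t = sign_fun k (\<mu> (q t))) ==>
   \<sigma> 0 = sign_fun a (\<mu> (q 0)) ==> \<sigma> 1 = sign_fun b (\<mu> (q 1)) ==> \<Xi> q = - a + b"
 proof (rule torsor_functional[of sign_fun ?C \<mu>, OF finite_bit])
  show "continuous_on UNIV (sign_fun a)" for a
  proof (rule continuous_on_coordinatewise_then_product)
   show "continuous_on UNIV (\<lambda>F. sign_fun a F s)" for s by (cases "a = 0") (simp_all add: sign_fun_def continuous_on_minus)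
  qed
  show "sign_fun (a + b) F = sign_fun a (sign_fun b F)" for a b F by (cases a; cases b; simp add: sign_fun_def)
  show "sign_fun 0 F = F" for F by (simp add: sign_fun_def)
  show "a = 0" if PC: "P \<in> topspace ?C" and eq: "sign_fun a (\<mu> P) = \<mu> P" for a P
  proof (rule ccontr)
   assume "a ~= 0"
   obtain s where s: "\<mu> P s ~= 0" using nonzero[OF PC] by blast
   have "sign_fun a (\<mu> P) s = \<mu> P s" using eq by (rule fun_cong)
   then show False using \<open>a ~= 0\<close> s by (simp add: sign_fun_def del: bit_not_zero_iff)
  qed
  fix P assume P: "P \<in> topspace ?C"
  obtain s0 where s0: "\<mu> P s0 ~= 0" using nonzero[OF P] by blast
  let ?V = "{Q \<in> topspace ?C. \<mu> Q s0 * \<mu> Q s0 \<in> - {0}}"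
  \<comment> \<open>The representative of \<mu> that is positive at \<open>s0\<close>. It is built
    from products of two values, each of which is continuous.\<close>
  let ?\<sigma> = "\<lambda>Q s. \<mu> Q s * \<mu> Q s0 / sqrt (\<mu> Q s0 * \<mu> Q s0)"
  have "openin ?C ?V" by (rule openin_continuous_map_preimage[OF cont]) (simp add: open_Compl)
  moreover have "P \<in> ?V" using P s0 by simp
  moreover have "continuous_map (subtopology ?C ?V) euclidean ?\<sigma>" unfolding euclidean_product_topology[symmetric] continuous_map_componentwise_UNIV
  proof
   fix s
   have "continuous_map (subtopology ?C ?V) euclideanreal (\<lambda>Q. \<mu> Q s * \<mu> Q s0)"
    "continuous_map (subtopology ?C ?V) euclideanreal (\<lambda>Q. sqrt (\<mu> Q s0 * \<mu> Q s0))"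
    by (intro continuous_map_sqrt continuous_map_from_subtopology cont)+
   then show "continuous_map (subtopology ?C ?V) euclideanreal (\<lambda>Q. ?\<sigma> Q s)" by (rule continuous_map_real_divide) auto
  qed
  moreover have "EX k. ?\<sigma> Q = sign_fun k (\<mu> Q)" if "Q \<in> ?V" for Q
  proof (cases "0 < \<mu> Q s0")
   case True
   then have "?\<sigma> Q = sign_fun 0 (\<mu> Q)" by (simp add: sign_fun_def fun_eq_iff)
   then show ?thesis by blast
  next
   case False
   then have "\<mu> Q s0 < 0" using that by auto
   then have "?\<sigma> Q = sign_fun 1 (\<mu> Q)" by (simp add: sign_fun_def fun_eq_iff)
   then show ?thesis by blast
  qed
  ultimately show "EX V \<sigma>. openin ?C V & P \<in> V & continuous_map (subtopology ?C V) euclidean \<sigma> & (ALL y:V. EX k. \<sigma> y = sign_fun k (\<mu> y))"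
   by (intro exI[of _ ?V] exI[of _ ?\<sigma>]) blast
 qed blast
 obtain T where T: "base (Suc n) T" using exists_base[of "Suc n"] n by auto
 have T': "finite T" "T \<subseteq> topspace U" "Suc (card T) = n" using T by (auto simp: base_def)
 let ?l = "linepath (- \<i>) \<i>"
 have lD: "?l t \<in> disc_piece g 0" if "t \<in> {0..1}" for t using crosscap_disc_piece[of 0] that unfolding pathin_top_of_set path_image_def by blast
 have cT: "crosscap 0 t ~: T" if t: "t \<in> {0..1}" for t
 proof -
  have "?l t = Complex 0 (2 * t - 1)" by (simp add: linepath_def complex_eq_iff)
  moreover have "\<bar>2 * t - 1\<bar> <= 1" using t by auto
  ultimately have "?l t \<in> strip" "norm (?l t) <= 1" by (simp_all add: strip_def cmod_def)
  then show ?thesis using base_avoids[OF T chart_pos] by (simp add: crosscap_def)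
 qed
 define q where "q t = cfg n (insert (crosscap 0 t) T)" for t
 have "pathin (subtopology U (- T)) (crosscap 0)" using crosscap_loop(1)[OF chart_pos] cT by (auto simp: pathin_subtopology)
 from pathin_compose[OF this continuous_map_strand[OF T']]
 have q: "pathin ?C q" by (simp add: q_def[abs_def] o_def)
 have q01: "q 0 = q 1" using crosscap_loop(2)[OF chart_pos] by (simp add: q_def)
 define \<sigma> where "\<sigma> t s = field_poly (?l t) s * (\<Prod>y\<in>T. val y s)" for t s
 have \<sigma>c: "continuous_on {0..1} \<sigma>"
 proof (rule continuous_on_coordinatewise_then_product)
  show "continuous_on {0..1} (\<lambda>t. \<sigma> t s)" for s
   unfolding \<sigma>_def by (intro continuous_on_mult continuous_on_const continuous_on_compose2[OF continuous_field_poly[of UNIV]] continuous_on_linepath) auto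
 qed
 have \<sigma>\<mu>: "EX k. \<sigma> t = sign_fun k (\<mu> (q t))" if t: "t \<in> {0..1}" for t
 proof -
  have "supp n (q t) = insert (crosscap 0 t) T" unfolding q_def by (rule supp_cfg) (use T' cT[OF t] in auto)
  then have m: "\<mu> (q t) s = val (p 0 (?l t)) s * (\<Prod>y\<in>T. val y s)" for s using T'(1) cT[OF t] by (simp add: \<mu>_def crosscap_def)
  show ?thesis using val[OF lD[OF t]]
  proof
   assume "ALL s. val (p 0 (?l t)) s = field_poly (?l t) s"
   then have "\<sigma> t = sign_fun 0 (\<mu> (q t))" by (simp add: sign_fun_def \<sigma>_def m fun_eq_iff)
   then show ?thesis by blast
  next
   assume "ALL s. val (p 0 (?l t)) s = - field_poly (?l t) s"
   then have "\<sigma> t = sign_fun 1 (\<mu> (q t))" by (simp add: sign_fun_def \<sigma>_def m fun_eq_iff)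
   then show ?thesis by blast
  qed
 qed
 obtain a where a: "\<sigma> 0 = sign_fun a (\<mu> (q 0))" using \<sigma>\<mu>[of 0] by auto
 have b: "\<sigma> 1 = sign_fun (a + 1) (\<mu> (q 1))"
 proof -
  have "\<sigma> 1 s = - \<sigma> 0 s" for s using field_poly_minus[of \<i> s] by (simp add: \<sigma>_def)
  then show ?thesis unfolding a q01[symmetric] by (cases a) (simp_all add: sign_fun_def fun_eq_iff)
 qed
 have "\<Xi> q = - a + (a + 1)" by (rule \<Xi>(2)[OF q \<sigma>c \<sigma>\<mu> a b])
 then have "\<Xi> q = 1" by (cases a) simp_all
 then show ?thesis using that[OF \<Xi>(1) q q01] by blast
qed

text \<open>The target has at most two classes, and the nontrivial loop squares to a trivial one. So
  sending a braid to a loop according to its parity is additive, and it is onto because some braid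
  has odd parity.\<close>

theorem epi_projective_plane: assumes n: "n >= 1" and b: "b \<in> topspace (unordered_config n U)" and c: "c \<in> topspace (ordered_config 1 U)"
 shows "EX \<phi>. \<phi> \<in> epi (braid_group n U b) (pure_braid_group 1 U c)"
proof -
 let ?X = "unordered_config n U" and ?Y = "ordered_config 1 U"
 define \<iota> where "\<iota> x = restrict (\<lambda>_. x) {..<1::nat}" for x :: 'a
 have \<iota>: "continuous_map U ?Y \<iota>" unfolding \<iota>_def by (rule continuous_map_ordered) (auto simp: inj_on_def)
 have \<iota>c: "\<iota> (e 0) = e" if "e \<in> topspace ?Y" for e
  using that by (auto simp: \<iota>_def topspace_ordered_config PiE_def extensional_def fun_eq_iff)
 have "c 0 \<in> topspace U" using c by (auto simp: topspace_ordered_config)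
 then obtain H where H: "loop_at U (c 0) H" "path_homotopic U (loop_concat H H) (\<lambda>_. c 0)"
  "ALL q. loop_at U (c 0) q --> path_homotopic U q (\<lambda>_. c 0) \<or> path_homotopic U q H" using projective_plane_loops by metis
 define K where "K = \<iota> o H"
 have const: "\<iota> o (\<lambda>_. c 0) = (\<lambda>_. c)" using \<iota>c[OF c] by (simp add: o_def)
 have K: "loop_at ?Y c K" using H(1) pathin_compose[OF _ \<iota>] \<iota>c[OF c] by (auto simp: loop_at_def K_def)
 have KK: "path_homotopic ?Y (loop_concat K K) (\<lambda>_. c)" using path_homotopic_compose[OF H(2) \<iota>] unfolding const K_def loop_concat_compose .
 have all: "path_homotopic ?Y q (\<lambda>_. c) \<or> path_homotopic ?Y q K" if q: "loop_at ?Y c q" for q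
 proof -
  have q': "pathin ?Y q" "q 0 = c" "q 1 = c" using q by (auto simp: loop_at_def)
  have qY: "q t \<in> topspace ?Y" if "0 <= t" "t <= 1" for t using q'(1) that by (auto simp: pathin_def continuous_map_def)
  have e: "path_homotopic ?Y q (\<iota> o ((\<lambda>e. e 0) o q))" by (rule path_homotopic_cong[OF q'(1)]) (use \<iota>c qY in auto)
  have "pathin U ((\<lambda>e. e 0) o q)" by (rule pathin_compose[OF q'(1) continuous_map_ordered_eval]) simp
  then have "loop_at U (c 0) ((\<lambda>e. e 0) o q)" using q' by (simp add: loop_at_def)
  with H(3) have "path_homotopic U ((\<lambda>e. e 0) o q) (\<lambda>_. c 0) \<or> path_homotopic U ((\<lambda>e. e 0) o q) H" by blast
  then show ?thesis
  proof
   assume "path_homotopic U ((\<lambda>e. e 0) o q) (\<lambda>_. c 0)"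
   from path_homotopic_trans[OF e path_homotopic_compose[OF this \<iota>]] show ?thesis unfolding const by (rule disjI1)
  next
   assume "path_homotopic U ((\<lambda>e. e 0) o q) H"
   from path_homotopic_trans[OF e path_homotopic_compose[OF this \<iota>]] show ?thesis unfolding K_def by (rule disjI2)
  qed
 qed
 obtain \<Xi> :: "(real => (nat => 'a) set) => bit" and q where \<Xi>: "path_functional ?X \<Xi>"
  and q: "pathin ?X q" "q 0 = q 1" "\<Xi> q = 1" using parity_functional[OF n] by blast
 have "q 0 \<in> topspace ?X" using path_start_in_topspace[OF q(1)] .
 then obtain d where d: "pathin ?X d" "d 0 = b" "d 1 = q 0" using path_connected_unordered_config[OF b] by blast
 have w: "loop_at ?X b (whisker d q d)" "\<Xi> (whisker d q d) = 1"
  using pathin_whisker[OF d(1) q(1) d(1)] d q(2,3) pf_whisker_loop[OF \<Xi> d(1) q(1) d(3) q(2)] by (simp_all add: loop_at_def)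
 have cY: "pathin ?Y (\<lambda>_. c)" using c by (simp add: pathin_const)
 have Kp: "pathin ?Y K" "K 0 = c" "K 1 = c" using K by (auto simp: loop_at_def)
 define f where "f r = (if \<Xi> r = 0 then (\<lambda>_. c) else K)" for r
 have "EX \<phi>. \<phi> \<in> epi (fundamental_group ?X b) (fundamental_group ?Y c)"
 proof (rule epi_of_loop_map[where f = f])
  show fl: "loop_at ?Y c (f r)" for r using K cY by (simp add: f_def loop_at_def)
  show "path_homotopic ?Y (f r) (f r')" if "path_homotopic ?X r r'" for r r'
  proof -
   have "f r = f r'" using pf_homotopic[OF \<Xi> that] by (simp add: f_def)
   moreover have "path_homotopic ?Y (f r) (f r)" using fl[of r] by (intro path_homotopic_refl) (simp add: loop_at_def)
   ultimately show ?thesis by simp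
  qed
  show "path_homotopic ?Y (f (loop_concat r r')) (loop_concat (f r) (f r'))" if "loop_at ?X b r" "loop_at ?X b r'" for r r'
  proof -
   have "\<Xi> (loop_concat r r') = \<Xi> r + \<Xi> r'" using that by (intro pf_concat[OF \<Xi>]) (auto simp: loop_at_def)
   moreover have "path_homotopic ?Y (\<lambda>_. c) (loop_concat (\<lambda>_. c) (\<lambda>_. c))" using path_homotopic_sym[OF path_homotopic_lid[OF cY]] .
   moreover have "path_homotopic ?Y K (loop_concat (\<lambda>_. c) K)" "path_homotopic ?Y K (loop_concat K (\<lambda>_. c))"
    using path_homotopic_sym[OF path_homotopic_lid[OF Kp(1)]] path_homotopic_sym[OF path_homotopic_rid[OF Kp(1)]] Kp by simp_all
   ultimately show ?thesis using path_homotopic_sym[OF KK] by (cases "\<Xi> r"; cases "\<Xi> r'"; simp add: f_def)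
  qed
  fix r assume r: "loop_at ?Y c r"
  show "EX s. loop_at ?X b s & path_homotopic ?Y (f s) r" using all[OF r]
  proof
   assume h: "path_homotopic ?Y r (\<lambda>_. c)"
   have "loop_at ?X b (\<lambda>_. b)" using b by (simp add: loop_at_def pathin_const)
   moreover have "f (\<lambda>_. b) = (\<lambda>_. c)" using pf_const[OF \<Xi> b] by (simp add: f_def)
   ultimately show ?thesis using path_homotopic_sym[OF h] by metis
  next
   assume h: "path_homotopic ?Y r K"
   have "f (whisker d q d) = K" using w(2) by (simp add: f_def)
   then show ?thesis using w(1) path_homotopic_sym[OF h] by metis
  qed
 qed
 then show ?thesis by (simp add: braid_group_def pure_braid_group_def)
qed

end

end

theorem corollary4p8:
  fixes g m n :: nat and U :: "'a topology"
    and b :: "(nat \<Rightarrow> 'a) set" and c :: "nat \<Rightarrow> 'a"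
  assumes "g \<ge> 1" and "m \<ge> 1" and "n \<ge> 1"
    and "U homeomorphic_space nonorientable_surface g"
    and "b \<in> topspace (unordered_config n U)"
    and "c \<in> topspace (ordered_config m U)"
  shows "(\<exists>\<phi>. \<phi> \<in> epi (braid_group n U b) (pure_braid_group m U c)) \<longleftrightarrow>
           (g = 1 \<and> m = 1) \<or> (n = 1 \<and> m = 1)"
proof -
 obtain p where "surface U g p" using exists_surface[OF assms(1,4)] .
 then interpret surface U g p .
 show ?thesis
 proof
  assume "EX \<phi>. \<phi> \<in> epi (braid_group n U b) (pure_braid_group m U c)"
  then obtain \<phi> where \<phi>: "\<phi> \<in> epi (braid_group n U b) (pure_braid_group m U c)" by blast
  show "(g = 1 & m = 1) \<or> (n = 1 & m = 1)"
  proof (cases "n = 1")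
   case True
   have "\<not> m >= 2" using no_epi_one_strand[of m b c \<phi>] \<phi> assms(5,6) unfolding True by blast
   then show ?thesis using True assms(2) by auto
  next
   case False
   then have "n >= 2" using assms(3) by simp
   then show ?thesis using no_epi_many_strands[OF _ assms(2) _ assms(5,6)] \<phi> by blast
  qed
 next
  assume "(g = 1 & m = 1) \<or> (n = 1 & m = 1)"
  then show "EX \<phi>. \<phi> \<in> epi (braid_group n U b) (pure_braid_group m U c)"
  proof
   assume "g = 1 & m = 1"
   then show ?thesis using epi_projective_plane[OF _ assms(3,5)] assms(6) by simp
  next
   assume "n = 1 & m = 1"
   then show ?thesis using epi_one_strand[OF path_connected_ordered_config] assms(5,6) by simp
  qed
 qed
qed

end
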